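(* Let $K$ be a field, $X_\Sigma$ a smooth projective split toric variety over $K$ with open orbit $U$, $\rho$ the rank of $\mathrm{Pic}(X_\Sigma)$, and $U_{0,d}$ ($d\ge0$) the quasi-projective variety parameterizing $K$-morphisms $\mathbb{P}^1_K\to X_\Sigma$ with image intersecting $U$ and of anticanonical degree $d$. Let $a\ge1$ be the integer defined in the context. For every $p\in\{0,\dots,a-1\}$, one of the following cases occurs when $d$ goes to infinity in the congruence class of $p$ modulo $a$: (i) either $\limsup\frac{\dim U_{0,d}}{d}<1$; (ii) or $\dim U_{0,d}-d$ has a finite limit. In this case, fixing a separable closure $K^s$ of $K$ and denoting by $\kappa(U_{0,d})$ the number of irreducible components of maximal dimension of $U_{0,d}$ over $K^s$, the quantity $$\frac{\log\kappa(U_{0,d})}{\log d}$$ converges to an element of the set $\{0,\dots,\rho-1\}$. Moreover, the second case happens for at least one value of $p\in\{0,\dots,a-1\}$.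
   Context: $U=\mathbb{G}_m^r$ and $\Sigma$ is a projective regular fan of its cocharacter lattice, with rays $\Sigma(1)$ and associated $U$-invariant divisors $D_\alpha$, $\alpha\in\Sigma(1)$. $\mathcal{L}_0\in\mathrm{Pic}(X_\Sigma)$ is the class of the anticanonical divisor $\sum_\alpha D_\alpha$, and the anticanonical degree of $f:\mathbb{P}^1\to X_\Sigma$ is $\deg f^*\mathcal{L}_0$. The effective cone of $X_\Sigma$ is the image in $\mathrm{Pic}(X_\Sigma)\otimes\mathbb{R}$ of $\sum_\alpha\mathbb{R}_{\ge0}D_\alpha$. Fix a regular fan $\Delta$ of the lattice $\mathrm{Pic}(X_\Sigma)^\vee$ whose support is the dual of the effective cone; for a ray $i\in\Delta(1)$, $m_i$ is its primitive generator. Then $a=\mathrm{lcm}\{\langle m_i,\mathcal{L}_0\rangle:i\in\Delta(1)\}$. Convention: the dimension of the empty variety is $-\infty$. *)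

theory Defs
  imports
    "HOL-Analysis.Analysis"
    "HOL-Library.Poly_Mapping"
    "HOL-Algebra.Algebraic_Closure_Type"
begin

section \<open>Lattices and fans\<close>

definition int_vec :: "int ^ 'n \<Rightarrow> real ^ 'n" where
  "int_vec v = (\<chi> i. of_int (v $ i))"

definition integer_lattice :: "(real ^ 'n) set" where
  "integer_lattice = range int_vec"

definition lattice_basis :: "'a::real_vector set \<Rightarrow> 'a set \<Rightarrow> bool" where
  "lattice_basis L B \<longleftrightarrow>
     finite B \<and> independent B \<and> L = range (\<lambda>k::'a \<Rightarrow> int. \<Sum>b\<in>B. of_int (k b) *\<^sub>R b)"

definition regular_cone :: "'a::real_vector set \<Rightarrow> 'a set \<Rightarrow> bool" where
  "regular_cone L \<sigma> \<longleftrightarrow> (\<exists>B S. lattice_basis L B \<and> S \<subseteq> B \<and> \<sigma> = convex_cone hull S)"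

text \<open>The empty set is a face of every convex set in the sense of \<open>face_of\<close>, hence the
  condition \<open>\<tau> \<noteq> {}\<close>.\<close>

definition regular_fan :: "'a::real_vector set \<Rightarrow> 'a set set \<Rightarrow> bool" where
  "regular_fan L \<Sigma> \<longleftrightarrow>
     finite \<Sigma> \<and> \<Sigma> \<noteq> {} \<and>
     (\<forall>\<sigma>\<in>\<Sigma>. regular_cone L \<sigma>) \<and>
     (\<forall>\<sigma>\<in>\<Sigma>. \<forall>\<tau>. \<tau> face_of \<sigma> \<and> \<tau> \<noteq> {} \<longrightarrow> \<tau> \<in> \<Sigma>) \<and>
     (\<forall>\<sigma>\<in>\<Sigma>. \<forall>\<tau>\<in>\<Sigma>. (\<sigma> \<inter> \<tau>) face_of \<sigma>)"

definition primitive_generator :: "'a::real_vector set \<Rightarrow> 'a set \<Rightarrow> 'a \<Rightarrow> bool" where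
  "primitive_generator L \<sigma> v \<longleftrightarrow> v \<noteq> 0 \<and> \<sigma> \<inter> L = range (\<lambda>n::nat. of_nat n *\<^sub>R v)"

definition ray_generators :: "'a::euclidean_space set \<Rightarrow> 'a set set \<Rightarrow> 'a set" where
  "ray_generators L \<Sigma> = {v. \<exists>\<sigma>\<in>\<Sigma>. dim \<sigma> = 1 \<and> primitive_generator L \<sigma> v}"

text \<open>The cocharacter lattice of the torus is \<open>\<int>\<^sup>r\<close>, embedded in \<open>\<real>\<^sup>r\<close> by \<open>int_vec\<close>; the
  character lattice is \<open>int ^ 'r\<close>.\<close>

definition dual_monoid :: "(real ^ 'r) set \<Rightarrow> (int ^ 'r) set" where
  "dual_monoid \<sigma> = {m. \<forall>x\<in>\<sigma>. 0 \<le> int_vec m \<bullet> x}"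

definition orthogonal_lattice :: "(real ^ 'r) set \<Rightarrow> (int ^ 'r) set" where
  "orthogonal_lattice \<sigma> = {m. \<forall>x\<in>\<sigma>. int_vec m \<bullet> x = 0}"

definition pairing :: "int ^ 'r \<Rightarrow> int ^ 'r \<Rightarrow> int" where
  "pairing m v = (\<Sum>i\<in>UNIV. m $ i * v $ i)"


section \<open>Divisors and the Picard group\<close>

text \<open>The rays of the fan are labelled by a finite type \<open>'s\<close>, with primitive generators
  \<open>u :: 's \<Rightarrow> int ^ 'r\<close>. An element of \<open>int ^ 's\<close> is an invariant divisor, and the Picard
  group is \<open>int ^ 's\<close> modulo the divisors of characters.\<close>

definition character_divisor :: "('s::finite \<Rightarrow> int ^ 'r) \<Rightarrow> int ^ 'r \<Rightarrow> int ^ 's" where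
  "character_divisor u m = (\<chi> \<alpha>. pairing m (u \<alpha>))"

definition anticanonical_divisor :: "int ^ 's" where
  "anticanonical_divisor = (\<chi> \<alpha>. 1)"

text \<open>The rank of the Picard group is the largest number of divisors whose classes are
  linearly independent over the integers.\<close>

definition pic_rank :: "('s::finite \<Rightarrow> int ^ 'r) \<Rightarrow> nat" where
  "pic_rank u = Max {card S | S. finite S \<and>
     (\<forall>k. (\<Sum>D\<in>S. k D *s D) \<in> range (character_divisor u) \<longrightarrow> (\<forall>D\<in>S. k D = (0::int)))}"

text \<open>A linear form on the Picard group is a linear form on divisors vanishing on the divisors
  of characters; forms on divisors are written as vectors through the inner product.\<close>

definition pic_dual_space :: "('s::finite \<Rightarrow> int ^ 'r) \<Rightarrow> (real ^ 's) set" where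
  "pic_dual_space u = {y. \<forall>m. y \<bullet> int_vec (character_divisor u m) = 0}"

definition pic_dual_lattice :: "('s::finite \<Rightarrow> int ^ 'r) \<Rightarrow> (real ^ 's) set" where
  "pic_dual_lattice u = pic_dual_space u \<inter> integer_lattice"

text \<open>The preimage of the effective cone in the space of real invariant divisors.\<close>

definition effective_cone :: "('s::finite \<Rightarrow> int ^ 'r) \<Rightarrow> (real ^ 's) set" where
  "effective_cone u = {x + y | x y. (\<forall>\<alpha>. 0 \<le> x $ \<alpha>) \<and>
     y \<in> span (range (\<lambda>m. int_vec (character_divisor u m)))}"

definition dual_effective_cone :: "('s::finite \<Rightarrow> int ^ 'r) \<Rightarrow> (real ^ 's) set" where
  "dual_effective_cone u = {y \<in> pic_dual_space u. \<forall>x\<in>effective_cone u. 0 \<le> y \<bullet> x}"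

definition anticanonical_period :: "('s::finite \<Rightarrow> int ^ 'r) \<Rightarrow> (real ^ 's) set set \<Rightarrow> nat" where
  "anticanonical_period u \<Delta> =
     Lcm {nat \<lfloor>v \<bullet> int_vec anticanonical_divisor\<rfloor> | v. v \<in> ray_generators (pic_dual_lattice u) \<Delta>}"

text \<open>Strict convexity of the support function of the divisor \<open>h\<close>: on a complete fan this is
  ampleness, and on a smooth complete toric variety ample invariant divisors are very ample.\<close>

definition ample_divisor ::
  "(real ^ 'r) set set \<Rightarrow> ('s::finite \<Rightarrow> int ^ 'r) \<Rightarrow> int ^ 's \<Rightarrow> bool" where
  "ample_divisor \<Sigma> u h \<longleftrightarrow> (\<forall>\<sigma>\<in>\<Sigma>. dim \<sigma> = CARD('r) \<longrightarrow>
     (\<exists>v. \<forall>\<alpha>. if int_vec (u \<alpha>) \<in> \<sigma> then pairing v (u \<alpha>) = - (h $ \<alpha>)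
              else pairing v (u \<alpha>) > - (h $ \<alpha>)))"

definition section_characters :: "('s::finite \<Rightarrow> int ^ 'r) \<Rightarrow> int ^ 's \<Rightarrow> (int ^ 'r) set" where
  "section_characters u h = {m. \<forall>\<alpha>. pairing m (u \<alpha>) \<ge> - (h $ \<alpha>)}"


section \<open>Points of the toric variety\<close>

text \<open>The affine chart of \<open>\<sigma>\<close> is the spectrum of the algebra of the dual monoid of \<open>\<sigma>\<close>, so its
  points over an algebraically closed field \<open>'o\<close> are the monoid homomorphisms from the dual
  monoid to \<open>('o, *)\<close>. After gluing the charts, every point lies in the orbit of exactly one
  cone: it is represented by the smallest cone \<open>\<sigma>\<close> whose chart contains it, together with the
  homomorphism \<open>\<gamma>\<close> for this chart, extended by 0 outside of the dual monoid. Minimality of \<open>\<sigma>\<close>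
  means that \<open>\<gamma>\<close> does not vanish exactly on the characters orthogonal to \<open>\<sigma>\<close>. The point lies in
  the chart of \<open>\<tau>\<close> iff \<open>\<sigma> \<subseteq> \<tau>\<close>, and a character \<open>m\<close> is regular at it iff
  \<open>m \<in> dual_monoid \<sigma>\<close>.\<close>

type_synonym ('r, 'o) toric_point = "(real ^ 'r) set \<times> (int ^ 'r \<Rightarrow> 'o)"

definition toric_points :: "(real ^ 'r) set set \<Rightarrow> ('r::finite, 'o::field) toric_point set" where
  "toric_points \<Sigma> = {(\<sigma>, \<gamma>). \<sigma> \<in> \<Sigma> \<and> \<gamma> 0 = 1 \<and>
     (\<forall>m\<in>dual_monoid \<sigma>. \<forall>m'\<in>dual_monoid \<sigma>. \<gamma> (m + m') = \<gamma> m * \<gamma> m') \<and>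
     (\<forall>m. \<gamma> m \<noteq> 0 \<longleftrightarrow> m \<in> orthogonal_lattice \<sigma>)}"

definition open_orbit :: "('r::finite, 'o::field) toric_point set" where
  "open_orbit = toric_points {{0}}"


section \<open>Morphisms from the projective line\<close>

text \<open>The projective line over \<open>'o\<close> is \<open>'o option\<close>: \<open>Some x\<close> is \<open>[x : 1]\<close> and \<open>None\<close> is
  \<open>[1 : 0]\<close>. A polynomial \<open>A\<close> of degree at most \<open>e\<close> stands for the binary form
  \<open>\<Sum>i\<le>e. coeff A i * X ^ i * Y ^ (e - i)\<close>; \<open>form_value\<close> is its value at the above
  representatives and \<open>form_order\<close> its order of vanishing.\<close>

definition form_value :: "nat \<Rightarrow> 'o::field poly \<Rightarrow> 'o option \<Rightarrow> 'o" where
  "form_value e A z = (case z of Some x \<Rightarrow> poly A x | None \<Rightarrow> poly.coeff A e)"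

definition form_order :: "nat \<Rightarrow> 'o::field poly \<Rightarrow> 'o option \<Rightarrow> nat" where
  "form_order e A z = (case z of Some x \<Rightarrow> Polynomial.order x A | None \<Rightarrow> e - Polynomial.degree A)"

definition toric_morphism ::
  "(real ^ 'r) set set \<Rightarrow> ('o::field option \<Rightarrow> ('r::finite, 'o) toric_point) \<Rightarrow> bool" where
  "toric_morphism \<Sigma> f \<longleftrightarrow> (\<forall>z. f z \<in> toric_points \<Sigma> \<and>
     (\<forall>m\<in>dual_monoid (fst (f z)). \<exists>e A B.
        Polynomial.degree A \<le> e \<and> Polynomial.degree B \<le> e \<and> form_value e B z \<noteq> 0 \<and>
        (\<forall>w. form_value e B w \<noteq> 0 \<longrightarrow>
           m \<in> dual_monoid (fst (f w)) \<and> snd (f w) m = form_value e A w / form_value e B w)))"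

text \<open>For \<open>f\<close> meeting the open orbit, the order at \<open>z\<close> of the rational function obtained by
  pulling back the character \<open>m\<close>.\<close>

definition character_order ::
  "('o::field option \<Rightarrow> ('r::finite, 'o) toric_point) \<Rightarrow> int ^ 'r \<Rightarrow> 'o option \<Rightarrow> int" where
  "character_order f m z = (THE k. \<exists>e A B.
     A \<noteq> 0 \<and> B \<noteq> 0 \<and> Polynomial.degree A \<le> e \<and> Polynomial.degree B \<le> e \<and>
     (\<forall>w. f w \<in> open_orbit \<and> form_value e B w \<noteq> 0 \<longrightarrow>
        snd (f w) m = form_value e A w / form_value e B w) \<and>
     k = int (form_order e A z) - int (form_order e B z))"

text \<open>On the chart of \<open>\<sigma>\<close>, the divisor \<open>D\<close> is the divisor of any character \<open>m\<close> whose pairing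
  with \<open>u \<alpha>\<close> is \<open>D $ \<alpha>\<close> for all rays \<open>\<alpha>\<close> of \<open>\<sigma>\<close>.\<close>

definition pullback_order ::
  "('s::finite \<Rightarrow> int ^ 'r) \<Rightarrow> int ^ 's \<Rightarrow> ('o::field option \<Rightarrow> ('r::finite, 'o) toric_point) \<Rightarrow>
   'o option \<Rightarrow> int" where
  "pullback_order u D f z = (THE k. \<exists>m.
     (\<forall>\<alpha>. int_vec (u \<alpha>) \<in> fst (f z) \<longrightarrow> pairing m (u \<alpha>) = D $ \<alpha>) \<and> k = character_order f m z)"

definition pullback_degree ::
  "('s::finite \<Rightarrow> int ^ 'r) \<Rightarrow> int ^ 's \<Rightarrow> ('o::field option \<Rightarrow> ('r::finite, 'o) toric_point) \<Rightarrow> int" where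
  "pullback_degree u D f = (\<Sum>z | pullback_order u D f z \<noteq> 0. pullback_order u D f z)"

definition rational_curves ::
  "(real ^ 'r) set set \<Rightarrow> ('s::finite \<Rightarrow> int ^ 'r) \<Rightarrow> nat \<Rightarrow>
   ('o::field option \<Rightarrow> ('r::finite, 'o) toric_point) set" where
  "rational_curves \<Sigma> u d = {f. toric_morphism \<Sigma> f \<and> (\<exists>z. f z \<in> open_orbit) \<and>
     pullback_degree u anticanonical_divisor f = int d}"


section \<open>The variety of rational curves\<close>

text \<open>The global sections of \<open>\<O>(h)\<close> have the basis \<open>section_characters u h\<close>, and for \<open>h\<close> ample
  they embed the toric variety into a projective space. On the chart of \<open>\<sigma>\<close> the sheaf is
  generated by a character \<open>v\<close> with \<open>pairing v (u \<alpha>) = - (h $ \<alpha>)\<close> on the rays of \<open>\<sigma>\<close>, and the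
  section \<open>m\<close> is the function \<open>m - v\<close> times this generator. \<open>embedded_forms u h f e g\<close> says that
  the binary forms \<open>g m\<close> of degree \<open>e\<close> are homogeneous coordinates of the composition of \<open>f\<close> with
  this embedding. They have no common zero (as \<open>\<O>(h)\<close> is globally generated), so \<open>e\<close> is the
  degree of the composition and \<open>g\<close> is unique up to a nonzero scalar.\<close>

definition embedded_forms ::
  "('s::finite \<Rightarrow> int ^ 'r) \<Rightarrow> int ^ 's \<Rightarrow> ('o::field option \<Rightarrow> ('r::finite, 'o) toric_point) \<Rightarrow>
   nat \<Rightarrow> (int ^ 'r \<Rightarrow> 'o poly) \<Rightarrow> bool" where
  "embedded_forms u h f e g \<longleftrightarrow>
     (\<forall>m. Polynomial.degree (g m) \<le> e) \<and> (\<forall>m. m \<notin> section_characters u h \<longrightarrow> g m = 0) \<and>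
     (\<forall>z. \<exists>v c. c \<noteq> 0 \<and>
        (\<forall>\<alpha>. int_vec (u \<alpha>) \<in> fst (f z) \<longrightarrow> pairing v (u \<alpha>) = - (h $ \<alpha>)) \<and>
        (\<forall>m\<in>section_characters u h. form_value e (g m) z = c * snd (f z) (m - v)))"

text \<open>Multivariate polynomials with variables in \<open>'v\<close> are finitely supported functions on the
  finitely supported exponent vectors.\<close>

definition mpoly_eval :: "(('v \<Rightarrow>\<^sub>0 nat) \<Rightarrow>\<^sub>0 'o::field) \<Rightarrow> ('v \<Rightarrow> 'o) \<Rightarrow> 'o" where
  "mpoly_eval p x = (\<Sum>t\<in>Poly_Mapping.keys p.
     Poly_Mapping.lookup p t * (\<Prod>v\<in>Poly_Mapping.keys t. x v ^ Poly_Mapping.lookup t v))"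

definition homogeneous_over :: "'o::field set \<Rightarrow> (('v \<Rightarrow>\<^sub>0 nat) \<Rightarrow>\<^sub>0 'o) \<Rightarrow> bool" where
  "homogeneous_over F p \<longleftrightarrow> (\<forall>t. Poly_Mapping.lookup p t \<in> F) \<and>
     (\<exists>n. \<forall>t\<in>Poly_Mapping.keys p. (\<Sum>v\<in>Poly_Mapping.keys t. Poly_Mapping.lookup t v) = n)"

text \<open>The coefficients of the forms \<open>g m\<close> identify the morphisms whose composition with the
  embedding has degree \<open>e\<close> with a locally closed subset of a projective space, and the variety
  of rational curves is the disjoint union of these pieces. It is described by its points over
  an algebraic closure \<open>'o\<close> of the base field, with the Zariski topology over a subfield \<open>F\<close>,
  where closed sets are defined by homogeneous polynomials with coefficients in \<open>F\<close>. The closed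
  sets then correspond to the closed sets of the scheme over \<open>F\<close>. The sets below form the
  basis of principal open subsets.\<close>

definition curve_space ::
  "'o set \<Rightarrow> (real ^ 'r) set set \<Rightarrow> ('s::finite \<Rightarrow> int ^ 'r) \<Rightarrow> int ^ 's \<Rightarrow> nat \<Rightarrow>
   ('o::field option \<Rightarrow> ('r::finite, 'o) toric_point) topology" where
  "curve_space F \<Sigma> u h d = topology_generated_by
     {{f \<in> rational_curves \<Sigma> u d. \<exists>g. embedded_forms u h f e g \<and>
         mpoly_eval p (\<lambda>(m, j). poly.coeff (g m) j) \<noteq> 0} |
      e (p :: (((int ^ 'r) \<times> nat) \<Rightarrow>\<^sub>0 nat) \<Rightarrow>\<^sub>0 'o). homogeneous_over F p}"


section \<open>Dimension and irreducible components\<close>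

definition irreducible_closed :: "'a topology \<Rightarrow> 'a set \<Rightarrow> bool" where
  "irreducible_closed T Z \<longleftrightarrow> closedin T Z \<and> Z \<noteq> {} \<and>
     (\<forall>A B. closedin T A \<and> closedin T B \<and> Z \<subseteq> A \<union> B \<longrightarrow> Z \<subseteq> A \<or> Z \<subseteq> B)"

text \<open>In \<open>ereal\<close> the supremum of the empty set is \<open>- \<infinity>\<close>, which is the dimension of the empty
  space.\<close>

definition krull_dim :: "'a topology \<Rightarrow> ereal" where
  "krull_dim T = Sup {ereal (real n) | n.
     \<exists>Z :: nat \<Rightarrow> 'a set. (\<forall>i\<le>n. irreducible_closed T (Z i)) \<and> (\<forall>i<n. Z i \<subset> Z (Suc i))}"

definition irreducible_components :: "'a topology \<Rightarrow> 'a set set" where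
  "irreducible_components T =
     {Z. irreducible_closed T Z \<and> (\<forall>Z'. irreducible_closed T Z' \<and> Z \<subseteq> Z' \<longrightarrow> Z' = Z)}"

definition top_dim_components :: "'a topology \<Rightarrow> 'a set set" where
  "top_dim_components T =
     {Z \<in> irreducible_components T. krull_dim (subtopology T Z) = krull_dim T}"

definition base_field :: "'k::field alg_closure set" where
  "base_field = range to_ac"

definition sep_closure :: "'k::field alg_closure set" where
  "sep_closure = {x. \<exists>p :: 'k poly. coprime p (pderiv p) \<and> poly (map_poly to_ac p) x = 0}"

definition curves_dim ::
  "'k::field itself \<Rightarrow> (real ^ 'r) set set \<Rightarrow> ('s::finite \<Rightarrow> int ^ 'r::finite) \<Rightarrow> int ^ 's \<Rightarrow> nat \<Rightarrow> ereal"
  where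
  "curves_dim _ \<Sigma> u h d = krull_dim (curve_space (base_field :: 'k alg_closure set) \<Sigma> u h d)"

definition curves_components ::
  "'k::field itself \<Rightarrow> (real ^ 'r) set set \<Rightarrow> ('s::finite \<Rightarrow> int ^ 'r::finite) \<Rightarrow> int ^ 's \<Rightarrow> nat \<Rightarrow> nat"
  where
  "curves_components _ \<Sigma> u h d =
     card (top_dim_components (curve_space (sep_closure :: 'k alg_closure set) \<Sigma> u h d))"

end

theory Submission
  imports Defs "HOL-Real_Asymp.Real_Asymp"
begin

text \<open>A curve meeting the open orbit is given by binary forms \<open>Q \<alpha>\<close>, one for each ray, whose common
  zeros are those allowed by the fan; it determines them up to the action of the Neron-Severi
  torus. Their degrees \<open>y \<alpha>\<close> satisfy \<open>\<Sum>\<alpha>. y \<alpha> * u \<alpha> = 0\<close>, so that \<open>y\<close> is a lattice point of the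
  dual of the effective cone, and the anticanonical degree is \<open>d = (\<Sum>\<alpha>. y \<alpha>)\<close>. The curves with
  a given \<open>y\<close> form an irreducible set of dimension \<open>d + r\<close>, with the roots of the forms and \<open>r\<close>
  torus coordinates as parameters. A generic curve of one stratum is not in the closure of another
  one: if \<open>y' \<alpha> < y \<alpha>\<close>, then on the stratum of \<open>y\<close> all sections vanishing along the divisor \<open>\<alpha>\<close> have
  a common factor of larger degree than on the generic curve of the stratum of \<open>y'\<close>. Hence the
  dimension is \<open>d + r\<close> or \<open>- \<infinity>\<close>, and the number of components of maximal dimension is the number of
  lattice points of degree \<open>d\<close>.

  Every lattice point is a unique combination with positive coefficients of the generators of a
  cone of \<open>\<Delta>\<close>. If the degree of such a combination of \<open>k\<close> generators is congruent to \<open>p\<close>, then the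
  number of these combinations of degree \<open>d\<close> grows like \<open>d ^ (k - 1)\<close> in the class of \<open>p\<close>, because
  adding a suitable multiple of any generator raises the degree by the period. The exponent
  in the corollary is \<open>k - 1\<close> for the largest such \<open>k\<close>.\<close>

section \<open>Regular fans\<close>

text \<open>The summand \<open>r\<close> is the number of rays minus the dimension of the
  Neron-Severi torus: each form carries one scalar, and the torus normalizes all scalars except
  those on the rays of one full-dimensional cone. The obstacle is that a stratum is known only
  through points over an algebraic closure and through homogeneous functions over a subfield that
  may be finite or imperfect, so dimension must be read off chains of irreducible closed sets.
  Products of linear factors answer this: admissibility persists at all but finitely many points of
  each line in parameter space through an admissible point, so every nonempty set obtained by
  freezing parameters has an irreducible closure. For the upper bound, functions separating a longer
  chain would be algebraically independent, but counting monomials shows that more functions than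
  parameters are dependent. For the lower bound, frozen roots are algebraic over the base field, and
  their equations separate successive sets. As all nonempty strata have the same dimension, the
  first case of the theorem occurs exactly in the classes without any curve, and class 0 is never
  one of them.\<close>

lemma convex_cone_hull_finite:
  assumes "finite S"
  shows "convex_cone hull S = {\<Sum>b\<in>S. c b *\<^sub>R b | c. \<forall>b\<in>S. 0 \<le> c b}" (is "_ = ?R")
proof
  have "convex_cone ?R"
    unfolding convex_cone_iff
  proof (intro conjI allI ballI impI)
    show "0 \<in> ?R" by (auto intro!: exI[of _ "\<lambda>_. 0"])
    fix x y assume "x \<in> ?R" "y \<in> ?R"
    then obtain c d where "x = (\<Sum>b\<in>S. c b *\<^sub>R b)" "\<forall>b\<in>S. 0 \<le> c b"
      "y = (\<Sum>b\<in>S. d b *\<^sub>R b)" "\<forall>b\<in>S. 0 \<le> d b" by auto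
    then show "x + y \<in> ?R"
      by (auto intro!: exI[of _ "\<lambda>b. c b + d b"] simp: scaleR_add_left sum.distrib)
  next
    fix x and k :: real assume "x \<in> ?R" "0 \<le> k"
    then obtain c where "x = (\<Sum>b\<in>S. c b *\<^sub>R b)" "\<forall>b\<in>S. 0 \<le> c b" by auto
    then show "k *\<^sub>R x \<in> ?R" using \<open>0 \<le> k\<close>
      by (auto intro!: exI[of _ "\<lambda>b. k * c b"] simp: scaleR_sum_right)
  qed
  moreover have "S \<subseteq> ?R"
  proof
    fix x assume "x \<in> S"
    then have "(\<Sum>b\<in>S. (if b = x then 1 else 0) *\<^sub>R b) = (\<Sum>b\<in>S. if b = x then x else 0)"
      by (intro sum.cong) auto
    also have "\<dots> = x" using \<open>x \<in> S\<close> assms by (simp add: sum.delta')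
    finally show "x \<in> ?R" by (intro CollectI exI[of _ "\<lambda>b. if b = x then 1 else 0"]) auto
  qed
  ultimately show "convex_cone hull S \<subseteq> ?R" by (rule hull_minimal[rotated])
next
  have "(\<Sum>b\<in>T. c b *\<^sub>R b) \<in> convex_cone hull S" if "finite T" "T \<subseteq> S" "\<forall>b\<in>S. 0 \<le> c b" for c T
    using that
  proof (induction T)
    case empty then show ?case by (simp add: convex_cone_hull_contains_0)
  next
    case (insert x F)
    have "c x *\<^sub>R x \<in> convex_cone hull S" using insert by (intro convex_cone_hull_mul hull_inc) auto
    then show ?case using insert by (simp add: convex_cone_hull_add)
  qed
  then show "?R \<subseteq> convex_cone hull S" using assms by auto
qed

lemma independent_sum_eqD:
  fixes B :: "'a::real_vector set"
  assumes "finite B" "independent B" "(\<Sum>b\<in>B. c b *\<^sub>R b) = (\<Sum>b\<in>B. d b *\<^sub>R b)" "b \<in> B"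
  shows "c b = d b"
proof -
  have "(\<Sum>b\<in>B. (c b - d b) *\<^sub>R b) = 0" using assms(3) by (simp add: scaleR_diff_left sum_subtractf)
  then have "c b - d b = 0" using independentD[OF assms(2,1) subset_refl, of "\<lambda>b. c b - d b"] assms(4) by blast
  then show ?thesis by simp
qed

lemma sum_restrict_subset:
  assumes "finite S" "T \<subseteq> S"
  shows "(\<Sum>b\<in>T. c b *\<^sub>R b) = (\<Sum>b\<in>S. (if b \<in> T then c b else 0) *\<^sub>R (b::'a::real_vector))"
  using assms by (intro sum.mono_neutral_cong_left) auto

text \<open>Independence makes coordinates in the cone unique. If an inner point of a segment has
  zero coordinates along \<open>S - T\<close>, then the coordinates of the endpoints there are
  nonnegative and have a vanishing combination with positive weights, so they vanish as
  well.\<close>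

lemma face_of_simplicial_cone:
  fixes S :: "'a::real_vector set"
  assumes S: "finite S" "independent S" and T: "T \<subseteq> S"
  shows "(convex_cone hull T) face_of (convex_cone hull S)"
  unfolding face_of_def
proof (intro conjI ballI impI)
  have fT: "finite T" using S T finite_subset by blast
  show "convex_cone hull T \<subseteq> convex_cone hull S" by (rule hull_mono[OF T])
  show "convex (convex_cone hull T)" by (rule convex_convex_cone_hull)
  fix a b x assume a: "a \<in> convex_cone hull S" and b: "b \<in> convex_cone hull S"
    and x: "x \<in> convex_cone hull T" and seg: "x \<in> open_segment a b"
  obtain ca where ca: "a = (\<Sum>v\<in>S. ca v *\<^sub>R v)" "\<forall>v\<in>S. 0 \<le> ca v"
    using a convex_cone_hull_finite[OF S(1)] by auto
  obtain cb where cb: "b = (\<Sum>v\<in>S. cb v *\<^sub>R v)" "\<forall>v\<in>S. 0 \<le> cb v"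
    using b convex_cone_hull_finite[OF S(1)] by auto
  obtain cx where cx: "x = (\<Sum>v\<in>T. cx v *\<^sub>R v)" "\<forall>v\<in>T. 0 \<le> cx v"
    using x convex_cone_hull_finite[OF fT] by auto
  obtain t where t: "0 < t" "t < 1" "x = (1 - t) *\<^sub>R a + t *\<^sub>R b"
    using seg by (auto simp: in_segment)
  have "(\<Sum>v\<in>S. ((1 - t) * ca v + t * cb v) *\<^sub>R v) = (\<Sum>v\<in>S. (if v \<in> T then cx v else 0) *\<^sub>R v)"
    using t(3) ca(1) cb(1) cx(1) sum_restrict_subset[OF S(1) T]
    by (simp add: scaleR_add_left sum.distrib scaleR_sum_right)
  from independent_sum_eqD[OF S this]
  have eq: "(1 - t) * ca v + t * cb v = 0" if "v \<in> S" "v \<notin> T" for v using that by auto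
  have z: "ca v = 0 \<and> cb v = 0" if "v \<in> S" "v \<notin> T" for v
  proof -
    have "0 \<le> (1 - t) * ca v" "0 \<le> t * cb v" using ca(2) cb(2) t that by auto
    then have "(1 - t) * ca v = 0" "t * cb v = 0" using eq[OF that] by linarith+
    then show ?thesis using t by auto
  qed
  have "a = (\<Sum>v\<in>T. ca v *\<^sub>R v)" "b = (\<Sum>v\<in>T. cb v *\<^sub>R v)"
    unfolding ca(1) cb(1) using z S T by (auto intro!: sum.mono_neutral_right)
  then show "a \<in> convex_cone hull T" "b \<in> convex_cone hull T"
    unfolding convex_cone_hull_finite[OF fT] using ca(2) cb(2) T by blast+
qed

lemma regular_fan_face: "regular_fan L \<Sigma> \<Longrightarrow> \<sigma> \<in> \<Sigma> \<Longrightarrow> \<tau> face_of \<sigma> \<Longrightarrow> \<tau> \<noteq> {} \<Longrightarrow> \<tau> \<in> \<Sigma>"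
  by (simp add: regular_fan_def)

lemma regular_fan_Int: "regular_fan L \<Sigma> \<Longrightarrow> \<sigma> \<in> \<Sigma> \<Longrightarrow> \<tau> \<in> \<Sigma> \<Longrightarrow> (\<sigma> \<inter> \<tau>) face_of \<sigma>"
  by (simp add: regular_fan_def)

lemma regular_fan_coneE:
  assumes "regular_fan L \<Sigma>" "\<sigma> \<in> \<Sigma>"
  obtains B S where "lattice_basis L B" "S \<subseteq> B" "\<sigma> = convex_cone hull S"
proof -
  have "regular_cone L \<sigma>" using assms by (simp add: regular_fan_def)
  then show ?thesis using that unfolding regular_cone_def by (elim exE conjE)
qed

lemma lattice_basis_combination: "lattice_basis L B \<Longrightarrow> (\<Sum>b\<in>B. of_int (k b) *\<^sub>R b) \<in> L"
  by (auto simp: lattice_basis_def)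

lemma lattice_basis_int_coeffs:
  assumes "lattice_basis L B" "S \<subseteq> B" "(\<Sum>b\<in>S. c b *\<^sub>R b) \<in> L" "b \<in> S"
  shows "c b \<in> \<int>"
proof -
  have B: "finite B" "independent B" and L: "L = range (\<lambda>k::_ \<Rightarrow> int. \<Sum>b\<in>B. of_int (k b) *\<^sub>R b)"
    using assms(1) by (auto simp: lattice_basis_def)
  obtain k :: "_ \<Rightarrow> int" where "(\<Sum>b\<in>S. c b *\<^sub>R b) = (\<Sum>b\<in>B. of_int (k b) *\<^sub>R b)"
    using assms(3) unfolding L by blast
  then have "(\<Sum>b\<in>B. (if b \<in> S then c b else 0) *\<^sub>R b) = (\<Sum>b\<in>B. of_int (k b) *\<^sub>R b)"
    using sum_restrict_subset[OF B(1) assms(2)] by metis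
  from independent_sum_eqD[OF B this, of b] show ?thesis using assms by auto
qed

lemma regular_cone_generator_primitive:
  assumes "lattice_basis L B" "b \<in> B"
  shows "primitive_generator L (convex_cone hull {b}) b"
proof -
  have B: "finite B" "independent B" and L: "L = range (\<lambda>k::_ \<Rightarrow> int. \<Sum>b\<in>B. of_int (k b) *\<^sub>R b)"
    using assms(1) by (auto simp: lattice_basis_def)
  have b0: "b \<noteq> 0" using B assms(2) dependent_zero by blast
  have "convex_cone hull {b} \<inter> L \<subseteq> range (\<lambda>n::nat. of_nat n *\<^sub>R b)"
  proof
    fix x assume x: "x \<in> convex_cone hull {b} \<inter> L"
    then obtain c where c: "x = c b *\<^sub>R b" "0 \<le> c b" by (auto simp: convex_cone_hull_finite)
    then have "c b \<in> \<int>" using lattice_basis_int_coeffs[OF assms(1), of "{b}" c b] x assms(2) by auto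
    then obtain n :: nat where "c b = of_nat n" using c(2) by (metis Ints_cases of_int_0_le_iff of_int_of_nat_eq zero_le_imp_eq_int)
    then show "x \<in> range (\<lambda>n::nat. of_nat n *\<^sub>R b)" using c(1) by (intro image_eqI[of _ _ n]) auto
  qed
  moreover have "of_nat n *\<^sub>R b \<in> convex_cone hull {b} \<inter> L" for n
  proof
    show "of_nat n *\<^sub>R b \<in> convex_cone hull {b}" by (intro convex_cone_hull_mul hull_inc) auto
    have "(\<Sum>v\<in>B. of_int (if v = b then int n else 0) *\<^sub>R v) = (\<Sum>v\<in>B. if v = b then of_nat n *\<^sub>R b else 0)"
      by (intro sum.cong) auto
    also have "\<dots> = of_nat n *\<^sub>R b" using B assms(2) by simp
    finally show "of_nat n *\<^sub>R b \<in> L"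
      using lattice_basis_combination[OF assms(1), of "\<lambda>v. if v = b then int n else 0"] by simp
  qed
  ultimately show ?thesis using b0 unfolding primitive_generator_def by blast
qed

lemma primitive_generator_unique:
  assumes "primitive_generator L \<sigma> v" "primitive_generator L \<sigma> w"
  shows "v = w"
proof -
  have eq: "range (\<lambda>n::nat. of_nat n *\<^sub>R v) = range (\<lambda>n::nat. of_nat n *\<^sub>R w)" and 0: "v \<noteq> 0" "w \<noteq> 0"
    using assms by (auto simp: primitive_generator_def)
  have "v \<in> range (\<lambda>n::nat. of_nat n *\<^sub>R w)" unfolding eq[symmetric] by (rule image_eqI[of _ _ 1]) auto
  then obtain n :: nat where n: "v = of_nat n *\<^sub>R w" by auto
  have "w \<in> range (\<lambda>n::nat. of_nat n *\<^sub>R v)" unfolding eq by (rule image_eqI[of _ _ 1]) auto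
  then obtain k :: nat where k: "w = of_nat k *\<^sub>R v" by auto
  have "v = of_nat (n * k) *\<^sub>R v" using n k by (metis of_nat_mult scaleR_scaleR)
  then have "n * k = 1" using 0
    by (metis of_nat_1_eq_iff scaleR_cancel_right scaleR_one)
  then show ?thesis using n by simp
qed

lemma fan_generator_is_ray_generator:
  fixes L :: "'a::euclidean_space set"
  assumes "regular_fan L \<Sigma>" "lattice_basis L B" "S \<subseteq> B" "convex_cone hull S \<in> \<Sigma>" "b \<in> S"
  shows "b \<in> ray_generators L \<Sigma>"
proof -
  have B: "finite B" "independent B" using assms(2) by (auto simp: lattice_basis_def)
  have S: "finite S" "independent S" using finite_subset[OF assms(3) B(1)] independent_mono[OF B(2) assms(3)] by auto
  have "(convex_cone hull {b}) face_of (convex_cone hull S)" using face_of_simplicial_cone[OF S, of "{b}"] assms by auto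
  then have mem: "convex_cone hull {b} \<in> \<Sigma>"
    by (rule regular_fan_face[OF assms(1,4) _ convex_cone_hull_nonempty])
  have "b \<noteq> 0" using S assms(5) dependent_zero by blast
  have "b \<in> convex_cone hull {b}" by (simp add: hull_inc)
  moreover have "convex_cone hull {b} \<subseteq> span {b}"
    by (simp add: hull_minimal convex_cone_span span_superset)
  ultimately have "span (convex_cone hull {b}) = span {b}"
    by (metis insert_subset order_antisym empty_subsetI span_mono span_span)
  then have "dim (convex_cone hull {b}) = dim {b}" by (metis dim_span)
  then have "dim (convex_cone hull {b}) = 1" using \<open>b \<noteq> 0\<close> by (simp add: dim_eq_card_independent)
  then show ?thesis using mem regular_cone_generator_primitive[OF assms(2)] assms(3,5)
    unfolding ray_generators_def by blast
qed

lemma double_in_segment: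
  fixes x :: "'a::real_vector"
  assumes "x \<noteq> 0"
  shows "2 *\<^sub>R x \<in> open_segment x (3 *\<^sub>R x)"
proof -
  have "x \<noteq> 3 *\<^sub>R x"
  proof
    assume "x = 3 *\<^sub>R x"
    then have "1 *\<^sub>R x = 3 *\<^sub>R x" by simp
    then show False using assms unfolding scaleR_cancel_right by simp
  qed
  moreover have "2 *\<^sub>R x = (1 - 1/2) *\<^sub>R x + (1/2) *\<^sub>R 3 *\<^sub>R x"
    by (simp flip: scaleR_add_left)
  ultimately show ?thesis unfolding in_segment by (intro conjI exI[of _ "1/2"]) auto
qed

text \<open>Faces are defined through open segments, and \<open>x + y\<close> is the midpoint of the
  segment from \<open>2 *\<^sub>R x\<close> to \<open>2 *\<^sub>R y\<close>. To descend from
  \<open>2 *\<^sub>R x\<close> to \<open>x\<close>, the face property is applied once more to the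
  segment from \<open>x\<close> to \<open>3 *\<^sub>R x\<close>. The cases are those in which one of
  the segments degenerates.\<close>

lemma cone_face_summand:
  fixes \<sigma> :: "'a::real_vector set"
  assumes "convex_cone \<sigma>" "\<tau> face_of \<sigma>" "x \<in> \<sigma>" "y \<in> \<sigma>" "x + y \<in> \<tau>"
  shows "x \<in> \<tau>"
proof (cases "x = y")
  case True
  show ?thesis
  proof (cases "x = 0")
    case True with assms \<open>x = y\<close> show ?thesis by simp
  next
    case False
    have "2 *\<^sub>R x \<in> \<tau>" using assms(5) True by (simp add: scaleR_2)
    moreover have "2 *\<^sub>R x \<in> open_segment x (3 *\<^sub>R x)" by (rule double_in_segment[OF False])
    moreover have "3 *\<^sub>R x \<in> \<sigma>" using convex_cone_scaleR[OF assms(1)] assms(3) by simp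
    ultimately show ?thesis using assms(2,3) unfolding face_of_def by blast
  qed
next
  case False
  have 2: "2 *\<^sub>R x \<in> \<sigma>" "2 *\<^sub>R y \<in> \<sigma>" using convex_cone_scaleR[OF assms(1)] assms by auto
  have "x + y \<in> open_segment (2 *\<^sub>R x) (2 *\<^sub>R y)"
    unfolding in_segment using False by (auto intro!: exI[of _ "1/2"])
  then have x2: "2 *\<^sub>R x \<in> \<tau>" "2 *\<^sub>R y \<in> \<tau>" using assms(2,5) 2 unfolding face_of_def by blast+
  show ?thesis
  proof (cases "x = 0")
    case True
    then show ?thesis using x2 by simp
  next
    case False
    have "2 *\<^sub>R x \<in> open_segment x (3 *\<^sub>R x)" by (rule double_in_segment[OF False])
    moreover have "3 *\<^sub>R x \<in> \<sigma>" using convex_cone_scaleR[OF assms(1)] assms(3) by simp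
    ultimately show ?thesis using assms(2,3) x2 unfolding face_of_def by blast
  qed
qed

text \<open>The ray \<rho> of \<open>v\<close> meets the cone in a face of it that contains
  \<open>v\<close>. Every summand of \<open>v\<close> with respect to \<open>S\<close> then lies in
  this face, hence in \<rho>, so some element of \<open>S\<close> is a positive multiple of
  \<open>v\<close>; as both are primitive generators of the same ray, they coincide.\<close>

lemma ray_generator_in_cone:
  fixes L :: "'a::euclidean_space set"
  assumes fan: "regular_fan L \<Sigma>" and B: "lattice_basis L B" "S \<subseteq> B" "convex_cone hull S \<in> \<Sigma>"
    and v: "v \<in> ray_generators L \<Sigma>" "v \<in> convex_cone hull S"
  shows "v \<in> S"
proof -
  have B': "finite B" "independent B" using B(1) by (auto simp: lattice_basis_def)
  have S: "finite S" "independent S" using finite_subset[OF B(2) B'(1)] independent_mono[OF B'(2) B(2)] by auto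
  obtain \<rho> where \<rho>: "\<rho> \<in> \<Sigma>" "dim \<rho> = 1" "primitive_generator L \<rho> v"
    using v(1) by (auto simp: ray_generators_def)
  have v0: "v \<noteq> 0" "v \<in> \<rho>"
    using \<rho>(3) by (auto simp: primitive_generator_def) (metis IntD1 of_nat_1 rangeI scaleR_one)
  obtain C T where C: "lattice_basis L C" "T \<subseteq> C" "\<rho> = convex_cone hull T"
    using regular_fan_coneE[OF fan \<rho>(1)] by blast
  have C': "finite C" "independent C" using C(1) by (auto simp: lattice_basis_def)
  have T: "finite T" "independent T" using finite_subset[OF C(2) C'(1)] independent_mono[OF C'(2) C(2)] by auto
  have "card T \<le> 1"
    using independent_card_le_dim[of T \<rho>] T \<rho>(2) C(3) hull_subset by metis
  moreover have "T \<noteq> {}" using v0 C(3) by (intro notI) simp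
  ultimately have "card T = 1" using T(1) card_0_eq[OF T(1)] by linarith
  then obtain b where b: "T = {b}" by (rule card_1_singletonE)
  have "v = b" using primitive_generator_unique[OF \<rho>(3)] regular_cone_generator_primitive[OF C(1)] C b by auto
  have face: "(convex_cone hull S \<inter> \<rho>) face_of convex_cone hull S"
    by (rule regular_fan_Int[OF fan B(3) \<rho>(1)])
  obtain c where c: "v = (\<Sum>x\<in>S. c x *\<^sub>R x)" "\<forall>x\<in>S. 0 \<le> c x"
    using v(2) convex_cone_hull_finite[OF S(1)] by auto
  obtain x where x: "x \<in> S" "c x \<noteq> 0"
    using v0 c(1) by (metis (mono_tags, lifting) scaleR_eq_0_iff sum.neutral)
  have "v = c x *\<^sub>R x + (\<Sum>x\<in>S - {x}. c x *\<^sub>R x)" using c(1) x(1) S(1) by (simp add: sum.remove)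
  moreover have "c x *\<^sub>R x \<in> convex_cone hull S" using x c by (intro convex_cone_hull_mul hull_inc) auto
  moreover have "(\<Sum>x\<in>S - {x}. c x *\<^sub>R x) \<in> convex_cone hull S"
  proof -
    have "(\<Sum>x\<in>S - {x}. c x *\<^sub>R x) \<in> convex_cone hull (S - {x})"
      using S c by (auto simp: convex_cone_hull_finite)
    then show ?thesis using hull_mono[of "S - {x}" S] by blast
  qed
  ultimately have "c x *\<^sub>R x \<in> \<rho>"
    using cone_face_summand[OF convex_cone_convex_cone_hull face] v(2) v0 by (metis IntD2 IntI)
  then obtain k where k: "c x *\<^sub>R x = k *\<^sub>R v" "0 \<le> k"
    using C(3) b \<open>v = b\<close> by (auto simp: convex_cone_hull_finite)
  have cx: "0 < c x" using x c(2) by (simp add: order_less_le)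
  define l where "l = inverse (c x) * k"
  have "inverse (c x) *\<^sub>R (c x *\<^sub>R x) = inverse (c x) *\<^sub>R (k *\<^sub>R v)" unfolding k(1) ..
  then have xk: "x = l *\<^sub>R v" using cx by (simp add: l_def)
  have "x \<noteq> 0" using S x dependent_zero by blast
  then have "l \<noteq> 0" using xk by auto
  then have l: "0 < l" using cx k(2) by (simp add: l_def order_less_le)
  have "l *\<^sub>R v \<in> convex_cone hull T" using l v0(2) C(3) by (intro convex_cone_hull_mul) auto
  then have "x \<in> \<rho>" using xk C(3) by simp
  have "inverse l *\<^sub>R x = v" using l by (subst xk) simp
  moreover have "inverse l *\<^sub>R x \<in> convex_cone hull {x}"
    using l by (intro convex_cone_hull_mul hull_inc) auto
  ultimately have "v \<in> convex_cone hull {x}" by simp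
  then have "\<rho> \<subseteq> convex_cone hull {x}" using C(3) b \<open>v = b\<close>
    by (simp add: hull_minimal convex_cone_convex_cone_hull)
  moreover have "convex_cone hull {x} \<subseteq> \<rho>" using \<open>x \<in> \<rho>\<close> C(3)
    by (simp add: hull_minimal convex_cone_convex_cone_hull)
  ultimately have "\<rho> = convex_cone hull {x}" by blast
  then have "v = x" using primitive_generator_unique[OF \<rho>(3)] regular_cone_generator_primitive[OF B(1)] B(2) x by blast
  then show ?thesis using x by simp
qed

section \<open>Characters dual to a lattice basis\<close>

lemma int_vec_inner: "int_vec m \<bullet> int_vec v = of_int (pairing m v)"
  by (simp add: inner_vec_def int_vec_def pairing_def)

lemma int_vec_add: "int_vec (v + w) = int_vec v + int_vec w"
  and int_vec_diff: "int_vec (v - w) = int_vec v - int_vec w"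
  and int_vec_minus: "int_vec (- v) = - int_vec v"
  and int_vec_0 [simp]: "int_vec 0 = 0"
  by (simp_all add: int_vec_def vec_eq_iff)

lemma pairing_add_left: "pairing (m + m') v = pairing m v + pairing m' v"
  and pairing_diff_left: "pairing (m - m') v = pairing m v - pairing m' v"
  and pairing_minus_left: "pairing (- m) v = - pairing m v"
  and pairing_0_left [simp]: "pairing 0 v = 0"
  by (simp_all add: pairing_def distrib_right left_diff_distrib sum.distrib sum_subtractf sum_negf)

text \<open>The real linear form with the prescribed values on \<open>B\<close> takes integral
  values on the standard basis, whose members are integral combinations of \<open>B\<close>; so it
  is given by an integral vector.\<close>

lemma lattice_basis_dual_character:
  assumes "lattice_basis (integer_lattice :: (real ^ 'r::finite) set) B"
  obtains m where "\<And>b. b \<in> B \<Longrightarrow> int_vec m \<bullet> b = of_int (\<phi> b)"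
proof -
  have B: "finite B" "independent B" and L: "integer_lattice = range (\<lambda>k::_ \<Rightarrow> int. \<Sum>b\<in>B. of_int (k b) *\<^sub>R b)"
    using assms by (auto simp: lattice_basis_def)
  obtain g :: "real ^ 'r \<Rightarrow> real" where g: "linear g" "\<forall>b\<in>B. g b = of_int (\<phi> b)"
    using linear_independent_extend[OF B(2), of "\<lambda>b. of_int (\<phi> b)"] by auto
  have int: "g (axis i 1) \<in> \<int>" for i
  proof -
    have "axis i 1 = int_vec (axis i 1 :: int ^ 'r)" by (simp add: int_vec_def axis_def vec_eq_iff)
    then have "axis i 1 \<in> (integer_lattice :: (real ^ 'r) set)" unfolding integer_lattice_def by (rule image_eqI) simp
    then obtain k :: "real ^ 'r \<Rightarrow> int" where k: "axis i 1 = (\<Sum>b\<in>B. of_int (k b) *\<^sub>R b)" unfolding L by blast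
    show ?thesis unfolding k linear_sum[OF g(1)] using g(2) by (auto simp: linear_cmul[OF g(1)] intro!: Ints_sum)
  qed
  define m where "m = (\<chi> i. \<lfloor>g (axis i 1)\<rfloor>)"
  have gx: "int_vec m \<bullet> x = g x" for x
  proof -
    have "g x = g (\<Sum>i\<in>UNIV. x $ i *\<^sub>R axis i 1)" by (subst (1) basis_expansion[of x, symmetric]) (simp add: scalar_mult_eq_scaleR)
    also have "\<dots> = (\<Sum>i\<in>UNIV. x $ i * g (axis i 1))" by (simp add: linear_sum[OF g(1)] linear_cmul[OF g(1)])
    also have "\<dots> = int_vec m \<bullet> x" unfolding inner_vec_def using int
      by (auto simp: int_vec_def m_def mult.commute intro!: sum.cong elim!: Ints_cases)
    finally show ?thesis by simp
  qed
  show ?thesis using that[of m] gx g(2) by auto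
qed

section \<open>The rays of a complete regular fan\<close>

definition rays_of :: "('s \<Rightarrow> int ^ 'r) \<Rightarrow> (real ^ 'r) set \<Rightarrow> 's set" where
  "rays_of u \<sigma> = {\<alpha>. int_vec (u \<alpha>) \<in> \<sigma>}"

locale complete_fan =
  fixes \<Sigma> :: "(real ^ 'r::finite) set set" and u :: "'s::finite \<Rightarrow> int ^ 'r"
  assumes fan: "regular_fan integer_lattice \<Sigma>"
    and complete: "\<Union>\<Sigma> = UNIV"
    and rays: "bij_betw (\<lambda>\<alpha>. int_vec (u \<alpha>)) UNIV (ray_generators integer_lattice \<Sigma>)"
begin

abbreviation R :: "(real ^ 'r) set \<Rightarrow> 's set" where "R \<equiv> rays_of u"
abbreviation U :: "'s \<Rightarrow> real ^ 'r" where "U \<alpha> \<equiv> int_vec (u \<alpha>)"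
abbreviation cone :: "'s set \<Rightarrow> (real ^ 'r) set" where "cone A \<equiv> convex_cone hull (U ` A)"

lemma inj_U: "inj U" using rays by (simp add: bij_betw_def)

lemma cone_basis:
  assumes "\<sigma> \<in> \<Sigma>"
  obtains B where "lattice_basis integer_lattice B" "U ` R \<sigma> \<subseteq> B" "\<sigma> = cone (R \<sigma>)"
proof -
  obtain B S where B: "lattice_basis integer_lattice B" "S \<subseteq> B" "\<sigma> = convex_cone hull S"
    by (rule regular_fan_coneE[OF fan assms])
  have "S = U ` R \<sigma>"
  proof
    show "S \<subseteq> U ` R \<sigma>"
    proof
      fix b assume b: "b \<in> S"
      then have "b \<in> ray_generators integer_lattice \<Sigma>"
        using fan_generator_is_ray_generator[OF fan B(1,2)] assms B(3) by blast
      then obtain \<alpha> where "b = U \<alpha>" using rays by (auto simp: bij_betw_def)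
      moreover have "b \<in> \<sigma>" using b B(3) by (simp add: hull_inc)
      ultimately show "b \<in> U ` R \<sigma>" by (auto simp: rays_of_def)
    qed
    show "U ` R \<sigma> \<subseteq> S"
    proof
      fix b assume "b \<in> U ` R \<sigma>"
      then have "b \<in> ray_generators integer_lattice \<Sigma>" "b \<in> convex_cone hull S"
        using rays B(3) by (auto simp: rays_of_def bij_betw_def)
      then show "b \<in> S" using ray_generator_in_cone[OF fan B(1,2)] assms B(3) by blast
    qed
  qed
  then show ?thesis using that B by blast
qed

lemma cone_rays: "\<sigma> \<in> \<Sigma> \<Longrightarrow> \<sigma> = cone (R \<sigma>)"
  by (rule cone_basis)

lemma dual_character:
  assumes "\<sigma> \<in> \<Sigma>"
  obtains m where "\<And>\<alpha>. \<alpha> \<in> R \<sigma> \<Longrightarrow> pairing m (u \<alpha>) = \<phi> \<alpha>"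
proof -
  obtain B where B: "lattice_basis integer_lattice B" "U ` R \<sigma> \<subseteq> B" by (rule cone_basis[OF assms])
  obtain m where m: "\<And>b. b \<in> B \<Longrightarrow> int_vec m \<bullet> b = of_int (\<phi> (inv_into UNIV U b))"
    using lattice_basis_dual_character[OF B(1), of "\<lambda>b. \<phi> (inv_into UNIV U b)"] by blast
  have "pairing m (u \<alpha>) = \<phi> \<alpha>" if "\<alpha> \<in> R \<sigma>" for \<alpha>
  proof -
    have "(of_int (pairing m (u \<alpha>)) :: real) = of_int (\<phi> (inv_into UNIV U (U \<alpha>)))"
      unfolding int_vec_inner[symmetric] using that B(2) by (intro m) auto
    then show ?thesis unfolding inv_f_f[OF inj_U] of_int_eq_iff .
  qed
  then show ?thesis using that by blast
qed

lemma cone_memD: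
  assumes "x \<in> cone A"
  obtains c where "\<And>\<alpha>. 0 \<le> c \<alpha>" "x = (\<Sum>\<alpha>\<in>A. c \<alpha> *\<^sub>R U \<alpha>)"
proof -
  obtain c where c: "x = (\<Sum>b\<in>U ` A. c b *\<^sub>R b)" "\<forall>b\<in>U ` A. 0 \<le> c b"
    using assms by (auto simp: convex_cone_hull_finite)
  have "x = (\<Sum>\<alpha>\<in>A. c (U \<alpha>) *\<^sub>R U \<alpha>)"
    unfolding c(1) using inj_U by (subst sum.reindex) (auto intro: inj_on_subset)
  also have "\<dots> = (\<Sum>\<alpha>\<in>A. (max 0 (c (U \<alpha>))) *\<^sub>R U \<alpha>)" using c(2) by (intro sum.cong) auto
  finally show ?thesis by (rule that[of "\<lambda>\<alpha>. max 0 (c (U \<alpha>))", rotated]) auto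
qed

lemma dual_monoid_cone: "m \<in> dual_monoid (cone A) \<longleftrightarrow> (\<forall>\<alpha>\<in>A. 0 \<le> pairing m (u \<alpha>))"
proof
  assume "m \<in> dual_monoid (cone A)"
  then show "\<forall>\<alpha>\<in>A. 0 \<le> pairing m (u \<alpha>)"
    unfolding dual_monoid_def using hull_inc[of "U _" "U ` A"] int_vec_inner[of m] by fastforce
next
  assume A: "\<forall>\<alpha>\<in>A. 0 \<le> pairing m (u \<alpha>)"
  have "0 \<le> int_vec m \<bullet> x" if "x \<in> cone A" for x
    using that
  proof (rule cone_memD)
    fix c assume "\<And>\<alpha>. 0 \<le> c \<alpha>" "x = (\<Sum>\<alpha>\<in>A. c \<alpha> *\<^sub>R U \<alpha>)"
    then show ?thesis using A by (auto simp: inner_sum_right int_vec_inner intro!: sum_nonneg)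
  qed
  then show "m \<in> dual_monoid (cone A)" by (simp add: dual_monoid_def)
qed

lemma orthogonal_lattice_cone: "m \<in> orthogonal_lattice (cone A) \<longleftrightarrow> (\<forall>\<alpha>\<in>A. pairing m (u \<alpha>) = 0)"
proof -
  have "m \<in> orthogonal_lattice \<sigma> \<longleftrightarrow> m \<in> dual_monoid \<sigma> \<and> - m \<in> dual_monoid \<sigma>" for \<sigma>
    unfolding orthogonal_lattice_def dual_monoid_def by (auto simp: int_vec_minus intro: antisym)
  then show ?thesis by (force simp: dual_monoid_cone pairing_minus_left)
qed

lemma dual_monoid_iff: "\<sigma> \<in> \<Sigma> \<Longrightarrow> m \<in> dual_monoid \<sigma> \<longleftrightarrow> (\<forall>\<alpha>\<in>R \<sigma>. 0 \<le> pairing m (u \<alpha>))"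
  using dual_monoid_cone cone_rays by metis

lemma orthogonal_lattice_iff: "\<sigma> \<in> \<Sigma> \<Longrightarrow> m \<in> orthogonal_lattice \<sigma> \<longleftrightarrow> (\<forall>\<alpha>\<in>R \<sigma>. pairing m (u \<alpha>) = 0)"
  using orthogonal_lattice_cone cone_rays by metis

lemma independent_rays:
  assumes "\<sigma> \<in> \<Sigma>" "A \<subseteq> R \<sigma>"
  shows "independent (U ` A)"
proof -
  obtain B where B: "lattice_basis integer_lattice B" "U ` R \<sigma> \<subseteq> B" by (rule cone_basis[OF assms(1)])
  then show ?thesis using assms(2) independent_mono[of B "U ` A"] by (auto simp: lattice_basis_def)
qed

text \<open>A further ray \<beta> in the cone of \<open>A\<close> would admit a character with value
  -1 at \<beta> and 0 on the other rays there. This character is nonnegative on the cone of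
  \<open>A\<close> but negative at a point of it.\<close>

lemma face_cone:
  assumes "\<sigma> \<in> \<Sigma>" "A \<subseteq> R \<sigma>"
  shows "cone A \<in> \<Sigma>" "R (cone A) = A"
proof -
  have "finite (U ` R \<sigma>)" "independent (U ` R \<sigma>)" using independent_rays[OF assms(1)] by auto
  from face_of_simplicial_cone[OF this, of "U ` A"] have face: "cone A face_of \<sigma>"
    using assms(2) cone_rays[OF assms(1)] by auto
  show mem: "cone A \<in> \<Sigma>" by (rule regular_fan_face[OF fan assms(1) face convex_cone_hull_nonempty])
  have "A \<subseteq> R (cone A)" by (auto simp: rays_of_def intro: hull_inc)
  moreover have "\<beta> \<in> A" if "\<beta> \<in> R (cone A)" for \<beta>
  proof (rule ccontr)
    assume "\<beta> \<notin> A"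
    obtain m where "\<And>\<alpha>. \<alpha> \<in> R (cone A) \<Longrightarrow> pairing m (u \<alpha>) = (if \<alpha> = \<beta> then - 1 else 0)"
      using dual_character[OF mem, of "\<lambda>\<alpha>. if \<alpha> = \<beta> then - 1 else 0"] by blast
    then have m: "m \<in> dual_monoid (cone A)" "pairing m (u \<beta>) = - 1"
      using that \<open>A \<subseteq> R (cone A)\<close> \<open>\<beta> \<notin> A\<close> by (auto simp: dual_monoid_cone)
    then show False using dual_monoid_iff[OF mem] that by force
  qed
  ultimately show "R (cone A) = A" by blast
qed

lemma zero_cone: "{0} \<in> \<Sigma>" "R {0} = {}"
proof -
  obtain \<sigma> where "\<sigma> \<in> \<Sigma>" using fan by (auto simp: regular_fan_def)
  from face_cone[OF this, of "{}"] show "{0} \<in> \<Sigma>" "R {0} = {}" by auto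
qed

definition full_cone :: "(real ^ 'r) set \<Rightarrow> bool" where
  "full_cone \<sigma> \<longleftrightarrow> \<sigma> \<in> \<Sigma> \<and> dim \<sigma> = CARD('r)"

text \<open>The union of the full-dimensional cones is closed. Its complement is open and is covered
  by finitely many cones of smaller dimension, so it is negligible and therefore empty.\<close>

lemma ex_full_cone:
  obtains \<sigma> where "full_cone \<sigma>" "x \<in> \<sigma>"
proof -
  have fin: "finite \<Sigma>" using fan by (simp add: regular_fan_def)
  have cl: "closed \<sigma>" if "\<sigma> \<in> \<Sigma>" for \<sigma>
    using cone_rays[OF that] closed_convex_cone_hull[of "U ` R \<sigma>"] by simp
  let ?F = "{\<sigma> \<in> \<Sigma>. dim \<sigma> = CARD('r)}"
  have "closed (\<Union>?F)" using fin cl by (intro closed_Union) auto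
  moreover have "negligible (\<Union>(\<Sigma> - ?F))"
  proof (rule negligible_Union)
    show "finite (\<Sigma> - ?F)" using fin by simp
    fix \<sigma> assume "\<sigma> \<in> \<Sigma> - ?F"
    then have "dim \<sigma> < DIM(real ^ 'r)"
      using dim_subset_UNIV[of \<sigma>] by (auto simp: order_less_le)
    then show "negligible \<sigma>" by (rule negligible_lowdim)
  qed
  moreover have "- \<Union>?F \<subseteq> \<Union>(\<Sigma> - ?F)" using complete by auto
  ultimately have "- \<Union>?F = {}"
    by (meson negligible_subset open_Compl open_not_negligible)
  then have "x \<in> \<Union>?F" by auto
  then show ?thesis using that by (auto simp: full_cone_def)
qed

text \<open>Let \<open>a\<close> be the sum of the rays in \<open>A\<close>. The points obtained
  from large multiples of \<open>a\<close> by subtracting the ray \<alpha> lie in full cones, and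
  one cone \<tau> contains infinitely many of them. After rescaling they converge to
  \<open>a\<close>, so \<open>a\<close> lies in \<tau> and the face property puts all of
  \<open>A\<close> there. If \<alpha> belonged to \<tau>, the character dual to it would be negative
  at one of these points. Such cones yield sections that vanish along \<alpha> but along no ray of
  \<open>A\<close>.\<close>

lemma ex_full_cone_avoiding:
  assumes "\<sigma> \<in> \<Sigma>" "A \<subseteq> R \<sigma>" "\<alpha> \<notin> A"
  obtains \<tau> where "full_cone \<tau>" "A \<subseteq> R \<tau>" "\<alpha> \<notin> R \<tau>"
proof -
  have cA: "cone A \<in> \<Sigma>" by (rule face_cone(1)[OF assms(1,2)])
  have fin: "finite \<Sigma>" using fan by (simp add: regular_fan_def)
  define a where "a = (\<Sum>\<beta>\<in>A. U \<beta>)"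
  define x where "x N = of_nat (Suc N) *\<^sub>R a - U \<alpha>" for N :: nat
  define f where "f N = (SOME \<tau>. full_cone \<tau> \<and> x N \<in> \<tau>)" for N
  have f: "full_cone (f N)" "x N \<in> f N" for N
    using someI_ex[of "\<lambda>\<tau>. full_cone \<tau> \<and> x N \<in> \<tau>"] ex_full_cone[of "x N"] unfolding f_def by metis+
  have "finite (range f)" using f(1) fin by (auto simp: full_cone_def intro: finite_subset)
  then obtain N0 where inf: "infinite {N. f N = f N0}"
    using pigeonhole_infinite[of UNIV f] by (auto simp: image_def)
  define \<tau> where "\<tau> = f N0"
  have \<tau>: "full_cone \<tau>" "\<tau> \<in> \<Sigma>" using f(1) by (auto simp: \<tau>_def full_cone_def)
  have \<tau>c: "closed \<tau>" using cone_rays[OF \<tau>(2)] closed_convex_cone_hull[of "U ` R \<tau>"] by simp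
  have cc: "convex_cone \<tau>" using cone_rays[OF \<tau>(2)] convex_cone_convex_cone_hull by metis
  have "a \<in> \<tau>"
  proof -
    define g where "g = enumerate {N. f N = f N0}"
    have g: "strict_mono g" "\<And>n. f (g n) = \<tau>"
      using strict_mono_enumerate[OF inf] enumerate_in_set[OF inf] by (auto simp: g_def \<tau>_def)
    have "(\<lambda>N. inverse (of_nat (Suc N)) *\<^sub>R x N) \<longlonglongrightarrow> a"
    proof -
      have "(\<lambda>N. a - inverse (of_nat (Suc N)) *\<^sub>R U \<alpha>) \<longlonglongrightarrow> a - 0 *\<^sub>R U \<alpha>"
        by (intro tendsto_intros LIMSEQ_inverse_real_of_nat)
      moreover have "inverse (of_nat (Suc N)) *\<^sub>R x N = a - inverse (of_nat (Suc N)) *\<^sub>R U \<alpha>" for N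
        by (simp add: x_def scaleR_diff_right del: of_nat_Suc)
      ultimately show ?thesis by simp
    qed
    then have "((\<lambda>N. inverse (of_nat (Suc N)) *\<^sub>R x N) \<circ> g) \<longlonglongrightarrow> a" by (rule LIMSEQ_subseq_LIMSEQ[OF _ g(1)])
    moreover have "((\<lambda>N. inverse (of_nat (Suc N)) *\<^sub>R x N) \<circ> g) n \<in> \<tau>" for n
      using f(2)[of "g n"] unfolding g(2)[of n] comp_def by (intro convex_cone_scaleR[OF cc]) auto
    ultimately show ?thesis using closed_sequentially[OF \<tau>c] by blast
  qed
  have aA: "a \<in> cone A" unfolding a_def by (auto simp: convex_cone_hull_finite sum.reindex[OF inj_on_subset[OF inj_U]] intro!: exI[of _ "\<lambda>_. 1"])
  have "A \<subseteq> R \<tau>"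
  proof
    fix \<beta> assume \<beta>: "\<beta> \<in> A"
    have face: "(cone A \<inter> \<tau>) face_of cone A" by (rule regular_fan_Int[OF fan cA \<tau>(2)])
    have "U \<beta> \<in> cone A" using \<beta> by (auto intro: hull_inc)
    moreover have "(\<Sum>\<gamma>\<in>A - {\<beta>}. U \<gamma>) \<in> cone A"
    proof -
      have "(\<Sum>\<gamma>\<in>A'. U \<gamma>) \<in> cone A" if "A' \<subseteq> A" for A'
        using finite[of A'] that
        by (induction A') (auto intro!: convex_cone_hull_add simp: hull_inc convex_cone_hull_contains_0)
      then show ?thesis by auto
    qed
    moreover have "U \<beta> + (\<Sum>\<gamma>\<in>A - {\<beta>}. U \<gamma>) = a" unfolding a_def using \<beta> by (simp add: sum.remove)
    ultimately have "U \<beta> \<in> cone A \<inter> \<tau>"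
      using cone_face_summand[OF convex_cone_convex_cone_hull face] aA \<open>a \<in> \<tau>\<close> by auto
    then show "\<beta> \<in> R \<tau>" by (auto simp: rays_of_def)
  qed
  moreover have "\<alpha> \<notin> R \<tau>"
  proof
    assume \<alpha>: "\<alpha> \<in> R \<tau>"
    obtain m where m: "\<And>\<beta>. \<beta> \<in> R \<tau> \<Longrightarrow> pairing m (u \<beta>) = (if \<beta> = \<alpha> then 1 else 0)"
      using dual_character[OF \<tau>(2), of "\<lambda>\<beta>. if \<beta> = \<alpha> then 1 else 0"] by blast
    then have "m \<in> dual_monoid \<tau>" using dual_monoid_iff[OF \<tau>(2)] by auto
    then have "0 \<le> int_vec m \<bullet> x N0" using f(2)[of N0] by (auto simp: dual_monoid_def \<tau>_def)
    moreover have "int_vec m \<bullet> a = 0" unfolding a_def inner_sum_right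
      using m \<open>A \<subseteq> R \<tau>\<close> assms(3) by (intro sum.neutral) (auto simp: int_vec_inner)
    moreover have "int_vec m \<bullet> U \<alpha> = 1" using m[OF \<alpha>] by (simp add: int_vec_inner)
    ultimately show False by (simp add: x_def inner_diff_right)
  qed
  ultimately show ?thesis using that \<tau>(1) by blast
qed

lemma full_cone_basis:
  assumes "full_cone \<sigma>"
  shows "lattice_basis integer_lattice (U ` R \<sigma>)" "card (R \<sigma>) = CARD('r)"
proof -
  have \<sigma>: "\<sigma> \<in> \<Sigma>" using assms by (simp add: full_cone_def)
  obtain B where B: "lattice_basis integer_lattice B" "U ` R \<sigma> \<subseteq> B" "\<sigma> = cone (R \<sigma>)" by (rule cone_basis[OF \<sigma>])
  have B': "finite B" "independent B" using B(1) by (auto simp: lattice_basis_def)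
  have "card B \<le> CARD('r)" using independent_bound[OF B'(2)] by simp
  have "\<sigma> \<subseteq> span (U ` R \<sigma>)" by (subst B(3)) (simp add: hull_minimal convex_cone_span span_superset)
  then have "dim \<sigma> \<le> card (U ` R \<sigma>)" by (intro dim_le_card) auto
  then have c: "CARD('r) \<le> card (U ` R \<sigma>)" using assms by (simp add: full_cone_def)
  then have "U ` R \<sigma> = B" using card_subset_eq[OF B'(1) B(2)] card_mono[OF B'(1) B(2)] \<open>card B \<le> CARD('r)\<close> by linarith
  then show "lattice_basis integer_lattice (U ` R \<sigma>)" using B(1) by simp
  show "card (R \<sigma>) = CARD('r)"
    using c \<open>U ` R \<sigma> = B\<close> \<open>card B \<le> CARD('r)\<close> card_image[OF inj_on_subset[OF inj_U], of "R \<sigma>"] by auto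
qed

lemma full_cone_dual_basis:
  assumes "full_cone \<sigma>"
  shows "\<exists>e. (\<forall>\<alpha>\<in>R \<sigma>. \<forall>\<beta>\<in>R \<sigma>. pairing (e \<alpha>) (u \<beta>) = (if \<beta> = \<alpha> then 1 else 0)) \<and>
    (\<forall>m v. pairing m v = (\<Sum>\<alpha>\<in>R \<sigma>. pairing m (u \<alpha>) * pairing (e \<alpha>) v))"
proof -
  have \<sigma>: "\<sigma> \<in> \<Sigma>" using assms by (simp add: full_cone_def)
  have "\<exists>m. \<forall>\<beta>\<in>R \<sigma>. pairing m (u \<beta>) = (if \<beta> = \<alpha> then 1 else 0)" for \<alpha>
    using dual_character[OF \<sigma>, of "\<lambda>\<beta>. if \<beta> = \<alpha> then 1 else 0"] by metis
  then obtain e where e: "\<And>\<alpha> \<beta>. \<beta> \<in> R \<sigma> \<Longrightarrow> pairing (e \<alpha>) (u \<beta>) = (if \<beta> = \<alpha> then 1 else 0)" by metis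
  have "pairing m v = (\<Sum>\<alpha>\<in>R \<sigma>. pairing m (u \<alpha>) * pairing (e \<alpha>) v)" for m v
  proof -
    have "int_vec v \<in> integer_lattice" by (simp add: integer_lattice_def)
    then obtain k :: "real ^ 'r \<Rightarrow> int" where k: "int_vec v = (\<Sum>b\<in>U ` R \<sigma>. of_int (k b) *\<^sub>R b)"
      using full_cone_basis(1)[OF assms] by (auto simp: lattice_basis_def)
    then have k': "int_vec v = (\<Sum>\<alpha>\<in>R \<sigma>. of_int (k (U \<alpha>)) *\<^sub>R U \<alpha>)"
      by (subst (asm) sum.reindex) (auto intro: inj_on_subset[OF inj_U])
    have p: "pairing m v = (\<Sum>\<alpha>\<in>R \<sigma>. k (U \<alpha>) * pairing m (u \<alpha>))" for m
    proof -
      have "(of_int (pairing m v) :: real) = of_int (\<Sum>\<alpha>\<in>R \<sigma>. k (U \<alpha>) * pairing m (u \<alpha>))"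
        unfolding int_vec_inner[symmetric] k' by (simp add: inner_sum_right int_vec_inner)
      then show ?thesis by linarith
    qed
    have "pairing (e \<alpha>) v = k (U \<alpha>)" if "\<alpha> \<in> R \<sigma>" for \<alpha>
    proof -
      have "pairing (e \<alpha>) v = (\<Sum>\<gamma>\<in>R \<sigma>. if \<gamma> = \<alpha> then k (U \<gamma>) else 0)"
        unfolding p using e by (intro sum.cong) auto
      then show ?thesis using that by simp
    qed
    then show ?thesis unfolding p[of m] by (intro sum.cong) auto
  qed
  then show ?thesis using e by (intro exI[of _ e] conjI ballI allI)
qed

text \<open>Later \<open>n\<close> is the cocharacter that records the orders of vanishing of
  characters at a point of a curve, and \<open>c\<close> gives the multiplicities along the
  divisors. Testing \<open>n\<close> with the characters dual to a lattice basis that extends the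
  rays of \<sigma> shows that its coordinates vanish outside these rays and are positive on
  them.\<close>

lemma relative_interior_lattice_point:
  assumes \<sigma>: "\<sigma> \<in> \<Sigma>"
    and pos: "\<And>m. m \<in> dual_monoid \<sigma> \<Longrightarrow> 0 \<le> pairing m n"
    and zero: "\<And>m. m \<in> dual_monoid \<sigma> \<Longrightarrow> pairing m n = 0 \<longleftrightarrow> m \<in> orthogonal_lattice \<sigma>"
  obtains c :: "'s \<Rightarrow> nat" where "\<And>\<alpha>. 0 < c \<alpha> \<longleftrightarrow> \<alpha> \<in> R \<sigma>"
    "\<And>m. pairing m n = (\<Sum>\<alpha>\<in>UNIV. int (c \<alpha>) * pairing m (u \<alpha>))"
proof -
  obtain B where B: "lattice_basis integer_lattice B" "U ` R \<sigma> \<subseteq> B" by (rule cone_basis[OF \<sigma>])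
  have fB: "finite B" using B(1) by (simp add: lattice_basis_def)
  have "int_vec n \<in> integer_lattice" by (simp add: integer_lattice_def)
  then obtain k :: "real ^ 'r \<Rightarrow> int" where k: "int_vec n = (\<Sum>b\<in>B. of_int (k b) *\<^sub>R b)"
    using B(1) by (auto simp: lattice_basis_def)
  have kb: "\<exists>m. (\<forall>b'\<in>B. int_vec m \<bullet> b' = (if b' = b then 1 else 0)) \<and> pairing m n = k b" if "b \<in> B" for b
  proof -
    obtain m where m: "\<And>b'. b' \<in> B \<Longrightarrow> int_vec m \<bullet> b' = of_int (if b' = b then 1 else 0)"
      using lattice_basis_dual_character[OF B(1), of "\<lambda>b'. if b' = b then 1 else 0"] by blast
    have "(of_int (pairing m n) :: real) = (\<Sum>b'\<in>B. if b' = b then of_int (k b') else 0)"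
      unfolding int_vec_inner[symmetric] k inner_sum_right using m by (intro sum.cong) auto
    also have "\<dots> = of_int (k b)" using that fB by simp
    finally have "pairing m n = k b" by linarith
    then show ?thesis using m by (intro exI[of _ m]) auto
  qed
  have k0: "k b = 0" if "b \<in> B" "b \<notin> U ` R \<sigma>" for b
  proof -
    obtain m where m: "\<forall>b'\<in>B. int_vec m \<bullet> b' = (if b' = b then 1 else 0)" "pairing m n = k b"
      using kb[OF \<open>b \<in> B\<close>] by auto
    have "pairing m (u \<alpha>) = 0" if "\<alpha> \<in> R \<sigma>" for \<alpha>
    proof -
      have "U \<alpha> \<in> B" "U \<alpha> \<noteq> b" using B(2) that \<open>b \<notin> U ` R \<sigma>\<close> by auto
      then show ?thesis using m(1) int_vec_inner[of m "u \<alpha>"] by simp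
    qed
    then have "m \<in> orthogonal_lattice \<sigma>" "m \<in> dual_monoid \<sigma>" using dual_monoid_iff[OF \<sigma>] orthogonal_lattice_iff[OF \<sigma>] by auto
    then show ?thesis using zero[of m] m(2) by auto
  qed
  have k1: "0 < k (U \<alpha>)" if \<alpha>: "\<alpha> \<in> R \<sigma>" for \<alpha>
  proof -
    obtain m where m: "\<forall>b'\<in>B. int_vec m \<bullet> b' = (if b' = U \<alpha> then 1 else 0)" "pairing m n = k (U \<alpha>)" using kb B(2) \<alpha> by blast
    have p: "pairing m (u \<beta>) = (if \<beta> = \<alpha> then 1 else 0)" if "\<beta> \<in> R \<sigma>" for \<beta>
    proof -
      have "int_vec m \<bullet> U \<beta> = (if U \<beta> = U \<alpha> then 1 else 0)" using m(1) B(2) that by blast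
      moreover have "U \<beta> = U \<alpha> \<longleftrightarrow> \<beta> = \<alpha>" using inj_eq[OF inj_U] by blast
      ultimately show ?thesis by (simp add: int_vec_inner split: if_splits)
    qed
    then have "m \<in> dual_monoid \<sigma>" "m \<notin> orthogonal_lattice \<sigma>" using dual_monoid_iff[OF \<sigma>] orthogonal_lattice_iff[OF \<sigma>] \<alpha> by auto
    then show ?thesis using zero[of m] pos[of m] m(2) by auto
  qed
  define c where "c \<alpha> = (if \<alpha> \<in> R \<sigma> then nat (k (U \<alpha>)) else 0)" for \<alpha>
  have "int_vec n = (\<Sum>b\<in>U ` R \<sigma>. of_int (k b) *\<^sub>R b)"
    unfolding k using k0 B(2) fB by (intro sum.mono_neutral_right) auto
  also have "\<dots> = (\<Sum>\<alpha>\<in>R \<sigma>. of_int (k (U \<alpha>)) *\<^sub>R U \<alpha>)"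
    by (subst sum.reindex) (auto intro: inj_on_subset[OF inj_U])
  also have "\<dots> = (\<Sum>\<alpha>\<in>UNIV. of_int (int (c \<alpha>)) *\<^sub>R U \<alpha>)"
    using k1 by (intro sum.mono_neutral_cong_left) (auto simp: c_def order_less_imp_le)
  finally have n: "int_vec n = (\<Sum>\<alpha>\<in>UNIV. of_int (int (c \<alpha>)) *\<^sub>R U \<alpha>)" .
  have "pairing m n = (\<Sum>\<alpha>\<in>UNIV. int (c \<alpha>) * pairing m (u \<alpha>))" for m
  proof -
    have "(of_int (pairing m n) :: real) = of_int (\<Sum>\<alpha>\<in>UNIV. int (c \<alpha>) * pairing m (u \<alpha>))"
      unfolding int_vec_inner[symmetric] n by (simp add: inner_sum_right int_vec_inner)
    then show ?thesis by linarith
  qed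
  moreover have "0 < c \<alpha> \<longleftrightarrow> \<alpha> \<in> R \<sigma>" for \<alpha> using k1 by (auto simp: c_def)
  ultimately show ?thesis using that by blast
qed

text \<open>Minus the sum of all rays lies in some full cone and has nonnegative integral
  coordinates there; adding 1 to the coefficient of every ray gives the relation. It is a lattice
  point of the dual effective cone with only positive entries.\<close>

lemma ex_positive_relation:
  "\<exists>y :: 's \<Rightarrow> nat. (\<forall>\<alpha>. 0 < y \<alpha>) \<and> (\<forall>m. (\<Sum>\<alpha>\<in>UNIV. int (y \<alpha>) * pairing m (u \<alpha>)) = 0)"
proof -
  define v where "v = - (\<Sum>\<alpha>\<in>UNIV. u \<alpha>)"
  have sum: "int_vec (\<Sum>\<alpha>\<in>A. u \<alpha>) = (\<Sum>\<alpha>\<in>A. U \<alpha>)" if "finite A" for A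
    using that by (induction A) (auto simp: int_vec_add)
  obtain \<sigma> where \<sigma>: "full_cone \<sigma>" "int_vec v \<in> \<sigma>" by (rule ex_full_cone)
  then have \<sigma>': "\<sigma> \<in> \<Sigma>" by (simp add: full_cone_def)
  obtain c where c: "\<And>\<alpha>. 0 \<le> c \<alpha>" "int_vec v = (\<Sum>\<alpha>\<in>R \<sigma>. c \<alpha> *\<^sub>R U \<alpha>)"
    using cone_memD \<sigma>(2) cone_rays[OF \<sigma>'] by metis
  have "c \<alpha> \<in> \<int>" if "\<alpha> \<in> R \<sigma>" for \<alpha>
  proof -
    obtain m where m: "\<And>\<beta>. \<beta> \<in> R \<sigma> \<Longrightarrow> pairing m (u \<beta>) = (if \<beta> = \<alpha> then 1 else 0)" using dual_character[OF \<sigma>', of "\<lambda>\<beta>. if \<beta> = \<alpha> then 1 else 0"] by blast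
    have "int_vec m \<bullet> int_vec v = (\<Sum>\<beta>\<in>R \<sigma>. if \<beta> = \<alpha> then c \<beta> else 0)"
      unfolding c(2) inner_sum_right using m by (intro sum.cong) (auto simp: int_vec_inner)
    then have "of_int (pairing m v) = c \<alpha>" using that by (simp add: int_vec_inner)
    then show ?thesis by (metis Ints_of_int)
  qed
  define y where "y \<alpha> = (if \<alpha> \<in> R \<sigma> then nat \<lfloor>c \<alpha>\<rfloor> else 0) + 1" for \<alpha>
  have ry: "real (y \<alpha>) = (if \<alpha> \<in> R \<sigma> then c \<alpha> else 0) + 1" for \<alpha>
    using \<open>\<And>\<alpha>. \<alpha> \<in> R \<sigma> \<Longrightarrow> c \<alpha> \<in> \<int>\<close>[of \<alpha>] c(1)[of \<alpha>] by (auto simp: y_def elim!: Ints_cases)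
  have "(\<Sum>\<alpha>\<in>UNIV. real (y \<alpha>) *\<^sub>R U \<alpha>) = (\<Sum>\<alpha>\<in>UNIV. (if \<alpha> \<in> R \<sigma> then c \<alpha> else 0) *\<^sub>R U \<alpha>) + (\<Sum>\<alpha>\<in>UNIV. U \<alpha>)"
    unfolding ry by (simp add: scaleR_add_left sum.distrib)
  also have "(\<Sum>\<alpha>\<in>UNIV. (if \<alpha> \<in> R \<sigma> then c \<alpha> else 0) *\<^sub>R U \<alpha>) = int_vec v"
    unfolding c(2) by (intro sum.mono_neutral_cong_right) auto
  finally have "(\<Sum>\<alpha>\<in>UNIV. real (y \<alpha>) *\<^sub>R U \<alpha>) = 0" by (simp add: v_def int_vec_minus sum)
  then have "int_vec m \<bullet> (\<Sum>\<alpha>\<in>UNIV. real (y \<alpha>) *\<^sub>R U \<alpha>) = 0" for m by simp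
  then have "(\<Sum>\<alpha>\<in>UNIV. real (y \<alpha>) * of_int (pairing m (u \<alpha>))) = 0" for m
    by (simp add: inner_sum_right int_vec_inner)
  moreover have "(\<Sum>\<alpha>\<in>UNIV. real (y \<alpha>) * of_int (pairing m (u \<alpha>))) = of_int (\<Sum>\<alpha>\<in>UNIV. int (y \<alpha>) * pairing m (u \<alpha>))" for m
    by simp
  ultimately have "(\<Sum>\<alpha>\<in>UNIV. int (y \<alpha>) * pairing m (u \<alpha>)) = 0" for m by (metis of_int_eq_0_iff)
  then show ?thesis by (intro exI[of _ y]) (auto simp: y_def)
qed

end

section \<open>Binary forms\<close>

abbreviation deg :: "'a::zero poly \<Rightarrow> nat" where "deg \<equiv> Polynomial.degree"
abbreviation cf :: "'a::zero poly \<Rightarrow> nat \<Rightarrow> 'a" where "cf \<equiv> Polynomial.coeff"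

lemma alg_closed_proots:
  fixes p :: "'o::alg_closed_field poly"
  assumes "p \<noteq> 0"
  shows "size (proots p) = deg p"
    and "p = Polynomial.smult (cf p (deg p)) (\<Prod>x\<in>#proots p. [:- x, 1:])"
proof -
  obtain A where A: "size A = deg p" "p = Polynomial.smult (cf p (deg p)) (\<Prod>x\<in>#A. [:-x, 1:])"
    using alg_closed_imp_factorization[OF assms] by auto
  have "proots p = proots (\<Prod>x\<in>#A. [:-x, 1:])"
    by (subst A(2), subst proots_smult) (use assms in auto)
  also have "\<dots> = A" 
  proof (induction A)
    case (add x A)
    have "(\<Prod>x\<in>#A. [:- x, 1:]) \<noteq> 0" by (auto simp: prod_mset_zero_iff)
    then show ?case using add by (simp add: proots_mult del: mult_pCons_left)
  qed simp
  finally show "size (proots p) = deg p" "p = Polynomial.smult (cf p (deg p)) (\<Prod>x\<in>#proots p. [:- x, 1:])"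
    using A by auto
qed

lemma alg_closed_orders_proportional:
  fixes p q :: "'o::alg_closed_field poly"
  assumes "p \<noteq> 0" "q \<noteq> 0" "\<And>x. Polynomial.order x p = Polynomial.order x q"
  obtains c where "c \<noteq> 0" "p = Polynomial.smult c q"
proof -
  have "proots p = proots q" using assms by (intro multiset_eqI) simp
  then have "p = Polynomial.smult (cf p (deg p) / cf q (deg q)) (Polynomial.smult (cf q (deg q)) (\<Prod>x\<in>#proots q. [:- x, 1:]))"
    using alg_closed_proots(2)[OF assms(1)] assms(2) by simp
  then have "p = Polynomial.smult (cf p (deg p) / cf q (deg q)) q" using alg_closed_proots(2)[OF assms(2)] by simp
  then show ?thesis using that assms(1,2) by (metis divide_eq_0_iff leading_coeff_0_iff)
qed

lemma infinite_alg_closed: "infinite (UNIV :: 'o::alg_closed_field set)"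
proof
  assume fin: "finite (UNIV :: 'o set)"
  define p where "p = (\<Prod>a\<in>(UNIV::'o set). [:- a, 1:]) + [:1:]"
  have nz: "(\<Prod>a\<in>(UNIV::'o set). [:- a, 1:]) \<noteq> 0" using fin by simp
  have "deg (\<Prod>a\<in>(UNIV::'o set). [:- a, 1:]) = (\<Sum>a\<in>(UNIV::'o set). deg [:- a, 1:])"
    by (rule degree_prod_eq_sum_degree) auto
  also have "\<dots> = card (UNIV :: 'o set)" by simp
  finally have d: "deg (\<Prod>a\<in>(UNIV::'o set). [:- a, 1:]) > 0" using fin by (simp add: finite_UNIV_card_ge_0)
  then have "deg p > 0" unfolding p_def by (subst degree_add_eq_left) auto
  then obtain x where "poly p x = 0" using alg_closed_imp_poly_has_root by blast
  moreover have "poly (\<Prod>a\<in>(UNIV::'o set). [:- a, 1:]) x = 0" using fin by (auto simp: poly_prod prod_zero_iff)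
  ultimately show False by (simp add: p_def)
qed

text \<open>This is multiplicativity of the value at infinity, where the form is read off its formal
  leading coefficient even if the true degree is smaller.\<close>

lemma coeff_mult_degree_le:
  fixes A B :: "'a::comm_semiring_0 poly"
  assumes "deg A \<le> e" "deg B \<le> e'"
  shows "cf (A * B) (e + e') = cf A e * cf B e'"
proof -
  have "cf (A * B) (e + e') = (\<Sum>i\<le>e + e'. cf A i * cf B (e + e' - i))" by (rule coeff_mult)
  also have "\<dots> = (\<Sum>i\<in>{e}. cf A i * cf B (e + e' - i))"
  proof (intro sum.mono_neutral_right ballI)
    fix i assume i: "i \<in> {..e + e'} - {e}"
    show "cf A i * cf B (e + e' - i) = 0"
    proof (cases "i < e")
      case True
      then have "deg B < e + e' - i" using assms by linarith
      then show ?thesis by (simp add: coeff_eq_0)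
    next
      case False
      then have "deg A < i" using assms i by auto
      then show ?thesis by (simp add: coeff_eq_0)
    qed
  qed auto
  finally show ?thesis by simp
qed

lemma form_value_mult:
  "deg A \<le> e \<Longrightarrow> deg B \<le> e' \<Longrightarrow> form_value (e + e') (A * B) z = form_value e A z * form_value e' B z"
  by (cases z) (auto simp: form_value_def coeff_mult_degree_le)

lemma form_value_0_1 [simp]: "form_value 0 1 z = 1"
  by (cases z) (auto simp: form_value_def)

lemma form_value_zero [simp]: "form_value e 0 z = 0"
  by (cases z) (auto simp: form_value_def)

lemma form_value_diff: "form_value e (A - B) z = form_value e A z - form_value e B z"
  by (cases z) (auto simp: form_value_def)

lemma form_value_smult: "form_value e (Polynomial.smult c A) z = c * form_value e A z"
  by (cases z) (auto simp: form_value_def)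

lemma form_value_power:
  "deg A \<le> e \<Longrightarrow> form_value (e * k) (A ^ k) z = form_value e A z ^ k"
proof (induction k)
  case (Suc k)
  have "deg (A ^ k) \<le> e * k" using degree_power_le[of A k] Suc.prems by (meson mult_le_mono1 order_trans)
  then show ?case using Suc form_value_mult[of A e "A ^ k" "e * k" z] by simp
qed simp

lemma degree_prod_le_sum:
  assumes "finite S" "\<And>i. i \<in> S \<Longrightarrow> deg (A i) \<le> e i"
  shows "deg (\<Prod>i\<in>S. A i) \<le> (\<Sum>i\<in>S. e i)"
proof -
  have "deg (\<Prod>i\<in>S. A i) \<le> (\<Sum>i\<in>S. deg (A i))" using degree_prod_sum_le[OF assms(1), of A] by (simp add: o_def)
  also have "\<dots> \<le> (\<Sum>i\<in>S. e i)" using assms(2) by (rule sum_mono)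
  finally show ?thesis .
qed

lemma form_value_prod:
  assumes "finite S" "\<And>i. i \<in> S \<Longrightarrow> deg (A i) \<le> e i"
  shows "form_value (\<Sum>i\<in>S. e i) (\<Prod>i\<in>S. A i) z = (\<Prod>i\<in>S. form_value (e i) (A i) z)"
  using assms
proof (induction S)
  case (insert i S)
  then show ?case by (simp add: form_value_mult degree_prod_le_sum)
qed simp

lemma degree_power_le_mult: "deg A \<le> e \<Longrightarrow> deg (A ^ k) \<le> e * k"
  using degree_power_le[of A k] by (meson mult_le_mono1 order_trans)

lemma form_order_eq_0_iff:
  assumes "A \<noteq> 0" "deg A \<le> e"
  shows "form_order e A z = 0 \<longleftrightarrow> form_value e A z \<noteq> 0"
proof (cases z)
  case None
  have "cf A e \<noteq> 0 \<longleftrightarrow> deg A = e"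
    using assms le_degree[of A e] by (metis leading_coeff_0_iff order_antisym)
  then show ?thesis using None assms by (auto simp: form_order_def form_value_def)
next
  case (Some x)
  then show ?thesis using assms by (simp add: form_order_def form_value_def order_root)
qed

lemma form_order_mult:
  fixes A B :: "'o::field poly"
  assumes "A \<noteq> 0" "B \<noteq> 0" "deg A \<le> e" "deg B \<le> e'"
  shows "form_order (e + e') (A * B) z = form_order e A z + form_order e' B z"
  using assms by (cases z) (auto simp: form_order_def order_mult degree_mult_eq)

lemma form_order_0_1 [simp]: "form_order 0 1 z = 0"
  by (cases z) (auto simp: form_order_def order_0I)

lemma form_order_power:
  fixes A :: "'o::field poly"
  assumes "A \<noteq> 0" "deg A \<le> e"
  shows "form_order (e * k) (A ^ k) z = k * form_order e A z"
proof (induction k)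
  case (Suc k)
  then show ?case using assms form_order_mult[of A "A ^ k" e "e * k" z] degree_power_le_mult[OF assms(2)] by simp
qed simp

lemma form_order_prod:
  fixes A :: "'i \<Rightarrow> 'o::field poly"
  assumes "finite S" "\<And>i. i \<in> S \<Longrightarrow> deg (A i) \<le> e i" "\<And>i. i \<in> S \<Longrightarrow> A i \<noteq> 0"
  shows "form_order (\<Sum>i\<in>S. e i) (\<Prod>i\<in>S. A i) z = (\<Sum>i\<in>S. form_order (e i) (A i) z)"
  using assms
proof (induction S)
  case (insert i S)
  then show ?case by (simp add: form_order_mult degree_prod_le_sum)
qed simp

lemma finite_form_zeros:
  fixes A :: "'o::field poly"
  assumes "A \<noteq> 0" "deg A \<le> e"
  shows "finite {z. form_value e A z = 0}"
proof -
  have "{z. form_value e A z = 0} \<subseteq> insert None (Some ` {x. poly A x = 0})"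
  proof
    fix z assume "z \<in> {z. form_value e A z = 0}"
    then show "z \<in> insert None (Some ` {x. poly A x = 0})" by (cases z) (auto simp: form_value_def)
  qed
  then show ?thesis using poly_roots_finite[OF assms(1)] finite_subset by fastforce
qed

lemma forms_eqI:
  fixes A B :: "'o::field poly"
  assumes "deg A \<le> e" "deg B \<le> e" "infinite Z" "\<And>z. z \<in> Z \<Longrightarrow> form_value e A z = form_value e B z"
  shows "A = B"
proof (rule ccontr)
  assume "A \<noteq> B"
  then have "finite {z. form_value e (A - B) z = 0}" using assms degree_diff_le by (intro finite_form_zeros) auto
  moreover have "Z \<subseteq> {z. form_value e (A - B) z = 0}" using assms(4) by (auto simp: form_value_diff)
  ultimately show False using assms(3) finite_subset by blast
qed

lemma finite_form_order:
  fixes A :: "'o::field poly"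
  assumes "A \<noteq> 0" "deg A \<le> e"
  shows "finite {z. form_order e A z \<noteq> 0}"
  using finite_form_zeros[OF assms] form_order_eq_0_iff[OF assms] by simp

text \<open>The polynomial has \<open>deg A\<close> roots with multiplicity, and the order at
  \<open>None\<close> supplies the missing \<open>e - deg A\<close>.\<close>

lemma sum_form_order:
  fixes A :: "'o::alg_closed_field poly"
  assumes "A \<noteq> 0" "deg A \<le> e" "finite Z" "{z. form_order e A z \<noteq> 0} \<subseteq> Z"
  shows "(\<Sum>z\<in>Z. form_order e A z) = e"
proof -
  let ?R = "{x. poly A x = 0}"
  have finR: "finite ?R" using poly_roots_finite[OF assms(1)] .
  have sub: "{z. form_order e A z \<noteq> 0} \<subseteq> insert None (Some ` ?R)"
  proof
    fix z assume "z \<in> {z. form_order e A z \<noteq> 0}"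
    then show "z \<in> insert None (Some ` {x. poly A x = 0})"
      using assms(1) by (cases z) (auto simp: form_order_def order_root)
  qed
  have "(\<Sum>z\<in>Z. form_order e A z) = (\<Sum>z\<in>{z. form_order e A z \<noteq> 0}. form_order e A z)"
    using assms(3,4) by (intro sum.mono_neutral_right) auto
  also have "\<dots> = (\<Sum>z\<in>insert None (Some ` ?R). form_order e A z)"
    using finR sub by (intro sum.mono_neutral_left) auto
  also have "\<dots> = form_order e A None + (\<Sum>x\<in>?R. form_order e A (Some x))"
    using finR by (subst sum.insert) (auto simp: sum.reindex)
  also have "(\<Sum>x\<in>?R. form_order e A (Some x)) = (\<Sum>x\<in>set_mset (proots A). count (proots A) x)"
    using assms(1) by (simp add: form_order_def)
  also have "\<dots> = deg A" using alg_closed_proots(1)[OF assms(1)] by (simp add: size_multiset_overloaded_eq)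
  finally show ?thesis using assms(2) by (simp add: form_order_def)
qed

lemma infinite_option: "infinite (UNIV :: 'o::alg_closed_field option set)"
  using infinite_alg_closed by (metis finite_option_UNIV)

section \<open>Curves in homogeneous coordinates\<close>

lemma pairing_eqD:
  assumes "\<And>v. pairing m v = pairing m' v"
  shows "m = m'"
proof -
  have "m $ i = m' $ i" for i
    using assms[of "axis i 1"] by (simp add: pairing_def axis_def if_distrib[of "\<lambda>x. _ * x"] cong: if_cong)
  then show ?thesis by (simp add: vec_eq_iff)
qed

lemma additive_eq_pairing:
  fixes g :: "int ^ 'r::finite \<Rightarrow> int"
  assumes add: "\<And>m m'. g (m + m') = g m + g m'"
  obtains n where "\<And>m. g m = pairing m n"
proof -
  have g0: "g 0 = 0" using add[of 0 0] by simp
  have neg: "g (- m) = - g m" for m using add[of m "- m"] g0 by simp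
  have nat: "g (int k *s m) = int k * g m" for k m
  proof (induction k)
    case 0 then show ?case by (simp add: g0)
  next
    case (Suc k)
    have "int (Suc k) *s m = m + int k *s m" by (simp add: vec_eq_iff algebra_simps)
    then show ?case using Suc by (simp add: add algebra_simps)
  qed
  have scale: "g (k *s m) = k * g m" for k m
  proof (cases "0 \<le> k")
    case True then show ?thesis using nat[of "nat k" m] by simp
  next
    case False
    have "k *s m = - (int (nat (- k)) *s m)" using False by (simp add: vec_eq_iff)
    then show ?thesis using nat[of "nat (- k)" m] neg False by simp
  qed
  have sum: "g (\<Sum>i\<in>S. m i) = (\<Sum>i\<in>S. g (m i))" if "finite S" for S and m :: "'r \<Rightarrow> int ^ 'r"
    using that by (induction S) (auto simp: g0 add)
  have "g m = pairing m (\<chi> i. g (axis i 1))" for m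
  proof -
    have "m = (\<Sum>i\<in>UNIV. m $ i *s axis i 1)" by (simp add: basis_expansion)
    then have "g m = (\<Sum>i\<in>UNIV. g (m $ i *s axis i 1))" using sum[of UNIV "\<lambda>i. m $ i *s axis i 1"] by simp
    then show ?thesis by (simp add: scale pairing_def)
  qed
  then show ?thesis using that by blast
qed

lemma power_int_split:
  fixes x :: "'o::field"
  assumes "x \<noteq> 0 \<or> k = 0"
  shows "x powi k = x ^ nat k / x ^ nat (- k)"
  using assms by (cases "0 \<le> k") (auto simp: power_int_def field_simps)

lemma open_orbit_iff: "f \<in> toric_points \<Sigma> \<Longrightarrow> f \<in> open_orbit \<longleftrightarrow> fst f = {0}"
  by (auto simp: open_orbit_def toric_points_def split: prod.splits)

lemma dual_monoid_zero [simp]: "dual_monoid {0} = UNIV"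
  and orthogonal_lattice_zero [simp]: "orthogonal_lattice {0} = UNIV"
  by (auto simp: dual_monoid_def orthogonal_lattice_def)

lemma open_orbit_nonzero: "f \<in> open_orbit \<Longrightarrow> snd f m \<noteq> 0"
  and open_orbit_mult: "f \<in> open_orbit \<Longrightarrow> snd f (m + m') = snd f m * snd f m'"
  by (auto simp: open_orbit_def toric_points_def)

lemma rational_function_unique:
  fixes A B A' B' :: "'o::alg_closed_field poly"
  assumes fin: "finite {w. w \<notin> W}"
    and A: "deg A \<le> e" "deg B \<le> e" "B \<noteq> 0" "deg A' \<le> e'" "deg B' \<le> e'" "B' \<noteq> 0"
    and v: "\<And>w. w \<in> W \<Longrightarrow> form_value e B w \<noteq> 0 \<Longrightarrow> g w = form_value e A w / form_value e B w"
    and v': "\<And>w. w \<in> W \<Longrightarrow> form_value e' B' w \<noteq> 0 \<Longrightarrow> g w = form_value e' A' w / form_value e' B' w"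
  shows "A * B' = A' * B"
proof (rule forms_eqI)
  let ?Z = "W - {w. form_value e B w = 0} - {w. form_value e' B' w = 0}"
  show "deg (A * B') \<le> e + e'" "deg (A' * B) \<le> e + e'"
    using A degree_mult_le[of A B'] degree_mult_le[of A' B] by linarith+
  have "finite (UNIV - ?Z)"
    using fin finite_form_zeros[OF A(3,2)] finite_form_zeros[OF A(6,5)]
    by (rule_tac finite_subset[of _ "{w. w \<notin> W} \<union> {w. form_value e B w = 0} \<union> {w. form_value e' B' w = 0}"]) auto
  then show "infinite ?Z" using infinite_option by (metis finite_Diff2)
  fix w assume w: "w \<in> ?Z"
  then have "form_value e A w * form_value e' B' w = form_value e' A' w * form_value e B w"
    using v[of w] v'[of w] by (auto simp: field_simps)
  then show "form_value (e + e') (A * B') w = form_value (e + e') (A' * B) w"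
    using A by (simp add: form_value_mult add.commute[of e e'], subst add.commute, simp add: form_value_mult)
qed

text \<open>Two fractions of forms that represent the same character agree at infinitely many
  points, so their cross products are equal polynomials. Hence the difference of orders does not
  depend on the fraction, and the definite description can be evaluated with any of them.\<close>

lemma character_order_eq:
  fixes A B :: "'o::alg_closed_field poly"
  assumes fin: "finite {w. f w \<notin> open_orbit}"
    and A: "A \<noteq> 0" "B \<noteq> 0" "deg A \<le> e" "deg B \<le> e"
    and v: "\<And>w. f w \<in> open_orbit \<Longrightarrow> form_value e B w \<noteq> 0 \<Longrightarrow> snd (f w) m = form_value e A w / form_value e B w"
  shows "character_order f m z = int (form_order e A z) - int (form_order e B z)"
  unfolding character_order_def
proof (rule the_equality)
  show "\<exists>e' A' B'. A' \<noteq> 0 \<and> B' \<noteq> 0 \<and> deg A' \<le> e' \<and> deg B' \<le> e' \<and>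
     (\<forall>w. f w \<in> open_orbit \<and> form_value e' B' w \<noteq> 0 \<longrightarrow> snd (f w) m = form_value e' A' w / form_value e' B' w) \<and>
     int (form_order e A z) - int (form_order e B z) = int (form_order e' A' z) - int (form_order e' B' z)"
    using A v by blast
  fix k assume "\<exists>e' A' B'. A' \<noteq> 0 \<and> B' \<noteq> 0 \<and> deg A' \<le> e' \<and> deg B' \<le> e' \<and>
     (\<forall>w. f w \<in> open_orbit \<and> form_value e' B' w \<noteq> 0 \<longrightarrow> snd (f w) m = form_value e' A' w / form_value e' B' w) \<and>
     k = int (form_order e' A' z) - int (form_order e' B' z)"
  then obtain e' A' B' where B: "A' \<noteq> 0" "B' \<noteq> 0" "deg A' \<le> e'" "deg B' \<le> e'"
     "\<And>w. f w \<in> open_orbit \<Longrightarrow> form_value e' B' w \<noteq> 0 \<Longrightarrow> snd (f w) m = form_value e' A' w / form_value e' B' w"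
     "k = int (form_order e' A' z) - int (form_order e' B' z)" by blast
  have "A * B' = A' * B"
    by (rule rational_function_unique[of "{w. f w \<in> open_orbit}" A e B A' e' B' "\<lambda>w. snd (f w) m"])
       (use fin A B v in auto)
  then have "form_order (e + e') (A * B') z = form_order (e' + e) (A' * B) z" by (simp add: add.commute)
  then have "form_order e A z + form_order e' B' z = form_order e' A' z + form_order e B z"
    using A B by (simp add: form_order_mult)
  then show "k = int (form_order e A z) - int (form_order e B z)" using B(6) by simp
qed

section \<open>Curves given by homogeneous coordinates\<close>

definition cox_zeros :: "('s \<Rightarrow> nat) \<Rightarrow> ('s \<Rightarrow> 'o::field poly) \<Rightarrow> 'o option \<Rightarrow> 's set" where
  "cox_zeros y Q z = {\<alpha>. form_value (y \<alpha>) (Q \<alpha>) z = 0}"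

text \<open>The quotient presentation of the toric variety: the values of the forms are the
  homogeneous coordinates of the point, the vanishing coordinates span its cone, and a character is
  a Laurent monomial in the coordinates. In the first branch a vanishing coordinate occurs only with
  exponent 0, where the power is 1; the other characters get the value 0 demanded by
  \<open>toric_points\<close>.\<close>

definition cox_curve :: "('s::finite \<Rightarrow> int ^ 'r::finite) \<Rightarrow> ('s \<Rightarrow> nat) \<Rightarrow> ('s \<Rightarrow> 'o::field poly) \<Rightarrow>
    'o option \<Rightarrow> ('r, 'o) toric_point" where
  "cox_curve u y Q z = (convex_cone hull ((\<lambda>\<alpha>. int_vec (u \<alpha>)) ` cox_zeros y Q z),
     \<lambda>m. if \<forall>\<alpha>\<in>cox_zeros y Q z. pairing m (u \<alpha>) = 0
          then \<Prod>\<alpha>\<in>UNIV. form_value (y \<alpha>) (Q \<alpha>) z powi pairing m (u \<alpha>) else 0)"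

text \<open>Truncation by \<open>nat\<close> keeps the positive exponents, so the Laurent monomial
  with exponents \<open>k\<close> is the quotient of the forms belonging to \<open>k\<close> and to
  \<open>- k\<close>.\<close>

definition monomial_form :: "('s::finite \<Rightarrow> 'o::field poly) \<Rightarrow> ('s \<Rightarrow> int) \<Rightarrow> 'o poly" where
  "monomial_form Q k = (\<Prod>\<alpha>\<in>UNIV. Q \<alpha> ^ nat (k \<alpha>))"

definition monomial_degree :: "('s::finite \<Rightarrow> nat) \<Rightarrow> ('s \<Rightarrow> int) \<Rightarrow> nat" where
  "monomial_degree y k = (\<Sum>\<alpha>\<in>UNIV. y \<alpha> * nat (k \<alpha>))"

lemma monomial_form_degree:
  "(\<And>\<alpha>. deg (Q \<alpha>) \<le> y \<alpha>) \<Longrightarrow> deg (monomial_form Q k) \<le> monomial_degree y k"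
  unfolding monomial_form_def monomial_degree_def by (intro degree_prod_le_sum degree_power_le_mult) auto

lemma monomial_form_nonzero:
  assumes "\<And>\<alpha>. Q \<alpha> \<noteq> 0"
  shows "monomial_form Q k \<noteq> 0"
  unfolding monomial_form_def prod_zero_iff[OF finite] using assms by (metis power_not_zero)

lemma int_nat_diff: "int (nat k) - int (nat (- k)) = k"
  by simp

lemma monomial_form_value:
  assumes "\<And>\<alpha>. deg (Q \<alpha>) \<le> y \<alpha>"
  shows "form_value (monomial_degree y k) (monomial_form Q k) z = (\<Prod>\<alpha>\<in>UNIV. form_value (y \<alpha>) (Q \<alpha>) z ^ nat (k \<alpha>))"
  unfolding monomial_form_def monomial_degree_def
  by (subst form_value_prod) (auto intro!: degree_power_le_mult prod.cong form_value_power assms)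

lemma monomial_form_order:
  assumes "\<And>\<alpha>. deg (Q \<alpha>) \<le> y \<alpha>" "\<And>\<alpha>. Q \<alpha> \<noteq> 0"
  shows "form_order (monomial_degree y k) (monomial_form Q k) z = (\<Sum>\<alpha>\<in>UNIV. nat (k \<alpha>) * form_order (y \<alpha>) (Q \<alpha>) z)"
  unfolding monomial_form_def monomial_degree_def
  by (subst form_order_prod) (auto intro!: degree_power_le_mult sum.cong form_order_power assms simp: assms)

text \<open>A Laurent monomial of total degree 0 has a numerator and a denominator of equal degree,
  as a rational function on the projective line requires.\<close>

lemma monomial_degree_balanced:
  assumes "(\<Sum>\<alpha>\<in>UNIV. int (y \<alpha>) * k \<alpha>) = 0"
  shows "monomial_degree y (\<lambda>\<alpha>. - k \<alpha>) = monomial_degree y k"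
proof -
  have "int (monomial_degree y k) - int (monomial_degree y (\<lambda>\<alpha>. - k \<alpha>)) = (\<Sum>\<alpha>\<in>UNIV. int (y \<alpha>) * k \<alpha>)"
    unfolding monomial_degree_def of_nat_sum sum_subtractf[symmetric]
    by (intro sum.cong refl) (simp only: of_nat_mult right_diff_distrib[symmetric] int_nat_diff)
  then show ?thesis using assms by simp
qed

lemma prod_power_int_split:
  fixes x :: "'s::finite \<Rightarrow> 'o::field"
  assumes "\<And>\<alpha>. x \<alpha> = 0 \<Longrightarrow> k \<alpha> = 0"
  shows "(\<Prod>\<alpha>\<in>UNIV. x \<alpha> powi k \<alpha>) = (\<Prod>\<alpha>\<in>UNIV. x \<alpha> ^ nat (k \<alpha>)) / (\<Prod>\<alpha>\<in>UNIV. x \<alpha> ^ nat (- k \<alpha>))"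
  unfolding prod_dividef[symmetric] using assms by (intro prod.cong power_int_split) auto

context complete_fan begin

text \<open>The linear relations make every character a rational function of degree 0. The last
  condition says that the coordinates avoid the irrelevant locus: the forms vanishing at a common
  point belong to the rays of a cone.\<close>

definition admissible :: "('s \<Rightarrow> nat) \<Rightarrow> ('s \<Rightarrow> 'o::field poly) \<Rightarrow> bool" where
  "admissible y Q \<longleftrightarrow> (\<forall>\<alpha>. Q \<alpha> \<noteq> 0 \<and> deg (Q \<alpha>) \<le> y \<alpha>) \<and>
     (\<forall>m. (\<Sum>\<alpha>\<in>UNIV. int (y \<alpha>) * pairing m (u \<alpha>)) = 0) \<and>
     (\<forall>z. \<exists>\<sigma>\<in>\<Sigma>. R \<sigma> = cox_zeros y Q z)"

lemma admissibleD:
  assumes "admissible y Q"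
  shows "Q \<alpha> \<noteq> 0" "deg (Q \<alpha>) \<le> y \<alpha>" "(\<Sum>\<alpha>\<in>UNIV. int (y \<alpha>) * pairing m (u \<alpha>)) = 0"
    "cone (cox_zeros y Q z) \<in> \<Sigma>" "R (cone (cox_zeros y Q z)) = cox_zeros y Q z"
proof -
  show "Q \<alpha> \<noteq> 0" "deg (Q \<alpha>) \<le> y \<alpha>" "(\<Sum>\<alpha>\<in>UNIV. int (y \<alpha>) * pairing m (u \<alpha>)) = 0"
    using assms by (auto simp: admissible_def)
  have "\<exists>\<sigma>\<in>\<Sigma>. R \<sigma> = cox_zeros y Q z" using assms unfolding admissible_def by blast
  then obtain \<sigma> where "\<sigma> \<in> \<Sigma>" "R \<sigma> = cox_zeros y Q z" by blast
  then show "cone (cox_zeros y Q z) \<in> \<Sigma>" "R (cone (cox_zeros y Q z)) = cox_zeros y Q z"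
    using cone_rays by metis+
qed

lemma cox_zeros_finite:
  assumes "admissible y (Q :: 's \<Rightarrow> 'o::field poly)"
  shows "finite {z. cox_zeros y Q z \<noteq> {}}"
proof -
  have "{z. cox_zeros y Q z \<noteq> {}} = (\<Union>\<alpha>. {z. form_value (y \<alpha>) (Q \<alpha>) z = 0})" by (auto simp: cox_zeros_def)
  then show ?thesis by (auto intro!: finite_form_zeros admissibleD[OF assms])
qed

lemma admissible_form_value:
  "admissible y Q \<Longrightarrow> form_value (monomial_degree y k) (monomial_form Q k) z = (\<Prod>\<alpha>\<in>UNIV. form_value (y \<alpha>) (Q \<alpha>) z ^ nat (k \<alpha>))"
  by (rule monomial_form_value) (rule admissibleD(2))

lemma admissible_balanced:
  "admissible y Q \<Longrightarrow> monomial_degree y (\<lambda>\<alpha>. - pairing m (u \<alpha>)) = monomial_degree y (\<lambda>\<alpha>. pairing m (u \<alpha>))"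
  by (rule monomial_degree_balanced) (rule admissibleD(3))

lemma cox_curve_toric_points:
  assumes "admissible y Q"
  shows "cox_curve u y Q z \<in> toric_points \<Sigma>"
proof -
  let ?x = "\<lambda>\<alpha>. form_value (y \<alpha>) (Q \<alpha>) z" and ?A = "cox_zeros y Q z"
  let ?g = "\<lambda>m. if \<forall>\<alpha>\<in>?A. pairing m (u \<alpha>) = 0 then \<Prod>\<alpha>\<in>UNIV. ?x \<alpha> powi pairing m (u \<alpha>) else 0"
  have "?g (m + m') = ?g m * ?g m'"
    if "\<forall>\<alpha>\<in>?A. 0 \<le> pairing m (u \<alpha>)" "\<forall>\<alpha>\<in>?A. 0 \<le> pairing m' (u \<alpha>)" for m m'
  proof (cases "(\<forall>\<alpha>\<in>?A. pairing m (u \<alpha>) = 0) \<and> (\<forall>\<alpha>\<in>?A. pairing m' (u \<alpha>) = 0)")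
    case True
    have "?x \<alpha> powi (pairing m (u \<alpha>) + pairing m' (u \<alpha>)) = ?x \<alpha> powi pairing m (u \<alpha>) * ?x \<alpha> powi pairing m' (u \<alpha>)" for \<alpha>
      using True by (cases "?x \<alpha> = 0") (auto simp: cox_zeros_def power_int_add)
    then show ?thesis using True by (simp add: pairing_add_left prod.distrib)
  next
    case False
    then have "\<not> (\<forall>\<alpha>\<in>?A. pairing (m + m') (u \<alpha>) = 0)"
      using that by (auto simp: pairing_add_left) (metis add_nonneg_eq_0_iff)+
    then show ?thesis using False by auto
  qed
  moreover have "?g m \<noteq> 0 \<longleftrightarrow> (\<forall>\<alpha>\<in>?A. pairing m (u \<alpha>) = 0)" for m
    by (auto simp: cox_zeros_def power_int_eq_0_iff)
  ultimately show ?thesis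
    using admissibleD(4)[OF assms]
    by (simp add: cox_curve_def toric_points_def dual_monoid_cone orthogonal_lattice_cone)
qed

lemma cox_curve_value:
  assumes Q: "admissible y Q" and m: "\<forall>\<alpha>\<in>cox_zeros y Q z. 0 \<le> pairing m (u \<alpha>)"
  shows "snd (cox_curve u y Q z) m =
     form_value (monomial_degree y (\<lambda>\<alpha>. pairing m (u \<alpha>))) (monomial_form Q (\<lambda>\<alpha>. pairing m (u \<alpha>))) z /
     form_value (monomial_degree y (\<lambda>\<alpha>. pairing m (u \<alpha>))) (monomial_form Q (\<lambda>\<alpha>. - pairing m (u \<alpha>))) z"
    (is "_ = ?p / ?n")
proof -
  let ?x = "\<lambda>\<alpha>. form_value (y \<alpha>) (Q \<alpha>) z"
  have v: "?p = (\<Prod>\<alpha>\<in>UNIV. ?x \<alpha> ^ nat (pairing m (u \<alpha>)))" "?n = (\<Prod>\<alpha>\<in>UNIV. ?x \<alpha> ^ nat (- pairing m (u \<alpha>)))"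
    using admissible_form_value[OF Q, where k = "\<lambda>\<alpha>. pairing m (u \<alpha>)" and z = z]
      admissible_form_value[OF Q, where k = "\<lambda>\<alpha>. - pairing m (u \<alpha>)" and z = z]
    unfolding admissible_balanced[OF Q] by auto
  show ?thesis
  proof (cases "\<forall>\<alpha>\<in>cox_zeros y Q z. pairing m (u \<alpha>) = 0")
    case True
    then have "snd (cox_curve u y Q z) m = (\<Prod>\<alpha>\<in>UNIV. ?x \<alpha> powi pairing m (u \<alpha>))" by (simp add: cox_curve_def)
    also have "\<dots> = ?p / ?n" unfolding v by (rule prod_power_int_split) (use True in \<open>auto simp: cox_zeros_def\<close>)
    finally show ?thesis .
  next
    case False
    then obtain \<alpha> where a: "?x \<alpha> = 0" "0 < pairing m (u \<alpha>)"
      using m by (force simp: cox_zeros_def)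
    then have "?p = 0" unfolding v by (auto intro!: bexI[of _ \<alpha>])
    moreover have "snd (cox_curve u y Q z) m = 0" by (simp only: cox_curve_def snd_conv if_not_P[OF False])
    ultimately show ?thesis by simp
  qed
qed

text \<open>The denominator of the Laurent monomial of \<open>m\<close> vanishes at \<open>w\<close>
  exactly if \<open>m\<close> is negative on some ray whose form vanishes there, that is, if
  \<open>m\<close> is not regular at the image of \<open>w\<close>. So one fraction serves at all
  points where \<open>m\<close> is regular.\<close>

lemma cox_curve_morphism:
  assumes Q: "admissible y Q"
  shows "toric_morphism \<Sigma> (cox_curve u y Q)"
  unfolding toric_morphism_def
proof (intro allI conjI ballI)
  fix z show "cox_curve u y Q z \<in> toric_points \<Sigma>" by (rule cox_curve_toric_points[OF Q])
  fix m assume "m \<in> dual_monoid (fst (cox_curve u y Q z))"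
  then have m: "\<forall>\<alpha>\<in>cox_zeros y Q z. 0 \<le> pairing m (u \<alpha>)" by (simp add: cox_curve_def dual_monoid_cone)
  let ?k = "\<lambda>\<alpha>. pairing m (u \<alpha>)"
  let ?e = "monomial_degree y ?k" and ?A = "monomial_form Q ?k" and ?B = "monomial_form Q (\<lambda>\<alpha>. - ?k \<alpha>)"
  have e: "monomial_degree y (\<lambda>\<alpha>. - ?k \<alpha>) = ?e"
    by (rule admissible_balanced[OF Q])
  have d: "deg ?A \<le> ?e" "deg ?B \<le> ?e"
    using monomial_form_degree[of Q y] admissibleD(2)[OF Q] e by metis+
  have B: "form_value ?e ?B w = (\<Prod>\<alpha>\<in>UNIV. form_value (y \<alpha>) (Q \<alpha>) w ^ nat (- ?k \<alpha>))" for w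
    using admissible_form_value[OF Q, where k = "\<lambda>\<alpha>. - pairing m (u \<alpha>)" and z = w] unfolding e by simp
  have Bw: "form_value ?e ?B w \<noteq> 0 \<longleftrightarrow> (\<forall>\<alpha>\<in>cox_zeros y Q w. 0 \<le> ?k \<alpha>)" for w
    unfolding B by (force simp: cox_zeros_def)
  show "\<exists>e A B. deg A \<le> e \<and> deg B \<le> e \<and> form_value e B z \<noteq> 0 \<and>
        (\<forall>w. form_value e B w \<noteq> 0 \<longrightarrow> m \<in> dual_monoid (fst (cox_curve u y Q w)) \<and>
          snd (cox_curve u y Q w) m = form_value e A w / form_value e B w)"
  proof (intro exI conjI allI impI)
    show "deg ?A \<le> ?e" "deg ?B \<le> ?e" by (fact d)+
    show "form_value ?e ?B z \<noteq> 0" using m Bw by blast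
    fix w assume "form_value ?e ?B w \<noteq> 0"
    then have w: "\<forall>\<alpha>\<in>cox_zeros y Q w. 0 \<le> ?k \<alpha>" using Bw by blast
    then show "m \<in> dual_monoid (fst (cox_curve u y Q w))" by (simp add: cox_curve_def dual_monoid_cone)
    show "snd (cox_curve u y Q w) m = form_value ?e ?A w / form_value ?e ?B w" by (rule cox_curve_value[OF Q w])
  qed
qed

lemma cox_curve_open_orbit:
  assumes Q: "admissible y Q"
  shows "cox_curve u y Q z \<in> open_orbit \<longleftrightarrow> cox_zeros y Q z = {}"
proof -
  have "cox_curve u y Q z \<in> open_orbit \<longleftrightarrow> cone (cox_zeros y Q z) = {0}"
    using open_orbit_iff[OF cox_curve_toric_points[OF Q]] by (simp add: cox_curve_def)
  also have "\<dots> \<longleftrightarrow> cox_zeros y Q z = {}"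
    using admissibleD(5)[OF Q, of z] zero_cone(2) by (metis convex_cone_hull_empty image_empty)
  finally show ?thesis .
qed

lemma cox_curve_character_order:
  fixes Q :: "'s \<Rightarrow> 'o::alg_closed_field poly"
  assumes Q: "admissible y Q"
  shows "character_order (cox_curve u y Q) m z = (\<Sum>\<alpha>\<in>UNIV. pairing m (u \<alpha>) * int (form_order (y \<alpha>) (Q \<alpha>) z))"
proof -
  let ?k = "\<lambda>\<alpha>. pairing m (u \<alpha>)"
  let ?e = "monomial_degree y ?k" and ?A = "monomial_form Q ?k" and ?B = "monomial_form Q (\<lambda>\<alpha>. - ?k \<alpha>)"
  have e: "monomial_degree y (\<lambda>\<alpha>. - ?k \<alpha>) = ?e"
    by (rule admissible_balanced[OF Q])
  have d: "deg ?A \<le> ?e" "deg ?B \<le> ?e"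
    using monomial_form_degree[of Q y] admissibleD(2)[OF Q] e by metis+
  have "character_order (cox_curve u y Q) m z = int (form_order ?e ?A z) - int (form_order ?e ?B z)"
  proof (rule character_order_eq)
    show "finite {w. cox_curve u y Q w \<notin> open_orbit}" using cox_zeros_finite[OF Q] by (simp add: cox_curve_open_orbit[OF Q])
    show "?A \<noteq> 0" "?B \<noteq> 0" by (rule monomial_form_nonzero, rule admissibleD(1)[OF Q])+
    fix w assume "cox_curve u y Q w \<in> open_orbit"
    then show "snd (cox_curve u y Q w) m = form_value ?e ?A w / form_value ?e ?B w"
      using cox_curve_value[OF Q, of w m] by (simp add: cox_curve_open_orbit[OF Q])
  qed (use d in auto)
  also have "\<dots> = int (form_order ?e ?A z) - int (form_order (monomial_degree y (\<lambda>\<alpha>. - ?k \<alpha>)) ?B z)" using e by simp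
  also have "\<dots> = (\<Sum>\<alpha>\<in>UNIV. ?k \<alpha> * int (form_order (y \<alpha>) (Q \<alpha>) z))"
    unfolding monomial_form_order[OF admissibleD(2,1)[OF Q]] of_nat_sum sum_subtractf[symmetric]
    by (intro sum.cong refl) (simp only: of_nat_mult left_diff_distrib[symmetric] int_nat_diff)
  finally show ?thesis .
qed

text \<open>Near a point, the anticanonical divisor is the divisor of a character with value 1 on
  the vanishing rays, so the pullback order is the sum of the orders of all forms. Summing over the
  points counts each form with its degree.\<close>

lemma cox_curve_degree:
  fixes Q :: "'s \<Rightarrow> 'o::alg_closed_field poly"
  assumes Q: "admissible y Q"
  shows "pullback_degree u anticanonical_divisor (cox_curve u y Q) = int (\<Sum>\<alpha>\<in>UNIV. y \<alpha>)"
proof -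
  let ?f = "cox_curve u y Q"
  have o0: "form_order (y \<alpha>) (Q \<alpha>) z = 0 \<longleftrightarrow> \<alpha> \<notin> cox_zeros y Q z" for \<alpha> z
    using form_order_eq_0_iff[OF admissibleD(1,2)[OF Q]] by (simp add: cox_zeros_def)
  have po: "pullback_order u anticanonical_divisor ?f z = (\<Sum>\<alpha>\<in>UNIV. int (form_order (y \<alpha>) (Q \<alpha>) z))" for z
    unfolding pullback_order_def
  proof (rule the_equality)
    have fz: "fst (?f z) = cone (cox_zeros y Q z)" by (simp add: cox_curve_def)
    have eq: "character_order ?f m z = (\<Sum>\<alpha>\<in>UNIV. int (form_order (y \<alpha>) (Q \<alpha>) z))"
      if m: "\<forall>\<alpha>. int_vec (u \<alpha>) \<in> fst (?f z) \<longrightarrow> pairing m (u \<alpha>) = anticanonical_divisor $ \<alpha>" for m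
    proof -
      have "pairing m (u \<alpha>) = 1" if "\<alpha> \<in> cox_zeros y Q z" for \<alpha>
        using m admissibleD(5)[OF Q, of z] that unfolding fz by (auto simp: rays_of_def anticanonical_divisor_def)
      then show ?thesis unfolding cox_curve_character_order[OF Q]
        using o0[of _ z] by (intro sum.cong refl) (metis mult_1 mult_zero_right of_nat_0)
    qed
    obtain m where "\<And>\<alpha>. \<alpha> \<in> R (cone (cox_zeros y Q z)) \<Longrightarrow> pairing m (u \<alpha>) = 1"
      using dual_character[OF admissibleD(4)[OF Q], of z "\<lambda>_. 1"] by blast
    then have m: "\<forall>\<alpha>. int_vec (u \<alpha>) \<in> fst (?f z) \<longrightarrow> pairing m (u \<alpha>) = anticanonical_divisor $ \<alpha>"
      unfolding fz by (auto simp: rays_of_def anticanonical_divisor_def)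
    then show "\<exists>m. (\<forall>\<alpha>. int_vec (u \<alpha>) \<in> fst (?f z) \<longrightarrow> pairing m (u \<alpha>) = anticanonical_divisor $ \<alpha>) \<and>
       (\<Sum>\<alpha>\<in>UNIV. int (form_order (y \<alpha>) (Q \<alpha>) z)) = character_order ?f m z"
      using eq[OF m] by (intro exI[of _ m]) simp
    show "k = (\<Sum>\<alpha>\<in>UNIV. int (form_order (y \<alpha>) (Q \<alpha>) z))"
      if "\<exists>m. (\<forall>\<alpha>. int_vec (u \<alpha>) \<in> fst (?f z) \<longrightarrow> pairing m (u \<alpha>) = anticanonical_divisor $ \<alpha>) \<and>
       k = character_order ?f m z" for k using that eq by blast
  qed
  let ?Z = "{z. cox_zeros y Q z \<noteq> {}}"
  have fZ: "finite ?Z" by (rule cox_zeros_finite[OF Q])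
  have "pullback_degree u anticanonical_divisor ?f = (\<Sum>z\<in>?Z. \<Sum>\<alpha>\<in>UNIV. int (form_order (y \<alpha>) (Q \<alpha>) z))"
    unfolding pullback_degree_def po
    using fZ by (intro sum.mono_neutral_left) (auto simp: sum_nonneg_eq_0_iff o0)
  also have "\<dots> = (\<Sum>\<alpha>\<in>UNIV. \<Sum>z\<in>?Z. int (form_order (y \<alpha>) (Q \<alpha>) z))" by (rule sum.swap)
  also have "\<dots> = (\<Sum>\<alpha>\<in>UNIV. int (y \<alpha>))"
  proof (rule sum.cong)
    fix \<alpha>
    have "(\<Sum>z\<in>?Z. form_order (y \<alpha>) (Q \<alpha>) z) = y \<alpha>"
      using fZ by (intro sum_form_order admissibleD[OF Q]) (auto simp: o0)
    then show "(\<Sum>z\<in>?Z. int (form_order (y \<alpha>) (Q \<alpha>) z)) = int (y \<alpha>)" by (metis of_nat_sum)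
  qed simp
  finally show ?thesis by simp
qed

lemma cox_curve_rational:
  fixes Q :: "'s \<Rightarrow> 'o::alg_closed_field poly"
  assumes Q: "admissible y Q" and d: "(\<Sum>\<alpha>\<in>UNIV. y \<alpha>) = d"
  shows "cox_curve u y Q \<in> rational_curves \<Sigma> u d"
proof -
  have "\<exists>z. z \<notin> {z. cox_zeros y Q z \<noteq> {}}" using cox_zeros_finite[OF Q] infinite_option ex_new_if_finite by metis
  then show ?thesis
    unfolding rational_curves_def
    using cox_curve_morphism[OF Q] cox_curve_degree[OF Q] d cox_curve_open_orbit[OF Q] by auto
qed

end

lemma pairing_sum_left:
  assumes "finite S"
  shows "pairing (\<Sum>\<alpha>\<in>S. k \<alpha> *s e \<alpha>) v = (\<Sum>\<alpha>\<in>S. k \<alpha> * pairing (e \<alpha>) v)"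
proof -
  have scale: "pairing (k *s m) v = k * pairing m v" for k m by (simp add: pairing_def sum_distrib_left mult.assoc)
  show ?thesis using assms by (induction S) (auto simp: pairing_add_left scale)
qed

lemma multiplicative_prod_power_int:
  fixes g :: "int ^ 'r::finite \<Rightarrow> 'o::field" and k :: "'s::finite \<Rightarrow> int"
  assumes mult: "\<And>m m'. g (m + m') = g m * g m'" and nz: "\<And>m. g m \<noteq> 0" and "finite S"
  shows "g (\<Sum>\<alpha>\<in>S. k \<alpha> *s e \<alpha>) = (\<Prod>\<alpha>\<in>S. g (e \<alpha>) powi k \<alpha>)"
proof -
  have one: "g 0 = 1" using mult[of 0 0] nz[of 0] by simp
  have neg: "g (- m) = inverse (g m)" for m
    using mult[of m "- m"] one nz[of m] by (simp add: field_simps)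
  have nat: "g (int k *s m) = g m ^ k" for k m
  proof (induction k)
    case (Suc k)
    have "int (Suc k) *s m = m + int k *s m" by (simp add: vec_eq_iff algebra_simps)
    then show ?case using Suc by (simp add: mult)
  qed (simp add: one)
  have scale: "g (k *s m) = g m powi k" for k m
  proof (cases "0 \<le> k")
    case True then show ?thesis using nat[of "nat k" m] by (simp add: power_int_def)
  next
    case False
    have "k *s m = - (int (nat (- k)) *s m)" using False by (simp add: vec_eq_iff)
    then show ?thesis using nat[of "nat (- k)" m] neg[of "int (nat (- k)) *s m"] False
      by (simp add: power_int_def power_inverse)
  qed
  show ?thesis using assms(3) by (induction S) (auto simp: one mult scale)
qed

section \<open>Every morphism meeting the open orbit has homogeneous coordinates\<close>

context complete_fan begin

text \<open>The characters regular at a point of the open orbit are all characters, so each is a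
  fraction of nonzero forms. Away from the zeros of the forms belonging to the basis characters, all
  basis characters are nonzero at the image, which forces its cone to be \<open>{0}\<close>.\<close>

lemma toric_morphism_finite_boundary:
  fixes f :: "'o::alg_closed_field option \<Rightarrow> ('r, 'o) toric_point"
  assumes f: "toric_morphism \<Sigma> f" and z0: "f z0 \<in> open_orbit"
  shows "finite {w. f w \<notin> open_orbit}"
    and "\<exists>e A B. A \<noteq> 0 \<and> B \<noteq> 0 \<and> deg A \<le> e \<and> deg B \<le> e \<and>
       (\<forall>w. f w \<in> open_orbit \<longrightarrow> form_value e B w \<noteq> 0 \<longrightarrow> snd (f w) m = form_value e A w / form_value e B w)"
proof -
  have pts: "f z \<in> toric_points \<Sigma>" for z using f by (simp add: toric_morphism_def)
  have "fst (f z0) = {0}" using z0 open_orbit_iff[OF pts] by blast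
  then have "\<exists>e A B. deg A \<le> e \<and> deg B \<le> e \<and> form_value e B z0 \<noteq> 0 \<and>
        (\<forall>w. form_value e B w \<noteq> 0 \<longrightarrow>
           m \<in> dual_monoid (fst (f w)) \<and> snd (f w) m = form_value e A w / form_value e B w)" for m
    using f by (simp add: toric_morphism_def)
  then obtain e A B where AB: "\<And>m. deg (A m) \<le> e m" "\<And>m. deg (B m) \<le> e m" "\<And>m. form_value (e m) (B m) z0 \<noteq> 0"
        "\<And>m w. form_value (e m) (B m) w \<noteq> 0 \<Longrightarrow> snd (f w) m = form_value (e m) (A m) w / form_value (e m) (B m) w"
    by metis
  have B0: "B m \<noteq> 0" for m using AB(3)[of m] by auto
  have A0: "A m \<noteq> 0" for m
    using AB(4)[OF AB(3), of m] open_orbit_nonzero[OF z0, of m] by auto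
  show "\<exists>e A B. A \<noteq> 0 \<and> B \<noteq> 0 \<and> deg A \<le> e \<and> deg B \<le> e \<and>
       (\<forall>w. f w \<in> open_orbit \<longrightarrow> form_value e B w \<noteq> 0 \<longrightarrow> snd (f w) m = form_value e A w / form_value e B w)"
    using A0[of m] B0[of m] AB(1)[of m] AB(2)[of m] AB(4)[of m] by blast
  let ?S = "\<Union>i. {w. form_value (e (axis i 1)) (A (axis i 1)) w = 0} \<union> {w. form_value (e (axis i 1)) (B (axis i 1)) w = 0}"
  have "f w \<in> open_orbit" if "w \<notin> ?S" for w
  proof -
    obtain \<sigma> \<gamma> where fw: "f w = (\<sigma>, \<gamma>)" by fastforce
    have \<sigma>: "\<sigma> \<in> \<Sigma>" and \<gamma>: "\<And>m. \<gamma> m \<noteq> 0 \<longleftrightarrow> m \<in> orthogonal_lattice \<sigma>"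
      using pts[of w] fw by (auto simp: toric_points_def)
    have "axis i 1 \<in> orthogonal_lattice \<sigma>" for i
      using that AB(4)[of "axis i 1" w] \<gamma>[of "axis i 1"] fw by auto
    then have "int_vec (axis i 1) \<bullet> x = 0" if "x \<in> \<sigma>" for i x using that by (auto simp: orthogonal_lattice_def)
    moreover have "int_vec (axis i 1) \<bullet> x = x $ i" for i and x :: "real ^ 'r"
      by (simp add: int_vec_def axis_def inner_vec_def if_distrib[of "\<lambda>x. x * _"] if_distrib[of real_of_int] cong: if_cong)
    ultimately have "x = 0" if "x \<in> \<sigma>" for x using that by (metis vec_eq_iff zero_index)
    moreover have "0 \<in> \<sigma>" using cone_rays[OF \<sigma>] convex_cone_hull_contains_0 by metis
    ultimately have "\<sigma> = {0}" by auto
    then show ?thesis using open_orbit_iff[OF pts, of w] unfolding fw by simp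
  qed
  then have "{w. f w \<notin> open_orbit} \<subseteq> ?S" by blast
  moreover have "finite ?S" using A0 B0 AB(1,2) by (auto intro!: finite_form_zeros)
  ultimately show "finite {w. f w \<notin> open_orbit}" by (rule finite_subset)
qed

text \<open>The order at \<open>z\<close> is additive in the character, hence it is the pairing with
  a cocharacter. Regular characters have nonnegative order, and order 0 exactly if they are
  orthogonal to the cone of the image; so the cocharacter is a lattice point of the relative
  interior of this cone.\<close>

lemma toric_morphism_orders:
  fixes f :: "'o::alg_closed_field option \<Rightarrow> ('r, 'o) toric_point"
  assumes f: "toric_morphism \<Sigma> f" and z0: "f z0 \<in> open_orbit"
  obtains c :: "'o option \<Rightarrow> 's \<Rightarrow> nat" where "\<And>z \<alpha>. 0 < c z \<alpha> \<longleftrightarrow> \<alpha> \<in> R (fst (f z))"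
    "\<And>z m. character_order f m z = (\<Sum>\<alpha>\<in>UNIV. int (c z \<alpha>) * pairing m (u \<alpha>))"
proof -
  have pts: "f z \<in> toric_points \<Sigma>" for z using f by (simp add: toric_morphism_def)
  note fin = toric_morphism_finite_boundary(1)[OF f z0]
  have add: "character_order f (m + m') z = character_order f m z + character_order f m' z" for m m' z
  proof -
    obtain e A B where 1: "A \<noteq> 0" "B \<noteq> 0" "deg A \<le> e" "deg B \<le> e"
       "\<And>w. f w \<in> open_orbit \<Longrightarrow> form_value e B w \<noteq> 0 \<Longrightarrow> snd (f w) m = form_value e A w / form_value e B w"
      using toric_morphism_finite_boundary(2)[OF f z0, of m] by blast
    obtain e' A' B' where 2: "A' \<noteq> 0" "B' \<noteq> 0" "deg A' \<le> e'" "deg B' \<le> e'"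
       "\<And>w. f w \<in> open_orbit \<Longrightarrow> form_value e' B' w \<noteq> 0 \<Longrightarrow> snd (f w) m' = form_value e' A' w / form_value e' B' w"
      using toric_morphism_finite_boundary(2)[OF f z0, of m'] by blast
    have "character_order f (m + m') z = int (form_order (e + e') (A * A') z) - int (form_order (e + e') (B * B') z)"
    proof (rule character_order_eq[OF fin])
      show "deg (A * A') \<le> e + e'" "deg (B * B') \<le> e + e'"
        using 1 2 degree_mult_le[of A A'] degree_mult_le[of B B'] by linarith+
      fix w assume w: "f w \<in> open_orbit" "form_value (e + e') (B * B') w \<noteq> 0"
      then show "snd (f w) (m + m') = form_value (e + e') (A * A') w / form_value (e + e') (B * B') w"
        using 1 2 open_orbit_mult[OF w(1), of m m'] by (simp add: form_value_mult)
    qed (use 1 2 in auto)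
    then show ?thesis
      using character_order_eq[OF fin 1, of z] character_order_eq[OF fin 2, of z] 1 2 by (simp add: form_order_mult)
  qed
  have "\<exists>c :: 's \<Rightarrow> nat. (\<forall>\<alpha>. 0 < c \<alpha> \<longleftrightarrow> \<alpha> \<in> R (fst (f z))) \<and>
    (\<forall>m. character_order f m z = (\<Sum>\<alpha>\<in>UNIV. int (c \<alpha>) * pairing m (u \<alpha>)))" for z
  proof -
    obtain n where n: "\<And>m. character_order f m z = pairing m n"
      using additive_eq_pairing[of "\<lambda>m. character_order f m z"] add by blast
    obtain \<sigma> \<gamma> where fz: "f z = (\<sigma>, \<gamma>)" by fastforce
    have \<sigma>: "\<sigma> \<in> \<Sigma>" and \<gamma>: "\<And>m. \<gamma> m \<noteq> 0 \<longleftrightarrow> m \<in> orthogonal_lattice \<sigma>"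
      using pts[of z] fz by (auto simp: toric_points_def)
    have reg: "0 \<le> character_order f m z \<and> (character_order f m z = 0 \<longleftrightarrow> m \<in> orthogonal_lattice \<sigma>)"
      if m: "m \<in> dual_monoid \<sigma>" for m
    proof -
      have "\<exists>e A B. deg A \<le> e \<and> deg B \<le> e \<and> form_value e B z \<noteq> 0 \<and>
        (\<forall>w. form_value e B w \<noteq> 0 \<longrightarrow>
           m \<in> dual_monoid (fst (f w)) \<and> snd (f w) m = form_value e A w / form_value e B w)"
        using f m fz unfolding toric_morphism_def by auto
      then obtain e A B where AB: "deg A \<le> e" "deg B \<le> e" "form_value e B z \<noteq> 0"
        "\<And>w. form_value e B w \<noteq> 0 \<Longrightarrow> snd (f w) m = form_value e A w / form_value e B w" by blast
      have B0: "B \<noteq> 0" using AB(3) by auto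
      have "finite ({w. f w \<notin> open_orbit} \<union> {w. form_value e B w = 0})" using fin finite_form_zeros[OF B0 AB(2)] by simp
      then obtain w where w: "f w \<in> open_orbit" "form_value e B w \<noteq> 0"
        using ex_new_if_finite[OF infinite_option] by blast
      have A0: "A \<noteq> 0" using AB(4)[OF w(2)] open_orbit_nonzero[OF w(1), of m] by auto
      have "character_order f m z = int (form_order e A z) - int (form_order e B z)"
        by (rule character_order_eq[OF fin A0 B0 AB(1,2)]) (rule AB(4))
      moreover have "form_order e B z = 0" using form_order_eq_0_iff[OF B0 AB(2)] AB(3) by blast
      moreover have "form_order e A z = 0 \<longleftrightarrow> m \<in> orthogonal_lattice \<sigma>"
        using form_order_eq_0_iff[OF A0 AB(1)] AB(4)[OF AB(3)] AB(3) \<gamma>[of m] fz by auto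
      ultimately show ?thesis by simp
    qed
    show ?thesis
      by (rule relative_interior_lattice_point[OF \<sigma>, of n]) (use reg n fz in auto)
  qed
  then obtain c :: "'o option \<Rightarrow> 's \<Rightarrow> nat" where "\<And>z. (\<forall>\<alpha>. 0 < c z \<alpha> \<longleftrightarrow> \<alpha> \<in> R (fst (f z))) \<and>
    (\<forall>m. character_order f m z = (\<Sum>\<alpha>\<in>UNIV. int (c z \<alpha>) * pairing m (u \<alpha>)))" by metis
  then show ?thesis using that[of c] by blast
qed

end

lemma form_with_orders:
  fixes c :: "'o::alg_closed_field option \<Rightarrow> nat"
  assumes fin: "finite Z" and c: "\<And>z. 0 < c z \<Longrightarrow> z \<in> Z"
  obtains Q where "Q \<noteq> 0" "deg Q \<le> (\<Sum>z\<in>Z. c z)" "\<And>z. form_order (\<Sum>z\<in>Z. c z) Q z = c z"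
proof -
  let ?F = "{x. Some x \<in> Z}"
  have finF: "finite ?F" using finite_vimageI[OF fin, of Some] by (simp add: vimage_def)
  define Q where "Q = (\<Prod>x\<in>?F. [:- x, 1:] ^ c (Some x))"
  have Q0: "Q \<noteq> 0" using finF by (simp add: Q_def)
  have "deg Q = (\<Sum>x\<in>?F. deg ([:- x, 1:] ^ c (Some x)))" unfolding Q_def by (rule degree_prod_eq_sum_degree) simp
  also have "\<dots> = (\<Sum>x\<in>?F. c (Some x))" by (simp add: degree_power_eq)
  finally have dQ: "deg Q = (\<Sum>x\<in>?F. c (Some x))" .
  have "(\<Sum>z\<in>Z. c z) = (\<Sum>z\<in>insert None (Some ` ?F). c z)"
  proof (rule sum.mono_neutral_left)
    show "Z \<subseteq> insert None (Some ` ?F)"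
    proof
      fix z assume "z \<in> Z" then show "z \<in> insert None (Some ` ?F)" by (cases z) auto
    qed
  qed (use finF c in auto)
  also have "\<dots> = c None + (\<Sum>x\<in>?F. c (Some x))" using finF by (subst sum.insert) (auto simp: sum.reindex)
  finally have s: "(\<Sum>z\<in>Z. c z) = c None + deg Q" using dQ by simp
  have o: "Polynomial.order x Q = c (Some x)" for x
  proof -
    have "form_order (\<Sum>a\<in>?F. 1 * c (Some a)) Q (Some x) = (\<Sum>a\<in>?F. form_order (1 * c (Some a)) ([:- a, 1:] ^ c (Some a)) (Some x))"
      unfolding Q_def using finF by (intro form_order_prod degree_power_le_mult) auto
    also have "\<dots> = (\<Sum>a\<in>?F. if a = x then c (Some a) else 0)"
    proof (rule sum.cong)
      fix a
      have "form_order (1 * c (Some a)) ([:- a, 1:] ^ c (Some a)) (Some x) = c (Some a) * form_order 1 [:- a, 1:] (Some x)"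
        by (rule form_order_power) auto
      moreover have "form_order 1 [:- a, 1:] (Some x) = (if a = x then 1 else 0)"
        using order_power_n_n[of a 1] by (auto simp: form_order_def intro!: order_0I)
      ultimately show "form_order (1 * c (Some a)) ([:- a, 1:] ^ c (Some a)) (Some x) = (if a = x then c (Some a) else 0)" by simp
    qed simp
    also have "\<dots> = c (Some x)" using finF c[of "Some x"] by (cases "Some x \<in> Z") auto
    finally show ?thesis by (simp add: form_order_def)
  qed
  have "form_order (\<Sum>z\<in>Z. c z) Q z = c z" for z
    by (cases z) (auto simp: form_order_def s o)
  then show ?thesis using that[of Q] Q0 s by simp
qed

context complete_fan begin

text \<open>Forms \<open>Q0\<close> with the prescribed orders along the divisors give each
  character up to a constant \<open>l m\<close>, since over an algebraically closed field orders
  determine a form up to a factor. Evaluation at a point of the open orbit shows that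
  \<open>l\<close> is multiplicative, so it can be absorbed by rescaling the forms.\<close>

theorem toric_morphism_cox_curve:
  fixes f :: "'o::alg_closed_field option \<Rightarrow> ('r, 'o) toric_point"
  assumes f: "toric_morphism \<Sigma> f" and z0: "f z0 \<in> open_orbit"
  obtains y Q where "admissible y Q" "f = cox_curve u y Q"
proof -
  have pts: "f z \<in> toric_points \<Sigma>" for z using f by (simp add: toric_morphism_def)
  note fin = toric_morphism_finite_boundary(1)[OF f z0]
  obtain c :: "'o option \<Rightarrow> 's \<Rightarrow> nat" where c: "\<And>z \<alpha>. 0 < c z \<alpha> \<longleftrightarrow> \<alpha> \<in> R (fst (f z))"
    "\<And>z m. character_order f m z = (\<Sum>\<alpha>\<in>UNIV. int (c z \<alpha>) * pairing m (u \<alpha>))"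
    using toric_morphism_orders[OF f z0] by blast
  define Z where "Z = {w. f w \<notin> open_orbit}"
  have finZ: "finite Z" using fin by (simp add: Z_def)
  have cZ: "z \<in> Z" if "0 < c z \<alpha>" for z \<alpha>
    using that c(1)[of z \<alpha>] zero_cone(2) open_orbit_iff[OF pts, of z] by (auto simp: Z_def)
  have c0: "c z \<alpha> = 0" if "z \<notin> Z" for z \<alpha> using cZ[of z \<alpha>] that by auto
  define y where "y \<alpha> = (\<Sum>z\<in>Z. c z \<alpha>)" for \<alpha>
  have "\<exists>Q. Q \<noteq> 0 \<and> deg Q \<le> y \<alpha> \<and> (\<forall>z. form_order (y \<alpha>) Q z = c z \<alpha>)" for \<alpha>
    using form_with_orders[OF finZ, of "\<lambda>z. c z \<alpha>"] cZ unfolding y_def by metis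
  then obtain Q0 where Q0: "\<And>\<alpha>. Q0 \<alpha> \<noteq> 0" "\<And>\<alpha>. deg (Q0 \<alpha>) \<le> y \<alpha>" "\<And>\<alpha> z. form_order (y \<alpha>) (Q0 \<alpha>) z = c z \<alpha>"
    by metis
  define k where "k m \<alpha> = pairing m (u \<alpha>)" for m \<alpha>
  define k' where "k' m \<alpha> = - pairing m (u \<alpha>)" for m \<alpha>
  let ?P = "\<lambda>m. monomial_form Q0 (k m)" and ?N = "\<lambda>m. monomial_form Q0 (k' m)"
  have PN0: "?P m \<noteq> 0" "?N m \<noteq> 0" for m by (rule monomial_form_nonzero, rule Q0)+
  have orders: "int (form_order (monomial_degree y (k m)) (?P m) z) - int (form_order (monomial_degree y (k' m)) (?N m) z) = character_order f m z" for m z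
    unfolding monomial_form_order[of Q0 y, OF Q0(2,1)] of_nat_sum sum_subtractf[symmetric] c(2) Q0(3)
    by (intro sum.cong refl) (simp only: of_nat_mult left_diff_distrib[symmetric] int_nat_diff k_def k'_def, rule mult.commute)
  \<comment> \<open>One constant has to serve all fractions that represent the character, because
    each point of the line may need a fraction of its own whose denominator does not vanish
    there.\<close>
  have scal: "\<exists>l. l \<noteq> 0 \<and> (\<forall>e A B. A \<noteq> 0 \<longrightarrow> B \<noteq> 0 \<longrightarrow> deg A \<le> e \<longrightarrow> deg B \<le> e \<longrightarrow>
      (\<forall>w. f w \<in> open_orbit \<longrightarrow> form_value e B w \<noteq> 0 \<longrightarrow> snd (f w) m = form_value e A w / form_value e B w) \<longrightarrow>
      A * ?N m = Polynomial.smult l (B * ?P m))" for m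
  proof -
    obtain e A B where AB: "A \<noteq> 0" "B \<noteq> 0" "deg A \<le> e" "deg B \<le> e"
       "\<And>w. f w \<in> open_orbit \<Longrightarrow> form_value e B w \<noteq> 0 \<Longrightarrow> snd (f w) m = form_value e A w / form_value e B w"
      using toric_morphism_finite_boundary(2)[OF f z0, of m] by blast
    have "Polynomial.order x (A * ?N m) = Polynomial.order x (B * ?P m)" for x
      using character_order_eq[OF fin AB, of "Some x"] orders[of m "Some x"] AB PN0[of m]
      by (simp add: order_mult form_order_def)
    then obtain l where l: "l \<noteq> 0" "A * ?N m = Polynomial.smult l (B * ?P m)"
      using alg_closed_orders_proportional[of "A * ?N m" "B * ?P m"] AB PN0 by (metis mult_eq_0_iff)
    have "A' * ?N m = Polynomial.smult l (B' * ?P m)" if AB': "A' \<noteq> 0" "B' \<noteq> 0" "deg A' \<le> e'" "deg B' \<le> e'"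
      "\<And>w. f w \<in> open_orbit \<Longrightarrow> form_value e' B' w \<noteq> 0 \<Longrightarrow> snd (f w) m = form_value e' A' w / form_value e' B' w" for e' A' B'
    proof -
      have "A * B' = A' * B"
        by (rule rational_function_unique[of "{w. f w \<in> open_orbit}" A e B A' e' B' "\<lambda>w. snd (f w) m"])
          (use fin AB AB' in auto)
      then have "(A' * ?N m) * B = (A * ?N m) * B'" by (simp add: ac_simps)
      also have "\<dots> = Polynomial.smult l (B' * ?P m) * B" unfolding l(2) by (simp add: ac_simps)
      finally show ?thesis using mult_right_cancel[OF AB(2)] by blast
    qed
    then show ?thesis using l(1) by blast
  qed
  obtain l where l: "\<And>m. l m \<noteq> 0" "\<And>m e A B. A \<noteq> 0 \<Longrightarrow> B \<noteq> 0 \<Longrightarrow> deg A \<le> e \<Longrightarrow> deg B \<le> e \<Longrightarrow>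
      (\<And>w. f w \<in> open_orbit \<Longrightarrow> form_value e B w \<noteq> 0 \<Longrightarrow> snd (f w) m = form_value e A w / form_value e B w) \<Longrightarrow>
      A * ?N m = Polynomial.smult (l m) (B * ?P m)" using scal by metis
  \<comment> \<open>Numerator and denominator both have \<open>e\<close> zeros, so the orders of a
    character sum to 0 over the projective line; interchanging the sums turns this into a relation
    for the totals \<open>y\<close>.\<close>
  have bal: "(\<Sum>\<alpha>\<in>UNIV. int (y \<alpha>) * pairing m (u \<alpha>)) = 0" for m
  proof -
    obtain e A B where AB: "A \<noteq> 0" "B \<noteq> 0" "deg A \<le> e" "deg B \<le> e"
       "\<And>w. f w \<in> open_orbit \<Longrightarrow> form_value e B w \<noteq> 0 \<Longrightarrow> snd (f w) m = form_value e A w / form_value e B w"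
      using toric_morphism_finite_boundary(2)[OF f z0, of m] by blast
    let ?W = "Z \<union> {z. form_order e A z \<noteq> 0} \<union> {z. form_order e B z \<noteq> 0}"
    have finW: "finite ?W" using finZ finite_form_order AB by auto
    have "(\<Sum>z\<in>?W. form_order e A z) = e" "(\<Sum>z\<in>?W. form_order e B z) = e"
      using finW AB by (auto intro!: sum_form_order)
    then have "(\<Sum>z\<in>?W. int (form_order e A z)) = (\<Sum>z\<in>?W. int (form_order e B z))" by (metis of_nat_sum)
    moreover have "character_order f m z = int (form_order e A z) - int (form_order e B z)" for z
      by (rule character_order_eq[OF fin AB])
    ultimately have "0 = (\<Sum>z\<in>?W. character_order f m z)" by (simp only: sum_subtractf)
    also have "\<dots> = (\<Sum>z\<in>Z. character_order f m z)"
      using finW c0 by (intro sum.mono_neutral_right) (auto simp: c(2))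
    also have "\<dots> = (\<Sum>\<alpha>\<in>UNIV. \<Sum>z\<in>Z. int (c z \<alpha>) * pairing m (u \<alpha>))" unfolding c(2) by (rule sum.swap)
    finally show ?thesis by (simp add: y_def sum_distrib_right)
  qed
  have zeros: "cox_zeros y Q0 z = R (fst (f z))" for z
    using form_order_eq_0_iff[OF Q0(1,2)] c(1)[of z] by (force simp: cox_zeros_def Q0(3))
  have md: "monomial_degree y (k' m) = monomial_degree y (k m)" for m
  proof -
    have "k' m = (\<lambda>\<alpha>. - k m \<alpha>)" by (auto simp: k_def k'_def)
    then show ?thesis using monomial_degree_balanced[of y "k m"] bal[of m] by (simp add: k_def)
  qed
  have dPN: "deg (?P m) \<le> monomial_degree y (k m)" "deg (?N m) \<le> monomial_degree y (k m)" for m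
    using monomial_form_degree[of Q0 y, OF Q0(2)] md by metis+
  have key: "snd (f z) m * form_value (monomial_degree y (k m)) (?N m) z = l m * form_value (monomial_degree y (k m)) (?P m) z"
    if m: "m \<in> dual_monoid (fst (f z))" for z m
  proof -
    have "\<exists>e A B. deg A \<le> e \<and> deg B \<le> e \<and> form_value e B z \<noteq> 0 \<and>
      (\<forall>w. form_value e B w \<noteq> 0 \<longrightarrow>
         m \<in> dual_monoid (fst (f w)) \<and> snd (f w) m = form_value e A w / form_value e B w)"
      using f m unfolding toric_morphism_def by auto
    then obtain e A B where AB: "deg A \<le> e" "deg B \<le> e" "form_value e B z \<noteq> 0"
      "\<And>w. form_value e B w \<noteq> 0 \<Longrightarrow> snd (f w) m = form_value e A w / form_value e B w" by blast
    have B0: "B \<noteq> 0" using AB(3) by auto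
    have "finite ({w. f w \<notin> open_orbit} \<union> {w. form_value e B w = 0})" using fin finite_form_zeros[OF B0 AB(2)] by simp
    then obtain w where w: "f w \<in> open_orbit" "form_value e B w \<noteq> 0"
      using ex_new_if_finite[OF infinite_option] by blast
    have A0: "A \<noteq> 0" using AB(4)[OF w(2)] open_orbit_nonzero[OF w(1), of m] by auto
    have "A * ?N m = Polynomial.smult (l m) (B * ?P m)" using l(2)[OF A0 B0 AB(1,2)] AB(4) by blast
    then have "form_value (e + monomial_degree y (k m)) (A * ?N m) z = l m * form_value (e + monomial_degree y (k m)) (B * ?P m) z"
      by (simp add: form_value_smult)
    then have "form_value e A z * form_value (monomial_degree y (k m)) (?N m) z =
       l m * (form_value e B z * form_value (monomial_degree y (k m)) (?P m) z)"
      using AB(1,2) dPN by (simp add: form_value_mult)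
    moreover have "form_value e A z = snd (f z) m * form_value e B z" using AB(3,4) by simp
    ultimately show ?thesis using AB(3) by (simp add: mult_ac)
  qed
  have mv: "form_value (monomial_degree y (k m)) (?P m) z = (\<Prod>\<alpha>\<in>UNIV. form_value (y \<alpha>) (Q0 \<alpha>) z ^ nat (pairing m (u \<alpha>)))"
    "form_value (monomial_degree y (k m)) (?N m) z = (\<Prod>\<alpha>\<in>UNIV. form_value (y \<alpha>) (Q0 \<alpha>) z ^ nat (- pairing m (u \<alpha>)))" for m z
    using monomial_form_value[of Q0 y "k m" z, OF Q0(2)] monomial_form_value[of Q0 y "k' m" z, OF Q0(2)] unfolding md by (auto simp: k_def k'_def)
  have key': "snd (f z) m = l m * (\<Prod>\<alpha>\<in>UNIV. form_value (y \<alpha>) (Q0 \<alpha>) z powi pairing m (u \<alpha>))"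
    if m: "\<forall>\<alpha>\<in>cox_zeros y Q0 z. pairing m (u \<alpha>) = 0" for z m
  proof -
    have s: "fst (f z) \<in> \<Sigma>" using pts[of z] by (auto simp: toric_points_def)
    have "m \<in> dual_monoid (fst (f z))" using m unfolding zeros dual_monoid_iff[OF s] by simp
    note key[OF this]
    moreover have "form_value (monomial_degree y (k m)) (?N m) z \<noteq> 0"
      unfolding mv using m by (auto simp: cox_zeros_def)
    ultimately have "snd (f z) m = l m * (form_value (monomial_degree y (k m)) (?P m) z / form_value (monomial_degree y (k m)) (?N m) z)"
      by (simp add: field_simps)
    also have "form_value (monomial_degree y (k m)) (?P m) z / form_value (monomial_degree y (k m)) (?N m) z =
        (\<Prod>\<alpha>\<in>UNIV. form_value (y \<alpha>) (Q0 \<alpha>) z powi pairing m (u \<alpha>))"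
      unfolding mv by (rule prod_power_int_split[symmetric]) (use m in \<open>auto simp: cox_zeros_def\<close>)
    finally show ?thesis .
  qed
  have z0z: "cox_zeros y Q0 z0 = {}" using z0 open_orbit_iff[OF pts] zero_cone(2) unfolding zeros by auto
  then have x0: "form_value (y \<alpha>) (Q0 \<alpha>) z0 \<noteq> 0" for \<alpha> by (auto simp: cox_zeros_def)
  have lmult: "l (m + m') = l m * l m'" for m m'
  proof -
    let ?p = "\<lambda>m. \<Prod>\<alpha>\<in>UNIV. form_value (y \<alpha>) (Q0 \<alpha>) z0 powi pairing m (u \<alpha>)"
    have "?p (m + m') = ?p m * ?p m'" using x0 by (simp add: pairing_add_left power_int_add prod.distrib)
    moreover have "l (m + m') * ?p (m + m') = (l m * ?p m) * (l m' * ?p m')"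
      using key'[of z0] z0z open_orbit_mult[OF z0, of m m'] by simp
    moreover have "?p m \<noteq> 0" "?p m' \<noteq> 0" using x0 by (auto simp: power_int_eq_0_iff)
    ultimately show ?thesis by (simp add: field_simps)
  qed
  obtain \<sigma> where \<sigma>: "full_cone \<sigma>" using ex_full_cone by blast
  obtain e where e: "\<forall>m v. pairing m v = (\<Sum>\<alpha>\<in>R \<sigma>. pairing m (u \<alpha>) * pairing (e \<alpha>) v)"
    using full_cone_dual_basis[OF \<sigma>] by (elim exE conjE)
  \<comment> \<open>The rays of a full cone form a lattice basis, so scalars on these rays alone
    realize any multiplicative \<open>l\<close>.\<close>
  define t where "t \<alpha> = (if \<alpha> \<in> R \<sigma> then l (e \<alpha>) else 1)" for \<alpha>
  have lt: "l m = (\<Prod>\<alpha>\<in>UNIV. t \<alpha> powi pairing m (u \<alpha>))" for m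
  proof -
    have "m = (\<Sum>\<alpha>\<in>R \<sigma>. pairing m (u \<alpha>) *s e \<alpha>)"
      by (rule pairing_eqD) (simp only: pairing_sum_left[OF finite] e[rule_format, symmetric])
    then have "l m = l (\<Sum>\<alpha>\<in>R \<sigma>. pairing m (u \<alpha>) *s e \<alpha>)" by (rule arg_cong)
    also have "\<dots> = (\<Prod>\<alpha>\<in>R \<sigma>. l (e \<alpha>) powi pairing m (u \<alpha>))"
      by (rule multiplicative_prod_power_int) (use lmult l in auto)
    also have "\<dots> = (\<Prod>\<alpha>\<in>UNIV. t \<alpha> powi pairing m (u \<alpha>))"
      by (rule prod.mono_neutral_cong_left) (auto simp: t_def)
    finally show ?thesis .
  qed
  have t0: "t \<alpha> \<noteq> 0" for \<alpha> using l(1) by (simp add: t_def)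
  define Q where "Q \<alpha> = Polynomial.smult (t \<alpha>) (Q0 \<alpha>)" for \<alpha>
  have zQ: "cox_zeros y Q z = R (fst (f z))" for z
    using zeros[of z] t0 by (simp add: cox_zeros_def Q_def form_value_smult)
  have "admissible y Q"
    unfolding admissible_def
  proof (intro conjI allI)
    fix \<alpha> show "Q \<alpha> \<noteq> 0" "deg (Q \<alpha>) \<le> y \<alpha>" using Q0 t0 by (auto simp: Q_def)
  next
    fix m show "(\<Sum>\<alpha>\<in>UNIV. int (y \<alpha>) * pairing m (u \<alpha>)) = 0" by (rule bal)
  next
    fix z have "fst (f z) \<in> \<Sigma>" using pts[of z] by (auto simp: toric_points_def)
    then show "\<exists>\<sigma>\<in>\<Sigma>. R \<sigma> = cox_zeros y Q z" using zQ by blast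
  qed
  moreover have "f = cox_curve u y Q"
  proof
    fix z
    obtain \<sigma> \<gamma> where fz: "f z = (\<sigma>, \<gamma>)" by fastforce
    have \<sigma>: "\<sigma> \<in> \<Sigma>" and \<gamma>: "\<And>m. \<gamma> m \<noteq> 0 \<longleftrightarrow> m \<in> orthogonal_lattice \<sigma>"
      using pts[of z] fz by (auto simp: toric_points_def)
    have "\<gamma> m = snd (cox_curve u y Q z) m" for m
    proof (cases "\<forall>\<alpha>\<in>cox_zeros y Q z. pairing m (u \<alpha>) = 0")
      case True
      then have "snd (f z) m = l m * (\<Prod>\<alpha>\<in>UNIV. form_value (y \<alpha>) (Q0 \<alpha>) z powi pairing m (u \<alpha>))"
        using key'[of z m] zQ zeros by simp
      also have "\<dots> = (\<Prod>\<alpha>\<in>UNIV. form_value (y \<alpha>) (Q \<alpha>) z powi pairing m (u \<alpha>))"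
        unfolding lt by (simp add: Q_def form_value_smult power_int_mult_distrib prod.distrib)
      finally show ?thesis using True fz by (simp add: cox_curve_def)
    next
      case False
      then have "m \<notin> orthogonal_lattice \<sigma>" using orthogonal_lattice_iff[OF \<sigma>] zQ[of z] fz by simp
      then have "\<gamma> m = 0" using \<gamma> by blast
      moreover have "snd (cox_curve u y Q z) m = 0" by (simp only: cox_curve_def snd_conv if_not_P[OF False])
      ultimately show ?thesis by simp
    qed
    then have "\<gamma> = snd (cox_curve u y Q z)" by blast
    moreover have "\<sigma> = fst (cox_curve u y Q z)" using cone_rays[OF \<sigma>] zQ[of z] fz by (simp add: cox_curve_def)
    ultimately show "f z = cox_curve u y Q z" using fz by simp
  qed
  ultimately show ?thesis by (rule that)
qed

lemma rational_curves_eq: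
  "(rational_curves \<Sigma> u d :: ('o::alg_closed_field option \<Rightarrow> ('r, 'o) toric_point) set) =
     {cox_curve u y Q | y Q. admissible y Q \<and> (\<Sum>\<alpha>\<in>UNIV. y \<alpha>) = d}"
proof (rule equalityI; rule subsetI)
  fix f :: "'o option \<Rightarrow> ('r, 'o) toric_point" assume f: "f \<in> rational_curves \<Sigma> u d"
  then obtain z where "toric_morphism \<Sigma> f" "f z \<in> open_orbit" by (auto simp: rational_curves_def)
  then obtain y Q where Q: "admissible y Q" "f = cox_curve u y Q" by (rule toric_morphism_cox_curve)
  moreover have "(\<Sum>\<alpha>\<in>UNIV. y \<alpha>) = d"
    using f cox_curve_degree[OF Q(1)] Q(2) by (simp add: rational_curves_def flip: of_nat_sum)
  ultimately show "f \<in> {cox_curve u y Q | y Q. admissible y Q \<and> (\<Sum>\<alpha>\<in>UNIV. y \<alpha>) = d}" by blast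
qed (use cox_curve_rational in blast)

end

section \<open>Homogeneous polynomial functions\<close>

definition is_subring :: "'o::comm_ring_1 set \<Rightarrow> bool" where
  "is_subring F \<longleftrightarrow> 0 \<in> F \<and> 1 \<in> F \<and> (\<forall>x\<in>F. \<forall>y\<in>F. x - y \<in> F \<and> x * y \<in> F)"

lemma is_subringD:
  assumes "is_subring F"
  shows "0 \<in> F" "1 \<in> F" "x \<in> F \<Longrightarrow> y \<in> F \<Longrightarrow> x - y \<in> F" "x \<in> F \<Longrightarrow> y \<in> F \<Longrightarrow> x * y \<in> F"
    "x \<in> F \<Longrightarrow> - x \<in> F" "x \<in> F \<Longrightarrow> y \<in> F \<Longrightarrow> x + y \<in> F"
proof -
  show F: "0 \<in> F" "1 \<in> F" "x \<in> F \<Longrightarrow> y \<in> F \<Longrightarrow> x - y \<in> F" "x \<in> F \<Longrightarrow> y \<in> F \<Longrightarrow> x * y \<in> F" for x y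
    using assms by (auto simp: is_subring_def)
  show n: "x \<in> F \<Longrightarrow> - x \<in> F" for x using F(3)[OF F(1), of x] by simp
  show "x \<in> F \<Longrightarrow> y \<in> F \<Longrightarrow> x + y \<in> F" using F(3)[of x "- y"] n by simp
qed

text \<open>Homogeneous polynomials over \<open>F\<close> as functions, which compose directly with
  parametrizations. A monomial is a multiset of variables, and the degree belongs to the expression:
  if \<open>F\<close> contains 0, the zero function has every degree.\<close>

inductive hfun :: "'o::field set \<Rightarrow> nat \<Rightarrow> (('v \<Rightarrow> 'o) \<Rightarrow> 'o) \<Rightarrow> bool" for F where
  hfun_mono: "c \<in> F \<Longrightarrow> hfun F (size M) (\<lambda>x. c * (\<Prod>v\<in>#M. x v))"
| hfun_add: "hfun F n \<phi> \<Longrightarrow> hfun F n \<psi> \<Longrightarrow> hfun F n (\<lambda>x. \<phi> x + \<psi> x)"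

lemma hfun_zero:
  assumes "0 \<in> F"
  shows "hfun F n (\<lambda>x :: 'v \<Rightarrow> 'o::field. 0)"
  using hfun_mono[OF assms, of "replicate_mset n undefined"] by simp

lemma hfun_const: "c \<in> F \<Longrightarrow> hfun F 0 (\<lambda>x. c)"
  using hfun_mono[of c F "{#}"] by simp

lemma hfun_var: "1 \<in> F \<Longrightarrow> hfun F 1 (\<lambda>x. x v)"
  using hfun_mono[of 1 F "{#v#}"] by simp

lemma hfun_sum:
  assumes "0 \<in> F" "finite S" "\<And>i. i \<in> S \<Longrightarrow> hfun F n (\<phi> i)"
  shows "hfun F n (\<lambda>x. \<Sum>i\<in>S. \<phi> i x)"
  using assms(2,3) by (induction S) (auto intro: hfun_add hfun_zero[OF assms(1)])

lemma hfun_mono_mult: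
  assumes F: "is_subring F" and "c \<in> F" "hfun F n \<phi>"
  shows "hfun F (size M + n) (\<lambda>x. (c * (\<Prod>v\<in>#M. x v)) * \<phi> x)"
  using assms(3)
proof induction
  case (hfun_mono d N)
  have "hfun F (size (M + N)) (\<lambda>x. (c * d) * (\<Prod>v\<in>#M + N. x v))"
    by (rule hfun.hfun_mono) (rule is_subringD(4)[OF F assms(2) hfun_mono])
  then show ?case by (simp add: ac_simps)
next
  case (hfun_add n \<phi> \<psi>)
  then show ?case by (simp add: distrib_left hfun.hfun_add)
qed

lemma hfun_mult:
  assumes F: "is_subring F" and "hfun F n \<phi>" "hfun F k \<psi>"
  shows "hfun F (n + k) (\<lambda>x. \<phi> x * \<psi> x)"
  using assms(2)
proof induction
  case (hfun_mono c M)
  then show ?case by (rule hfun_mono_mult[OF F _ assms(3)])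
next
  case (hfun_add n \<phi> \<phi>')
  then show ?case by (simp add: distrib_right hfun.hfun_add)
qed

lemma hfun_cmult: "is_subring F \<Longrightarrow> c \<in> F \<Longrightarrow> hfun F n \<phi> \<Longrightarrow> hfun F n (\<lambda>x. c * \<phi> x)"
  using hfun_mult[OF _ hfun_const[of c F]] by fastforce

lemma hfun_diff:
  assumes F: "is_subring F" and "hfun F n \<phi>" "hfun F n \<psi>"
  shows "hfun F n (\<lambda>x. \<phi> x - \<psi> x)"
  using hfun_add[OF assms(2) hfun_cmult[OF F is_subringD(5)[OF F is_subringD(2)[OF F]] assms(3)]] by simp

lemma hfun_power:
  assumes F: "is_subring F" and "hfun F n \<phi>"
  shows "hfun F (n * k) (\<lambda>x. \<phi> x ^ k)"
proof (induction k)
  case 0 then show ?case using hfun_const[OF is_subringD(2)[OF F]] by simp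
next
  case (Suc k) then show ?case using hfun_mult[OF F assms(2) Suc] by simp
qed

lemma hfun_prod:
  assumes F: "is_subring F" and "finite S" "\<And>i. i \<in> S \<Longrightarrow> hfun F (n i) (\<phi> i)"
  shows "hfun F (\<Sum>i\<in>S. n i) (\<lambda>x. \<Prod>i\<in>S. \<phi> i x)"
  using assms(2,3)
proof (induction S)
  case empty then show ?case using hfun_const[OF is_subringD(2)[OF F]] by simp
next
  case (insert i S) then show ?case using hfun_mult[OF F, of "n i" "\<phi> i"] by simp
qed

lemma hfun_scale: "hfun F n \<phi> \<Longrightarrow> \<phi> (\<lambda>v. l * x v) = l ^ n * \<phi> x"
proof (induction rule: hfun.induct)
  case (hfun_mono c M)
  have "(\<Prod>v\<in>#M. l * x v) = l ^ size M * (\<Prod>v\<in>#M. x v)" by (induction M) (auto simp: ac_simps)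
  then show ?case by simp
next
  case (hfun_add n \<phi> \<psi>) then show ?case by (simp add: distrib_left)
qed

lemma mpoly_eval_superset:
  assumes "finite S" "Poly_Mapping.keys p \<subseteq> S"
  shows "mpoly_eval p x = (\<Sum>t\<in>S. Poly_Mapping.lookup p t * (\<Prod>v\<in>Poly_Mapping.keys t. x v ^ Poly_Mapping.lookup t v))"
  unfolding mpoly_eval_def using assms by (intro sum.mono_neutral_left) (auto simp: in_keys_iff)

lemma mpoly_eval_add: "mpoly_eval (p + q) x = mpoly_eval p x + mpoly_eval q x"
proof -
  let ?S = "Poly_Mapping.keys p \<union> Poly_Mapping.keys q"
  have "Poly_Mapping.keys (p + q) \<subseteq> ?S" by (rule Poly_Mapping.keys_add)
  then show ?thesis
    using mpoly_eval_superset[of ?S "p + q" x] mpoly_eval_superset[of ?S p x] mpoly_eval_superset[of ?S q x]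
    by (simp add: lookup_add distrib_right sum.distrib)
qed

lemma mpoly_eval_hfun:
  fixes p :: "('v \<Rightarrow>\<^sub>0 nat) \<Rightarrow>\<^sub>0 'o::field"
  assumes "0 \<in> F" "homogeneous_over F p"
  obtains n where "hfun F n (mpoly_eval p)"
proof -
  obtain n where p: "\<And>t. Poly_Mapping.lookup p t \<in> F"
    and n: "\<And>t. t \<in> Poly_Mapping.keys p \<Longrightarrow> (\<Sum>v\<in>Poly_Mapping.keys t. Poly_Mapping.lookup t v) = n"
    using assms(2) by (auto simp: homogeneous_over_def)
  have "hfun F n (\<lambda>x. Poly_Mapping.lookup p t * (\<Prod>v\<in>Poly_Mapping.keys t. x v ^ Poly_Mapping.lookup t v))"
    if "t \<in> Poly_Mapping.keys p" for t
  proof -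
    define M where "M = (\<Sum>v\<in>Poly_Mapping.keys t. replicate_mset (Poly_Mapping.lookup t v) v)"
    have "size M = n" unfolding M_def using n[OF that] by (simp add: size_multiset_sum)
    moreover have "(\<Prod>v\<in>#M. x v) = (\<Prod>v\<in>Poly_Mapping.keys t. x v ^ Poly_Mapping.lookup t v)" for x :: "'v \<Rightarrow> 'o"
    proof -
      have "(\<Prod>v\<in>#(\<Sum>v\<in>S. replicate_mset (Poly_Mapping.lookup t v) v). x v) = (\<Prod>v\<in>S. x v ^ Poly_Mapping.lookup t v)" if "finite S" for S
        using that by (induction S) auto
      then show ?thesis unfolding M_def by simp
    qed
    ultimately show ?thesis using hfun_mono[OF p[of t], of M] by simp
  qed
  then have "hfun F n (\<lambda>x. \<Sum>t\<in>Poly_Mapping.keys p. Poly_Mapping.lookup p t * (\<Prod>v\<in>Poly_Mapping.keys t. x v ^ Poly_Mapping.lookup t v))"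
    by (intro hfun_sum[OF assms(1)]) auto
  then show ?thesis using that by (simp add: mpoly_eval_def[abs_def])
qed

lemma hfun_mpoly_eval:
  assumes F: "is_subring F" and "hfun F n (\<phi> :: ('v \<Rightarrow> 'o::field) \<Rightarrow> 'o)"
  shows "\<exists>p. (\<forall>t. Poly_Mapping.lookup p t \<in> F) \<and>
     (\<forall>t\<in>Poly_Mapping.keys p. (\<Sum>v\<in>Poly_Mapping.keys t. Poly_Mapping.lookup t v) = n) \<and> \<phi> = mpoly_eval p"
  using assms(2)
proof induction
  case (hfun_mono c M)
  define t where "t = Abs_poly_mapping (count M)"
  have lt: "Poly_Mapping.lookup t = count M" unfolding t_def by (subst lookup_Abs_poly_mapping) (auto simp: finite_set_mset)
  have kt: "Poly_Mapping.keys t = set_mset M" by (auto simp: keys.rep_eq lt)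
  have "mpoly_eval (Poly_Mapping.single t c) x = c * (\<Prod>v\<in>#M. x v)" for x :: "'v \<Rightarrow> 'o"
  proof -
    have "mpoly_eval (Poly_Mapping.single t c) x = (\<Sum>s\<in>{t}. Poly_Mapping.lookup (Poly_Mapping.single t c) s * (\<Prod>v\<in>Poly_Mapping.keys s. x v ^ Poly_Mapping.lookup s v))"
      by (rule mpoly_eval_superset) auto
    then show ?thesis by (simp add: lt kt image_prod_mset_multiplicity)
  qed
  moreover have "(\<Sum>v\<in>Poly_Mapping.keys t. Poly_Mapping.lookup t v) = size M"
    by (simp add: lt kt size_multiset_overloaded_eq)
  ultimately show ?case
    using hfun_mono is_subringD(1)[OF F] by (intro exI[of _ "Poly_Mapping.single t c"]) (auto simp: lookup_single when_def split: if_splits)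
next
  case (hfun_add n \<phi> \<psi>)
  then obtain p q where p: "\<forall>t. Poly_Mapping.lookup p t \<in> F"
     "\<forall>t\<in>Poly_Mapping.keys p. (\<Sum>v\<in>Poly_Mapping.keys t. Poly_Mapping.lookup t v) = n" "\<phi> = mpoly_eval p"
     and q: "\<forall>t. Poly_Mapping.lookup q t \<in> F"
     "\<forall>t\<in>Poly_Mapping.keys q. (\<Sum>v\<in>Poly_Mapping.keys t. Poly_Mapping.lookup t v) = n" "\<psi> = mpoly_eval q" by blast
  have "Poly_Mapping.keys (p + q) \<subseteq> Poly_Mapping.keys p \<union> Poly_Mapping.keys q" by (rule Poly_Mapping.keys_add)
  then show ?case using p q is_subringD(6)[OF F]
    by (intro exI[of _ "p + q"] conjI ext) (auto simp: lookup_add mpoly_eval_add)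
qed

text \<open>Gaussian elimination without divisions; the degrees only serve to keep all entries of a
  vector homogeneous of the same degree.\<close>

lemma independence_polynomial:
  fixes v :: "'i \<Rightarrow> 'j \<Rightarrow> ('v \<Rightarrow> 'o::field) \<Rightarrow> 'o"
  assumes F: "is_subring F" and "finite I"
    and "\<And>i j. i \<in> I \<Longrightarrow> hfun F (n i) (v i j)"
    and "\<And>c. (\<And>j. (\<Sum>i\<in>I. c i * v i j x0) = 0) \<Longrightarrow> \<forall>i\<in>I. c i = 0"
  shows "\<exists>n p. hfun F n p \<and> p x0 \<noteq> 0 \<and>
    (\<forall>x c. (\<forall>j. (\<Sum>i\<in>I. c i * v i j x) = 0) \<longrightarrow> (\<exists>i\<in>I. c i \<noteq> 0) \<longrightarrow> p x = 0)"
  using assms(2-4)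
proof (induction I arbitrary: v n)
  case empty
  then show ?case using hfun_const[OF is_subringD(2)[OF F]] by (intro exI[of _ 0] exI[of _ "\<lambda>_. 1"]) auto
next
  case (insert k I)
  have "\<exists>j. v k j x0 \<noteq> 0"
  proof (rule ccontr)
    assume "\<nexists>j. v k j x0 \<noteq> 0"
    then have "(\<Sum>i\<in>insert k I. (if i = k then 1 else 0) * v i j x0) = 0" for j
      by (intro sum.neutral) auto
    from insert.prems(2)[OF this] show False by simp
  qed
  then obtain l where l: "v k l x0 \<noteq> 0" ..
  \<comment> \<open>Row \<open>i\<close> after its entry in column \<open>l\<close> has been cleared
    with the pivot row \<open>k\<close>. The polynomial finally obtained is the product of all
    pivots.\<close>
  define w where "w i j x = v k l x * v i j x - v i l x * v k j x" for i j x
  have sumw: "(\<Sum>i\<in>I. c i * w i j x) = (\<Sum>i\<in>insert k I. (if i = k then - (\<Sum>i\<in>I. c i * v i l x) else c i * v k l x) * v i j x)" for c j x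
  proof -
    have "(\<Sum>i\<in>I. (if i = k then - (\<Sum>i\<in>I. c i * v i l x) else c i * v k l x) * v i j x) = (\<Sum>i\<in>I. c i * v k l x * v i j x)"
      using insert.hyps(2) by (intro sum.cong) auto
    then show ?thesis using insert.hyps
      by (simp add: w_def right_diff_distrib sum_subtractf sum_distrib_left sum_distrib_right ac_simps)
  qed
  have "\<exists>n p. hfun F n p \<and> p x0 \<noteq> 0 \<and>
    (\<forall>x c. (\<forall>j. (\<Sum>i\<in>I. c i * w i j x) = 0) \<longrightarrow> (\<exists>i\<in>I. c i \<noteq> 0) \<longrightarrow> p x = 0)"
  proof (rule insert.IH)
    fix i j assume "i \<in> I"
    then have "hfun F (n k + n i) (\<lambda>x. v k l x * v i j x)" "hfun F (n k + n i) (\<lambda>x. v i l x * v k j x)"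
      using hfun_mult[OF F insert.prems(1)[of k l] insert.prems(1)[of i j]]
        hfun_mult[OF F insert.prems(1)[of i l] insert.prems(1)[of k j]] by (auto simp: add.commute)
    then show "hfun F (n k + n i) (w i j)" unfolding w_def by (rule hfun_diff[OF F])
  next
    fix c assume "\<And>j. (\<Sum>i\<in>I. c i * w i j x0) = 0"
    then have "\<forall>i\<in>insert k I. (if i = k then - (\<Sum>i\<in>I. c i * v i l x0) else c i * v k l x0) = 0"
      using sumw by (intro insert.prems(2)) metis
    then show "\<forall>i\<in>I. c i = 0" using l insert.hyps(2) by (auto split: if_splits)
  qed
  then obtain n' p where p: "hfun F n' p" "p x0 \<noteq> 0"
    "\<And>x c. (\<And>j. (\<Sum>i\<in>I. c i * w i j x) = 0) \<Longrightarrow> \<exists>i\<in>I. c i \<noteq> 0 \<Longrightarrow> p x = 0" by blast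
  show ?case
  proof (intro exI conjI allI impI)
    show "hfun F (n k + n') (\<lambda>x. v k l x * p x)" by (rule hfun_mult[OF F insert.prems(1) p(1)]) simp
    show "v k l x0 * p x0 \<noteq> 0" using l p(2) by simp
    fix x c assume c: "\<forall>j. (\<Sum>i\<in>insert k I. c i * v i j x) = 0" "\<exists>i\<in>insert k I. c i \<noteq> 0"
    show "v k l x * p x = 0"
    proof (cases "\<exists>i\<in>I. c i \<noteq> 0")
      case True
      have s: "(\<Sum>i\<in>I. c i * v i j x) = - c k * v k j x" for j
        using c(1) insert.hyps by (simp add: add_eq_0_iff2)
      have "(\<Sum>i\<in>I. c i * w i j x) = v k l x * (\<Sum>i\<in>I. c i * v i j x) - (\<Sum>i\<in>I. c i * v i l x) * v k j x" for j
        by (simp add: w_def right_diff_distrib sum_subtractf sum_distrib_left sum_distrib_right ac_simps)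
      then have "(\<Sum>i\<in>I. c i * w i j x) = 0" for j unfolding s by simp
      then show ?thesis using p(3)[of c x] True by simp
    next
      case False
      then have "c k \<noteq> 0" "(\<Sum>i\<in>I. c i * v i l x) = 0" using c(2) by (auto intro: sum.neutral)
      then show ?thesis using c(1) insert.hyps by (auto dest: spec[of _ l])
    qed
  qed
qed

text \<open>One unknown is eliminated by cross-multiplication with a nonzero pivot, and the solution
  of the smaller system is scaled by the pivot. Avoiding division makes the statement available over
  the integers, where it bounds the rank of the Picard group, as well as over the base
  field.\<close>

lemma underdetermined_system:
  fixes A :: "'i \<Rightarrow> 'j \<Rightarrow> 'a::idom"
  assumes "finite I" "finite J" "card I < card J"
  shows "\<exists>x. (\<exists>j\<in>J. x j \<noteq> 0) \<and> (\<forall>i\<in>I. (\<Sum>j\<in>J. A i j * x j) = 0)"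
  using assms
proof (induction I arbitrary: J A)
  case empty
  then have "J \<noteq> {}" by auto
  then show ?case by (intro exI[of _ "\<lambda>_. 1"]) auto
next
  case (insert k I)
  show ?case
  proof (cases "\<forall>j\<in>J. A k j = 0")
    case True
    obtain x where "\<exists>j\<in>J. x j \<noteq> 0" "\<forall>i\<in>I. (\<Sum>j\<in>J. A i j * x j) = 0"
      using insert.IH[of J A] insert.prems insert.hyps by auto
    then show ?thesis using True by (intro exI[of _ x]) auto
  next
    case False
    then obtain l where l: "l \<in> J" "A k l \<noteq> 0" by blast
    let ?J = "J - {l}"
    have "card I < card ?J" using insert.prems insert.hyps l(1) by (simp add: card_Diff_singleton)
    then obtain x where x: "\<exists>j\<in>?J. x j \<noteq> 0" "\<forall>i\<in>I. (\<Sum>j\<in>?J. (A k l * A i j - A i l * A k j) * x j) = 0"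
      using insert.IH[of ?J "\<lambda>i j. A k l * A i j - A i l * A k j"] insert.prems(1) by blast
    define z where "z j = (if j = l then - (\<Sum>j\<in>?J. A k j * x j) else A k l * x j)" for j
    have z: "(\<Sum>j\<in>J. A i j * z j) = (\<Sum>j\<in>?J. (A k l * A i j - A i l * A k j) * x j)" for i
    proof -
      have "(\<Sum>j\<in>J. A i j * z j) = A i l * z l + (\<Sum>j\<in>?J. A i j * z j)" using l(1) insert.prems(1) by (simp add: sum.remove)
      also have "(\<Sum>j\<in>?J. A i j * z j) = (\<Sum>j\<in>?J. A i j * (A k l * x j))" by (intro sum.cong) (auto simp: z_def)
      finally show ?thesis
        by (simp add: z_def left_diff_distrib right_diff_distrib sum_subtractf sum_distrib_left ac_simps)
    qed
    have "(\<Sum>j\<in>J. A k j * z j) = 0" unfolding z by (intro sum.neutral) (simp add: ac_simps)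
    moreover have "\<exists>j\<in>J. z j \<noteq> 0" using x(1) l by (auto simp: z_def)
    ultimately show ?thesis using x(2) z by (intro exI[of _ z]) auto
  qed
qed

section \<open>The projective embedding\<close>

lemma toric_points_mult:
  "f \<in> toric_points \<Sigma> \<Longrightarrow> m \<in> dual_monoid (fst f) \<Longrightarrow> m' \<in> dual_monoid (fst f) \<Longrightarrow> snd f (m + m') = snd f m * snd f m'"
  by (auto simp: toric_points_def)

locale projective_fan = complete_fan \<Sigma> u
  for \<Sigma> :: "(real ^ 'r::finite) set set" and u :: "'s::finite \<Rightarrow> int ^ 'r" +
  fixes h :: "int ^ 's"
  assumes ample: "ample_divisor \<Sigma> u h"
begin

definition sec_order :: "int ^ 'r \<Rightarrow> 's \<Rightarrow> int" where
  "sec_order m \<alpha> = pairing m (u \<alpha>) + h $ \<alpha>"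

abbreviation sections :: "(int ^ 'r) set" where "sections \<equiv> section_characters u h"

lemma sections_iff: "m \<in> sections \<longleftrightarrow> (\<forall>\<alpha>. 0 \<le> sec_order m \<alpha>)"
  by (auto simp: section_characters_def sec_order_def algebra_simps) (smt (verit))+

text \<open>Geometrically, \<open>v\<close> is the vertex of the polytope of \<open>h\<close> that
  corresponds to the cone, and its section vanishes exactly along the divisors outside the cone.
  Ampleness makes the inequalities for the other rays strict.\<close>

lemma vertex:
  assumes "full_cone \<sigma>"
  obtains v where "v \<in> sections" "\<And>\<alpha>. sec_order v \<alpha> = 0 \<longleftrightarrow> \<alpha> \<in> R \<sigma>"
proof -
  obtain v where v: "\<And>\<alpha>. if int_vec (u \<alpha>) \<in> \<sigma> then pairing v (u \<alpha>) = - (h $ \<alpha>) else pairing v (u \<alpha>) > - (h $ \<alpha>)"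
    using ample assms unfolding ample_divisor_def full_cone_def by blast
  have "0 \<le> sec_order v \<alpha>" "sec_order v \<alpha> = 0 \<longleftrightarrow> \<alpha> \<in> R \<sigma>" for \<alpha>
    using v[of \<alpha>] by (auto simp: sec_order_def rays_of_def split: if_splits)
  then show ?thesis using that sections_iff by blast
qed

definition coords :: "('s \<Rightarrow> 'o::field poly) \<Rightarrow> int ^ 'r \<Rightarrow> 'o poly" where
  "coords Q m = (if m \<in> sections then monomial_form Q (sec_order m) else 0)"

text \<open>The intersection number of the divisor \<open>h\<close> with a curve of multidegree
  \<open>y\<close>, that is, the degree of the curve in projective space.\<close>

definition embedded_degree :: "('s \<Rightarrow> nat) \<Rightarrow> nat" where
  "embedded_degree y = nat (\<Sum>\<alpha>\<in>UNIV. int (y \<alpha>) * h $ \<alpha>)"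

lemma monomial_degree_sec_order:
  assumes y: "\<And>m. (\<Sum>\<alpha>\<in>UNIV. int (y \<alpha>) * pairing m (u \<alpha>)) = 0" and m: "m \<in> sections"
  shows "monomial_degree y (sec_order m) = embedded_degree y"
proof -
  have "int (monomial_degree y (sec_order m)) = (\<Sum>\<alpha>\<in>UNIV. int (y \<alpha>) * sec_order m \<alpha>)"
    unfolding monomial_degree_def of_nat_sum using m sections_iff by (intro sum.cong) auto
  also have "\<dots> = (\<Sum>\<alpha>\<in>UNIV. int (y \<alpha>) * h $ \<alpha>)"
    using y[of m] by (simp add: sec_order_def distrib_left sum.distrib)
  finally show ?thesis by (simp add: embedded_degree_def)
qed

lemma coords_degree:
  assumes Q: "admissible y Q"
  shows "deg (coords Q m) \<le> embedded_degree y"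
  using monomial_form_degree[of Q y, OF admissibleD(2)[OF Q]] monomial_degree_sec_order[OF admissibleD(3)[OF Q]]
  unfolding coords_def by (metis degree_0 le0)

lemma coords_value:
  assumes Q: "admissible y Q" and m: "m \<in> sections"
  shows "form_value (embedded_degree y) (coords Q m) z = (\<Prod>\<alpha>\<in>UNIV. form_value (y \<alpha>) (Q \<alpha>) z ^ nat (sec_order m \<alpha>))"
  using admissible_form_value[OF Q, of "sec_order m" z] monomial_degree_sec_order[OF admissibleD(3)[OF Q] m] m
  by (simp add: coords_def)

lemma coords_nonzero: "admissible y Q \<Longrightarrow> m \<in> sections \<Longrightarrow> coords Q m \<noteq> 0"
  by (simp add: coords_def monomial_form_nonzero admissibleD(1))

text \<open>A full cone \<tau> containing all rays that vanish at \<open>z\<close> has a vertex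
  section which is a monomial in the coordinates outside \<tau>; these are nonzero at
  \<open>z\<close>.\<close>

lemma coords_no_common_zero:
  assumes Q: "admissible y Q"
  obtains m where "m \<in> sections" "form_value (embedded_degree y) (coords Q m) z \<noteq> 0"
proof -
  obtain \<tau> where \<tau>: "full_cone \<tau>" "cox_zeros y Q z \<subseteq> R \<tau>"
  proof (cases "cox_zeros y Q z = UNIV")
    \<comment> \<open>Impossible: if all forms vanished at \<open>z\<close>, some character would
      have the value 1 on every ray, which contradicts a relation with positive coefficients among
      the rays.\<close>
    case True
    obtain w :: "'s \<Rightarrow> nat" where w: "\<forall>\<alpha>. 0 < w \<alpha>" "\<forall>m. (\<Sum>\<alpha>\<in>UNIV. int (w \<alpha>) * pairing m (u \<alpha>)) = 0"
      using ex_positive_relation by (elim exE conjE)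
    obtain m where m: "\<And>\<alpha>. \<alpha> \<in> R (cone (cox_zeros y Q z)) \<Longrightarrow> pairing m (u \<alpha>) = 1"
      using dual_character[OF admissibleD(4)[OF Q], of z "\<lambda>_. 1"] by blast
    have "pairing m (u \<alpha>) = 1" for \<alpha> by (rule m, subst trans[OF admissibleD(5)[OF Q] True]) simp
    then have "(\<Sum>\<alpha>\<in>UNIV. int (w \<alpha>)) = 0" using spec[OF w(2), of m] by simp
    then show ?thesis using w(1) by (simp add: sum_nonneg_eq_0_iff)
  next
    case False
    then obtain \<alpha> where \<alpha>: "\<alpha> \<notin> cox_zeros y Q z" by auto
    have sub: "cox_zeros y Q z \<subseteq> R (cone (cox_zeros y Q z))" using admissibleD(5)[OF Q, of z] by simp
    obtain \<tau> where "full_cone \<tau>" "cox_zeros y Q z \<subseteq> R \<tau>" by (rule ex_full_cone_avoiding[OF admissibleD(4)[OF Q] sub \<alpha>])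
    then show ?thesis by (rule that)
  qed
  obtain v where v: "v \<in> sections" "\<And>\<alpha>. sec_order v \<alpha> = 0 \<longleftrightarrow> \<alpha> \<in> R \<tau>" using vertex[OF \<tau>(1)] by blast
  have "nat (sec_order v \<alpha>) = 0" if "form_value (y \<alpha>) (Q \<alpha>) z = 0" for \<alpha>
    using that \<tau>(2) v(2)[of \<alpha>] by (auto simp: cox_zeros_def)
  then have "form_value (y \<alpha>) (Q \<alpha>) z ^ nat (sec_order v \<alpha>) \<noteq> 0" for \<alpha> by (cases "form_value (y \<alpha>) (Q \<alpha>) z = 0") auto
  then have "form_value (embedded_degree y) (coords Q v) z \<noteq> 0" unfolding coords_value[OF Q v(1)] prod_zero_iff[OF finite] by blast
  then show ?thesis by (rule that[OF v(1)])
qed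

lemma coords_embedded_forms:
  assumes Q: "admissible y Q"
  shows "embedded_forms u h (cox_curve u y Q) (embedded_degree y) (coords Q)"
  unfolding embedded_forms_def
proof (intro conjI allI impI)
  fix m show "deg (coords Q m) \<le> embedded_degree y" by (rule coords_degree[OF Q])
next
  fix m assume "m \<notin> sections" then show "coords Q m = 0" by (simp add: coords_def)
next
  fix z
  let ?A = "cox_zeros y Q z" and ?x = "\<lambda>\<alpha>. form_value (y \<alpha>) (Q \<alpha>) z"
  have fz: "fst (cox_curve u y Q z) = cone ?A" by (simp add: cox_curve_def)
  obtain v where v: "\<And>\<alpha>. \<alpha> \<in> R (cone ?A) \<Longrightarrow> pairing v (u \<alpha>) = - (h $ \<alpha>)"
    using dual_character[OF admissibleD(4)[OF Q], of z "\<lambda>\<alpha>. - (h $ \<alpha>)"] by blast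
  have v': "sec_order v \<alpha> = 0" if "\<alpha> \<in> ?A" for \<alpha> using v[of \<alpha>] that admissibleD(5)[OF Q, of z] by (simp add: sec_order_def)
  \<comment> \<open>The value at \<open>z\<close> of the local generator \<open>v\<close>. Its
    orders along the vanishing rays are 0, so no zero is raised to a nonzero power, and
    \<open>c\<close> does not vanish.\<close>
  define c where "c = (\<Prod>\<alpha>\<in>UNIV. ?x \<alpha> powi sec_order v \<alpha>)"
  have "?x \<alpha> powi sec_order v \<alpha> \<noteq> 0" for \<alpha> using v'[of \<alpha>] by (auto simp: power_int_eq_0_iff cox_zeros_def)
  then have c0: "c \<noteq> 0" by (simp add: c_def)
  have "form_value (embedded_degree y) (coords Q m) z = c * snd (cox_curve u y Q z) (m - v)" if m: "m \<in> sections" for m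
  proof (cases "\<forall>\<alpha>\<in>?A. pairing (m - v) (u \<alpha>) = 0")
    case True
    then have "snd (cox_curve u y Q z) (m - v) = (\<Prod>\<alpha>\<in>UNIV. ?x \<alpha> powi pairing (m - v) (u \<alpha>))" by (simp add: cox_curve_def)
    moreover have "?x \<alpha> powi sec_order v \<alpha> * ?x \<alpha> powi pairing (m - v) (u \<alpha>) = ?x \<alpha> ^ nat (sec_order m \<alpha>)" for \<alpha>
    proof (cases "?x \<alpha> = 0")
      case True': True
      then have "\<alpha> \<in> ?A" by (simp add: cox_zeros_def)
      then have "sec_order v \<alpha> = 0" "pairing (m - v) (u \<alpha>) = 0" using v' True by auto
      then show ?thesis by (simp add: sec_order_def pairing_diff_left)
    next
      case False
      then have "?x \<alpha> powi sec_order v \<alpha> * ?x \<alpha> powi pairing (m - v) (u \<alpha>) = ?x \<alpha> powi sec_order m \<alpha>"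
        by (simp add: sec_order_def pairing_diff_left add.commute flip: power_int_add)
      then show ?thesis using m sections_iff by (simp add: power_int_def)
    qed
    ultimately show ?thesis unfolding coords_value[OF Q m] c_def by (simp flip: prod.distrib)
  next
    case False
    then obtain \<alpha> where a: "\<alpha> \<in> ?A" "pairing (m - v) (u \<alpha>) \<noteq> 0" by blast
    then have "0 < sec_order m \<alpha>" using v'[OF a(1)] m sections_iff by (auto simp: sec_order_def pairing_diff_left order_less_le)
    then have "form_value (embedded_degree y) (coords Q m) z = 0"
      unfolding coords_value[OF Q m] using a(1) by (auto simp: cox_zeros_def intro!: bexI[of _ \<alpha>])
    moreover have "snd (cox_curve u y Q z) (m - v) = 0" by (simp only: cox_curve_def snd_conv if_not_P[OF False])
    ultimately show ?thesis by simp
  qed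
  then show "\<exists>v c. c \<noteq> 0 \<and> (\<forall>\<alpha>. int_vec (u \<alpha>) \<in> fst (cox_curve u y Q z) \<longrightarrow> pairing v (u \<alpha>) = - (h $ \<alpha>)) \<and>
      (\<forall>m\<in>sections. form_value (embedded_degree y) (coords Q m) z = c * snd (cox_curve u y Q z) (m - v))"
    using c0 v unfolding fz by (intro exI[of _ v] exI[of _ c]) (auto simp: rays_of_def)
qed

text \<open>Two local generators \<open>v\<close> and \<open>v'\<close> at the same point differ by
  a character orthogonal to the cone of that point, whose value there is nonzero.\<close>

lemma embedded_forms_pointwise:
  assumes Q: "admissible y Q" and g: "embedded_forms u h (cox_curve u y Q) e g" and g': "embedded_forms u h (cox_curve u y Q) e' g'"
  shows "\<exists>c. c \<noteq> 0 \<and> (\<forall>m\<in>sections. form_value e (g m) z = c * form_value e' (g' m) z)"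
proof -
  let ?f = "cox_curve u y Q"
  obtain v c where v: "c \<noteq> 0" "\<And>\<alpha>. int_vec (u \<alpha>) \<in> fst (?f z) \<Longrightarrow> pairing v (u \<alpha>) = - (h $ \<alpha>)"
      "\<And>m. m \<in> sections \<Longrightarrow> form_value e (g m) z = c * snd (?f z) (m - v)"
    using g unfolding embedded_forms_def by blast
  obtain v' c' where v': "c' \<noteq> 0" "\<And>\<alpha>. int_vec (u \<alpha>) \<in> fst (?f z) \<Longrightarrow> pairing v' (u \<alpha>) = - (h $ \<alpha>)"
      "\<And>m. m \<in> sections \<Longrightarrow> form_value e' (g' m) z = c' * snd (?f z) (m - v')"
    using g' unfolding embedded_forms_def by blast
  let ?A = "cox_zeros y Q z"
  have vv: "pairing v (u \<alpha>) = - (h $ \<alpha>)" "pairing v' (u \<alpha>) = - (h $ \<alpha>)" if "\<alpha> \<in> ?A" for \<alpha>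
  proof -
    have "int_vec (u \<alpha>) \<in> fst (?f z)" using that by (auto simp: cox_curve_def intro: hull_inc)
    then show "pairing v (u \<alpha>) = - (h $ \<alpha>)" "pairing v' (u \<alpha>) = - (h $ \<alpha>)" using v(2) v'(2) by auto
  qed
  define k where "k = snd (?f z) (v' - v)"
  have pts: "?f z \<in> toric_points \<Sigma>" by (rule cox_curve_toric_points[OF Q])
  have dm: "m \<in> dual_monoid (fst (?f z)) \<longleftrightarrow> (\<forall>\<alpha>\<in>?A. 0 \<le> pairing m (u \<alpha>))" for m
    by (simp add: cox_curve_def dual_monoid_cone)
  have "k \<noteq> 0"
  proof -
    have "v' - v \<in> orthogonal_lattice (fst (?f z))"
      using vv by (simp add: cox_curve_def orthogonal_lattice_cone pairing_diff_left)
    then show ?thesis using pts by (auto simp: k_def toric_points_def split: prod.splits)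
  qed
  have "snd (?f z) (m - v) = k * snd (?f z) (m - v')" if m: "m \<in> sections" for m
  proof -
    have "m - v' \<in> dual_monoid (fst (?f z))" "v' - v \<in> dual_monoid (fst (?f z))"
      using vv m unfolding dm sections_iff by (auto simp: pairing_diff_left sec_order_def)
    from toric_points_mult[OF pts this(2,1)]
    show ?thesis by (simp add: k_def)
  qed
  then show ?thesis using v v' \<open>k \<noteq> 0\<close>
    by (intro exI[of _ "c * k / c'"]) (auto simp: field_simps)
qed

lemma sections_nonempty: "\<exists>m. m \<in> sections"
  using ex_full_cone vertex by metis

text \<open>Proportionality at each point makes the cross products of two coordinate systems equal.
  At each point some coordinate is nonzero in both systems, so corresponding coordinates have equal
  orders everywhere. This gives a common factor \<open>l\<close>, and the order at infinity shows
  that the degrees agree.\<close>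

lemma embedded_forms_unique:
  fixes Q :: "'s \<Rightarrow> 'o::alg_closed_field poly"
  assumes Q: "admissible y Q" and g: "embedded_forms u h (cox_curve u y Q) e g"
  shows "e = embedded_degree y" "\<exists>l. l \<noteq> 0 \<and> (\<forall>m. g m = Polynomial.smult l (coords Q m))"
proof -
  let ?e = "embedded_degree y" and ?g = "coords Q"
  note pw = embedded_forms_pointwise[OF Q g coords_embedded_forms[OF Q]]
  have dg: "deg (g m) \<le> e" for m using g by (simp add: embedded_forms_def)
  have cross: "g m * ?g m' = g m' * ?g m" if "m \<in> sections" "m' \<in> sections" for m m'
  proof (rule forms_eqI[of _ "e + ?e", where Z = UNIV])
    show "deg (g m * ?g m') \<le> e + ?e" "deg (g m' * ?g m) \<le> e + ?e"
      using dg coords_degree[OF Q] degree_mult_le by (meson add_mono order_trans)+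
    show "infinite (UNIV :: 'o option set)" by (rule infinite_option)
    fix z
    obtain c where "\<forall>m\<in>sections. form_value e (g m) z = c * form_value ?e (?g m) z"
      using pw[of z] by (elim exE conjE)
    then have "form_value e (g m) z = c * form_value ?e (?g m) z" "form_value e (g m') z = c * form_value ?e (?g m') z"
      using that by auto
    then show "form_value (e + ?e) (g m * ?g m') z = form_value (e + ?e) (g m' * ?g m) z"
      using dg coords_degree[OF Q] by (simp add: form_value_mult)
  qed
  have g0: "g m \<noteq> 0" if m: "m \<in> sections" for m
  proof
    assume "g m = 0"
    then have "g m' = 0" if "m' \<in> sections" for m'
      using cross[OF m that] coords_nonzero[OF Q m] by auto
    moreover obtain m' where "m' \<in> sections" "form_value ?e (?g m') None \<noteq> 0" by (rule coords_no_common_zero[OF Q])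
    ultimately show False using pw[of None] by (metis form_value_zero mult_eq_0_iff)
  qed
  obtain m0 where m0: "m0 \<in> sections" using sections_nonempty by blast
  have fo: "form_order e (g m0) z = form_order ?e (?g m0) z" for z
  proof -
    obtain m where m: "m \<in> sections" "form_value ?e (?g m) z \<noteq> 0" by (rule coords_no_common_zero[OF Q])
    then have "form_value e (g m) z \<noteq> 0" using pw[of z] by auto
    then have "form_order e (g m) z = 0" "form_order ?e (?g m) z = 0"
      using form_order_eq_0_iff[OF g0[OF m(1)] dg] form_order_eq_0_iff[OF coords_nonzero[OF Q m(1)] coords_degree[OF Q]] m(2) by auto
    moreover have "form_order (e + ?e) (g m0 * ?g m) z = form_order (e + ?e) (g m * ?g m0) z" using cross[OF m0 m(1)] by simp
    ultimately show ?thesis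
      using g0 m0 m(1) coords_nonzero[OF Q] dg coords_degree[OF Q] by (simp add: form_order_mult)
  qed
  have "Polynomial.order x (g m0) = Polynomial.order x (?g m0)" for x using fo[of "Some x"] by (simp add: form_order_def)
  then obtain l where l: "l \<noteq> 0" "g m0 = Polynomial.smult l (?g m0)"
    using alg_closed_orders_proportional[OF g0[OF m0] coords_nonzero[OF Q m0]] by blast
  have "e - deg (g m0) = ?e - deg (?g m0)" using fo[of None] by (simp add: form_order_def)
  moreover have "deg (g m0) = deg (?g m0)" using l by simp
  ultimately show "e = ?e" using dg[of m0] coords_degree[OF Q, of m0] by linarith
  have "g m = Polynomial.smult l (?g m)" for m
  proof (cases "m \<in> sections")
    case True
    have "g m * ?g m0 = Polynomial.smult l (?g m) * ?g m0" using cross[OF m0 True] unfolding l(2) by (simp add: mult.commute)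
    then show ?thesis using mult_right_cancel[OF coords_nonzero[OF Q m0]] by blast
  next
    case False
    then show ?thesis using g by (simp add: embedded_forms_def coords_def)
  qed
  then show "\<exists>l. l \<noteq> 0 \<and> (\<forall>m. g m = Polynomial.smult l (?g m))" using l(1) by blast
qed

definition coord_vector :: "('s \<Rightarrow> 'o::field poly) \<Rightarrow> (int ^ 'r) \<times> nat \<Rightarrow> 'o" where
  "coord_vector Q = (\<lambda>(m, j). cf (coords Q m) j)"

definition principal_open :: "nat \<Rightarrow> nat \<Rightarrow> (((int ^ 'r) \<times> nat \<Rightarrow> 'o::field) \<Rightarrow> 'o) \<Rightarrow> ('o option \<Rightarrow> ('r, 'o) toric_point) set" where
  "principal_open d e \<phi> = {f \<in> rational_curves \<Sigma> u d. \<exists>g. embedded_forms u h f e g \<and> \<phi> (\<lambda>(m, j). cf (g m) j) \<noteq> 0}"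

lemma principal_open_iff:
  fixes Q :: "'s \<Rightarrow> 'o::alg_closed_field poly"
  assumes Q: "admissible y Q" and d: "(\<Sum>\<alpha>\<in>UNIV. y \<alpha>) = d" and \<phi>: "hfun F n \<phi>"
  shows "cox_curve u y Q \<in> principal_open d e \<phi> \<longleftrightarrow> e = embedded_degree y \<and> \<phi> (coord_vector Q) \<noteq> 0"
proof
  assume "cox_curve u y Q \<in> principal_open d e \<phi>"
  then obtain g where g: "embedded_forms u h (cox_curve u y Q) e g" "\<phi> (\<lambda>(m, j). cf (g m) j) \<noteq> 0"
    by (auto simp: principal_open_def)
  obtain l where l: "l \<noteq> 0" "\<forall>m. g m = Polynomial.smult l (coords Q m)" using embedded_forms_unique(2)[OF Q g(1)] by blast
  have "(\<lambda>(m, j). cf (g m) j) = (\<lambda>v. l * coord_vector Q v)" using l(2) by (auto simp: coord_vector_def)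
  then have "\<phi> (coord_vector Q) \<noteq> 0" using g(2) hfun_scale[OF \<phi>, of l "coord_vector Q"] by simp
  then show "e = embedded_degree y \<and> \<phi> (coord_vector Q) \<noteq> 0" using embedded_forms_unique(1)[OF Q g(1)] by blast
next
  assume "e = embedded_degree y \<and> \<phi> (coord_vector Q) \<noteq> 0"
  then show "cox_curve u y Q \<in> principal_open d e \<phi>"
    using coords_embedded_forms[OF Q] cox_curve_rational[OF Q d] by (auto simp: principal_open_def coord_vector_def)
qed

lemma rational_curveE:
  fixes f :: "'o::alg_closed_field option \<Rightarrow> ('r, 'o) toric_point"
  assumes "f \<in> rational_curves \<Sigma> u d"
  obtains y Q where "admissible y Q" "(\<Sum>\<alpha>\<in>UNIV. y \<alpha>) = d" "f = cox_curve u y Q"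
  using assms unfolding rational_curves_eq by blast

lemma principal_open_Int:
  fixes \<phi> \<psi> :: "((int ^ 'r) \<times> nat \<Rightarrow> 'o::alg_closed_field) \<Rightarrow> 'o"
  assumes F: "is_subring F" and "hfun F n \<phi>" "hfun F k \<psi>"
  shows "principal_open d e \<phi> \<inter> principal_open d e \<psi> = principal_open d e (\<lambda>x. \<phi> x * \<psi> x)"
proof -
  have "f \<in> principal_open d e \<phi> \<inter> principal_open d e \<psi> \<longleftrightarrow> f \<in> principal_open d e (\<lambda>x. \<phi> x * \<psi> x)"
    if f: "f \<in> rational_curves \<Sigma> u d" for f
    using f
  proof (rule rational_curveE)
    fix y Q assume Q: "admissible y Q" "(\<Sum>\<alpha>\<in>UNIV. y \<alpha>) = d" "f = cox_curve u y Q"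
    show ?thesis unfolding Q(3) Int_iff
      unfolding principal_open_iff[OF Q(1,2) assms(2)] principal_open_iff[OF Q(1,2) assms(3)] principal_open_iff[OF Q(1,2) hfun_mult[OF assms]]
      by auto
  qed
  moreover have "principal_open d e \<phi> \<subseteq> rational_curves \<Sigma> u d" for e \<phi> by (auto simp: principal_open_def)
  ultimately show ?thesis by blast
qed

text \<open>The principal sets form a basis, not merely a subbasis: for equal \<open>e\<close> an
  intersection is defined by the product of the functions, and for different \<open>e\<close> it is
  empty, since a curve has only one degree.\<close>

lemma openin_curve_space:
  fixes S :: "('o::alg_closed_field option \<Rightarrow> ('r, 'o) toric_point) set"
  assumes F: "is_subring F"
  shows "openin (curve_space F \<Sigma> u h d) S \<longleftrightarrow> S \<subseteq> rational_curves \<Sigma> u d \<and>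
     (\<forall>f\<in>S. \<exists>e n \<phi>. hfun F n \<phi> \<and> f \<in> principal_open d e \<phi> \<and> principal_open d e \<phi> \<subseteq> S)"
    (is "_ \<longleftrightarrow> ?P S")
proof
  have PO: "principal_open d e \<phi> \<subseteq> rational_curves \<Sigma> u d" for e and \<phi> :: "((int ^ 'r) \<times> nat \<Rightarrow> 'o) \<Rightarrow> 'o"
    by (auto simp: principal_open_def)
  assume "openin (curve_space F \<Sigma> u h d) S"
  then have "generate_topology_on {{f \<in> rational_curves \<Sigma> u d. \<exists>g. embedded_forms u h f e g \<and>
         mpoly_eval p (\<lambda>(m, j). cf (g m) j) \<noteq> 0} |
      e (p :: (((int ^ 'r) \<times> nat) \<Rightarrow>\<^sub>0 nat) \<Rightarrow>\<^sub>0 'o). homogeneous_over F p} S"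
    by (simp add: curve_space_def openin_topology_generated_by_iff)
  then show "?P S"
  proof induction
    case Empty then show ?case by simp
  next
    case (Int A B)
    show ?case
    proof (intro conjI ballI)
      show "A \<inter> B \<subseteq> rational_curves \<Sigma> u d" using Int.IH by blast
      fix f assume f: "f \<in> A \<inter> B"
      then obtain e n \<phi> e' n' \<psi> where *: "hfun F n \<phi>" "f \<in> principal_open d e \<phi>" "principal_open d e \<phi> \<subseteq> A"
        "hfun F n' \<psi>" "f \<in> principal_open d e' \<psi>" "principal_open d e' \<psi> \<subseteq> B" using Int.IH by (metis IntE)
      have "f \<in> rational_curves \<Sigma> u d" using f Int.IH by blast
      then obtain y Q where Q: "admissible y Q" "(\<Sum>\<alpha>\<in>UNIV. y \<alpha>) = d" "f = cox_curve u y Q" by (rule rational_curveE)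
      have "e = e'" using * principal_open_iff[OF Q(1,2) *(1)] principal_open_iff[OF Q(1,2) *(4)] Q(3) by metis
      then show "\<exists>e n \<phi>. hfun F n \<phi> \<and> f \<in> principal_open d e \<phi> \<and> principal_open d e \<phi> \<subseteq> A \<inter> B"
        using * principal_open_Int[OF F *(1,4), of d e] hfun_mult[OF F *(1,4)] by blast
    qed
  next
    case (UN K)
    then show ?case by (meson Sup_least Union_iff Union_upper order_trans)
  next
    case (Basis A)
    then obtain e p where A: "A = {f \<in> rational_curves \<Sigma> u d. \<exists>g. embedded_forms u h f e g \<and>
         mpoly_eval p (\<lambda>(m, j). cf (g m) j) \<noteq> 0}" "homogeneous_over F p" by blast
    obtain n where n: "hfun F n (mpoly_eval p)" by (rule mpoly_eval_hfun[OF is_subringD(1)[OF F] A(2)])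
    have "A = principal_open d e (mpoly_eval p)" unfolding A(1) principal_open_def ..
    then show ?case using n PO by blast
  qed
next
  assume P: "?P S"
  have op: "openin (curve_space F \<Sigma> u h d) (principal_open d e \<phi>)" if \<phi>: "hfun F n \<phi>" for e n and \<phi> :: "((int ^ 'r) \<times> nat \<Rightarrow> 'o) \<Rightarrow> 'o"
  proof -
    obtain p where p: "\<forall>t. Poly_Mapping.lookup p t \<in> F"
     "\<forall>t\<in>Poly_Mapping.keys p. (\<Sum>v\<in>Poly_Mapping.keys t. Poly_Mapping.lookup t v) = n" "\<phi> = mpoly_eval p"
      using hfun_mpoly_eval[OF F \<phi>] by blast
    then have "homogeneous_over F p" by (auto simp: homogeneous_over_def)
    then show ?thesis unfolding curve_space_def p(3) principal_open_def
      by (intro topology_generated_by_Basis) blast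
  qed
  have "S = \<Union>{principal_open d e \<phi> | e \<phi>. (\<exists>n. hfun F n \<phi>) \<and> principal_open d e \<phi> \<subseteq> S}" using P by blast
  also have "openin (curve_space F \<Sigma> u h d) \<dots>" by (rule openin_Union) (use op in blast)
  finally show "openin (curve_space F \<Sigma> u h d) S" .
qed

lemma topspace_curve_space:
  assumes F: "is_subring F"
  shows "topspace (curve_space F \<Sigma> u h d) = (rational_curves \<Sigma> u d :: ('o::alg_closed_field option \<Rightarrow> ('r, 'o) toric_point) set)"
proof
  show "topspace (curve_space F \<Sigma> u h d) \<subseteq> rational_curves \<Sigma> u d"
    using openin_curve_space[OF F] openin_topspace by blast
  have "openin (curve_space F \<Sigma> u h d) (rational_curves \<Sigma> u d)"
    unfolding openin_curve_space[OF F]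
  proof (intro conjI ballI)
    fix f :: "'o option \<Rightarrow> ('r, 'o) toric_point" assume "f \<in> rational_curves \<Sigma> u d"
    then obtain y Q where Q: "admissible y Q" "(\<Sum>\<alpha>\<in>UNIV. y \<alpha>) = d" "f = cox_curve u y Q" by (rule rational_curveE)
    have 1: "hfun F 0 (\<lambda>_. 1)" using hfun_const[OF is_subringD(2)[OF F]] .
    have "f \<in> principal_open d (embedded_degree y) (\<lambda>_. 1)" using principal_open_iff[OF Q(1,2) 1] Q(3) by simp
    then show "\<exists>e n \<phi>. hfun F n \<phi> \<and> f \<in> principal_open d e \<phi> \<and> principal_open d e \<phi> \<subseteq> rational_curves \<Sigma> u d"
      using 1 by (intro exI[of _ "embedded_degree y"] exI[of _ 0] exI[of _ "\<lambda>_. 1"]) (auto simp: principal_open_def)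
  qed simp
  then show "rational_curves \<Sigma> u d \<subseteq> topspace (curve_space F \<Sigma> u h d)" by (rule openin_subset)
qed

end

section \<open>Forms split into linear factors\<close>

definition line :: "('c \<Rightarrow> 'o::field) \<Rightarrow> ('c \<Rightarrow> 'o) \<Rightarrow> 'o \<Rightarrow> 'c \<Rightarrow> 'o" where
  "line x x' \<epsilon> c = x c + \<epsilon> * (x' c - x c)"

text \<open>Functions of the parameters matter here only through their restrictions to lines, which
  have finitely many zeros unless they vanish identically. The notion is closed under sums and
  products without fixing a degree or a finite set of variables.\<close>

definition line_poly :: "(('c \<Rightarrow> 'o::field) \<Rightarrow> 'o) \<Rightarrow> bool" where
  "line_poly \<phi> \<longleftrightarrow> (\<forall>x x'. \<exists>q. \<forall>\<epsilon>. \<phi> (line x x' \<epsilon>) = poly q \<epsilon>)"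

lemma line_0 [simp]: "line x x' 0 = x" and line_1 [simp]: "line x x' 1 = x'"
  by (auto simp: line_def)

lemma line_poly_const: "line_poly (\<lambda>x. k)"
  unfolding line_poly_def by (intro allI exI[of _ "[:k:]"]) simp

lemma line_poly_coord: "line_poly (\<lambda>x. x c)"
  unfolding line_poly_def line_def
proof (intro allI)
  fix x x' :: "'a \<Rightarrow> 'b"
  show "\<exists>q. \<forall>\<epsilon>. x c + \<epsilon> * (x' c - x c) = poly q \<epsilon>" by (intro exI[of _ "[:x c, x' c - x c:]"]) simp
qed

lemma line_poly_add:
  assumes "line_poly \<phi>" "line_poly \<psi>" shows "line_poly (\<lambda>x. \<phi> x + \<psi> x)"
  unfolding line_poly_def
proof (intro allI)
  fix x x'
  obtain p q where "\<forall>\<epsilon>. \<phi> (line x x' \<epsilon>) = poly p \<epsilon>" "\<forall>\<epsilon>. \<psi> (line x x' \<epsilon>) = poly q \<epsilon>"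
    using assms unfolding line_poly_def by metis
  then show "\<exists>q. \<forall>\<epsilon>. \<phi> (line x x' \<epsilon>) + \<psi> (line x x' \<epsilon>) = poly q \<epsilon>" by (intro exI[of _ "p + q"]) simp
qed

lemma line_poly_mult:
  assumes "line_poly \<phi>" "line_poly \<psi>" shows "line_poly (\<lambda>x. \<phi> x * \<psi> x)"
  unfolding line_poly_def
proof (intro allI)
  fix x x'
  obtain p q where "\<forall>\<epsilon>. \<phi> (line x x' \<epsilon>) = poly p \<epsilon>" "\<forall>\<epsilon>. \<psi> (line x x' \<epsilon>) = poly q \<epsilon>"
    using assms unfolding line_poly_def by metis
  then show "\<exists>q. \<forall>\<epsilon>. \<phi> (line x x' \<epsilon>) * \<psi> (line x x' \<epsilon>) = poly q \<epsilon>" by (intro exI[of _ "p * q"]) simp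
qed

lemma line_poly_sum: "(\<And>i. i \<in> S \<Longrightarrow> line_poly (\<phi> i)) \<Longrightarrow> line_poly (\<lambda>x. \<Sum>i\<in>S. \<phi> i x)"
  by (induction S rule: infinite_finite_induct) (auto intro: line_poly_const line_poly_add)

lemma line_poly_prod: "(\<And>i. i \<in> S \<Longrightarrow> line_poly (\<phi> i)) \<Longrightarrow> line_poly (\<lambda>x. \<Prod>i\<in>S. \<phi> i x)"
  by (induction S rule: infinite_finite_induct) (auto intro: line_poly_const line_poly_mult)

lemma line_poly_finite_zeros:
  assumes "line_poly \<phi>" "\<phi> (line x x' e0) \<noteq> 0"
  shows "finite {\<epsilon>. \<phi> (line x x' \<epsilon>) = 0}"
proof -
  obtain q where q: "\<And>\<epsilon>. \<phi> (line x x' \<epsilon>) = poly q \<epsilon>" using assms(1) unfolding line_poly_def by metis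
  then have "q \<noteq> 0" using assms(2) by auto
  then show ?thesis unfolding q by (rule poly_roots_finite)
qed

definition coeffs_line_poly :: "(('c \<Rightarrow> 'o::field) \<Rightarrow> 'o poly) \<Rightarrow> bool" where
  "coeffs_line_poly P \<longleftrightarrow> (\<forall>j. line_poly (\<lambda>x. cf (P x) j))"

lemma coeffs_line_poly_mult: "coeffs_line_poly P \<Longrightarrow> coeffs_line_poly P' \<Longrightarrow> coeffs_line_poly (\<lambda>x. P x * P' x)"
  unfolding coeffs_line_poly_def coeff_mult by (auto intro!: line_poly_sum line_poly_mult)

lemma coeffs_line_poly_const: "coeffs_line_poly (\<lambda>x. p)"
  unfolding coeffs_line_poly_def by (auto intro: line_poly_const)

lemma coeffs_line_poly_prod: "(\<And>i. i \<in> S \<Longrightarrow> coeffs_line_poly (P i)) \<Longrightarrow> coeffs_line_poly (\<lambda>x. \<Prod>i\<in>S. P i x)"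
  by (induction S rule: infinite_finite_induct) (auto intro: coeffs_line_poly_const coeffs_line_poly_mult)

lemma coeffs_line_poly_power: "coeffs_line_poly P \<Longrightarrow> coeffs_line_poly (\<lambda>x. P x ^ k)"
  by (induction k) (auto intro: coeffs_line_poly_const coeffs_line_poly_mult)

lemma hfun_line_poly:
  assumes "hfun F n \<phi>" "\<And>v. line_poly (\<lambda>x. g x v)"
  shows "line_poly (\<lambda>x. \<phi> (g x))"
  using assms(1)
proof induction
  case (hfun_mono c M)
  have "line_poly (\<lambda>x. \<Prod>v\<in>#M. g x v)"
    by (induction M) (auto intro: line_poly_const line_poly_mult assms(2))
  then show ?case by (intro line_poly_mult line_poly_const)
next
  case (hfun_add n \<phi> \<psi>)
  then show ?case by (intro line_poly_add)
qed

section \<open>Parameters for products of linear factors\<close>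

datatype 's coord = Scalar 's | Lead 's nat | Const 's nat

definition linear_factor :: "('s coord \<Rightarrow> 'o::field) \<Rightarrow> 's \<Rightarrow> nat \<Rightarrow> 'o poly" where
  "linear_factor x \<alpha> i = [:x (Const \<alpha> i), x (Lead \<alpha> i):]"

text \<open>The parametrization is redundant on purpose: roots at infinity are covered by vanishing
  leading coefficients, and common zeros of several forms become vanishing determinants of pairs of
  linear factors.\<close>

definition split_form :: "('s \<Rightarrow> nat) \<Rightarrow> ('s coord \<Rightarrow> 'o::field) \<Rightarrow> 's \<Rightarrow> 'o poly" where
  "split_form y x \<alpha> = Polynomial.smult (x (Scalar \<alpha>)) (\<Prod>i<y \<alpha>. linear_factor x \<alpha> i)"

lemma linear_factor_degree: "deg (linear_factor x \<alpha> i) \<le> 1"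
  by (simp add: linear_factor_def)

lemma split_form_degree: "deg (split_form y x \<alpha>) \<le> y \<alpha>"
proof -
  have "deg (\<Prod>i<y \<alpha>. linear_factor x \<alpha> i) \<le> (\<Sum>i<y \<alpha>. 1)"
    by (intro degree_prod_le_sum linear_factor_degree) simp
  then show ?thesis unfolding split_form_def using degree_smult_le[of "x (Scalar \<alpha>)"] by (metis card_lessThan order_trans sum_constant mult.right_neutral of_nat_id)
qed

lemma split_form_value:
  "form_value (y \<alpha>) (split_form y x \<alpha>) z = x (Scalar \<alpha>) * (\<Prod>i<y \<alpha>. form_value 1 (linear_factor x \<alpha> i) z)"
proof -
  have "form_value (\<Sum>i<y \<alpha>. 1) (\<Prod>i<y \<alpha>. linear_factor x \<alpha> i) z = (\<Prod>i<y \<alpha>. form_value 1 (linear_factor x \<alpha> i) z)"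
    by (intro form_value_prod linear_factor_degree) simp
  then show ?thesis by (simp add: split_form_def form_value_smult)
qed

lemma split_form_nonzero_iff:
  "split_form y x \<alpha> \<noteq> 0 \<longleftrightarrow> x (Scalar \<alpha>) \<noteq> 0 \<and> (\<forall>i<y \<alpha>. x (Lead \<alpha> i) \<noteq> 0 \<or> x (Const \<alpha> i) \<noteq> 0)"
  by (auto simp: split_form_def linear_factor_def)

text \<open>The factors beyond the true degree are the constants 1, with leading coefficient 0; they
  are the roots at infinity of the binary form of degree \<open>n\<close>.\<close>

lemma split_form_surj:
  fixes p :: "'o::alg_closed_field poly"
  assumes "p \<noteq> 0" "deg p \<le> n"
  shows "\<exists>t a b. p = Polynomial.smult t (\<Prod>i<n. [:b i, a i:])"
proof -
  obtain xs where xs: "mset xs = proots p" using ex_mset by blast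
  have len: "length xs = deg p" using alg_closed_proots(1)[OF assms(1)] xs by (metis size_mset)
  have "(\<Prod>x\<in>#proots p. [:- x, 1:]) = (\<Prod>i<length xs. [:- (xs ! i), 1:])"
    unfolding xs[symmetric] by (simp add: prod_mset_prod_list prod.list_conv_set_nth atLeast0LessThan flip: mset_map)
  also have "\<dots> = (\<Prod>i<n. if i < length xs then [:- (xs ! i), 1:] else 1)"
    using len assms(2) by (intro prod.mono_neutral_cong_left) auto
  also have "\<dots> = (\<Prod>i<n. [:if i < length xs then - (xs ! i) else 1, if i < length xs then 1 else 0:])"
    by (intro prod.cong) auto
  finally show ?thesis using alg_closed_proots(2)[OF assms(1)]
    by (intro exI[of _ "cf p (deg p)"] exI[of _ "\<lambda>i. if i < length xs then 1 else 0"] exI[of _ "\<lambda>i. if i < length xs then - (xs ! i) else 1"]) simp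
qed

lemma linear_value_proportional:
  fixes a b a' b' :: "'o::field"
  assumes "a * b' = a' * b" "a \<noteq> 0 \<or> b \<noteq> 0" "a' \<noteq> 0 \<or> b' \<noteq> 0"
  shows "form_value 1 [:b, a:] z = 0 \<longleftrightarrow> form_value 1 [:b', a':] z = 0"
proof (cases z)
  case None
  then show ?thesis using assms by (auto simp: form_value_def)
next
  case (Some w)
  have "a' * (b + w * a) = a * (b' + w * a')" "b' * (b + w * a) = b * (b' + w * a')"
    using assms(1) by (auto simp: algebra_simps)
  then show ?thesis using assms(2,3) Some by (auto simp: form_value_def)
qed

lemma linear_common_zero:
  fixes a b a' b' :: "'o::field"
  assumes "form_value 1 [:b, a:] z = 0" "form_value 1 [:b', a':] z = 0"
  shows "a * b' = a' * b"
proof (cases z)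
  case None
  then show ?thesis using assms by (auto simp: form_value_def)
next
  case (Some w)
  then have "b = - (w * a)" "b' = - (w * a')" using assms by (auto simp: form_value_def add_eq_0_iff2)
  then show ?thesis by simp
qed

lemma linear_zero:
  fixes a b :: "'o::field"
  assumes "a \<noteq> 0 \<or> b \<noteq> 0"
  obtains z where "form_value 1 [:b, a:] z = 0"
proof (cases "a = 0")
  case True
  then have "form_value 1 [:b, a:] None = 0" by (simp add: form_value_def)
  then show ?thesis by (rule that)
next
  case False
  then have "form_value 1 [:b, a:] (Some (- b / a)) = 0" by (simp add: form_value_def)
  then show ?thesis by (rule that)
qed

context complete_fan begin

definition params :: "('s \<Rightarrow> nat) \<Rightarrow> ('s coord \<Rightarrow> 'o::field) set" where
  "params y = {x. admissible y (split_form y x)}"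

lemma admissible_split:
  fixes Q :: "'s \<Rightarrow> 'o::alg_closed_field poly"
  assumes Q: "admissible y Q"
  obtains x where "x \<in> params y" "Q = split_form y x"
proof -
  have "\<exists>t a b. Q \<alpha> = Polynomial.smult t (\<Prod>i<y \<alpha>. [:b i, a i:])" for \<alpha>
    by (rule split_form_surj[OF admissibleD(1,2)[OF Q]])
  then obtain t a b where *: "\<And>\<alpha>. Q \<alpha> = Polynomial.smult (t \<alpha>) (\<Prod>i<y \<alpha>. [:b \<alpha> i, a \<alpha> i:])" by metis
  define x where "x c = (case c of Scalar \<alpha> \<Rightarrow> t \<alpha> | Lead \<alpha> i \<Rightarrow> a \<alpha> i | Const \<alpha> i \<Rightarrow> b \<alpha> i)" for c
  have "Q = split_form y x" by (rule ext) (simp add: * split_form_def linear_factor_def x_def)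
  then show ?thesis using that[of x] Q by (simp add: params_def)
qed

lemma subset_cone_zeros:
  assumes "\<sigma> \<in> \<Sigma>" "A \<subseteq> R \<sigma>"
  shows "\<exists>\<tau>\<in>\<Sigma>. R \<tau> = A"
  using face_cone[OF assms] by blast

text \<open>Nonzero scalars, nonzero coefficients of factors and nonzero determinants of pairs of
  factors at \<open>x\<close> remain nonzero for all but finitely many \<epsilon>. Then factors with
  a common root at the new parameters already had one at \<open>x\<close>, so the forms vanishing
  together at a point also vanish together at some point \<open>z'\<close> for \<open>x\<close>.
  Their rays are among those of a cone of the fan, and any such subset spans a cone.\<close>

lemma params_line:
  fixes x x' :: "'s coord \<Rightarrow> 'o::field"
  assumes x: "x \<in> params y"
  shows "finite {\<epsilon>. line x x' \<epsilon> \<notin> params y}"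
proof -
  have adm: "admissible y (split_form y x)" using x by (simp add: params_def)
  define det where "det \<alpha> i \<beta> j = (\<lambda>x :: 's coord \<Rightarrow> 'o. x (Lead \<alpha> i) * x (Const \<beta> j) + (- 1) * (x (Lead \<beta> j) * x (Const \<alpha> i)))" for \<alpha> i \<beta> j
  define I where "I = (SIGMA \<alpha>:UNIV. {..<y \<alpha>})"
  have finI: "finite I" by (simp add: I_def)
  have lpdet: "line_poly (det \<alpha> i \<beta> j)" for \<alpha> i \<beta> j
    unfolding det_def by (intro line_poly_add line_poly_mult line_poly_coord line_poly_const)
  define bad where "bad = (\<Union>\<alpha>. {\<epsilon>. line x x' \<epsilon> (Scalar \<alpha>) = 0}) \<union>
     (\<Union>(\<alpha>, i)\<in>I. {\<epsilon>. x (Lead \<alpha> i) \<noteq> 0 \<and> line x x' \<epsilon> (Lead \<alpha> i) = 0}) \<union>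
     (\<Union>(\<alpha>, i)\<in>I. {\<epsilon>. x (Const \<alpha> i) \<noteq> 0 \<and> line x x' \<epsilon> (Const \<alpha> i) = 0}) \<union>
     (\<Union>(\<alpha>, i)\<in>I. \<Union>(\<beta>, j)\<in>I. {\<epsilon>. det \<alpha> i \<beta> j x \<noteq> 0 \<and> det \<alpha> i \<beta> j (line x x' \<epsilon>) = 0})"
  have f1: "finite {\<epsilon>. x c \<noteq> 0 \<and> line x x' \<epsilon> c = 0}" for c
    using line_poly_finite_zeros[OF line_poly_coord[of c], of x x' 0] by (cases "x c = 0") auto
  have f2: "finite {\<epsilon>. det \<alpha> i \<beta> j x \<noteq> 0 \<and> det \<alpha> i \<beta> j (line x x' \<epsilon>) = 0}" for \<alpha> i \<beta> j
    using line_poly_finite_zeros[OF lpdet[of \<alpha> i \<beta> j], of x x' 0] by (cases "det \<alpha> i \<beta> j x = 0") auto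
  have nz: "x (Scalar \<alpha>) \<noteq> 0" "i < y \<alpha> \<Longrightarrow> x (Lead \<alpha> i) \<noteq> 0 \<or> x (Const \<alpha> i) \<noteq> 0" for \<alpha> i
    using admissibleD(1)[OF adm, of \<alpha>] unfolding split_form_nonzero_iff by auto
  have "finite bad"
    unfolding bad_def using f1 f2 finI f1[of "Scalar _"] nz(1) by (intro finite_UnI finite_UN_I) (auto split: prod.splits)
  moreover have "line x x' \<epsilon> \<in> params y" if e: "\<epsilon> \<notin> bad" for \<epsilon>
  proof -
    let ?x = "line x x' \<epsilon>"
    have nz': "?x (Scalar \<alpha>) \<noteq> 0" for \<alpha> using e by (auto simp: bad_def)
    have nl: "?x (Lead \<alpha> i) \<noteq> 0 \<or> ?x (Const \<alpha> i) \<noteq> 0" if "i < y \<alpha>" for \<alpha> i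
      using nz(2)[OF that] e that by (auto simp: bad_def I_def)
    have dt: "det \<alpha> i \<beta> j x = 0" if "i < y \<alpha>" "j < y \<beta>" "det \<alpha> i \<beta> j ?x = 0" for \<alpha> i \<beta> j
      using e that by (simp add: bad_def I_def) blast
    have "\<exists>\<sigma>\<in>\<Sigma>. R \<sigma> = cox_zeros y (split_form y ?x) z" for z
    proof (cases "cox_zeros y (split_form y ?x) z = {}")
      case True
      then show ?thesis using zero_cone by auto
    next
      case False
      let ?Z = "cox_zeros y (split_form y ?x) z"
      have "\<exists>i<y \<alpha>. form_value 1 (linear_factor ?x \<alpha> i) z = 0" if "\<alpha> \<in> ?Z" for \<alpha>
        using that nz'[of \<alpha>] by (auto simp: cox_zeros_def split_form_value)
      then obtain k where k: "\<And>\<alpha>. \<alpha> \<in> ?Z \<Longrightarrow> k \<alpha> < y \<alpha>" "\<And>\<alpha>. \<alpha> \<in> ?Z \<Longrightarrow> form_value 1 (linear_factor ?x \<alpha> (k \<alpha>)) z = 0" by metis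
      have d0: "x (Lead \<alpha> (k \<alpha>)) * x (Const \<beta> (k \<beta>)) = x (Lead \<beta> (k \<beta>)) * x (Const \<alpha> (k \<alpha>))" if "\<alpha> \<in> ?Z" "\<beta> \<in> ?Z" for \<alpha> \<beta>
      proof -
        have "det \<alpha> (k \<alpha>) \<beta> (k \<beta>) ?x = 0"
          using linear_common_zero[of "?x (Const \<alpha> (k \<alpha>))" "?x (Lead \<alpha> (k \<alpha>))" z "?x (Const \<beta> (k \<beta>))" "?x (Lead \<beta> (k \<beta>))"] k(2) that
          by (simp add: det_def linear_factor_def)
        then have "det \<alpha> (k \<alpha>) \<beta> (k \<beta>) x = 0" using dt k(1) that by blast
        then show ?thesis by (simp add: det_def)
      qed
      obtain \<alpha>0 where a0: "\<alpha>0 \<in> ?Z" using False by auto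
      obtain z' where z': "form_value 1 [:x (Const \<alpha>0 (k \<alpha>0)), x (Lead \<alpha>0 (k \<alpha>0)):] z' = 0"
        using linear_zero[OF nz(2)[OF k(1)[OF a0]]] by blast
      have "?Z \<subseteq> cox_zeros y (split_form y x) z'"
      proof
        fix \<alpha> assume a: "\<alpha> \<in> ?Z"
        have "form_value 1 (linear_factor x \<alpha> (k \<alpha>)) z' = 0"
          using linear_value_proportional[OF d0[OF a0 a] nz(2)[OF k(1)[OF a0]] nz(2)[OF k(1)[OF a]]] z' by (simp add: linear_factor_def)
        then show "\<alpha> \<in> cox_zeros y (split_form y x) z'"
          using k(1)[OF a] by (auto simp: cox_zeros_def split_form_value)
      qed
      then show ?thesis using subset_cone_zeros[OF admissibleD(4)[OF adm, of z']] admissibleD(5)[OF adm, of z'] by blast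
    qed
    moreover have "split_form y ?x \<alpha> \<noteq> 0" for \<alpha> unfolding split_form_nonzero_iff using nz' nl by blast
    ultimately show ?thesis using adm by (simp add: params_def admissible_def split_form_degree)
  qed
  ultimately show ?thesis by (rule_tac finite_subset[of _ bad]) auto
qed

text \<open>The line runs from \<open>x1\<close> at 0 to \<open>x2\<close> at 1. Each of the three
  conditions holds at one of these points, hence fails for only finitely many \<epsilon>, and the
  field is infinite.\<close>

lemma params_meet:
  fixes x1 x2 :: "'s coord \<Rightarrow> 'o::alg_closed_field"
  assumes x: "x1 \<in> params y" and p: "line_poly \<phi>1" "line_poly \<phi>2" and n: "\<phi>1 x1 \<noteq> 0" "\<phi>2 x2 \<noteq> 0"
  shows "\<exists>\<epsilon>. line x1 x2 \<epsilon> \<in> params y \<and> \<phi>1 (line x1 x2 \<epsilon>) \<noteq> 0 \<and> \<phi>2 (line x1 x2 \<epsilon>) \<noteq> 0"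
proof -
  have "finite ({\<epsilon>. line x1 x2 \<epsilon> \<notin> params y} \<union> {\<epsilon>. \<phi>1 (line x1 x2 \<epsilon>) = 0} \<union> {\<epsilon>. \<phi>2 (line x1 x2 \<epsilon>) = 0})"
    using params_line[OF x] line_poly_finite_zeros[OF p(1), of x1 x2 0] line_poly_finite_zeros[OF p(2), of x1 x2 1] n by simp
  from ex_new_if_finite[OF infinite_alg_closed this] show ?thesis by auto
qed

lemma ray_in_cone: "\<exists>\<sigma>\<in>\<Sigma>. R \<sigma> = {\<alpha>}"
proof -
  obtain \<sigma> where "\<sigma> \<in> \<Sigma>" "U \<alpha> \<in> \<sigma>" using complete by blast
  then show ?thesis using subset_cone_zeros[of \<sigma> "{\<alpha>}"] by (auto simp: rays_of_def)
qed

lemma params_distinct_roots: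
  fixes x :: "'s coord \<Rightarrow> 'o::field"
  assumes y: "\<And>m. (\<Sum>\<alpha>\<in>UNIV. int (y \<alpha>) * pairing m (u \<alpha>)) = 0"
    and x: "\<And>\<alpha>. x (Scalar \<alpha>) \<noteq> 0" "\<And>\<alpha> i. i < y \<alpha> \<Longrightarrow> x (Lead \<alpha> i) = 1"
      "\<And>\<alpha> i \<beta> j. i < y \<alpha> \<Longrightarrow> j < y \<beta> \<Longrightarrow> \<alpha> \<noteq> \<beta> \<Longrightarrow> x (Const \<alpha> i) \<noteq> x (Const \<beta> j)"
  shows "x \<in> params y"
proof -
  have "\<exists>\<sigma>\<in>\<Sigma>. R \<sigma> = cox_zeros y (split_form y x) z" for z
  proof -
    have z: "\<exists>i<y \<alpha>. \<exists>w. z = Some w \<and> x (Const \<alpha> i) = - w" if a: "\<alpha> \<in> cox_zeros y (split_form y x) z" for \<alpha>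
    proof -
      obtain i where i: "i < y \<alpha>" "form_value 1 (linear_factor x \<alpha> i) z = 0"
        using a x(1)[of \<alpha>] by (auto simp: cox_zeros_def split_form_value)
      then show ?thesis using x(2)[OF i(1)] by (cases z) (auto simp: form_value_def linear_factor_def add_eq_0_iff2)
    qed
    have "\<alpha> = \<beta>" if "\<alpha> \<in> cox_zeros y (split_form y x) z" "\<beta> \<in> cox_zeros y (split_form y x) z" for \<alpha> \<beta>
      using z[OF that(1)] z[OF that(2)] x(3)[of _ \<alpha> _ \<beta>] by force
    then have "cox_zeros y (split_form y x) z = {} \<or> (\<exists>\<alpha>. cox_zeros y (split_form y x) z = {\<alpha>})" by blast
    then show ?thesis using zero_cone ray_in_cone by metis
  qed
  moreover have "split_form y x \<alpha> \<noteq> 0" for \<alpha> unfolding split_form_nonzero_iff using x(1,2) by simp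
  ultimately show ?thesis using y by (simp add: params_def admissible_def split_form_degree)
qed

end

section \<open>Chains of irreducible closed sets\<close>

lemma irreducible_closureI:
  assumes S: "S \<subseteq> topspace T" "S \<noteq> {}"
    and meet: "\<And>A B. openin T A \<Longrightarrow> openin T B \<Longrightarrow> A \<inter> S \<noteq> {} \<Longrightarrow> B \<inter> S \<noteq> {} \<Longrightarrow> A \<inter> B \<inter> S \<noteq> {}"
  shows "irreducible_closed T (T closure_of S)"
  unfolding irreducible_closed_def
proof (intro conjI allI impI)
  show "closedin T (T closure_of S)" by simp
  show "T closure_of S \<noteq> {}" using S closure_of_subset by fastforce
  fix A B assume AB: "closedin T A \<and> closedin T B \<and> T closure_of S \<subseteq> A \<union> B"
  have sub: "S \<subseteq> A \<union> B" using AB closure_of_subset[OF S(1)] by blast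
  have "openin T (topspace T - A)" "openin T (topspace T - B)" using AB by auto
  then have "(topspace T - A) \<inter> S = {} \<or> (topspace T - B) \<inter> S = {}" using meet sub by blast
  then have "S \<subseteq> A \<or> S \<subseteq> B" using S by blast
  then show "T closure_of S \<subseteq> A \<or> T closure_of S \<subseteq> B" using AB closure_of_minimal by blast
qed

lemma irreducible_closed_meet:
  assumes "irreducible_closed T Z" "openin T A" "openin T B" "A \<inter> Z \<noteq> {}" "B \<inter> Z \<noteq> {}"
  shows "A \<inter> B \<inter> Z \<noteq> {}"
proof
  assume "A \<inter> B \<inter> Z = {}"
  moreover have "Z \<subseteq> topspace T" using assms(1) by (auto simp: irreducible_closed_def dest: closedin_subset)
  ultimately have "Z \<subseteq> (topspace T - A) \<union> (topspace T - B)" by blast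
  moreover have "closedin T (topspace T - A)" "closedin T (topspace T - B)" using assms by auto
  ultimately have "Z \<subseteq> topspace T - A \<or> Z \<subseteq> topspace T - B" using assms(1) by (simp add: irreducible_closed_def)
  then show False using assms(4,5) by blast
qed

lemma irreducible_closed_Union:
  assumes "irreducible_closed T Z" "finite I" "\<And>i. i \<in> I \<Longrightarrow> closedin T (C i)" "Z \<subseteq> (\<Union>i\<in>I. C i)"
  obtains i where "i \<in> I" "Z \<subseteq> C i"
proof -
  have "\<exists>i\<in>I. Z \<subseteq> C i" using assms(2-4)
  proof (induction I)
    case empty then show ?case using assms(1) by (auto simp: irreducible_closed_def)
  next
    case (insert i I)
    have "closedin T (C i)" "closedin T (\<Union>i\<in>I. C i)" using insert by (auto intro: closedin_Union)
    then have "Z \<subseteq> C i \<or> Z \<subseteq> (\<Union>i\<in>I. C i)" using assms(1) insert.prems by (simp add: irreducible_closed_def)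
    then show ?case using insert by auto
  qed
  then show ?thesis using that by blast
qed

definition irreducible_chain :: "'a topology \<Rightarrow> nat \<Rightarrow> (nat \<Rightarrow> 'a set) \<Rightarrow> bool" where
  "irreducible_chain T n Z \<longleftrightarrow> (\<forall>i\<le>n. irreducible_closed T (Z i)) \<and> (\<forall>i<n. Z i \<subset> Z (Suc i))"

lemma krull_dim_chain: "krull_dim T = Sup {ereal (real n) | n. \<exists>Z. irreducible_chain T n Z}"
  by (simp add: krull_dim_def irreducible_chain_def)

lemma irreducible_chain_mono: "irreducible_chain T n Z \<Longrightarrow> i \<le> j \<Longrightarrow> j \<le> n \<Longrightarrow> Z i \<subseteq> Z j"
proof (induction j)
  case (Suc j)
  have "Z j \<subset> Z (Suc j)" using Suc.prems by (simp add: irreducible_chain_def)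
  then show ?case using Suc by (cases "i = Suc j") auto
qed simp

lemma krull_dim_eqI:
  assumes "irreducible_chain T N Z" "\<And>n Z. irreducible_chain T n Z \<Longrightarrow> n \<le> N"
  shows "krull_dim T = ereal (real N)"
  unfolding krull_dim_chain
  by (rule antisym) (auto intro!: Sup_least Sup_upper dest: assms(2) intro: assms(1) exI[of _ N])

lemma irreducible_closed_subtopology:
  assumes "closedin T C"
  shows "irreducible_closed (subtopology T C) Z \<longleftrightarrow> irreducible_closed T Z \<and> Z \<subseteq> C"
proof -
  have cl: "closedin (subtopology T C) A \<longleftrightarrow> closedin T A \<and> A \<subseteq> C" for A
    using closedin_closed_subtopology[OF assms] by blast
  show ?thesis
  proof
    assume Z: "irreducible_closed (subtopology T C) Z"
    then have ZC: "Z \<subseteq> C" by (simp add: irreducible_closed_def cl)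
    have "irreducible_closed T Z"
      unfolding irreducible_closed_def
    proof (intro conjI allI impI)
      show "closedin T Z" "Z \<noteq> {}" using Z by (auto simp: irreducible_closed_def cl)
      fix A B assume "closedin T A \<and> closedin T B \<and> Z \<subseteq> A \<union> B"
      then have "closedin (subtopology T C) (A \<inter> C)" "closedin (subtopology T C) (B \<inter> C)" "Z \<subseteq> (A \<inter> C) \<union> (B \<inter> C)"
        using ZC assms by (auto simp: cl)
      then have "Z \<subseteq> A \<inter> C \<or> Z \<subseteq> B \<inter> C" using Z unfolding irreducible_closed_def by blast
      then show "Z \<subseteq> A \<or> Z \<subseteq> B" by blast
    qed
    then show "irreducible_closed T Z \<and> Z \<subseteq> C" using ZC by blast
  next
    assume "irreducible_closed T Z \<and> Z \<subseteq> C"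
    then show "irreducible_closed (subtopology T C) Z" unfolding irreducible_closed_def cl by blast
  qed
qed

lemma irreducible_chain_subtopology:
  assumes "closedin T C"
  shows "irreducible_chain (subtopology T C) n Z \<longleftrightarrow> irreducible_chain T n Z \<and> Z n \<subseteq> C"
proof -
  have "Z i \<subseteq> C" if "irreducible_chain T n Z" "Z n \<subseteq> C" "i \<le> n" for i
    using irreducible_chain_mono[OF that(1,3)] that(2) by blast
  then show ?thesis unfolding irreducible_chain_def irreducible_closed_subtopology[OF assms] by blast
qed

text \<open>Every irreducible closed set lies in one of the finitely many closures, so
  \<open>N\<close> bounds all chains. If no stratum is contained in the closure of another one, then
  these closures are pairwise different and are the irreducible components, all of dimension
  \<open>N\<close>.\<close>

lemma equidimensional_space:
  assumes fin: "finite I" and cover: "topspace T = (\<Union>i\<in>I. S i)"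
    and irr: "\<And>i. i \<in> I \<Longrightarrow> irreducible_closed T (T closure_of S i)"
    and low: "\<And>i. i \<in> I \<Longrightarrow> \<exists>Z. irreducible_chain T N Z \<and> Z N \<subseteq> T closure_of S i"
    and up: "\<And>i n Z. i \<in> I \<Longrightarrow> irreducible_chain T n Z \<Longrightarrow> Z n \<subseteq> T closure_of S i \<Longrightarrow> n \<le> N"
  shows "I \<noteq> {} \<Longrightarrow> krull_dim T = ereal (real N)" "I = {} \<Longrightarrow> krull_dim T = - \<infinity>"
    and "(\<And>i j. i \<in> I \<Longrightarrow> j \<in> I \<Longrightarrow> i \<noteq> j \<Longrightarrow> \<not> S i \<subseteq> T closure_of S j) \<Longrightarrow> card (top_dim_components T) = card I"
proof -
  have sub: "S i \<subseteq> T closure_of S i" if "i \<in> I" for i using cover that by (intro closure_of_subset) auto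
  have in_comp: "\<exists>i\<in>I. Z \<subseteq> T closure_of S i" if Z: "irreducible_closed T Z" for Z
  proof -
    have "Z \<subseteq> topspace T" using Z by (auto simp: irreducible_closed_def dest: closedin_subset)
    then have "Z \<subseteq> (\<Union>i\<in>I. T closure_of S i)" using cover sub by blast
    then show ?thesis using irreducible_closed_Union[OF Z fin, of "\<lambda>i. T closure_of S i"] closedin_closure_of by metis
  qed
  have bound: "n \<le> N" if "irreducible_chain T n Z" for n Z
  proof -
    have "irreducible_closed T (Z n)" using that by (simp add: irreducible_chain_def)
    then show ?thesis using in_comp up that by blast
  qed
  have dimT: "krull_dim T = ereal (real N)" if "i \<in> I" for i
    using low[OF that] bound by (auto intro: krull_dim_eqI)
  then show "I \<noteq> {} \<Longrightarrow> krull_dim T = ereal (real N)" by blast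
  have empty: "krull_dim T = - \<infinity>" if "I = {}"
  proof -
    have no: "\<nexists>Z. irreducible_chain T n Z" for n using in_comp that by (auto simp: irreducible_chain_def)
    have "{ereal (real n) | n. \<exists>Z. irreducible_chain T n Z} = {}" using no by blast
    then have "krull_dim T = Sup {}" unfolding krull_dim_chain by (rule arg_cong)
    then show ?thesis by (simp add: bot_ereal_def)
  qed
  then show "I = {} \<Longrightarrow> krull_dim T = - \<infinity>" .
  assume ne: "\<And>i j. i \<in> I \<Longrightarrow> j \<in> I \<Longrightarrow> i \<noteq> j \<Longrightarrow> \<not> S i \<subseteq> T closure_of S j"
  have ne': "i = j" if "i \<in> I" "j \<in> I" "T closure_of S i \<subseteq> T closure_of S j" for i j
    using ne[OF that(1,2)] sub[OF that(1)] that(3) by blast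
  have comps: "irreducible_components T = (\<lambda>i. T closure_of S i) ` I"
  proof
    show "irreducible_components T \<subseteq> (\<lambda>i. T closure_of S i) ` I"
    proof
      fix Z assume Z: "Z \<in> irreducible_components T"
      then have "irreducible_closed T Z" by (simp add: irreducible_components_def)
      then obtain i where "i \<in> I" "Z \<subseteq> T closure_of S i" using in_comp by blast
      then have "T closure_of S i = Z" using Z irr by (auto simp: irreducible_components_def)
      then show "Z \<in> (\<lambda>i. T closure_of S i) ` I" using \<open>i \<in> I\<close> by blast
    qed
    show "(\<lambda>i. T closure_of S i) ` I \<subseteq> irreducible_components T"
    proof
      fix Z assume "Z \<in> (\<lambda>i. T closure_of S i) ` I"
      then obtain i where i: "i \<in> I" "Z = T closure_of S i" by blast
      have "Z' = Z" if Z': "irreducible_closed T Z'" "Z \<subseteq> Z'" for Z'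
      proof -
        obtain j where j: "j \<in> I" "Z' \<subseteq> T closure_of S j" using in_comp[OF Z'(1)] by blast
        then have "i = j" using ne'[OF i(1) j(1)] i(2) Z'(2) by blast
        then show ?thesis using j i Z' by blast
      qed
      then show "Z \<in> irreducible_components T" using irr[OF i(1)] i(2) by (auto simp: irreducible_components_def)
    qed
  qed
  have dimC: "krull_dim (subtopology T (T closure_of S i)) = ereal (real N)" if i: "i \<in> I" for i
  proof -
    have cl: "closedin T (T closure_of S i)" by simp
    obtain Z where "irreducible_chain T N Z" "Z N \<subseteq> T closure_of S i" using low[OF i] by blast
    then show ?thesis using up[OF i] by (intro krull_dim_eqI[of _ N Z]) (auto simp: irreducible_chain_subtopology[OF cl])
  qed
  have "top_dim_components T = (\<lambda>i. T closure_of S i) ` I"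
    unfolding top_dim_components_def comps using dimC dimT by auto
  moreover have "inj_on (\<lambda>i. T closure_of S i) I" using ne' by (auto simp: inj_on_def)
  ultimately show "card (top_dim_components T) = card I" by (simp add: card_image)
qed

section \<open>Strata of given multidegree\<close>

lemma power_int_prod: "(\<Prod>\<beta>\<in>S. x \<beta> :: 'o::field) powi k = (\<Prod>\<beta>\<in>S. x \<beta> powi k)"
  by (induction S rule: infinite_finite_induct) (auto simp: power_int_mult_distrib)

lemma power_int_sum: "x \<noteq> 0 \<Longrightarrow> (x :: 'o::field) powi (\<Sum>\<alpha>\<in>S. k \<alpha>) = (\<Prod>\<alpha>\<in>S. x powi k \<alpha>)"
  by (induction S rule: infinite_finite_induct) (auto simp: power_int_add)

context complete_fan begin

text \<open>The condition on \<open>s\<close> says that it is a point of the Neron-Severi torus, the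
  kernel of the map from the torus of all scalars to the open orbit.\<close>

lemma cox_curve_scale:
  fixes Q :: "'s \<Rightarrow> 'o::field poly"
  assumes Q: "admissible y Q" and s: "\<And>\<alpha>. s \<alpha> \<noteq> 0" "\<And>m. (\<Prod>\<alpha>\<in>UNIV. s \<alpha> powi pairing m (u \<alpha>)) = 1"
  shows "admissible y (\<lambda>\<alpha>. Polynomial.smult (s \<alpha>) (Q \<alpha>))"
    "cox_curve u y (\<lambda>\<alpha>. Polynomial.smult (s \<alpha>) (Q \<alpha>)) = cox_curve u y Q"
proof -
  have z: "cox_zeros y (\<lambda>\<alpha>. Polynomial.smult (s \<alpha>) (Q \<alpha>)) = cox_zeros y Q"
    using s(1) by (auto simp: cox_zeros_def form_value_smult)
  show "admissible y (\<lambda>\<alpha>. Polynomial.smult (s \<alpha>) (Q \<alpha>))"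
    using Q s(1) by (auto simp: admissible_def z)
  show "cox_curve u y (\<lambda>\<alpha>. Polynomial.smult (s \<alpha>) (Q \<alpha>)) = cox_curve u y Q"
    unfolding cox_curve_def z form_value_smult power_int_mult_distrib prod.distrib s(2) mult_1 ..
qed

text \<open>The torus acting on the forms of a curve can be used to normalize the leading coefficients of
  all forms except those of the rays of a full-dimensional cone.\<close>

lemma torus_normalization:
  assumes \<sigma>: "full_cone \<sigma>" and t: "\<And>\<alpha>. t \<alpha> \<noteq> (0 :: 'o::field)"
  obtains s where "\<And>\<alpha>. s \<alpha> \<noteq> 0" "\<And>m. (\<Prod>\<alpha>\<in>UNIV. s \<alpha> powi pairing m (u \<alpha>)) = 1"
    "\<And>\<alpha>. \<alpha> \<notin> R \<sigma> \<Longrightarrow> s \<alpha> * t \<alpha> = 1"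
proof -
  obtain e where e: "\<forall>m v. pairing m v = (\<Sum>\<alpha>\<in>R \<sigma>. pairing m (u \<alpha>) * pairing (e \<alpha>) v)"
    using full_cone_dual_basis[OF \<sigma>] by (elim exE conjE)
  \<comment> \<open>Scalars that differ from 1 only on the rays of \<sigma> but give every character
    the same value as \<open>t\<close>. So \<open>t' / t\<close> lies in the Neron-Severi
    torus.\<close>
  define t' where "t' \<alpha> = (if \<alpha> \<in> R \<sigma> then \<Prod>\<beta>\<in>UNIV. t \<beta> powi pairing (e \<alpha>) (u \<beta>) else 1)" for \<alpha>
  have t'0: "t' \<alpha> \<noteq> 0" for \<alpha> using t by (auto simp: t'_def power_int_eq_0_iff)
  have eq: "(\<Prod>\<alpha>\<in>UNIV. t' \<alpha> powi pairing m (u \<alpha>)) = (\<Prod>\<beta>\<in>UNIV. t \<beta> powi pairing m (u \<beta>))" for m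
  proof -
    have "(\<Prod>\<alpha>\<in>UNIV. t' \<alpha> powi pairing m (u \<alpha>)) = (\<Prod>\<alpha>\<in>R \<sigma>. (\<Prod>\<beta>\<in>UNIV. t \<beta> powi pairing (e \<alpha>) (u \<beta>)) powi pairing m (u \<alpha>))"
      by (rule prod.mono_neutral_cong_right) (auto simp: t'_def)
    also have "\<dots> = (\<Prod>\<alpha>\<in>R \<sigma>. \<Prod>\<beta>\<in>UNIV. t \<beta> powi (pairing m (u \<alpha>) * pairing (e \<alpha>) (u \<beta>)))"
      by (simp add: power_int_prod mult.commute flip: power_int_mult)
    also have "\<dots> = (\<Prod>\<beta>\<in>UNIV. \<Prod>\<alpha>\<in>R \<sigma>. t \<beta> powi (pairing m (u \<alpha>) * pairing (e \<alpha>) (u \<beta>)))" by (rule prod.swap)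
    also have "\<dots> = (\<Prod>\<beta>\<in>UNIV. t \<beta> powi pairing m (u \<beta>))"
      by (intro prod.cong refl) (simp only: power_int_sum[OF t, symmetric] e[rule_format, symmetric])
    finally show ?thesis .
  qed
  have "(\<Prod>\<alpha>\<in>UNIV. (t' \<alpha> / t \<alpha>) powi pairing m (u \<alpha>)) = 1" for m
    using eq[of m] t by (simp add: power_int_divide_distrib prod_dividef power_int_eq_0_iff)
  then show ?thesis using that[of "\<lambda>\<alpha>. t' \<alpha> / t \<alpha>"] t t'0 by (auto simp: t'_def)
qed

end

definition normal_base :: "'s coord \<Rightarrow> 'o::field" where
  "normal_base c = (case c of Const _ _ \<Rightarrow> 0 | _ \<Rightarrow> 1)"

text \<open>The parameters that stay free in normal form: the scalars on \<open>A\<close>, later the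
  \<open>r\<close> rays of a full cone, and the constant terms of all factors, which are monic. The
  remaining ones are fixed by \<open>normal_base\<close>.\<close>

definition normal_coords :: "('s \<Rightarrow> nat) \<Rightarrow> 's set \<Rightarrow> 's coord set" where
  "normal_coords y A = Scalar ` A \<union> (\<lambda>(\<alpha>, i). Const \<alpha> i) ` (SIGMA \<alpha>:UNIV. {..<y \<alpha>})"

lemma normal_coords_card:
  fixes y :: "'s::finite \<Rightarrow> nat"
  shows "finite (normal_coords y A)" "card (normal_coords y A) = card A + (\<Sum>\<alpha>\<in>UNIV. y \<alpha>)"
proof -
  let ?I = "SIGMA \<alpha>:UNIV. {..<y \<alpha>}"
  show "finite (normal_coords y A)" by (auto simp: normal_coords_def)
  have "card (normal_coords y A) = card (Scalar ` A) + card ((\<lambda>(\<alpha>, i). Const \<alpha> i) ` ?I)"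
    unfolding normal_coords_def by (rule card_Un_disjoint) auto
  also have "card (Scalar ` A) = card A" by (rule card_image) (auto simp: inj_on_def)
  also have "card ((\<lambda>(\<alpha>, i). Const \<alpha> i) ` ?I) = card ?I" by (rule card_image) (auto simp: inj_on_def)
  also have "card ?I = (\<Sum>\<alpha>\<in>UNIV. y \<alpha>)" by simp
  finally show "card (normal_coords y A) = card A + (\<Sum>\<alpha>\<in>UNIV. y \<alpha>)" .
qed

context projective_fan begin

text \<open>The curves whose parameters outside \<open>C\<close> are frozen at \<open>b\<close>.
  With \<open>C = UNIV\<close> this is a whole stratum; growing sets \<open>C\<close> give the
  members of a chain.\<close>

definition piece :: "('s \<Rightarrow> nat) \<Rightarrow> 's coord set \<Rightarrow> ('s coord \<Rightarrow> 'o::field) \<Rightarrow> ('o option \<Rightarrow> ('r, 'o) toric_point) set" where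
  "piece y C b = {cox_curve u y (split_form y x) | x. x \<in> params y \<and> (\<forall>c. c \<notin> C \<longrightarrow> x c = b c)}"

lemma coeffs_line_poly_split_form: "coeffs_line_poly (\<lambda>x :: 's coord \<Rightarrow> 'o::field. split_form y x \<alpha>)"
proof -
  have "coeffs_line_poly (\<lambda>x :: 's coord \<Rightarrow> 'o. linear_factor x \<alpha> i)" for i
    unfolding coeffs_line_poly_def linear_factor_def
  proof
    fix j
    have c: "cf [:p, q:] j = (if j = 0 then p else if j = 1 then q else 0)" for p q :: 'o
      by (auto simp: coeff_pCons split: nat.splits)
    show "line_poly (\<lambda>x. cf [:x (Const \<alpha> i) :: 'o, x (Lead \<alpha> i):] j)"
      unfolding c by (cases "j = 0"; cases "j = 1") (auto simp: line_poly_coord line_poly_const)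
  qed
  then have "coeffs_line_poly (\<lambda>x :: 's coord \<Rightarrow> 'o. \<Prod>i<y \<alpha>. linear_factor x \<alpha> i)" by (intro coeffs_line_poly_prod) simp
  then show ?thesis unfolding coeffs_line_poly_def split_form_def
    by (auto intro!: line_poly_mult line_poly_coord)
qed

lemma hfun_coord_line_poly:
  assumes "hfun F n \<phi>"
  shows "line_poly (\<lambda>x. \<phi> (coord_vector (split_form y x)))"
proof (rule hfun_line_poly[OF assms])
  fix v :: "(int ^ 'r) \<times> nat"
  obtain m j where v: "v = (m, j)" by fastforce
  have "coeffs_line_poly (\<lambda>x. coords (split_form y x) m)"
    unfolding coords_def monomial_form_def
    by (cases "m \<in> sections") (auto intro!: coeffs_line_poly_prod coeffs_line_poly_power coeffs_line_poly_split_form coeffs_line_poly_const)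
  then show "line_poly (\<lambda>x. coord_vector (split_form y x) v)" 
    unfolding coeffs_line_poly_def v coord_vector_def split_conv by (rule spec)
qed

lemma openin_curve_spaceE:
  fixes Q :: "'s \<Rightarrow> 'o::alg_closed_field poly"
  assumes F: "is_subring F" and A: "openin (curve_space F \<Sigma> u h d) A" and Q: "admissible y Q" "(\<Sum>\<alpha>\<in>UNIV. y \<alpha>) = d"
    and mem: "cox_curve u y Q \<in> A"
  obtains n \<phi> where "hfun F n \<phi>" "\<phi> (coord_vector Q) \<noteq> 0"
    "\<And>Q'. admissible y Q' \<Longrightarrow> \<phi> (coord_vector Q') \<noteq> 0 \<Longrightarrow> cox_curve u y Q' \<in> A"
proof -
  have "\<exists>e n \<phi>. hfun F n \<phi> \<and> cox_curve u y Q \<in> principal_open d e \<phi> \<and> principal_open d e \<phi> \<subseteq> A"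
    using A mem unfolding openin_curve_space[OF F] by blast
  then obtain e n \<phi> where \<phi>: "hfun F n \<phi>" "cox_curve u y Q \<in> principal_open d e \<phi>" "principal_open d e \<phi> \<subseteq> A"
    by (elim exE conjE)
  have e: "e = embedded_degree y" "\<phi> (coord_vector Q) \<noteq> 0"
    using \<phi>(2) principal_open_iff[OF Q \<phi>(1)] by auto
  show ?thesis
    by (rule that[OF \<phi>(1) e(2)]) (use principal_open_iff[OF _ Q(2) \<phi>(1)] \<phi>(3) e(1) in blast)
qed

lemma openin_principal_open:
  assumes F: "is_subring F" and \<phi>: "hfun F n (\<phi> :: ((int ^ 'r) \<times> nat \<Rightarrow> 'o::alg_closed_field) \<Rightarrow> 'o)"
  shows "openin (curve_space F \<Sigma> u h d) (principal_open d e \<phi>)"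
  unfolding openin_curve_space[OF F] using \<phi> by (auto simp: principal_open_def)

text \<open>The nonvanishing of \<open>p\<close> is an open condition around the curve. It is
  confined to one embedded degree, so the vanishing of \<open>p\<close> on \<open>S\<close> matters
  only for curves of that degree.\<close>

lemma not_in_closure:
  fixes Q' :: "'s \<Rightarrow> 'o::alg_closed_field poly"
  assumes F: "is_subring F" and p: "hfun F n p"
    and Q': "admissible y' Q'" "(\<Sum>\<alpha>\<in>UNIV. y' \<alpha>) = d" "p (coord_vector Q') \<noteq> 0"
    and S: "\<And>f. f \<in> S \<Longrightarrow> \<exists>y Q. admissible y Q \<and> (\<Sum>\<alpha>\<in>UNIV. y \<alpha>) = d \<and> f = cox_curve u y Q \<and>
        (embedded_degree y = embedded_degree y' \<longrightarrow> p (coord_vector Q) = 0)"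
  shows "cox_curve u y' Q' \<notin> curve_space F \<Sigma> u h d closure_of S"
proof
  let ?A = "principal_open d (embedded_degree y') p"
  assume "cox_curve u y' Q' \<in> curve_space F \<Sigma> u h d closure_of S"
  moreover have "cox_curve u y' Q' \<in> ?A" using principal_open_iff[OF Q'(1,2) p] Q'(3) by blast
  ultimately obtain f where f: "f \<in> S" "f \<in> ?A" using openin_principal_open[OF F p] unfolding in_closure_of by blast
  then obtain y Q where Q: "admissible y Q" "(\<Sum>\<alpha>\<in>UNIV. y \<alpha>) = d" "f = cox_curve u y Q"
    "embedded_degree y = embedded_degree y' \<longrightarrow> p (coord_vector Q) = 0" using S by blast
  then show False using principal_open_iff[OF Q(1,2) p] f(2) by auto
qed

lemma piece_subset:
  "(\<Sum>\<alpha>\<in>UNIV. y \<alpha>) = d \<Longrightarrow> piece y C b \<subseteq> (rational_curves \<Sigma> u d :: ('o::alg_closed_field option \<Rightarrow> ('r, 'o) toric_point) set)"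
  by (auto simp: piece_def params_def intro: cox_curve_rational)

lemma piece_irreducible:
  fixes b :: "'s coord \<Rightarrow> 'o::alg_closed_field"
  assumes F: "is_subring F" and d: "(\<Sum>\<alpha>\<in>UNIV. y \<alpha>) = d" and ne: "piece y C b \<noteq> {}"
  shows "irreducible_closed (curve_space F \<Sigma> u h d) (curve_space F \<Sigma> u h d closure_of (piece y C b))"
proof (rule irreducible_closureI)
  let ?T = "curve_space F \<Sigma> u h d"
  show "piece y C b \<subseteq> topspace ?T" unfolding topspace_curve_space[OF F] by (rule piece_subset[OF d])
  show "piece y C b \<noteq> {}" by (rule ne)
  fix A B assume A: "openin ?T A" "A \<inter> piece y C b \<noteq> {}" and B: "openin ?T B" "B \<inter> piece y C b \<noteq> {}"
  obtain x1 where x1: "x1 \<in> params y" "\<And>c. c \<notin> C \<Longrightarrow> x1 c = b c" "cox_curve u y (split_form y x1) \<in> A"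
    using A(2) by (auto simp: piece_def)
  obtain x2 where x2: "x2 \<in> params y" "\<And>c. c \<notin> C \<Longrightarrow> x2 c = b c" "cox_curve u y (split_form y x2) \<in> B"
    using B(2) by (auto simp: piece_def)
  have ad: "admissible y (split_form y x1)" "admissible y (split_form y x2)" using x1 x2 by (auto simp: params_def)
  obtain n1 \<phi>1 where 1: "hfun F n1 \<phi>1" "\<phi>1 (coord_vector (split_form y x1)) \<noteq> 0"
    "\<And>Q'. admissible y Q' \<Longrightarrow> \<phi>1 (coord_vector Q') \<noteq> 0 \<Longrightarrow> cox_curve u y Q' \<in> A"
    using openin_curve_spaceE[OF F A(1) ad(1) d x1(3)] by blast
  obtain n2 \<phi>2 where 2: "hfun F n2 \<phi>2" "\<phi>2 (coord_vector (split_form y x2)) \<noteq> 0"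
    "\<And>Q'. admissible y Q' \<Longrightarrow> \<phi>2 (coord_vector Q') \<noteq> 0 \<Longrightarrow> cox_curve u y Q' \<in> B"
    using openin_curve_spaceE[OF F B(1) ad(2) d x2(3)] by blast
  obtain \<epsilon> where e: "line x1 x2 \<epsilon> \<in> params y" "\<phi>1 (coord_vector (split_form y (line x1 x2 \<epsilon>))) \<noteq> 0"
    "\<phi>2 (coord_vector (split_form y (line x1 x2 \<epsilon>))) \<noteq> 0"
    using params_meet[OF x1(1) hfun_coord_line_poly[OF 1(1), of y] hfun_coord_line_poly[OF 2(1), of y] 1(2) 2(2)] by blast
  have "line x1 x2 \<epsilon> c = b c" if "c \<notin> C" for c using x1(2)[OF that] x2(2)[OF that] by (simp add: line_def)
  then have "cox_curve u y (split_form y (line x1 x2 \<epsilon>)) \<in> piece y C b" using e(1) by (auto simp: piece_def)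
  moreover have "admissible y (split_form y (line x1 x2 \<epsilon>))" using e(1) by (simp add: params_def)
  ultimately show "A \<inter> B \<inter> piece y C b \<noteq> {}" using 1(3) 2(3) e(2,3) by blast
qed

text \<open>Each neighbourhood of a curve contains one whose leading coefficients are all nonzero,
  found on the line towards \<open>x0\<close>. There every factor can be made monic, and the torus
  normalizes the scalars off the rays of \<sigma> without changing the curve.\<close>

lemma normal_piece_dense:
  fixes x0 b :: "'s coord \<Rightarrow> 'o::alg_closed_field"
  assumes F: "is_subring F" and d: "(\<Sum>\<alpha>\<in>UNIV. y \<alpha>) = d"
    and \<sigma>: "full_cone \<sigma>" and x0: "x0 \<in> params y" "\<And>\<alpha> i. i < y \<alpha> \<Longrightarrow> x0 (Lead \<alpha> i) = 1"
  shows "piece y UNIV b \<subseteq> curve_space F \<Sigma> u h d closure_of (piece y (normal_coords y (R \<sigma>)) normal_base)"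
proof
  let ?T = "curve_space F \<Sigma> u h d"
  fix f :: "'o option \<Rightarrow> ('r, 'o) toric_point" assume f: "f \<in> piece y UNIV b"
  then obtain x where x: "x \<in> params y" "f = cox_curve u y (split_form y x)" by (auto simp: piece_def)
  have ad: "admissible y (split_form y x)" using x by (simp add: params_def)
  show "f \<in> ?T closure_of (piece y (normal_coords y (R \<sigma>)) normal_base)"
    unfolding in_closure_of
  proof (intro conjI allI impI)
    show "f \<in> topspace ?T" unfolding topspace_curve_space[OF F] using piece_subset[OF d] f by blast
    fix A assume A: "f \<in> A \<and> openin ?T A"
    obtain n \<phi> where \<phi>: "hfun F n \<phi>" "\<phi> (coord_vector (split_form y x)) \<noteq> 0"
      "\<And>Q'. admissible y Q' \<Longrightarrow> \<phi> (coord_vector Q') \<noteq> 0 \<Longrightarrow> cox_curve u y Q' \<in> A"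
      using openin_curve_spaceE[OF F _ ad d, of A] A x(2) by blast
    define \<psi> where "\<psi> x = (\<Prod>\<alpha>\<in>UNIV. \<Prod>i<y \<alpha>. x (Lead \<alpha> i))" for x :: "'s coord \<Rightarrow> 'o"
    have "line_poly \<psi>" unfolding \<psi>_def by (intro line_poly_prod line_poly_coord)
    moreover have "\<psi> x0 \<noteq> 0" using x0(2) by (simp add: \<psi>_def)
    ultimately obtain \<epsilon> where e: "line x x0 \<epsilon> \<in> params y" "\<phi> (coord_vector (split_form y (line x x0 \<epsilon>))) \<noteq> 0" "\<psi> (line x x0 \<epsilon>) \<noteq> 0"
      using params_meet[OF x(1) hfun_coord_line_poly[OF \<phi>(1), of y] _ \<phi>(2)] by blast
    define z where "z = line x x0 \<epsilon>"
    have adz: "admissible y (split_form y z)" using e(1) by (simp add: z_def params_def)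
    have zL: "z (Lead \<alpha> i) \<noteq> 0" if "i < y \<alpha>" for \<alpha> i using e(3) that by (auto simp: \<psi>_def z_def)
    define t where "t \<alpha> = z (Scalar \<alpha>) * (\<Prod>i<y \<alpha>. z (Lead \<alpha> i))" for \<alpha>
    have t0: "t \<alpha> \<noteq> 0" for \<alpha>
      using admissibleD(1)[OF adz, of \<alpha>] zL by (auto simp: t_def split_form_nonzero_iff)
    obtain s where s: "\<And>\<alpha>. s \<alpha> \<noteq> 0" "\<And>m. (\<Prod>\<alpha>\<in>UNIV. s \<alpha> powi pairing m (u \<alpha>)) = 1"
      "\<And>\<alpha>. \<alpha> \<notin> R \<sigma> \<Longrightarrow> s \<alpha> * t \<alpha> = 1" using torus_normalization[OF \<sigma>, of t] t0 by blast
    \<comment> \<open>The leading coefficients are moved into the scalar \<open>t\<close>. Constant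
      terms with index beyond \<open>y \<alpha>\<close> belong to no factor and take the value of
      \<open>normal_base\<close>.\<close>
    define w where "w c = (case c of Scalar \<alpha> \<Rightarrow> s \<alpha> * t \<alpha> | Lead \<alpha> i \<Rightarrow> 1
       | Const \<alpha> i \<Rightarrow> if i < y \<alpha> then z (Const \<alpha> i) / z (Lead \<alpha> i) else 0)" for c
    have sw: "split_form y w \<alpha> = Polynomial.smult (s \<alpha>) (split_form y z \<alpha>)" for \<alpha>
    proof -
      have "(\<Prod>i<y \<alpha>. linear_factor z \<alpha> i) = (\<Prod>i<y \<alpha>. Polynomial.smult (z (Lead \<alpha> i)) (linear_factor w \<alpha> i))"
        using zL by (intro prod.cong) (auto simp: linear_factor_def w_def)
      also have "\<dots> = Polynomial.smult (\<Prod>i<y \<alpha>. z (Lead \<alpha> i)) (\<Prod>i<y \<alpha>. linear_factor w \<alpha> i)"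
        by (rule prod_smult)
      finally show ?thesis by (simp add: split_form_def w_def t_def mult.assoc)
    qed
    have sw': "split_form y w = (\<lambda>\<alpha>. Polynomial.smult (s \<alpha>) (split_form y z \<alpha>))" using sw by blast
    have "w \<in> params y" using cox_curve_scale(1)[OF adz s(1,2)] by (simp add: params_def sw')
    moreover have "w c = normal_base c" if "c \<notin> normal_coords y (R \<sigma>)" for c
      using that s(3) by (cases c) (auto simp: w_def normal_base_def normal_coords_def image_iff)
    ultimately have "cox_curve u y (split_form y w) \<in> piece y (normal_coords y (R \<sigma>)) normal_base" by (auto simp: piece_def)
    moreover have "cox_curve u y (split_form y w) = cox_curve u y (split_form y z)"
      unfolding sw' by (rule cox_curve_scale(2)[OF adz s(1,2)])
    moreover have "cox_curve u y (split_form y z) \<in> A" using \<phi>(3)[OF adz] e(2) by (simp add: z_def)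
    ultimately show "\<exists>g. g \<in> piece y (normal_coords y (R \<sigma>)) normal_base \<and> g \<in> A" by auto
  qed
qed

end

section \<open>Algebraic independence along a chain\<close>

text \<open>The base field enters through an embedding, so that linear systems can be solved with
  coefficients in its own type before they are mapped to the closed field.\<close>

definition is_field_hom :: "('a::field \<Rightarrow> 'o::field) \<Rightarrow> bool" where
  "is_field_hom \<iota> \<longleftrightarrow> \<iota> 1 = 1 \<and> (\<forall>x y. \<iota> (x + y) = \<iota> x + \<iota> y) \<and> (\<forall>x y. \<iota> (x * y) = \<iota> x * \<iota> y)"

lemma is_field_homD:
  assumes "is_field_hom \<iota>"
  shows "\<iota> 0 = 0" "\<iota> 1 = 1" "\<iota> (x + y) = \<iota> x + \<iota> y" "\<iota> (x * y) = \<iota> x * \<iota> y" "\<iota> (- x) = - \<iota> x"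
    "\<iota> (x - y) = \<iota> x - \<iota> y" "\<iota> x = 0 \<longleftrightarrow> x = 0"
proof -
  have h: "\<iota> 1 = 1" "\<iota> (x + y) = \<iota> x + \<iota> y" "\<iota> (x * y) = \<iota> x * \<iota> y" for x y
    using assms by (auto simp: is_field_hom_def)
  then show "\<iota> 1 = 1" "\<iota> (x + y) = \<iota> x + \<iota> y" "\<iota> (x * y) = \<iota> x * \<iota> y" by auto
  show z: "\<iota> 0 = 0" using h(2)[of 0 0] add_left_cancel[of "\<iota> 0" "\<iota> 0" 0] by (metis add.right_neutral)
  show n: "\<iota> (- x) = - \<iota> x" for x using h(2)[of x "- x"] z by (simp add: eq_neg_iff_add_eq_0 add.commute)
  show "\<iota> (x - y) = \<iota> x - \<iota> y" using h(2)[of x "- y"] n by simp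
  show "\<iota> x = 0 \<longleftrightarrow> x = 0"
  proof
    assume "\<iota> x = 0"
    then show "x = 0" using h(3)[of x "inverse x"] h(1) by (cases "x = 0") auto
  qed (simp add: z)
qed

lemma is_subring_range:
  assumes "is_field_hom \<iota>"
  shows "is_subring (range \<iota>)"
proof -
  have "\<iota> x - \<iota> y \<in> range \<iota>" "\<iota> x * \<iota> y \<in> range \<iota>" for x y
    unfolding is_field_homD(4,6)[OF assms, symmetric] by auto
  moreover have "0 \<in> range \<iota>" "1 \<in> range \<iota>"
    using is_field_homD(1,2)[OF assms] by (metis rangeI)+
  ultimately show ?thesis by (auto simp: is_subring_def)
qed

lemma field_hom_sum: "is_field_hom \<iota> \<Longrightarrow> \<iota> (\<Sum>i\<in>S. f i) = (\<Sum>i\<in>S. \<iota> (f i))"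
  by (induction S rule: infinite_finite_induct) (auto simp: is_field_homD)

text \<open>The bound \<open>k\<close> applies to each exponent separately, so the monomials form a
  box of \<open>(k + 1) ^ card V\<close> elements, which is easy to count.\<close>

inductive polyfun_upto :: "('a::field \<Rightarrow> 'o::field) \<Rightarrow> 'c set \<Rightarrow> nat \<Rightarrow> (('c \<Rightarrow> 'o) \<Rightarrow> 'o) \<Rightarrow> bool" for \<iota> V where
  polyfun_upto_mono: "(\<And>v. v \<in> V \<Longrightarrow> e v \<le> k) \<Longrightarrow> polyfun_upto \<iota> V k (\<lambda>x. \<iota> c * (\<Prod>v\<in>V. x v ^ e v))"
| polyfun_upto_add: "polyfun_upto \<iota> V k \<phi> \<Longrightarrow> polyfun_upto \<iota> V k \<psi> \<Longrightarrow> polyfun_upto \<iota> V k (\<lambda>x. \<phi> x + \<psi> x)"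

lemma polyfun_upto_weaken: "polyfun_upto \<iota> V k \<phi> \<Longrightarrow> k \<le> l \<Longrightarrow> polyfun_upto \<iota> V l \<phi>"
  by (induction rule: polyfun_upto.induct) (auto intro!: polyfun_upto.intros intro: order_trans)

lemma polyfun_upto_const: "polyfun_upto \<iota> V 0 (\<lambda>x. \<iota> c)"
  using polyfun_upto_mono[of V "\<lambda>_. 0" 0 \<iota> c] by simp

lemma polyfun_upto_var:
  assumes "is_field_hom \<iota>" "finite V" "v \<in> V"
  shows "polyfun_upto \<iota> V 1 (\<lambda>x. x v)"
proof -
  have "(\<Prod>w\<in>V. x w ^ (if w = v then 1 else 0)) = (\<Prod>w\<in>V. if w = v then x w else 1)" for x :: "'c \<Rightarrow> 'b"
    by (intro prod.cong) auto
  then have "(\<Prod>w\<in>V. x w ^ (if w = v then 1 else 0)) = x v" for x :: "'c \<Rightarrow> 'b" using assms by simp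
  then show ?thesis using polyfun_upto_mono[of V "\<lambda>w. if w = v then 1 else 0" 1 \<iota> 1] is_field_homD(2)[OF assms(1)] by simp
qed

lemma polyfun_upto_mult:
  assumes \<iota>: "is_field_hom \<iota>" and "polyfun_upto \<iota> V k \<phi>" "polyfun_upto \<iota> V l \<psi>"
  shows "polyfun_upto \<iota> V (k + l) (\<lambda>x. \<phi> x * \<psi> x)"
  using assms(2)
proof induction
  case (polyfun_upto_mono e k c)
  show ?case using assms(3)
  proof induction
    case (polyfun_upto_mono e' l c')
    have "polyfun_upto \<iota> V (k + l) (\<lambda>x. \<iota> (c * c') * (\<Prod>v\<in>V. x v ^ (e v + e' v)))"
      using polyfun_upto_mono \<open>\<And>v. v \<in> V \<Longrightarrow> e v \<le> k\<close> by (intro polyfun_upto.polyfun_upto_mono add_mono) auto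
    then show ?case by (simp add: is_field_homD(4)[OF \<iota>] power_add prod.distrib ac_simps)
  next
    case (polyfun_upto_add l \<phi> \<psi>)
    then show ?case by (simp add: distrib_left polyfun_upto.polyfun_upto_add)
  qed
next
  case (polyfun_upto_add k \<phi> \<phi>')
  then show ?case by (simp add: distrib_right polyfun_upto.polyfun_upto_add)
qed

lemma polyfun_upto_power:
  assumes \<iota>: "is_field_hom \<iota>" and "polyfun_upto \<iota> V k \<phi>"
  shows "polyfun_upto \<iota> V (n * k) (\<lambda>x. \<phi> x ^ n)"
proof (induction n)
  case 0 then show ?case using polyfun_upto_const[of \<iota> V 1] is_field_homD(2)[OF \<iota>] by simp
next
  case (Suc n) then show ?case using polyfun_upto_mult[OF \<iota> assms(2)] by simp
qed

lemma polyfun_upto_prod: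
  assumes \<iota>: "is_field_hom \<iota>" and "finite S" "\<And>i. i \<in> S \<Longrightarrow> polyfun_upto \<iota> V (k i) (\<phi> i)"
  shows "polyfun_upto \<iota> V (\<Sum>i\<in>S. k i) (\<lambda>x. \<Prod>i\<in>S. \<phi> i x)"
  using assms(2,3)
proof (induction S)
  case empty then show ?case using polyfun_upto_const[of \<iota> V 1] is_field_homD(2)[OF \<iota>] by simp
next
  case (insert i S) then show ?case by (auto intro: polyfun_upto_mult[OF \<iota>])
qed

lemma polyfun_upto_representation:
  assumes \<iota>: "is_field_hom \<iota>" and V: "finite V" and "polyfun_upto \<iota> V k \<phi>"
  shows "\<exists>c. \<forall>x. \<phi> x = (\<Sum>e\<in>PiE V (\<lambda>_. {..k}). \<iota> (c e) * (\<Prod>v\<in>V. x v ^ e v))"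
  using assms(3)
proof induction
  case (polyfun_upto_mono e k c)
  define e' where "e' = restrict e V"
  have e': "e' \<in> PiE V (\<lambda>_. {..k})" using polyfun_upto_mono by (auto simp: e'_def)
  have "(\<Sum>f\<in>PiE V (\<lambda>_. {..k}). \<iota> (if f = e' then c else 0) * (\<Prod>v\<in>V. x v ^ f v)) = \<iota> c * (\<Prod>v\<in>V. x v ^ e v)" for x
  proof -
    have "(\<Sum>f\<in>PiE V (\<lambda>_. {..k}). \<iota> (if f = e' then c else 0) * (\<Prod>v\<in>V. x v ^ f v)) =
        (\<Sum>f\<in>PiE V (\<lambda>_. {..k}). if f = e' then \<iota> c * (\<Prod>v\<in>V. x v ^ f v) else 0)"
      by (intro sum.cong) (auto simp: is_field_homD(1)[OF \<iota>])
    also have "\<dots> = \<iota> c * (\<Prod>v\<in>V. x v ^ e' v)" using e' V by (simp add: finite_PiE)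
    also have "(\<Prod>v\<in>V. x v ^ e' v) = (\<Prod>v\<in>V. x v ^ e v)" by (intro prod.cong) (auto simp: e'_def)
    finally show ?thesis .
  qed
  then show ?case by (intro exI[of _ "\<lambda>f. if f = e' then c else 0"]) simp
next
  case (polyfun_upto_add k \<phi> \<psi>)
  then obtain c d where "\<forall>x. \<phi> x = (\<Sum>e\<in>PiE V (\<lambda>_. {..k}). \<iota> (c e) * (\<Prod>v\<in>V. x v ^ e v))"
    "\<forall>x. \<psi> x = (\<Sum>e\<in>PiE V (\<lambda>_. {..k}). \<iota> (d e) * (\<Prod>v\<in>V. x v ^ e v))" by blast
  then show ?case
    by (intro exI[of _ "\<lambda>e. c e + d e"]) (simp add: is_field_homD(3)[OF \<iota>] distrib_right sum.distrib)
qed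

text \<open>The left base is at most \<open>(n * q + 1) * (K + 1)\<close>. With
  \<open>K = (n * q + 1) ^ N\<close> the power on the left is at most
  \<open>K * (K + 1) ^ N\<close>, which is less than \<open>(K + 1) ^ Suc N\<close>.\<close>

lemma large_power_inequality:
  fixes n N q :: nat
  assumes "N < n"
  shows "\<exists>K. (n * K * q + 1) ^ N < (K + 1) ^ n"
proof -
  define K where "K = (n * q + 1) ^ N"
  have "n * K * q + 1 \<le> (n * q + 1) * (K + 1)" by (simp add: algebra_simps)
  then have "(n * K * q + 1) ^ N \<le> ((n * q + 1) * (K + 1)) ^ N" by (rule power_mono) simp
  also have "\<dots> = K * (K + 1) ^ N" by (simp only: power_mult_distrib K_def[symmetric])
  also have "\<dots> < (K + 1) * (K + 1) ^ N" by simp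
  also have "\<dots> = (K + 1) ^ Suc N" by simp
  also have "\<dots> \<le> (K + 1) ^ n" using assms by (intro power_increasing) auto
  finally show ?thesis by blast
qed

text \<open>There are \<open>(K + 1) ^ n\<close> products of the functions with exponents up to
  \<open>K\<close>, each padded by a power of \<open>f 0\<close> to the same number
  \<open>n * K\<close> of factors, but only \<open>(n * K * q + 1) ^ card V\<close> monomials in
  which to expand them. For large \<open>K\<close> the coefficient equations are underdetermined,
  with a nonzero solution in the base field.\<close>

lemma algebraic_dependence:
  fixes \<iota> :: "'a::field \<Rightarrow> 'o::field" and f :: "nat \<Rightarrow> ('c \<Rightarrow> 'o) \<Rightarrow> 'o"
  assumes \<iota>: "is_field_hom \<iota>" and V: "finite V" "card V < n"
    and f: "\<And>i. i \<le> n \<Longrightarrow> polyfun_upto \<iota> V q (f i)"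
  shows "\<exists>K c. (\<exists>a\<in>PiE {1..n} (\<lambda>_. {..K}). c a \<noteq> 0) \<and>
    (\<forall>x. (\<Sum>a\<in>PiE {1..n} (\<lambda>_. {..K}). \<iota> (c a) * (f 0 x ^ (n * K - (\<Sum>i\<in>{1..n}. a i)) * (\<Prod>i\<in>{1..n}. f i x ^ a i))) = 0)"
proof -
  obtain K where K: "(n * K * q + 1) ^ card V < (K + 1) ^ n" using large_power_inequality[OF V(2)] by blast
  define A where "A = PiE {1..n} (\<lambda>_. {..K})"
  define M where "M = PiE V (\<lambda>_. {..n * K * q})"
  have A: "finite A" "card A = (K + 1) ^ n" by (simp_all add: A_def finite_PiE card_PiE)
  have M: "finite M" "card M = (n * K * q + 1) ^ card V" using V by (simp_all add: M_def finite_PiE card_PiE)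
  define g where "g a x = f 0 x ^ (n * K - (\<Sum>i\<in>{1..n}. a i)) * (\<Prod>i\<in>{1..n}. f i x ^ a i)" for a x
  have "\<exists>c. \<forall>x. g a x = (\<Sum>e\<in>M. \<iota> (c e) * (\<Prod>v\<in>V. x v ^ e v))" if a: "a \<in> A" for a
  proof -
    have "(\<Sum>i\<in>{1..n}. a i) \<le> (\<Sum>i\<in>{1..n}. K)" using a by (intro sum_mono) (auto simp: A_def PiE_def Pi_def)
    then have s: "(\<Sum>i\<in>{1..n}. a i) \<le> n * K" by simp
    have "polyfun_upto \<iota> V ((n * K - (\<Sum>i\<in>{1..n}. a i)) * q + (\<Sum>i\<in>{1..n}. a i * q)) (g a)"
      unfolding g_def using f by (intro polyfun_upto_mult[OF \<iota>] polyfun_upto_prod[OF \<iota>] polyfun_upto_power[OF \<iota>]) auto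
    moreover have "(n * K - (\<Sum>i\<in>{1..n}. a i)) * q + (\<Sum>i\<in>{1..n}. a i * q) = n * K * q"
      using s by (simp flip: sum_distrib_right distrib_right)
    ultimately have "polyfun_upto \<iota> V (n * K * q) (g a)" by simp
    then show ?thesis unfolding M_def by (rule polyfun_upto_representation[OF \<iota> V(1)])
  qed
  then have "\<forall>a\<in>A. \<exists>c. \<forall>x. g a x = (\<Sum>e\<in>M. \<iota> (c e) * (\<Prod>v\<in>V. x v ^ e v))" by blast
  from bchoice[OF this] obtain C where C: "\<And>a x. a \<in> A \<Longrightarrow> g a x = (\<Sum>e\<in>M. \<iota> (C a e) * (\<Prod>v\<in>V. x v ^ e v))"
    by blast
  obtain c where c: "\<exists>a\<in>A. c a \<noteq> 0" "\<forall>e\<in>M. (\<Sum>a\<in>A. C a e * c a) = 0"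
    using underdetermined_system[OF M(1) A(1), of "\<lambda>e a. C a e"] K A(2) M(2) by auto
  have "(\<Sum>a\<in>A. \<iota> (c a) * g a x) = 0" for x
  proof -
    have "(\<Sum>a\<in>A. \<iota> (c a) * g a x) = (\<Sum>a\<in>A. \<Sum>e\<in>M. \<iota> (C a e * c a) * (\<Prod>v\<in>V. x v ^ e v))"
      by (intro sum.cong refl) (simp add: C sum_distrib_left is_field_homD(4)[OF \<iota>] ac_simps)
    also have "\<dots> = (\<Sum>e\<in>M. \<Sum>a\<in>A. \<iota> (C a e * c a) * (\<Prod>v\<in>V. x v ^ e v))" by (rule sum.swap)
    also have "\<dots> = (\<Sum>e\<in>M. \<iota> (\<Sum>a\<in>A. C a e * c a) * (\<Prod>v\<in>V. x v ^ e v))"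
      by (simp add: field_hom_sum[OF \<iota>] sum_distrib_right)
    also have "\<dots> = 0" using c(2) by (simp add: is_field_homD(1)[OF \<iota>])
    finally show ?thesis .
  qed
  then show ?thesis using c(1) unfolding A_def g_def by (intro exI[of _ K] exI[of _ c] conjI allI)
qed

text \<open>Functions cutting out the members of a chain of irreducible sets are algebraically
  independent: divide a relation by the highest possible power of the last function and restrict
  it to the previous member of the chain. The function \<open>f 0\<close> homogenizes the relation.\<close>

lemma algebraic_independence:
  fixes Z :: "nat \<Rightarrow> 'x set" and f :: "nat \<Rightarrow> 'x \<Rightarrow> 'o::field" and \<iota> :: "'a::field \<Rightarrow> 'o"
    and hm :: "nat \<Rightarrow> ('x \<Rightarrow> 'o) \<Rightarrow> bool"
  assumes \<iota>: "is_field_hom \<iota>"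
    and hm: "\<And>k c. hm 0 (\<lambda>_. \<iota> c)" "\<And>k g g'. hm k g \<Longrightarrow> hm k g' \<Longrightarrow> hm k (\<lambda>x. g x + g' x)"
      "\<And>k l g g'. hm k g \<Longrightarrow> hm l g' \<Longrightarrow> hm (k + l) (\<lambda>x. g x * g' x)" "\<And>k. hm k (\<lambda>_. 0)"
    and f: "\<And>i. i \<le> n \<Longrightarrow> hm \<delta> (f i)"
    and irr: "\<And>i k l g g'. i \<le> n \<Longrightarrow> hm k g \<Longrightarrow> hm l g' \<Longrightarrow> \<forall>x\<in>Z i. g x * g' x = 0 \<Longrightarrow> (\<forall>x\<in>Z i. g x = 0) \<or> (\<forall>x\<in>Z i. g' x = 0)"
    and Z: "\<And>i. i < n \<Longrightarrow> Z i \<subseteq> Z (Suc i)" "\<And>i x. i < n \<Longrightarrow> x \<in> Z i \<Longrightarrow> f (Suc i) x = 0"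
      "\<And>i. i \<le> n \<Longrightarrow> \<exists>x\<in>Z i. f i x \<noteq> 0"
    and A: "finite A" "\<And>a a'. a \<in> A \<Longrightarrow> a' \<in> A \<Longrightarrow> \<forall>i\<in>{1..n}. a i = a' i \<Longrightarrow> a = a'"
      "\<And>a. a \<in> A \<Longrightarrow> (\<Sum>i\<in>{1..n}. a i) \<le> E"
    and rel: "\<And>x. x \<in> Z n \<Longrightarrow> (\<Sum>a\<in>A. \<iota> (c a) * (f 0 x ^ (E - (\<Sum>i\<in>{1..n}. a i)) * (\<Prod>i\<in>{1..n}. f i x ^ a i))) = 0"
  shows "\<forall>a\<in>A. c a = 0"
  using f irr Z A rel
proof (induction n arbitrary: A E)
  case 0
  obtain x where x: "x \<in> Z 0" "f 0 x \<noteq> 0" using "0.prems"(5) by blast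
  show ?case
  proof
    fix a assume a: "a \<in> A"
    then have "A = {a}" using "0.prems"(7) by auto
    then show "c a = 0" using "0.prems"(9)[OF x(1)] x(2) is_field_homD(7)[OF \<iota>] by simp
  qed
next
  case (Suc n)
  show ?case
  proof (rule ccontr)
    assume "\<not> ?case"
    define B where "B = {a \<in> A. c a \<noteq> 0}"
    have B: "finite B" "B \<noteq> {}" using Suc.prems(6) \<open>\<not> ?case\<close> by (auto simp: B_def)
    \<comment> \<open>The least exponent of the last function in a term with nonzero coefficient,
      that is, the highest power by which the relation can be divided.\<close>
    define k where "k = Min ((\<lambda>a. a (Suc n)) ` B)"
    have k: "k \<le> a (Suc n)" if "a \<in> B" for a using B(1) that by (simp add: k_def)
    have "k \<in> (\<lambda>a. a (Suc n)) ` B" unfolding k_def using B by (intro Min_in) auto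
    then obtain a0 where a0: "a0 \<in> B" "a0 (Suc n) = k" by auto
    let ?s = "\<lambda>a. \<Sum>i\<in>{1..n}. a i"
    have sE: "?s a + a (Suc n) \<le> E" if "a \<in> B" for a using Suc.prems(8)[of a] that by (simp add: B_def)
    define t where "t a x = f 0 x ^ (E - (?s a + a (Suc n))) * (\<Prod>i\<in>{1..n}. f i x ^ a i) * f (Suc n) x ^ (a (Suc n) - k)" for a x
    define \<Psi> where "\<Psi> x = (\<Sum>a\<in>B. \<iota> (c a) * t a x)" for x
    have hpow: "hm (m * \<delta>) (\<lambda>x. f i x ^ m)" if "i \<le> Suc n" for i m
      using hm(1)[of 1] hm(3)[OF Suc.prems(1)[OF that]] by (induction m) (auto simp: is_field_homD(2)[OF \<iota>])
    have ht: "hm ((E - k) * \<delta>) (t a)" if a: "a \<in> B" for a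
    proof -
      have hp: "hm ((\<Sum>i\<in>S. a i) * \<delta>) (\<lambda>x. \<Prod>i\<in>S. f i x ^ a i)" if "finite S" "S \<subseteq> {1..n}" for S
        using that
      proof (induction S)
        case empty then show ?case using hm(1)[of 1] by (simp add: is_field_homD(2)[OF \<iota>])
      next
        case (insert i S)
        then show ?case using hm(3)[OF hpow[of i "a i"]] by (auto simp: distrib_right)
      qed
      have "hm ((E - (?s a + a (Suc n))) * \<delta> + ?s a * \<delta> + (a (Suc n) - k) * \<delta>) (t a)"
        unfolding t_def by (intro hm(3) hpow hp) auto
      moreover have "(E - (?s a + a (Suc n))) + ?s a + (a (Suc n) - k) = E - k" using sE[OF a] k[OF a] by simp
      ultimately show ?thesis by (metis distrib_right)
    qed
    have h\<Psi>: "hm ((E - k) * \<delta>) \<Psi>"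
    proof -
      have "hm ((E - k) * \<delta>) (\<lambda>x. \<Sum>a\<in>S. \<iota> (c a) * t a x)" if "finite S" "S \<subseteq> B" for S
        using that by (induction S) (use hm(4) hm(2) hm(3)[OF hm(1) ht] in auto)
      then show ?thesis unfolding \<Psi>_def using B(1) by auto
    qed
    have eq: "f (Suc n) x ^ k * \<Psi> x = (\<Sum>a\<in>A. \<iota> (c a) * (f 0 x ^ (E - (\<Sum>i\<in>{1..Suc n}. a i)) * (\<Prod>i\<in>{1..Suc n}. f i x ^ a i)))" for x
    proof -
      have "f (Suc n) x ^ k * \<Psi> x = (\<Sum>a\<in>B. \<iota> (c a) * (f 0 x ^ (E - (\<Sum>i\<in>{1..Suc n}. a i)) * (\<Prod>i\<in>{1..Suc n}. f i x ^ a i)))"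
        unfolding \<Psi>_def sum_distrib_left
      proof (intro sum.cong refl)
        fix a assume "a \<in> B"
        then have "f (Suc n) x ^ k * f (Suc n) x ^ (a (Suc n) - k) = f (Suc n) x ^ a (Suc n)"
          using k by (simp flip: power_add)
        then show "f (Suc n) x ^ k * (\<iota> (c a) * t a x) = \<iota> (c a) * (f 0 x ^ (E - (\<Sum>i\<in>{1..Suc n}. a i)) * (\<Prod>i\<in>{1..Suc n}. f i x ^ a i))"
          unfolding t_def by (simp add: mult.left_commute[of "f (Suc n) x ^ k"] mult.assoc add.commute)
      qed
      also have "\<dots> = (\<Sum>a\<in>A. \<iota> (c a) * (f 0 x ^ (E - (\<Sum>i\<in>{1..Suc n}. a i)) * (\<Prod>i\<in>{1..Suc n}. f i x ^ a i)))"
        using Suc.prems(6) by (intro sum.mono_neutral_left) (auto simp: B_def is_field_homD(1)[OF \<iota>])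
      finally show ?thesis .
    qed
    \<comment> \<open>The relation factors as this power times \<Psi>. The power does not vanish
      identically on \<open>Z (Suc n)\<close>, so irreducibility leaves the vanishing of
      \<Psi>.\<close>
    have "(\<forall>x\<in>Z (Suc n). f (Suc n) x ^ k = 0) \<or> (\<forall>x\<in>Z (Suc n). \<Psi> x = 0)"
      by (rule Suc.prems(2)[OF _ hpow h\<Psi>]) (use Suc.prems(9) eq in auto)
    moreover have "\<not> (\<forall>x\<in>Z (Suc n). f (Suc n) x ^ k = 0)" using Suc.prems(5)[of "Suc n"] by auto
    ultimately have \<Psi>0: "\<Psi> x = 0" if "x \<in> Z n" for x using Suc.prems(3)[of n] that by auto
    let ?C = "{a \<in> B. a (Suc n) = k}"
    have "\<forall>a\<in>?C. c a = 0"
    proof (rule Suc.IH)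
      show "finite ?C" using B by simp
      show "a = a'" if "a \<in> ?C" "a' \<in> ?C" "\<forall>i\<in>{1..n}. a i = a' i" for a a'
        using that by (intro Suc.prems(7)) (auto simp: B_def le_Suc_eq)
      show "?s a \<le> E - k" if "a \<in> ?C" for a using sE[of a] that by simp
      fix x assume x: "x \<in> Z n"
      \<comment> \<open>On \<open>Z n\<close> the last function is 0, so only the terms whose
        exponent is exactly \<open>k\<close> survive in \<Psi>.\<close>
      have "(\<Sum>a\<in>?C. \<iota> (c a) * (f 0 x ^ (E - k - ?s a) * (\<Prod>i\<in>{1..n}. f i x ^ a i))) = (\<Sum>a\<in>B. \<iota> (c a) * t a x)"
      proof (rule sum.mono_neutral_cong_left)
        show "\<forall>a\<in>B - ?C. \<iota> (c a) * t a x = 0"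
        proof
          fix a assume a: "a \<in> B - ?C"
          then have "0 < a (Suc n) - k" using k[of a] by auto
          then show "\<iota> (c a) * t a x = 0" using Suc.prems(4)[OF _ x] by (simp add: t_def)
        qed
        show "\<iota> (c a) * (f 0 x ^ (E - k - ?s a) * (\<Prod>i\<in>{1..n}. f i x ^ a i)) = \<iota> (c a) * t a x" if "a \<in> ?C" for a
          using that by (simp add: t_def add.commute)
      qed (use B in auto)
      then show "(\<Sum>a\<in>?C. \<iota> (c a) * (f 0 x ^ (E - k - ?s a) * (\<Prod>i\<in>{1..n}. f i x ^ a i))) = 0"
        using \<Psi>0[OF x] by (simp add: \<Psi>_def)
    qed (use Suc.prems(1-5) in auto)
    then show False using a0 by (auto simp: B_def)
  qed
qed

text \<open>Scaling the argument by 0 makes all arguments equal, while the value is multiplied by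
  \<open>0 ^ 0 = 1\<close>.\<close>

lemma hfun_0_const: "hfun F 0 \<phi> \<Longrightarrow> \<phi> x = \<phi> x'"
  using hfun_scale[of F 0 \<phi> 0 x] hfun_scale[of F 0 \<phi> 0 x'] by simp

definition polyfun :: "('a::field \<Rightarrow> 'o::field) \<Rightarrow> 'c set \<Rightarrow> (('c \<Rightarrow> 'o) \<Rightarrow> 'o) \<Rightarrow> bool" where
  "polyfun \<iota> V \<phi> \<longleftrightarrow> (\<exists>k. polyfun_upto \<iota> V k \<phi>)"

lemma polyfun_const: "polyfun \<iota> V (\<lambda>x. \<iota> c)"
  using polyfun_upto_const by (auto simp: polyfun_def)

lemma polyfun_0: "is_field_hom \<iota> \<Longrightarrow> polyfun \<iota> V (\<lambda>x. 0)" and polyfun_1: "is_field_hom \<iota> \<Longrightarrow> polyfun \<iota> V (\<lambda>x. 1)"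
  using polyfun_const[of \<iota> V 0] polyfun_const[of \<iota> V 1] by (simp_all add: is_field_homD)

lemma polyfun_add: "polyfun \<iota> V \<phi> \<Longrightarrow> polyfun \<iota> V \<psi> \<Longrightarrow> polyfun \<iota> V (\<lambda>x. \<phi> x + \<psi> x)"
  unfolding polyfun_def
proof (elim exE)
  fix k l assume "polyfun_upto \<iota> V k \<phi>" "polyfun_upto \<iota> V l \<psi>"
  then have "polyfun_upto \<iota> V (max k l) \<phi>" "polyfun_upto \<iota> V (max k l) \<psi>" by (auto intro: polyfun_upto_weaken)
  then show "\<exists>k. polyfun_upto \<iota> V k (\<lambda>x. \<phi> x + \<psi> x)" by (intro exI polyfun_upto_add)
qed

lemma polyfun_mult: "is_field_hom \<iota> \<Longrightarrow> polyfun \<iota> V \<phi> \<Longrightarrow> polyfun \<iota> V \<psi> \<Longrightarrow> polyfun \<iota> V (\<lambda>x. \<phi> x * \<psi> x)"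
  unfolding polyfun_def by (elim exE, rule exI, rule polyfun_upto_mult)

lemma polyfun_sum: "is_field_hom \<iota> \<Longrightarrow> (\<And>i. i \<in> S \<Longrightarrow> polyfun \<iota> V (\<phi> i)) \<Longrightarrow> polyfun \<iota> V (\<lambda>x. \<Sum>i\<in>S. \<phi> i x)"
  by (induction S rule: infinite_finite_induct) (auto intro: polyfun_0 polyfun_add)

definition coeffs_polyfun :: "('a::field \<Rightarrow> 'o::field) \<Rightarrow> 'c set \<Rightarrow> (('c \<Rightarrow> 'o) \<Rightarrow> 'o poly) \<Rightarrow> bool" where
  "coeffs_polyfun \<iota> V P \<longleftrightarrow> (\<forall>j. polyfun \<iota> V (\<lambda>x. cf (P x) j))"

lemma coeffs_polyfun_mult: "is_field_hom \<iota> \<Longrightarrow> coeffs_polyfun \<iota> V P \<Longrightarrow> coeffs_polyfun \<iota> V P' \<Longrightarrow> coeffs_polyfun \<iota> V (\<lambda>x. P x * P' x)"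
  unfolding coeffs_polyfun_def coeff_mult by (auto intro!: polyfun_sum polyfun_mult)

lemma coeffs_polyfun_0: "is_field_hom \<iota> \<Longrightarrow> coeffs_polyfun \<iota> V (\<lambda>x. 0)"
  unfolding coeffs_polyfun_def by (auto intro: polyfun_0)

lemma coeffs_polyfun_1: "is_field_hom \<iota> \<Longrightarrow> coeffs_polyfun \<iota> V (\<lambda>x. 1)"
  unfolding coeffs_polyfun_def by (auto intro: polyfun_0 polyfun_1 simp: coeff_1)

lemma coeffs_polyfun_prod: "is_field_hom \<iota> \<Longrightarrow> (\<And>i. i \<in> S \<Longrightarrow> coeffs_polyfun \<iota> V (P i)) \<Longrightarrow> coeffs_polyfun \<iota> V (\<lambda>x. \<Prod>i\<in>S. P i x)"
  by (induction S rule: infinite_finite_induct) (auto intro: coeffs_polyfun_1 coeffs_polyfun_mult)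

lemma coeffs_polyfun_power: "is_field_hom \<iota> \<Longrightarrow> coeffs_polyfun \<iota> V P \<Longrightarrow> coeffs_polyfun \<iota> V (\<lambda>x. P x ^ k)"
  by (induction k) (auto intro: coeffs_polyfun_1 coeffs_polyfun_mult)

lemma hfun_polyfun:
  assumes \<iota>: "is_field_hom \<iota>" and "hfun (range \<iota>) n \<phi>" "\<And>v. polyfun \<iota> V (\<lambda>x. g x v)"
  shows "polyfun \<iota> V (\<lambda>x. \<phi> (g x))"
  using assms(2)
proof induction
  case (hfun_mono c M)
  then obtain c' where c: "c = \<iota> c'" by blast
  have "polyfun \<iota> V (\<lambda>x. \<Prod>v\<in>#M. g x v)"
    by (induction M) (auto intro: polyfun_1[OF \<iota>] polyfun_mult[OF \<iota>] assms(3))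
  then show ?case unfolding c by (intro polyfun_mult[OF \<iota>] polyfun_const)
next
  case (hfun_add n \<phi> \<psi>)
  then show ?case by (intro polyfun_add)
qed

definition fill :: "'c set \<Rightarrow> ('c \<Rightarrow> 'o) \<Rightarrow> ('c \<Rightarrow> 'o) \<Rightarrow> 'c \<Rightarrow> 'o" where
  "fill C b x c = (if c \<in> C then x c else b c)"

section \<open>The upper bound for chains\<close>

context projective_fan begin

lemma hfun_coord_polyfun:
  fixes \<iota> :: "'a::field \<Rightarrow> 'o::field"
  assumes \<iota>: "is_field_hom \<iota>" and \<phi>: "hfun (range \<iota>) n \<phi>" and C: "finite C" "\<And>c. b c \<in> range \<iota>"
  shows "polyfun \<iota> C (\<lambda>x. \<phi> (coord_vector (split_form y (fill C b x))))"
proof (rule hfun_polyfun[OF \<iota> \<phi>])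
  have fl: "polyfun \<iota> C (\<lambda>x. fill C b x c)" for c
  proof (cases "c \<in> C")
    case True
    then show ?thesis using polyfun_upto_var[OF \<iota> C(1) True] by (auto simp: fill_def polyfun_def)
  next
    case False
    obtain k where "b c = \<iota> k" using C(2) by blast
    then show ?thesis using False polyfun_const[of \<iota> C k] by (simp add: fill_def)
  qed
  have lf: "coeffs_polyfun \<iota> C (\<lambda>x. linear_factor (fill C b x) \<alpha> i)" for \<alpha> :: 's and i
    unfolding coeffs_polyfun_def linear_factor_def
  proof
    fix j
    have c: "cf [:p, q:] j = (if j = 0 then p else if j = 1 then q else 0)" for p q :: 'o
      by (auto simp: coeff_pCons split: nat.splits)
    show "polyfun \<iota> C (\<lambda>x. cf [:fill C b x (Const \<alpha> i), fill C b x (Lead \<alpha> i):] j)"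
      unfolding c by (cases "j = 0"; cases "j = 1") (auto simp: fl polyfun_0[OF \<iota>])
  qed
  have "coeffs_polyfun \<iota> C (\<lambda>x. \<Prod>i<y \<alpha>. linear_factor (fill C b x) \<alpha> i)" for \<alpha> by (intro coeffs_polyfun_prod[OF \<iota>] lf)
  then have sf: "coeffs_polyfun \<iota> C (\<lambda>x. split_form y (fill C b x) \<alpha>)" for \<alpha>
    unfolding coeffs_polyfun_def split_form_def by (auto intro!: polyfun_mult[OF \<iota>] fl)
  fix v :: "(int ^ 'r) \<times> nat"
  obtain m j where v: "v = (m, j)" by fastforce
  have "coeffs_polyfun \<iota> C (\<lambda>x. coords (split_form y (fill C b x)) m)"
    unfolding coords_def monomial_form_def
    by (cases "m \<in> sections") (auto intro!: coeffs_polyfun_prod[OF \<iota>] coeffs_polyfun_power[OF \<iota>] sf coeffs_polyfun_0[OF \<iota>])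
  then show "polyfun \<iota> C (\<lambda>x. coord_vector (split_form y (fill C b x)) v)"
    unfolding coeffs_polyfun_def v coord_vector_def split_conv by (rule spec)
qed

definition cox_rep :: "nat \<Rightarrow> ('o::field option \<Rightarrow> ('r, 'o) toric_point) \<Rightarrow> ('s \<Rightarrow> nat) \<times> ('s \<Rightarrow> 'o poly)" where
  "cox_rep d f = (SOME p. admissible (fst p) (snd p) \<and> (\<Sum>\<alpha>\<in>UNIV. fst p \<alpha>) = d \<and> f = cox_curve u (fst p) (snd p))"

text \<open>The value depends on the chosen coordinates of the curve, but fixing one choice per
  curve makes evaluation compatible with sums and products. For homogeneous \<phi> its vanishing
  does not depend on the choice.\<close>

definition curve_eval :: "nat \<Rightarrow> (((int ^ 'r) \<times> nat \<Rightarrow> 'o::field) \<Rightarrow> 'o) \<Rightarrow> ('o option \<Rightarrow> ('r, 'o) toric_point) \<Rightarrow> 'o" where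
  "curve_eval d \<phi> f = \<phi> (coord_vector (snd (cox_rep d f)))"

definition curve_degree :: "nat \<Rightarrow> ('o::field option \<Rightarrow> ('r, 'o) toric_point) \<Rightarrow> nat" where
  "curve_degree d f = embedded_degree (fst (cox_rep d f))"

lemma cox_rep:
  fixes f :: "'o::alg_closed_field option \<Rightarrow> ('r, 'o) toric_point"
  assumes "f \<in> rational_curves \<Sigma> u d"
  shows "admissible (fst (cox_rep d f)) (snd (cox_rep d f))" "(\<Sum>\<alpha>\<in>UNIV. fst (cox_rep d f) \<alpha>) = d"
    "f = cox_curve u (fst (cox_rep d f)) (snd (cox_rep d f))"
proof -
  obtain y Q where "admissible y Q" "(\<Sum>\<alpha>\<in>UNIV. y \<alpha>) = d" "f = cox_curve u y Q" by (rule rational_curveE[OF assms])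
  then have "\<exists>p. admissible (fst p) (snd p) \<and> (\<Sum>\<alpha>\<in>UNIV. fst p \<alpha>) = d \<and> f = cox_curve u (fst p) (snd p)"
    by (intro exI[of _ "(y, Q)"]) simp
  from someI_ex[OF this] show "admissible (fst (cox_rep d f)) (snd (cox_rep d f))" "(\<Sum>\<alpha>\<in>UNIV. fst (cox_rep d f) \<alpha>) = d"
    "f = cox_curve u (fst (cox_rep d f)) (snd (cox_rep d f))" unfolding cox_rep_def by auto
qed

lemma principal_open_ev:
  fixes f :: "'o::alg_closed_field option \<Rightarrow> ('r, 'o) toric_point"
  assumes f: "f \<in> rational_curves \<Sigma> u d" and \<phi>: "hfun F n \<phi>"
  shows "f \<in> principal_open d e \<phi> \<longleftrightarrow> e = curve_degree d f \<and> curve_eval d \<phi> f \<noteq> 0"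
  using principal_open_iff[OF cox_rep(1,2)[OF f] \<phi>, of e] cox_rep(3)[OF f] by (simp add: curve_eval_def curve_degree_def)

text \<open>If \<open>n\<close> exceeded the number of parameters, then the \<open>n + 1\<close>
  functions attached to the chain, written in the parameters, would satisfy a relation. It holds on
  the piece, hence on its closure and on \<open>Z n\<close>, whereas functions separating the
  members of a chain admit no such relation.\<close>

theorem chain_upper_bound:
  fixes \<iota> :: "'a::field \<Rightarrow> 'o::alg_closed_field" and b :: "'s coord \<Rightarrow> 'o"
  defines "T \<equiv> curve_space (range \<iota>) \<Sigma> u h"
  assumes \<iota>: "is_field_hom \<iota>" and d: "(\<Sum>\<alpha>\<in>UNIV. y \<alpha>) = d"
    and C: "finite C" "\<And>c. b c \<in> range \<iota>"
    and chain: "irreducible_chain (T d) n Z" and Zn: "Z n \<subseteq> T d closure_of (piece y C b)"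
  shows "n \<le> card C"
proof (rule ccontr)
  assume "\<not> n \<le> card C"
  then have nC: "card C < n" by simp
  let ?F = "range \<iota>"
  have F: "is_subring ?F" by (rule is_subring_range[OF \<iota>])
  have top: "topspace (T d) = rational_curves \<Sigma> u d" unfolding T_def by (rule topspace_curve_space[OF F])
  have irr: "irreducible_closed (T d) (Z i)" if "i \<le> n" for i using chain that by (simp add: irreducible_chain_def)
  have ZZ: "Z i \<subset> Z (Suc i)" if "i < n" for i using chain that by (simp add: irreducible_chain_def)
  have Zin: "Z i \<subseteq> Z n" if "i \<le> n" for i using irreducible_chain_mono[OF chain that] by simp
  have ZRC: "f \<in> rational_curves \<Sigma> u d" if "f \<in> Z i" "i \<le> n" for f i
    using irr[OF that(2)] that(1) top by (auto simp: irreducible_closed_def dest: closedin_subset)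
  have Zne: "Z i \<noteq> {}" if "i \<le> n" for i using irr[OF that] by (simp add: irreducible_closed_def)
  have op: "openin (T d) (principal_open d e \<phi>)" if "hfun ?F k \<phi>" for e k and \<phi> :: "((int ^ 'r) \<times> nat \<Rightarrow> 'o) \<Rightarrow> 'o"
    unfolding T_def by (rule openin_principal_open[OF F that])
  have meet: "\<exists>g\<in>Z i. curve_degree d g = curve_degree d f1 \<and> curve_degree d g = curve_degree d f2 \<and> curve_eval d \<phi> g \<noteq> 0 \<and> curve_eval d \<psi> g \<noteq> 0"
    if i: "i \<le> n" and h: "hfun ?F k \<phi>" "hfun ?F l \<psi>" and f1: "f1 \<in> Z i" "curve_eval d \<phi> f1 \<noteq> 0" and f2: "f2 \<in> Z i" "curve_eval d \<psi> f2 \<noteq> 0"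
    for i k l \<phi> \<psi> f1 f2
  proof -
    have "f1 \<in> principal_open d (curve_degree d f1) \<phi>" using principal_open_ev[OF ZRC[OF f1(1) i] h(1)] f1(2) by simp
    moreover have "f2 \<in> principal_open d (curve_degree d f2) \<psi>" using principal_open_ev[OF ZRC[OF f2(1) i] h(2)] f2(2) by simp
    ultimately obtain g where g: "g \<in> Z i" "g \<in> principal_open d (curve_degree d f1) \<phi>" "g \<in> principal_open d (curve_degree d f2) \<psi>"
      using irreducible_closed_meet[OF irr[OF i] op[OF h(1), of "curve_degree d f1"] op[OF h(2), of "curve_degree d f2"]] f1(1) f2(1) by blast
    then show ?thesis using principal_open_ev[OF ZRC[OF g(1) i] h(1)] principal_open_ev[OF ZRC[OF g(1) i] h(2)] by auto
  qed
  have one: "hfun ?F 0 (\<lambda>_. 1)" by (rule hfun_const[OF is_subringD(2)[OF F]])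
  \<comment> \<open>Curves of different embedded degree lie in disjoint open sets, but nonempty open
    subsets of an irreducible set meet.\<close>
  have deg_eq: "curve_degree d f1 = curve_degree d f2" if "f1 \<in> Z n" "f2 \<in> Z n" for f1 f2
    using meet[OF order_refl one one that(1) _ that(2)] by (auto simp: curve_eval_def)
  \<comment> \<open>For positive \<open>i\<close> the function vanishes on the preceding member but
    not on \<open>Z i\<close>. For \<open>i = 0\<close> it is a single coordinate that is nonzero
    somewhere on \<open>Z 0\<close>; it homogenizes the relations.\<close>
  have sep: "\<exists>k \<phi>. 1 \<le> k \<and> hfun ?F k \<phi> \<and> (\<exists>f\<in>Z i. curve_eval d \<phi> f \<noteq> 0) \<and> (\<forall>j. i = Suc j \<longrightarrow> (\<forall>f\<in>Z j. curve_eval d \<phi> f = 0))"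
    if i: "i \<le> n" for i
  proof (cases i)
    case 0
    obtain f where f: "f \<in> Z 0" using Zne[of 0] by auto
    obtain m where m: "m \<in> sections" "form_value (embedded_degree (fst (cox_rep d f))) (coords (snd (cox_rep d f)) m) None \<noteq> 0"
      by (rule coords_no_common_zero[OF cox_rep(1)[OF ZRC[OF f]]]) auto
    let ?v = "(m, embedded_degree (fst (cox_rep d f)))"
    have "curve_eval d (\<lambda>x. x ?v) f \<noteq> 0" using m(2) by (simp add: curve_eval_def coord_vector_def form_value_def)
    moreover have "hfun ?F 1 (\<lambda>x. x ?v)" by (rule hfun_var[OF is_subringD(2)[OF F]])
    ultimately show ?thesis using f 0 by blast
  next
    case (Suc j)
    have j: "j < n" using i Suc by simp
    obtain f where f: "f \<in> Z i" "f \<notin> Z j" using ZZ[OF j] Suc by blast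
    have "openin (T d) (topspace (T d) - Z j)" using irr[of j] j by (auto simp: irreducible_closed_def)
    moreover have "f \<in> topspace (T d) - Z j" using f ZRC[OF f(1) i] top by simp
    ultimately have "\<exists>e k \<phi>. hfun ?F k \<phi> \<and> f \<in> principal_open d e \<phi> \<and> principal_open d e \<phi> \<subseteq> topspace (T d) - Z j"
      unfolding T_def openin_curve_space[OF F] by blast
    then obtain e k \<phi> where \<phi>: "hfun ?F k \<phi>" "f \<in> principal_open d e \<phi>" "principal_open d e \<phi> \<subseteq> topspace (T d) - Z j"
      by (elim exE conjE)
    have e: "e = curve_degree d f" "curve_eval d \<phi> f \<noteq> 0" using principal_open_ev[OF ZRC[OF f(1) i] \<phi>(1)] \<phi>(2) by auto
    have van: "curve_eval d \<phi> g = 0" if g: "g \<in> Z j" for g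
    proof -
      have "g \<notin> principal_open d e \<phi>" using \<phi>(3) g by blast
      moreover have "curve_degree d g = e"
        unfolding e(1) using deg_eq[of g f] Zin[of j] Zin[OF i] g f(1) j by auto
      ultimately show ?thesis using principal_open_ev[OF ZRC[OF g] \<phi>(1)] j by auto
    qed
    have "k \<noteq> 0"
    proof
      assume "k = 0"
      obtain g where "g \<in> Z j" using Zne[of j] j by auto
      then show False using van[of g] e(2) hfun_0_const[of ?F \<phi>] \<phi>(1) \<open>k = 0\<close> unfolding curve_eval_def by metis
    qed
    then show ?thesis using \<phi>(1) f(1) e(2) van Suc by (intro exI[of _ k] exI[of _ \<phi>]) auto
  qed
  then obtain k \<phi> where \<phi>: "\<And>i. i \<le> n \<Longrightarrow> 1 \<le> k i" "\<And>i. i \<le> n \<Longrightarrow> hfun ?F (k i) (\<phi> i)"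
    "\<And>i. i \<le> n \<Longrightarrow> \<exists>f\<in>Z i. curve_eval d (\<phi> i) f \<noteq> 0" "\<And>j f. Suc j \<le> n \<Longrightarrow> f \<in> Z j \<Longrightarrow> curve_eval d (\<phi> (Suc j)) f = 0"
    by metis
  \<comment> \<open>The functions are raised to powers that give them a common degree. As all
    \<open>k i\<close> are positive, these powers have nonzero exponents and preserve the
    zeros.\<close>
  define \<delta> where "\<delta> = (\<Prod>i\<le>n. k i)"
  define F' where "F' i w = \<phi> i w ^ (\<delta> div k i)" for i w
  have hF': "hfun ?F \<delta> (F' i)" if "i \<le> n" for i
  proof -
    have "k i dvd \<delta>" unfolding \<delta>_def using that by (intro dvd_prodI) auto
    then have "k i * (\<delta> div k i) = \<delta>" by simp
    then show ?thesis using hfun_power[OF F \<phi>(2)[OF that], of "\<delta> div k i"] unfolding F'_def by metis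
  qed
  have d0: "\<delta> div k i \<noteq> 0" if "i \<le> n" for i
  proof -
    have "k i dvd \<delta>" unfolding \<delta>_def using that by (intro dvd_prodI) auto
    moreover have "k j \<noteq> 0" if "j \<le> n" for j using \<phi>(1)[OF that] by simp
    then have "\<delta> \<noteq> 0" unfolding \<delta>_def by simp
    ultimately show ?thesis by (metis dvd_div_eq_0_iff)
  qed
  have evF': "curve_eval d (F' i) f = curve_eval d (\<phi> i) f ^ (\<delta> div k i)" for i f by (simp add: curve_eval_def F'_def)
  define G where "G i x = F' i (coord_vector (split_form y (fill C b x)))" for i x
  have "\<exists>q. polyfun_upto \<iota> C q (G i)" if "i \<le> n" for i
    using hfun_coord_polyfun[OF \<iota> hF'[OF that] C(1), of b y] C(2) unfolding G_def polyfun_def by blast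
  then obtain q where q: "\<And>i. i \<le> n \<Longrightarrow> polyfun_upto \<iota> C (q i) (G i)" by metis
  have q': "polyfun_upto \<iota> C (Max (q ` {..n})) (G i)" if "i \<le> n" for i
    using polyfun_upto_weaken[OF q[OF that]] that by simp
  obtain K c where c: "\<exists>a\<in>PiE {1..n} (\<lambda>_. {..K}). c a \<noteq> 0"
    "\<And>x. (\<Sum>a\<in>PiE {1..n} (\<lambda>_. {..K}). \<iota> (c a) * (G 0 x ^ (n * K - (\<Sum>i\<in>{1..n}. a i)) * (\<Prod>i\<in>{1..n}. G i x ^ a i))) = 0"
    using algebraic_dependence[OF \<iota> C(1) nC, of "Max (q ` {..n})" G] q' by blast
  let ?A = "PiE {1..n} (\<lambda>_. {..K})"
  have sA: "(\<Sum>i\<in>{1..n}. a i) \<le> n * K" if "a \<in> ?A" for a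
  proof -
    have "(\<Sum>i\<in>{1..n}. a i) \<le> (\<Sum>i\<in>{1..n}. K)" using that by (intro sum_mono) (auto simp: PiE_def Pi_def)
    then show ?thesis by simp
  qed
  define \<Psi> where "\<Psi> w = (\<Sum>a\<in>?A. \<iota> (c a) * (F' 0 w ^ (n * K - (\<Sum>i\<in>{1..n}. a i)) * (\<Prod>i\<in>{1..n}. F' i w ^ a i)))" for w
  have h\<Psi>: "hfun ?F (\<delta> * (n * K)) \<Psi>"
    unfolding \<Psi>_def
  proof (rule hfun_sum[OF is_subringD(1)[OF F]])
    show "finite ?A" by (intro finite_PiE) auto
    fix a assume a: "a \<in> ?A"
    have "hfun ?F (\<delta> * (n * K - (\<Sum>i\<in>{1..n}. a i)) + (\<Sum>i\<in>{1..n}. \<delta> * a i)) (\<lambda>w. F' 0 w ^ (n * K - (\<Sum>i\<in>{1..n}. a i)) * (\<Prod>i\<in>{1..n}. F' i w ^ a i))"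
      by (intro hfun_mult[OF F] hfun_prod[OF F] hfun_power[OF F] hF') auto
    moreover have "\<delta> * (n * K - (\<Sum>i\<in>{1..n}. a i)) + (\<Sum>i\<in>{1..n}. \<delta> * a i) = \<delta> * (n * K)"
      using sA[OF a] by (simp flip: sum_distrib_left distrib_left)
    ultimately show "hfun ?F (\<delta> * (n * K)) (\<lambda>w. \<iota> (c a) * (F' 0 w ^ (n * K - (\<Sum>i\<in>{1..n}. a i)) * (\<Prod>i\<in>{1..n}. F' i w ^ a i)))"
      by (intro hfun_cmult[OF F]) auto
  qed
  \<comment> \<open>The relation \<Psi> vanishes identically in the parameters; a curve with nonzero
    value would have a neighbourhood disjoint from the piece.\<close>
  have \<Psi>0: "curve_eval d \<Psi> f = 0" if f: "f \<in> Z n" for f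
  proof (rule ccontr)
    assume "curve_eval d \<Psi> f \<noteq> 0"
    then have nz: "\<Psi> (coord_vector (snd (cox_rep d f))) \<noteq> 0" by (simp add: curve_eval_def)
    have "cox_curve u (fst (cox_rep d f)) (snd (cox_rep d f)) \<notin> curve_space ?F \<Sigma> u h d closure_of (piece y C b)"
    proof (rule not_in_closure[OF F h\<Psi> cox_rep(1,2)[OF ZRC[OF f order_refl]] nz])
      fix g :: "'o option \<Rightarrow> ('r, 'o) toric_point" assume "g \<in> piece y C b"
      then obtain x where x: "x \<in> params y" "\<forall>c. c \<notin> C \<longrightarrow> x c = b c" "g = cox_curve u y (split_form y x)" by (auto simp: piece_def)
      have "fill C b x = x" using x(2) by (auto simp: fill_def)
      then have "\<Psi> (coord_vector (split_form y x)) = 0" using c(2)[of x] by (simp add: \<Psi>_def G_def)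
      then show "\<exists>y' Q. admissible y' Q \<and> (\<Sum>\<alpha>\<in>UNIV. y' \<alpha>) = d \<and> g = cox_curve u y' Q \<and>
        (embedded_degree y' = embedded_degree (fst (cox_rep d f)) \<longrightarrow> \<Psi> (coord_vector Q) = 0)"
        using x d by (intro exI[of _ y] exI[of _ "split_form y x"]) (auto simp: params_def)
    qed
    then show False using Zn f cox_rep(3)[OF ZRC[OF f order_refl]] by (auto simp: T_def)
  qed
  define hm where "hm k g \<longleftrightarrow> (\<exists>\<phi>. hfun ?F k \<phi> \<and> g = curve_eval d \<phi>)" for k and g :: "('o option \<Rightarrow> ('r, 'o) toric_point) \<Rightarrow> 'o"
  have "\<forall>a\<in>?A. c a = 0"
  proof (rule algebraic_independence[OF \<iota>, where hm = hm and Z = Z and f = "\<lambda>i. curve_eval d (F' i)" and n = n and \<delta> = \<delta> and E = "n * K"])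
    show "hm 0 (\<lambda>_. \<iota> c)" for c unfolding hm_def
      by (intro exI[of _ "\<lambda>_. \<iota> c"] conjI hfun_const) (auto simp: curve_eval_def)
    show "hm k (\<lambda>x. g x + g' x)" if gg: "hm k g" "hm k g'" for k g g'
    proof -
      obtain \<phi> \<psi> where "hfun ?F k \<phi>" "g = curve_eval d \<phi>" "hfun ?F k \<psi>" "g' = curve_eval d \<psi>" using gg by (auto simp: hm_def)
      then show ?thesis unfolding hm_def by (intro exI[of _ "\<lambda>x. \<phi> x + \<psi> x"] conjI hfun_add) (auto simp: curve_eval_def)
    qed
    show "hm (k + l) (\<lambda>x. g x * g' x)" if gg: "hm k g" "hm l g'" for k l g g'
    proof -
      obtain \<phi> \<psi> where "hfun ?F k \<phi>" "g = curve_eval d \<phi>" "hfun ?F l \<psi>" "g' = curve_eval d \<psi>" using gg by (auto simp: hm_def)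
      then show ?thesis unfolding hm_def by (intro exI[of _ "\<lambda>x. \<phi> x * \<psi> x"] conjI hfun_mult[OF F]) (auto simp: curve_eval_def)
    qed
    show "hm k (\<lambda>_. 0)" for k unfolding hm_def
      by (intro exI[of _ "\<lambda>_. 0"] conjI hfun_zero is_subringD(1)[OF F]) (auto simp: curve_eval_def)
    show "hm \<delta> (curve_eval d (F' i))" if "i \<le> n" for i using hF'[OF that] by (auto simp: hm_def)
    show "(\<forall>x\<in>Z i. g x = 0) \<or> (\<forall>x\<in>Z i. g' x = 0)" if i: "i \<le> n" and g: "hm k g" "hm l g'" and z: "\<forall>x\<in>Z i. g x * g' x = 0" for i k l g g'
    proof (rule ccontr)
      assume a: "\<not> ?thesis"
      obtain \<phi> \<psi> where h: "hfun ?F k \<phi>" "g = curve_eval d \<phi>" "hfun ?F l \<psi>" "g' = curve_eval d \<psi>" using g by (auto simp: hm_def)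
      obtain f1 f2 where "f1 \<in> Z i" "curve_eval d \<phi> f1 \<noteq> 0" "f2 \<in> Z i" "curve_eval d \<psi> f2 \<noteq> 0" using a h by blast
      from meet[OF i h(1,3) this] show False using z h by auto
    qed
    show "Z i \<subseteq> Z (Suc i)" if "i < n" for i using ZZ[OF that] by blast
    show "curve_eval d (F' (Suc i)) x = 0" if "i < n" "x \<in> Z i" for i x
      using \<phi>(4)[of i x] that d0[of "Suc i"] by (simp add: evF')
    show "\<exists>x\<in>Z i. curve_eval d (F' i) x \<noteq> 0" if "i \<le> n" for i using \<phi>(3)[OF that] by (auto simp: evF')
    show "finite ?A" by (intro finite_PiE) auto
    show "a = a'" if "a \<in> ?A" "a' \<in> ?A" "\<forall>i\<in>{1..n}. a i = a' i" for a a' using that by (auto intro: PiE_ext)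
    show "(\<Sum>i\<in>{1..n}. a i) \<le> n * K" if "a \<in> ?A" for a by (rule sA[OF that])
    show "(\<Sum>a\<in>?A. \<iota> (c a) * (curve_eval d (F' 0) x ^ (n * K - (\<Sum>i\<in>{1..n}. a i)) * (\<Prod>i\<in>{1..n}. curve_eval d (F' i) x ^ a i))) = 0" if "x \<in> Z n" for x
      using \<Psi>0[OF that] by (simp add: curve_eval_def \<Psi>_def)
  qed
  then show False using c(1) by blast
qed

end

section \<open>Common factors of polynomials\<close>

text \<open>\<open>G\<close> is a nonzero element of least degree in the ideal generated by the
  polynomials; the remainder of any of them modulo \<open>G\<close> lies in the ideal and must
  vanish.\<close>

lemma poly_bezout:
  fixes g :: "'i \<Rightarrow> 'o::field poly"
  assumes "finite M" "\<exists>m\<in>M. g m \<noteq> 0"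
  shows "\<exists>G c. G \<noteq> 0 \<and> G = (\<Sum>m\<in>M. c m * g m) \<and> (\<forall>m\<in>M. G dvd g m)"
proof -
  define J where "J = {\<Sum>m\<in>M. c m * g m | c. True}"
  have gJ: "g m \<in> J" if "m \<in> M" for m
  proof -
    have "(\<Sum>i\<in>M. (if i = m then 1 else 0) * g i) = (\<Sum>i\<in>M. if i = m then g i else 0)" by (intro sum.cong) auto
    then have "(\<Sum>i\<in>M. (if i = m then 1 else 0) * g i) = g m" using that assms(1) by simp
    then show ?thesis unfolding J_def by (intro CollectI exI[of _ "\<lambda>i. if i = m then 1 else 0"]) simp
  qed
  have Jmod: "a mod b \<in> J" if ab: "a \<in> J" "b \<in> J" for a b
  proof -
    obtain c d where "a = (\<Sum>m\<in>M. c m * g m)" "b = (\<Sum>m\<in>M. d m * g m)" using ab by (auto simp: J_def)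
    then have "a - (a div b) * b = (\<Sum>m\<in>M. (c m - (a div b) * d m) * g m)"
      by (simp add: sum_subtractf left_diff_distrib sum_distrib_left mult.assoc)
    then have "a mod b = (\<Sum>m\<in>M. (c m - (a div b) * d m) * g m)" by (simp add: minus_div_mult_eq_mod)
    then show ?thesis unfolding J_def by (intro CollectI exI[of _ "\<lambda>m. c m - (a div b) * d m"]) simp
  qed
  have "\<exists>G. G \<in> J \<and> G \<noteq> 0" using gJ assms(2) by blast
  then obtain G where G: "G \<in> J" "G \<noteq> 0" "\<And>b. b \<in> J \<Longrightarrow> b \<noteq> 0 \<Longrightarrow> deg G \<le> deg b"
    using ex_has_least_nat[of "\<lambda>G. G \<in> J \<and> G \<noteq> 0" _ deg] by blast
  have "G dvd g m" if m: "m \<in> M" for m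
  proof (rule ccontr)
    assume "\<not> G dvd g m"
    then have ne: "g m mod G \<noteq> 0" by (simp add: dvd_eq_mod_eq_0)
    then have "deg G \<le> deg (g m mod G)" using G(3) Jmod[OF gJ[OF m] G(1)] by blast
    then show False using degree_mod_less[of G "g m"] G(2) ne by linarith
  qed
  moreover obtain c where "G = (\<Sum>m\<in>M. c m * g m)" using G(1) by (auto simp: J_def)
  ultimately show ?thesis using G(2) by blast
qed

lemma coeff_truncated_mult:
  "cf ((\<Sum>i<a. Polynomial.monom (c i) i) * P) j = (\<Sum>i<a. c i * (if i \<le> j then cf P (j - i) else 0))"
  by (auto simp: sum_distrib_right coeff_sum coeff_monom_mult intro!: sum.cong)

lemma poly_eq_truncated_sum:
  "deg A < a \<Longrightarrow> A = (\<Sum>i<a. Polynomial.monom (cf A i) i)"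
  by (rule poly_eqI) (auto simp: coeff_sum coeff_eq_0)

text \<open>A common divisor of degree \<open>\<kappa>\<close> gives a relation \<open>A * P1 x + B * P2 x = 0\<close> with
  \<open>deg A \<le> d2 - \<kappa>\<close> and \<open>deg B \<le> d1 - \<kappa>\<close>; such relations are detected by a minor of the Sylvester
  matrix.\<close>

lemma common_factor_polynomial:
  fixes P1 P2 :: "('v \<Rightarrow> 'o::field) \<Rightarrow> 'o poly"
  assumes F: "is_subring F"
    and h: "\<And>j. hfun F n1 (\<lambda>x. cf (P1 x) j)" "\<And>j. hfun F n2 (\<lambda>x. cf (P2 x) j)"
    and x0: "deg (P1 x0) = d1" "P1 x0 \<noteq> 0" "P2 x0 \<noteq> 0"
    and G: "G = s * P1 x0 + t * P2 x0" "G dvd P1 x0" "G dvd P2 x0" "deg G < \<kappa>"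
  shows "\<exists>n p. hfun F n p \<and> p x0 \<noteq> 0 \<and>
    (\<forall>x D. D dvd P1 x \<longrightarrow> D dvd P2 x \<longrightarrow> \<kappa> \<le> deg D \<longrightarrow> deg (P1 x) \<le> d1 \<longrightarrow> deg (P2 x) \<le> d2 \<longrightarrow> P1 x \<noteq> 0 \<longrightarrow> p x = 0)"
proof -
  \<comment> \<open>\<open>a\<close> and \<open>b\<close> count the unknown coefficients of the two
    multipliers. Truncated subtraction leaves no unknowns when the bound on a degree would be
    negative.\<close>
  define a where "a = d2 + 1 - \<kappa>"
  define b where "b = d1 + 1 - \<kappa>"
  define I where "I = Inl ` {..<a} \<union> (Inr ` {..<b} :: (nat + nat) set)"
  define v where "v i j x = (case i of Inl i \<Rightarrow> if i \<le> j then cf (P1 x) (j - i) else 0 | Inr i \<Rightarrow> if i \<le> j then cf (P2 x) (j - i) else 0)" for i :: "nat + nat" and j x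
  define A where "A c = (\<Sum>i<a. Polynomial.monom (c (Inl i)) i)" for c :: "nat + nat \<Rightarrow> 'o"
  define B where "B c = (\<Sum>i<b. Polynomial.monom (c (Inr i)) i)" for c :: "nat + nat \<Rightarrow> 'o"
  have fI: "finite I" by (simp add: I_def)
  have sumI: "(\<Sum>i\<in>I. f i) = (\<Sum>i<a. f (Inl i)) + (\<Sum>i<b. f (Inr i))" for f :: "nat + nat \<Rightarrow> 'o"
    unfolding I_def by (subst sum.union_disjoint) (auto simp: sum.reindex)
  have comb: "(\<Sum>i\<in>I. c i * v i j x) = cf (A c * P1 x + B c * P2 x) j" for c j x
    unfolding sumI coeff_add A_def B_def coeff_truncated_mult by (simp add: v_def)
  \<comment> \<open>After division by \<open>G\<close> the cofactors of \<open>P1 x0\<close> and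
    \<open>P2 x0\<close> are coprime, so the first one divides \<open>B c\<close>. Its degree
    \<open>d1 - deg G\<close> exceeds \<open>d1 - \<kappa>\<close>, the largest possible degree of
    \<open>B c\<close>, which is therefore 0.\<close>
  have rel0: "A c = 0 \<and> B c = 0" if "A c * P1 x0 + B c * P2 x0 = 0" for c
  proof -
    obtain P1' where P1': "P1 x0 = G * P1'" using G(2) by (elim dvdE)
    obtain P2' where P2': "P2 x0 = G * P2'" using G(3) by (elim dvdE)
    have G0: "G \<noteq> 0" using x0(2) P1' by auto
    have "G * (s * P1' + t * P2') = G * 1" using G(1) unfolding P1' P2' by (simp add: algebra_simps)
    then have bez: "s * P1' + t * P2' = 1" using mult_left_cancel[OF G0] by blast
    have "G * (A c * P1' + B c * P2') = 0" using that unfolding P1' P2' by (simp add: algebra_simps)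
    then have "B c * P2' = - (A c * P1')" using G0 by (simp add: add_eq_0_iff)
    moreover have "B c * (s * P1' + t * P2') = s * B c * P1' + t * (B c * P2')" by (simp add: algebra_simps)
    ultimately have "B c * (s * P1' + t * P2') = P1' * (s * B c - t * A c)" by (simp add: algebra_simps)
    then have "P1' dvd B c" using bez by (metis dvd_triv_left mult.right_neutral)
    moreover have "B c = 0 \<or> deg (B c) < deg P1'"
    proof (cases "b = 0")
      case True then show ?thesis by (simp add: B_def)
    next
      case False
      have "deg (B c) < b" unfolding B_def
      proof (rule degree_sum_less)
        fix i assume "i \<in> {..<b}"
        then show "deg (Polynomial.monom (c (Inr i)) i) < b" using degree_monom_le[of "c (Inr i)" i] by simp
      qed (use False in simp)
      moreover have "deg (P1 x0) = deg G + deg P1'" unfolding P1' using x0(2) P1' by (intro degree_mult_eq) auto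
      ultimately have "deg (B c) < deg P1'" using x0(1) G(4) unfolding b_def by linarith
      then show ?thesis ..
    qed
    ultimately have "B c = 0" using dvd_imp_degree_le[of P1' "B c"] by (metis not_le)
    then show ?thesis using that x0(2) by simp
  qed
  have zero: "c i = 0" if "A c = 0" "B c = 0" "i \<in> I" for c i
  proof -
    have "cf (A c) i = (if i < a then c (Inl i) else 0)" "cf (B c) i = (if i < b then c (Inr i) else 0)" for i
      by (simp_all add: A_def B_def coeff_sum)
    then show ?thesis using that by (auto simp: I_def) (metis coeff_0)+
  qed
  have "\<exists>n p. hfun F n p \<and> p x0 \<noteq> 0 \<and> (\<forall>x c. (\<forall>j. (\<Sum>i\<in>I. c i * v i j x) = 0) \<longrightarrow> (\<exists>i\<in>I. c i \<noteq> 0) \<longrightarrow> p x = 0)"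
  proof (rule independence_polynomial[OF F fI, where n = "case_sum (\<lambda>_. n1) (\<lambda>_. n2)"])
    fix i j
    show "hfun F (case_sum (\<lambda>_. n1) (\<lambda>_. n2) i) (v i j)"
      unfolding v_def
      by (cases "case i of Inl i \<Rightarrow> i \<le> j | Inr i \<Rightarrow> i \<le> j"; cases i) (auto intro: h hfun_zero is_subringD(1)[OF F])
  next
    fix c :: "nat + nat \<Rightarrow> 'o" assume "\<And>j. (\<Sum>i\<in>I. c i * v i j x0) = 0"
    then have "A c * P1 x0 + B c * P2 x0 = 0" unfolding comb by (intro poly_eqI) simp
    then show "\<forall>i\<in>I. c i = 0" using rel0 zero by blast
  qed
  then obtain n p where p: "hfun F n p" "p x0 \<noteq> 0"
    "\<And>x c. (\<And>j. (\<Sum>i\<in>I. c i * v i j x) = 0) \<Longrightarrow> \<exists>i\<in>I. c i \<noteq> 0 \<Longrightarrow> p x = 0" by blast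
  have "p x = 0"
    if D: "D dvd P1 x" "D dvd P2 x" "\<kappa> \<le> deg D" "deg (P1 x) \<le> d1" "deg (P2 x) \<le> d2" "P1 x \<noteq> 0" for x D
  proof -
    obtain R1 where R1: "P1 x = D * R1" using D(1) by (elim dvdE)
    obtain R2 where R2: "P2 x = D * R2" using D(2) by (elim dvdE)
    have D0: "D \<noteq> 0" "R1 \<noteq> 0" using D(6) R1 by auto
    have "deg (P1 x) = deg D + deg R1" unfolding R1 using D0 by (intro degree_mult_eq)
    then have d1: "deg R1 < b" using D(3,4) by (simp add: b_def)
    have d2: "R2 = 0 \<or> deg R2 < a"
    proof (cases "R2 = 0")
      case False
      have "deg (P2 x) = deg D + deg R2" unfolding R2 using D0 False by (intro degree_mult_eq)
      then have "deg R2 < a" using D(3,5) unfolding a_def by linarith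
      then show ?thesis ..
    qed simp
    \<comment> \<open>The cofactors with respect to \<open>D\<close>, crossed and with one sign
      changed, form a relation. It is nontrivial because \<open>R1\<close> is nonzero.\<close>
    define c where "c i = (case i of Inl i \<Rightarrow> cf R2 i | Inr i \<Rightarrow> - cf R1 i)" for i
    have B: "B c = - R1" unfolding B_def c_def using poly_eq_truncated_sum[of "- R1" b] d1 by simp
    have A: "A c = R2" unfolding A_def c_def using poly_eq_truncated_sum[of R2 a] d2 by auto
    have "A c * P1 x + B c * P2 x = 0" unfolding A B R1 R2 by (simp add: algebra_simps)
    then have "(\<Sum>i\<in>I. c i * v i j x) = 0" for j unfolding comb by simp
    moreover have "\<exists>i\<in>I. c i \<noteq> 0"
    proof (rule ccontr)
      assume "\<not> ?thesis"
      then have "B c = 0" by (auto simp: B_def I_def)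
      then show False using B D0 by simp
    qed
    ultimately show "p x = 0" by (rule p(3))
  qed
  then show ?thesis using p(1,2) by blast
qed

section \<open>A chain of maximal length\<close>

lemma hom_map_poly:
  assumes "is_field_hom \<iota>"
  shows "cf (map_poly \<iota> q) j = \<iota> (cf q j)" "map_poly \<iota> q = 0 \<longleftrightarrow> q = 0" "deg (map_poly \<iota> q) = deg q"
proof -
  note z = is_field_homD[OF assms]
  show c: "cf (map_poly \<iota> q) j = \<iota> (cf q j)" for j by (simp add: coeff_map_poly z)
  show "map_poly \<iota> q = 0 \<longleftrightarrow> q = 0" by (simp add: poly_eq_iff c z)
  show "deg (map_poly \<iota> q) = deg q" by (simp add: degree_map_poly z)
qed

text \<open>Each new value avoids the finitely many roots of the earlier polynomials and then
  receives an annihilating polynomial of its own. The condition is one-sided: a later polynomial may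
  also annihilate an earlier value.\<close>

lemma separated_roots:
  fixes \<iota> :: "'a::field \<Rightarrow> 'o::alg_closed_field"
  assumes \<iota>: "is_field_hom \<iota>" and alg: "\<And>x. \<exists>p. p \<noteq> 0 \<and> poly (map_poly \<iota> p) x = 0"
  shows "\<exists>\<tau> q. \<forall>k<(n::nat). q k \<noteq> 0 \<and> poly (map_poly \<iota> (q k)) (\<tau> k) = 0 \<and> (\<forall>j<n. k < j \<longrightarrow> poly (map_poly \<iota> (q k)) (\<tau> j) \<noteq> 0)"
proof (induction n)
  case (Suc n)
  then obtain \<tau> q where *: "\<forall>k<n. q k \<noteq> 0 \<and> poly (map_poly \<iota> (q k)) (\<tau> k) = 0 \<and> (\<forall>j<n. k < j \<longrightarrow> poly (map_poly \<iota> (q k)) (\<tau> j) \<noteq> 0)" by blast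
  have "finite (\<Union>k<n. {x. poly (map_poly \<iota> (q k)) x = 0})"
    using * by (auto intro!: poly_roots_finite simp: hom_map_poly(2)[OF \<iota>])
  from ex_new_if_finite[OF infinite_alg_closed this] obtain t where t: "\<And>k. k < n \<Longrightarrow> poly (map_poly \<iota> (q k)) t \<noteq> 0" by auto
  obtain p where p: "p \<noteq> 0" "poly (map_poly \<iota> p) t = 0" using alg by blast
  show ?case
    by (intro exI[of _ "\<tau>(n := t)"] exI[of _ "q(n := p)"]) (use * t p in \<open>auto simp: less_Suc_eq\<close>)
qed simp

lemma ex_inj_avoiding:
  fixes S :: "'o::alg_closed_field set"
  assumes "finite S"
  shows "\<exists>\<rho> :: nat \<Rightarrow> 'o. inj \<rho> \<and> (\<forall>i. \<rho> i \<notin> S)"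
proof -
  have "infinite (- S)" using assms infinite_alg_closed by (metis finite_compl)
  then obtain \<rho> :: "nat \<Rightarrow> 'o" where "inj \<rho>" "range \<rho> \<subseteq> - S" using infinite_countable_subset by blast
  then show ?thesis by blast
qed

context projective_fan begin

lemma split_form_poly:
  assumes "\<And>i. i < y \<alpha> \<Longrightarrow> x (Lead \<alpha> i) = 1"
  shows "poly (split_form y x \<alpha>) w = x (Scalar \<alpha>) * (\<Prod>i<y \<alpha>. x (Const \<alpha> i) + w)"
    "form_value (y \<alpha>) (split_form y x \<alpha>) None = x (Scalar \<alpha>)"
proof -
  have "(\<Prod>i<y \<alpha>. poly (linear_factor x \<alpha> i) w) = (\<Prod>i<y \<alpha>. x (Const \<alpha> i) + w)"
    using assms by (intro prod.cong) (auto simp: linear_factor_def)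
  then show "poly (split_form y x \<alpha>) w = x (Scalar \<alpha>) * (\<Prod>i<y \<alpha>. x (Const \<alpha> i) + w)"
    by (simp add: split_form_def poly_prod)
  have "(\<Prod>i<y \<alpha>. form_value 1 (linear_factor x \<alpha> i) None) = 1"
    using assms by (intro prod.neutral) (auto simp: linear_factor_def form_value_def)
  then show "form_value (y \<alpha>) (split_form y x \<alpha>) None = x (Scalar \<alpha>)"
    by (simp add: split_form_value)
qed

lemma coords_leading:
  assumes x: "x \<in> params y" "\<And>\<alpha> i. i < y \<alpha> \<Longrightarrow> x (Lead \<alpha> i) = 1" and m: "m \<in> sections"
  shows "coord_vector (split_form y x) (m, embedded_degree y) = (\<Prod>\<alpha>\<in>UNIV. x (Scalar \<alpha>) ^ nat (sec_order m \<alpha>))"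
proof -
  have ad: "admissible y (split_form y x)" using x by (simp add: params_def)
  have "form_value (y \<alpha>) (split_form y x \<alpha>) None = x (Scalar \<alpha>)" for \<alpha> by (rule split_form_poly(2)) (rule x(2))
  then show ?thesis using coords_value[OF ad m, of None] by (simp add: coord_vector_def form_value_def)
qed

lemma coords_poly:
  "m \<in> sections \<Longrightarrow> poly (coords Q m) w = (\<Prod>\<alpha>\<in>UNIV. poly (Q \<alpha>) w ^ nat (sec_order m \<alpha>))"
  by (simp add: coords_def monomial_form_def poly_prod)

text \<open>With monic factors, the coordinate of a section at infinity is a monomial in the
  scalars. The section \<open>v\<close> is the vertex of \<sigma> and does not involve the scalars
  on its rays; \<open>m\<close> is the vertex of a full cone that contains \<open>A\<close> but not
  \<alpha>. The difference of the two coordinates is therefore 0 as long as only scalars on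
  \<open>A\<close> vary, and becomes the \<open>K\<close>-th power of the scalar of \<alpha> minus 1
  when only that one varies, where \<open>K\<close> is the order of \<open>m\<close> along
  \<alpha>.\<close>

lemma torus_step:
  assumes F: "is_subring (F :: 'o::alg_closed_field set)" and \<sigma>: "full_cone \<sigma>" and A: "A \<subseteq> R \<sigma>" "\<alpha> \<in> R \<sigma>" "\<alpha> \<notin> A"
  shows "\<exists>n p K. hfun F n p \<and> 0 < K \<and>
    (\<forall>x\<in>params y. (\<forall>\<alpha>. \<forall>i<y \<alpha>. x (Lead \<alpha> i) = 1) \<longrightarrow> (\<forall>\<beta>. \<beta> \<notin> A \<longrightarrow> x (Scalar \<beta>) = 1) \<longrightarrow> p (coord_vector (split_form y x)) = 0) \<and>
    (\<forall>x\<in>params y. (\<forall>\<alpha>. \<forall>i<y \<alpha>. x (Lead \<alpha> i) = 1) \<longrightarrow> (\<forall>\<beta>. \<beta> \<noteq> \<alpha> \<longrightarrow> x (Scalar \<beta>) = 1) \<longrightarrow>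
       x (Scalar \<alpha>) ^ K \<noteq> 1 \<longrightarrow> p (coord_vector (split_form y x)) \<noteq> 0)"
proof -
  have \<sigma>': "\<sigma> \<in> \<Sigma>" using \<sigma> by (simp add: full_cone_def)
  obtain \<tau> where \<tau>: "full_cone \<tau>" "A \<subseteq> R \<tau>" "\<alpha> \<notin> R \<tau>" by (rule ex_full_cone_avoiding[OF \<sigma>' A(1,3)])
  obtain m where m: "m \<in> sections" "\<And>\<alpha>. sec_order m \<alpha> = 0 \<longleftrightarrow> \<alpha> \<in> R \<tau>" using vertex[OF \<tau>(1)] by blast
  obtain v where v: "v \<in> sections" "\<And>\<alpha>. sec_order v \<alpha> = 0 \<longleftrightarrow> \<alpha> \<in> R \<sigma>" using vertex[OF \<sigma>] by blast
  define K where "K = nat (sec_order m \<alpha>)"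
  have "0 \<le> sec_order m \<alpha>" "sec_order m \<alpha> \<noteq> 0" using m \<tau>(3) sections_iff[of m] by auto
  then have K: "0 < K" by (simp add: K_def)
  define p where "p z = z (m, embedded_degree y) - z (v, embedded_degree y)" for z :: "(int ^ 'r) \<times> nat \<Rightarrow> 'o"
  have "hfun F 1 p" unfolding p_def by (intro hfun_diff[OF F] hfun_var is_subringD(2)[OF F])
  moreover have "p (coord_vector (split_form y x)) = 0"
    if x: "x \<in> params y" "\<forall>\<alpha>. \<forall>i<y \<alpha>. x (Lead \<alpha> i) = 1" "\<forall>\<beta>. \<beta> \<notin> A \<longrightarrow> x (Scalar \<beta>) = 1" for x
  proof -
    have c: "coord_vector (split_form y x) (k, embedded_degree y) = (\<Prod>\<alpha>\<in>UNIV. x (Scalar \<alpha>) ^ nat (sec_order k \<alpha>))"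
      if "k \<in> sections" for k by (rule coords_leading[OF x(1) _ that]) (use x(2) in blast)
    have "x (Scalar \<beta>) ^ nat (sec_order m \<beta>) = 1" "x (Scalar \<beta>) ^ nat (sec_order v \<beta>) = 1" for \<beta>
      using x(3) m(2)[of \<beta>] v(2)[of \<beta>] \<tau>(2) A(1) by (cases "\<beta> \<in> A"; auto)+
    then show ?thesis unfolding p_def c[OF m(1)] c[OF v(1)] by simp
  qed
  moreover have "p (coord_vector (split_form y x)) \<noteq> 0"
    if x: "x \<in> params y" "\<forall>\<alpha>. \<forall>i<y \<alpha>. x (Lead \<alpha> i) = 1" "\<forall>\<beta>. \<beta> \<noteq> \<alpha> \<longrightarrow> x (Scalar \<beta>) = 1" "x (Scalar \<alpha>) ^ K \<noteq> 1" for x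
  proof -
    have c: "coord_vector (split_form y x) (k, embedded_degree y) = (\<Prod>\<alpha>\<in>UNIV. x (Scalar \<alpha>) ^ nat (sec_order k \<alpha>))"
      if "k \<in> sections" for k by (rule coords_leading[OF x(1) _ that]) (use x(2) in blast)
    have "(\<Prod>\<beta>\<in>UNIV. x (Scalar \<beta>) ^ nat (sec_order m \<beta>)) = (\<Prod>\<beta>\<in>UNIV. if \<beta> = \<alpha> then x (Scalar \<alpha>) ^ K else 1)"
      using x(3) by (intro prod.cong) (auto simp: K_def)
    also have "\<dots> = x (Scalar \<alpha>) ^ K" by simp
    finally have 1: "(\<Prod>\<beta>\<in>UNIV. x (Scalar \<beta>) ^ nat (sec_order m \<beta>)) = x (Scalar \<alpha>) ^ K" .
    have "x (Scalar \<beta>) ^ nat (sec_order v \<beta>) = 1" for \<beta>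
      using x(3) v(2)[of \<beta>] A(2) by (cases "\<beta> = \<alpha>") auto
    then have "(\<Prod>\<beta>\<in>UNIV. x (Scalar \<beta>) ^ nat (sec_order v \<beta>)) = 1" by simp
    then show ?thesis using 1 x(4) unfolding p_def c[OF m(1)] c[OF v(1)] by simp
  qed
  ultimately show ?thesis using K by (intro exI[of _ 1] exI[of _ p] exI[of _ K] conjI ballI impI)
qed

text \<open>The form of the section \<open>m\<close> read off an arbitrary coordinate vector. Its
  coefficients are homogeneous functions of degree 1, as the criterion for common factors
  requires.\<close>

definition section_poly :: "nat \<Rightarrow> int ^ 'r \<Rightarrow> ((int ^ 'r) \<times> nat \<Rightarrow> 'o::field) \<Rightarrow> 'o poly" where
  "section_poly e m z = (\<Sum>j\<le>e. Polynomial.monom (z (m, j)) j)"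

lemma section_poly_coeff: "cf (section_poly e m z) j = (if j \<le> e then z (m, j) else 0)"
  by (simp add: section_poly_def coeff_sum)

lemma section_poly_degree: "deg (section_poly e m z) \<le> e"
  by (rule degree_le) (simp add: section_poly_coeff)

lemma section_poly_hfun:
  assumes "is_subring F"
  shows "hfun F 1 (\<lambda>z. cf (section_poly e m z) j)"
  unfolding section_poly_coeff
  by (cases "j \<le> e") (auto intro: hfun_zero is_subringD[OF assms] simp: hfun_var[OF is_subringD(2)[OF assms], unfolded One_nat_def])

lemma section_poly_coord_vector:
  assumes "admissible y Q"
  shows "section_poly (embedded_degree y) m (coord_vector Q) = coords Q m"
  using coords_degree[OF assms, of m]
  by (intro poly_eqI) (auto simp: section_poly_coeff coord_vector_def coeff_eq_0)

text \<open>Freezing a root at \<open>t\<close> has to be expressed over the base field, which need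
  not contain \<open>t\<close>. A section vanishing along \<alpha> then shares the root
  \<open>t\<close> with \<open>q\<close>, whereas at \<open>x1\<close> no root of any form is a root
  of \<open>q\<close>; the condition of having a common factor with \<open>q\<close> has
  coefficients in the base field. The sign of \<open>t\<close> is due to the linear factors being a
  variable plus a constant.\<close>

lemma root_step:
  fixes \<iota> :: "'a::field \<Rightarrow> 'o::alg_closed_field"
  assumes \<iota>: "is_field_hom \<iota>" and q: "q \<noteq> 0" "poly (map_poly \<iota> q) t = 0" and i: "i < y \<alpha>"
    and x1: "x1 \<in> params y" "\<And>\<alpha> i. i < y \<alpha> \<Longrightarrow> x1 (Lead \<alpha> i) = 1"
      "\<And>\<beta> j. j < y \<beta> \<Longrightarrow> poly (map_poly \<iota> q) (- x1 (Const \<beta> j)) \<noteq> 0"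
  shows "\<exists>n p. hfun (range \<iota>) n p \<and> p (coord_vector (split_form y x1)) \<noteq> 0 \<and>
    (\<forall>x\<in>params y. (\<forall>\<alpha>. \<forall>i<y \<alpha>. x (Lead \<alpha> i) = 1) \<longrightarrow> x (Const \<alpha> i) = - t \<longrightarrow> p (coord_vector (split_form y x)) = 0)"
proof -
  let ?q = "map_poly \<iota> q" and ?e = "embedded_degree y"
  have F: "is_subring (range \<iota>)" by (rule is_subring_range[OF \<iota>])
  have q0: "?q \<noteq> 0" using q(1) hom_map_poly(2)[OF \<iota>] by blast
  obtain \<tau> where \<tau>: "full_cone \<tau>" "\<alpha> \<notin> R \<tau>"
    using ex_full_cone_avoiding[OF zero_cone(1), of "{}" \<alpha>] by blast
  obtain m where m: "m \<in> sections" "\<And>\<alpha>. sec_order m \<alpha> = 0 \<longleftrightarrow> \<alpha> \<in> R \<tau>" using vertex[OF \<tau>(1)] by blast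
  have "0 \<le> sec_order m \<alpha>" "sec_order m \<alpha> \<noteq> 0" using m \<tau>(2) sections_iff[of m] by auto
  then have ma: "0 < nat (sec_order m \<alpha>)" by simp
  have ad1: "admissible y (split_form y x1)" using x1(1) by (simp add: params_def)
  let ?P2 = "section_poly ?e m"
  have P2: "?P2 (coord_vector (split_form y x)) = coords (split_form y x) m" if "x \<in> params y" for x
    using that by (intro section_poly_coord_vector) (simp add: params_def)
  have P20: "coords (split_form y x) m \<noteq> 0" if "x \<in> params y" for x
    using that m(1) by (intro coords_nonzero) (auto simp: params_def)
  define g where "g k = (if k then ?q else coords (split_form y x1) m)" for k
  have "\<exists>k\<in>UNIV. g k \<noteq> 0" using q0 by (intro bexI[of _ True]) (auto simp: g_def)
  then obtain G c where G: "G \<noteq> 0" "G = (\<Sum>k\<in>UNIV. c k * g k)" "\<forall>k\<in>UNIV. G dvd g k"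
    using poly_bezout[of UNIV g] by (meson finite)
  have Gd: "G dvd ?q" "G dvd coords (split_form y x1) m" using bspec[OF G(3), of True] bspec[OF G(3), of False] by (auto simp: g_def)
  have "deg G = 0"
  proof (rule ccontr)
    assume "deg G \<noteq> 0"
    then obtain w where w: "poly G w = 0" using alg_closed_imp_poly_has_root[of G] by blast
    then have w': "poly ?q w = 0" "poly (coords (split_form y x1) m) w = 0" using Gd by (auto elim!: dvdE)
    then obtain \<beta> where "poly (split_form y x1 \<beta>) w = 0" unfolding coords_poly[OF m(1)] by (auto simp: prod_zero_iff)
    moreover have "poly (split_form y x1 \<beta>) w = x1 (Scalar \<beta>) * (\<Prod>i<y \<beta>. x1 (Const \<beta> i) + w)"
      by (rule split_form_poly(1)) (rule x1(2))
    moreover have "x1 (Scalar \<beta>) \<noteq> 0" using admissibleD(1)[OF ad1, of \<beta>] by (simp add: split_form_nonzero_iff)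
    ultimately obtain j where j: "j < y \<beta>" "x1 (Const \<beta> j) + w = 0" by auto
    then have "w = - x1 (Const \<beta> j)" by (simp add: eq_neg_iff_add_eq_0 add.commute)
    then show False using x1(3)[OF j(1)] w'(1) by simp
  qed
  then have dG: "deg G < 1" by simp
  have G': "G = c True * ?q + c False * ?P2 (coord_vector (split_form y x1))"
    unfolding G(2) P2[OF x1(1)] by (simp add: UNIV_bool g_def)
  have "\<exists>n p. hfun (range \<iota>) n p \<and> p (coord_vector (split_form y x1)) \<noteq> 0 \<and>
    (\<forall>z D. D dvd ?q \<longrightarrow> D dvd ?P2 z \<longrightarrow> 1 \<le> deg D \<longrightarrow> deg ?q \<le> deg ?q \<longrightarrow> deg (?P2 z) \<le> ?e \<longrightarrow> ?q \<noteq> 0 \<longrightarrow> p z = 0)"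
  proof (rule common_factor_polynomial[OF F])
    show "hfun (range \<iota>) 0 (\<lambda>x. cf ?q j)" for j by (rule hfun_const) (simp add: hom_map_poly[OF \<iota>])
    show "hfun (range \<iota>) 1 (\<lambda>z. cf (?P2 z) j)" for j by (rule section_poly_hfun[OF F])
    show "?P2 (coord_vector (split_form y x1)) \<noteq> 0" using P2[OF x1(1)] P20[OF x1(1)] by simp
    show "G = c True * ?q + c False * ?P2 (coord_vector (split_form y x1))" by (rule G')
    show "G dvd ?q" by (rule Gd)
    show "G dvd ?P2 (coord_vector (split_form y x1))" using Gd(2) P2[OF x1(1)] by simp
    show "deg G < 1" by (rule dG)
  qed (use q0 in auto)
  then obtain n p where p: "hfun (range \<iota>) n p" "p (coord_vector (split_form y x1)) \<noteq> 0"
    "\<And>z D. D dvd ?q \<Longrightarrow> D dvd ?P2 z \<Longrightarrow> 1 \<le> deg D \<Longrightarrow> deg ?q \<le> deg ?q \<Longrightarrow> deg (?P2 z) \<le> ?e \<Longrightarrow> ?q \<noteq> 0 \<Longrightarrow> p z = 0"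
    by blast
  have "p (coord_vector (split_form y x)) = 0"
    if x: "x \<in> params y" "\<forall>\<alpha>. \<forall>i<y \<alpha>. x (Lead \<alpha> i) = 1" "x (Const \<alpha> i) = - t" for x
  proof (rule p(3))
    show "[:- t, 1:] dvd ?q" using q(2) by (simp add: poly_eq_0_iff_dvd)
    have "poly (split_form y x \<alpha>) t = x (Scalar \<alpha>) * (\<Prod>i<y \<alpha>. x (Const \<alpha> i) + t)"
      by (rule split_form_poly(1)) (use x(2) in blast)
    moreover have "(\<Prod>i<y \<alpha>. x (Const \<alpha> i) + t) = 0" using i x(3) by (intro prod_zero) (auto intro!: bexI[of _ i])
    ultimately have "poly (split_form y x \<alpha>) t = 0" by simp
    then have "poly (coords (split_form y x) m) t = 0" unfolding coords_poly[OF m(1)] using ma by (auto simp: prod_zero_iff)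
    then show "[:- t, 1:] dvd ?P2 (coord_vector (split_form y x))" unfolding P2[OF x(1)] by (simp add: poly_eq_0_iff_dvd)
  qed (use q0 section_poly_degree in auto)
  then show ?thesis using p(1,2) by (intro exI[of _ n] exI[of _ p]) blast
qed

text \<open>The parameters are released one at a time, first the torus coordinates and then the roots. At
  the start, the root \<open>\<tau> k\<close> is annihilated by a polynomial \<open>q k\<close> over the base field that does not
  annihilate the later ones.\<close>

lemma chain_lower:
  fixes \<iota> :: "'a::field \<Rightarrow> 'o::alg_closed_field"
  assumes \<iota>: "is_field_hom \<iota>" and alg: "\<And>x. \<exists>p. p \<noteq> 0 \<and> poly (map_poly \<iota> p) x = 0"
    and y: "\<And>m. (\<Sum>\<alpha>\<in>UNIV. int (y \<alpha>) * pairing m (u \<alpha>)) = 0" "(\<Sum>\<alpha>\<in>UNIV. y \<alpha>) = d"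
    and \<sigma>: "full_cone \<sigma>"
  shows "\<exists>Z. irreducible_chain (curve_space (range \<iota>) \<Sigma> u h d) (CARD('r) + d) Z \<and>
    Z (CARD('r) + d) \<subseteq> curve_space (range \<iota>) \<Sigma> u h d closure_of (piece y (normal_coords y (R \<sigma>)) normal_base)"
proof -
  let ?T = "curve_space (range \<iota>) \<Sigma> u h d" and ?r = "CARD('r)"
  have F: "is_subring (range \<iota>)" by (rule is_subring_range[OF \<iota>])
  have \<sigma>': "\<sigma> \<in> \<Sigma>" using \<sigma> by (simp add: full_cone_def)
  define I where "I = (SIGMA \<alpha>:UNIV. {..<y \<alpha>})"
  have "finite I" "card I = d" using y(2) by (simp_all add: I_def)
  then obtain idx where idx: "bij_betw idx {..<d} I"
    using ex_bij_betw_nat_finite[of I] by (auto simp: atLeast0LessThan)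
  define pos where "pos = inv_into {..<d} idx"
  have pos: "pos (\<alpha>, i) < d" "idx (pos (\<alpha>, i)) = (\<alpha>, i)" if "i < y \<alpha>" for \<alpha> i
  proof -
    have "(\<alpha>, i) \<in> idx ` {..<d}" using that idx by (auto simp: I_def bij_betw_def)
    from inv_into_into[OF this] f_inv_into_f[OF this]
    show "pos (\<alpha>, i) < d" "idx (pos (\<alpha>, i)) = (\<alpha>, i)" by (simp_all add: pos_def)
  qed
  have pos_inj: "pos (\<alpha>, i) \<noteq> pos (\<beta>, j)" if "i < y \<alpha>" "j < y \<beta>" "\<alpha> \<noteq> \<beta>" for \<alpha> \<beta> i j
    using pos(2)[OF that(1)] pos(2)[OF that(2)] that(3) by auto
  have pos_idx: "pos (idx k) = k" if "k < d" for k
    using idx that unfolding pos_def by (simp add: bij_betw_def inv_into_f_f)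
  have idx_mem: "snd (idx k) < y (fst (idx k))" if "k < d" for k
    using idx that by (auto simp: bij_betw_def I_def)
  obtain a where a: "bij_betw a {..<?r} (R \<sigma>)"
    using ex_bij_betw_nat_finite[of "R \<sigma>"] full_cone_basis(2)[OF \<sigma>] by (auto simp: atLeast0LessThan)
  have a_inj: "a k \<noteq> a j" if "j < ?r" "k < ?r" "j \<noteq> k" for j k
    using a that by (auto simp: bij_betw_def inj_on_def)
  obtain \<tau> q where tq: "\<forall>k<d. q k \<noteq> 0 \<and> poly (map_poly \<iota> (q k)) (\<tau> k) = 0 \<and> (\<forall>j<d. k < j \<longrightarrow> poly (map_poly \<iota> (q k)) (\<tau> j) \<noteq> 0)"
    using separated_roots[OF \<iota> alg] by blast
  have \<tau>_inj: "\<tau> j \<noteq> \<tau> k" if "j < d" "k < d" "j \<noteq> k" for j k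
    proof (cases "j < k")
    case True
    then have "poly (map_poly \<iota> (q j)) (\<tau> k) \<noteq> 0" "poly (map_poly \<iota> (q j)) (\<tau> j) = 0" using tq that by blast+
    then show ?thesis by auto
  next
    case False
    then have "poly (map_poly \<iota> (q k)) (\<tau> j) \<noteq> 0" "poly (map_poly \<iota> (q k)) (\<tau> k) = 0" using tq that by auto
    then show ?thesis by auto
  qed
  \<comment> \<open>The order in which parameters are released: \<open>r\<close> scalars along
    \<open>a\<close>, then the \<open>d\<close> constant terms in the enumeration
    \<open>idx\<close>.\<close>
  define co where "co k = (if k < ?r then Scalar (a k) else Const (fst (idx (k - ?r))) (snd (idx (k - ?r))))" for k
  define pt where "pt s v c = (case c of Scalar \<alpha> \<Rightarrow> s \<alpha> | Lead _ _ \<Rightarrow> 1 | Const \<alpha> i \<Rightarrow> if i < y \<alpha> then - v (pos (\<alpha>, i)) else 0)"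
    for s :: "'s \<Rightarrow> 'o" and v :: "nat \<Rightarrow> 'o" and c
  have pt_params: "pt s v \<in> params y" if s: "\<And>\<alpha>. s \<alpha> \<noteq> 0" and v: "\<And>j k. j < d \<Longrightarrow> k < d \<Longrightarrow> j \<noteq> k \<Longrightarrow> v j \<noteq> v k" for s v
  proof (rule params_distinct_roots)
    fix \<alpha> i \<beta> j assume "i < y \<alpha>" "j < y \<beta>" "\<alpha> \<noteq> \<beta>"
    then show "pt s v (Const \<alpha> i) \<noteq> pt s v (Const \<beta> j)"
      using v[OF pos(1) pos(1) pos_inj] by (simp add: pt_def)
  qed (use y s in \<open>auto simp: pt_def\<close>)
  define x0 where "x0 = pt (\<lambda>_. 1) \<tau>"
  have x0: "x0 \<in> params y" unfolding x0_def by (rule pt_params) (use \<tau>_inj in auto)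
  define C where "C k = co ` {..<k}" for k
  define S where "S k = piece y (C k) x0" for k
  have S_mono: "S k \<subseteq> S l" if "k \<le> l" for k l
    using that unfolding S_def piece_def C_def by (fastforce simp: image_iff)
  have S_ne: "S k \<noteq> {}" for k using x0 by (auto simp: S_def piece_def)
  have Lead: "x (Lead \<alpha> i) = 1" if "\<forall>c. c \<notin> C k \<longrightarrow> x c = x0 c" for k x \<alpha> i
    using that[rule_format, of "Lead \<alpha> i"] by (auto simp: C_def co_def x0_def pt_def split: if_splits)
  \<comment> \<open>Strictness of the chain needs an equation over the base field that holds on the
    piece of \<open>C k\<close> and a curve in the next piece that violates it.\<close>
  have step: "\<exists>x n p. x \<in> params y \<and> (\<forall>c. c \<notin> C (Suc k) \<longrightarrow> x c = x0 c) \<and> hfun (range \<iota>) n p \<and>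
      p (coord_vector (split_form y x)) \<noteq> 0 \<and>
      (\<forall>x\<in>params y. (\<forall>c. c \<notin> C k \<longrightarrow> x c = x0 c) \<longrightarrow> p (coord_vector (split_form y x)) = 0)"
    if k: "k < ?r + d" for k
  proof (cases "k < ?r")
    case True
    let ?A = "a ` {..<k}"
    have A: "?A \<subseteq> R \<sigma>" "a k \<in> R \<sigma>" "a k \<notin> ?A"
      using a True a_inj by (auto simp: bij_betw_def dest: inj_onD)
    obtain n p K where p: "hfun (range \<iota>) n p" "0 < K"
      "\<forall>x\<in>params y. (\<forall>\<alpha>. \<forall>i<y \<alpha>. x (Lead \<alpha> i) = 1) \<longrightarrow> (\<forall>\<beta>. \<beta> \<notin> ?A \<longrightarrow> x (Scalar \<beta>) = 1) \<longrightarrow> p (coord_vector (split_form y x)) = 0"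
      "\<forall>x\<in>params y. (\<forall>\<alpha>. \<forall>i<y \<alpha>. x (Lead \<alpha> i) = 1) \<longrightarrow> (\<forall>\<beta>. \<beta> \<noteq> a k \<longrightarrow> x (Scalar \<beta>) = 1) \<longrightarrow>
       x (Scalar (a k)) ^ K \<noteq> 1 \<longrightarrow> p (coord_vector (split_form y x)) \<noteq> 0"
      using torus_step[OF F \<sigma> A, of y] by (elim exE conjE) auto
    have "Polynomial.monom (1 :: 'o) K - 1 \<noteq> 0"
    proof
      assume "Polynomial.monom (1 :: 'o) K - 1 = 0"
      then have "cf (Polynomial.monom (1 :: 'o) K - 1) K = 0" by simp
      then show False using p(2) by simp
    qed
    then have "finite {t :: 'o. poly (Polynomial.monom 1 K - 1) t = 0}" by (rule poly_roots_finite)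
    then have "finite (insert 0 {t :: 'o. t ^ K = 1})" by (simp add: poly_monom)
    \<comment> \<open>Any nonzero scalar that is not a \<open>K\<close>-th root of unity violates
      the equation obtained from the torus.\<close>
    then obtain t :: 'o where t: "t \<noteq> 0" "t ^ K \<noteq> 1" using ex_new_if_finite[OF infinite_alg_closed] by blast
    define x where "x = pt ((\<lambda>_. 1)(a k := t)) \<tau>"
    have x: "x \<in> params y" unfolding x_def by (rule pt_params) (use t \<tau>_inj in auto)
    have "\<forall>c. c \<notin> C (Suc k) \<longrightarrow> x c = x0 c"
    proof (intro allI impI)
      fix c assume c: "c \<notin> C (Suc k)"
      have "co k \<in> C (Suc k)" unfolding C_def by simp
      then have "c \<noteq> Scalar (a k)" using c True by (auto simp: co_def)
      then show "x c = x0 c" by (cases c) (auto simp: x_def x0_def pt_def)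
    qed
    moreover have "p (coord_vector (split_form y x)) \<noteq> 0"
      by (rule p(4)[rule_format, OF x]) (use t in \<open>auto simp: x_def pt_def\<close>)
    moreover have "p (coord_vector (split_form y x)) = 0" if x: "x \<in> params y" "\<forall>c. c \<notin> C k \<longrightarrow> x c = x0 c" for x
    proof (rule p(3)[rule_format, OF x(1)])
      fix \<beta> assume "\<beta> \<notin> ?A"
      then have "Scalar \<beta> \<notin> C k" using True by (auto simp: C_def co_def)
      then show "x (Scalar \<beta>) = 1" using x(2) by (auto simp: x0_def pt_def)
    qed (rule Lead[OF x(2)])
    ultimately show ?thesis using x p(1) by blast
  next
    case False
    define i where "i = k - ?r"
    have i: "i < d" "k = ?r + i" using k False by (auto simp: i_def)
    let ?q = "map_poly \<iota> (q i)"
    have q: "q i \<noteq> 0" "poly ?q (\<tau> i) = 0" "\<And>j. j < d \<Longrightarrow> i < j \<Longrightarrow> poly ?q (\<tau> j) \<noteq> 0" using tq i(1) by blast+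
    have "finite {w. poly ?q w = 0}" using q(1) by (intro poly_roots_finite) (simp add: hom_map_poly(2)[OF \<iota>])
    then have "finite ({w. poly ?q w = 0} \<union> \<tau> ` {..<d})" by simp
    from ex_inj_avoiding[OF this] obtain \<rho> :: "nat \<Rightarrow> 'o"
      where \<rho>: "inj \<rho>" "\<And>j. \<rho> j \<notin> {w. poly ?q w = 0} \<union> \<tau> ` {..<d}"
      by (elim exE conjE) blast
    \<comment> \<open>The roots up to index \<open>i\<close> are released by now and are moved away
      from the zeros of \<open>q i\<close>; the later ones stay frozen at values that
      \<open>q i\<close> does not annihilate. So \<open>q i\<close> has no zero among the
      roots.\<close>
    define v where "v j = (if j \<le> i then \<rho> j else \<tau> j)" for j
    define x where "x = pt (\<lambda>_. 1) v"
    have "v j \<noteq> v l" if "j < d" "l < d" "j \<noteq> l" for j l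
    proof -
      have "\<rho> j \<noteq> \<tau> l" "\<tau> j \<noteq> \<rho> l" "\<rho> j \<noteq> \<rho> l"
        using that \<rho>(2)[of j] \<rho>(2)[of l] inj_eq[OF \<rho>(1), of j l] by (blast intro: sym)+
      then show ?thesis using \<tau>_inj[OF that] by (simp add: v_def)
    qed
    then have x: "x \<in> params y" unfolding x_def by (intro pt_params) auto
    have vq: "poly ?q (v j) \<noteq> 0" if "j < d" for j
      using \<rho>(2)[of j] q(3)[OF that] by (auto simp: v_def)
    obtain \<alpha> l where al: "idx i = (\<alpha>, l)" by fastforce
    have l: "l < y \<alpha>" using idx_mem[OF i(1)] al by simp
    have pal: "pos (\<alpha>, l) = i" using pos_idx[OF i(1)] al by simp
    have "\<exists>n p. hfun (range \<iota>) n p \<and> p (coord_vector (split_form y x)) \<noteq> 0 \<and>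
      (\<forall>x\<in>params y. (\<forall>\<alpha>. \<forall>i<y \<alpha>. x (Lead \<alpha> i) = 1) \<longrightarrow> x (Const \<alpha> l) = - \<tau> i \<longrightarrow> p (coord_vector (split_form y x)) = 0)"
      by (rule root_step[OF \<iota> q(1,2) l x]) (auto simp: x_def pt_def vq pos)
    then obtain n p where p: "hfun (range \<iota>) n p" "p (coord_vector (split_form y x)) \<noteq> 0"
      "\<forall>x\<in>params y. (\<forall>\<alpha>. \<forall>i<y \<alpha>. x (Lead \<alpha> i) = 1) \<longrightarrow> x (Const \<alpha> l) = - \<tau> i \<longrightarrow> p (coord_vector (split_form y x)) = 0"
      by (elim exE conjE)
    have "\<forall>c. c \<notin> C (Suc k) \<longrightarrow> x c = x0 c"
    proof (intro allI impI)
      fix c assume c: "c \<notin> C (Suc k)"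
      show "x c = x0 c"
      proof (cases c)
        case (Const \<beta> j)
        show ?thesis
        proof (cases "j < y \<beta> \<and> pos (\<beta>, j) \<le> i")
          case True
          then have "co (?r + pos (\<beta>, j)) = c" using pos(2) Const by (simp add: co_def)
          then have "c \<in> C (Suc k)" unfolding C_def using True i(2) by (intro image_eqI[of _ _ "?r + pos (\<beta>, j)"]) auto
          then show ?thesis using c by blast
        qed (auto simp: x_def x0_def pt_def v_def Const)
      qed (auto simp: x_def x0_def pt_def)
    qed
    moreover have "p (coord_vector (split_form y x)) = 0" if x: "x \<in> params y" "\<forall>c. c \<notin> C k \<longrightarrow> x c = x0 c" for x
    proof (rule p(3)[rule_format, OF x(1)])
      have "Const \<alpha> l \<notin> C k"
      proof
        assume "Const \<alpha> l \<in> C k"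
        then obtain j where j: "j < k" "co j = Const \<alpha> l" by (auto simp: C_def)
        then have "idx (j - ?r) = (\<alpha>, l)" "j - ?r < i" using i(2) by (auto simp: co_def split: if_splits)
        then show False using pos_idx[of "j - ?r"] pal i(1) by simp
      qed
      then show "x (Const \<alpha> l) = - \<tau> i" using x(2) l pal by (auto simp: x0_def pt_def)
    qed (rule Lead[OF x(2)])
    ultimately show ?thesis using x p(1,2) by blast
  qed
  have Sclosure: "S k \<subseteq> ?T closure_of S k" for k
    unfolding S_def by (rule closure_of_subset) (use piece_subset[OF y(2)] topspace_curve_space[OF F] in blast)
  have strict: "?T closure_of S k \<subset> ?T closure_of S (Suc k)" if k: "k < ?r + d" for k
  proof -
    obtain x n p where x: "x \<in> params y" "\<forall>c. c \<notin> C (Suc k) \<longrightarrow> x c = x0 c" "hfun (range \<iota>) n p"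
      "p (coord_vector (split_form y x)) \<noteq> 0"
      "\<forall>x\<in>params y. (\<forall>c. c \<notin> C k \<longrightarrow> x c = x0 c) \<longrightarrow> p (coord_vector (split_form y x)) = 0"
      using step[OF k] by (elim exE conjE)
    have ad: "admissible y (split_form y x)" using x(1) by (simp add: params_def)
    have "cox_curve u y (split_form y x) \<notin> ?T closure_of S k"
    proof (rule not_in_closure[OF F x(3) ad y(2) x(4)])
      fix f assume "f \<in> S k"
      then obtain x' where "x' \<in> params y" "\<forall>c. c \<notin> C k \<longrightarrow> x' c = x0 c" "f = cox_curve u y (split_form y x')"
        by (auto simp: S_def piece_def)
      then show "\<exists>y' Q. admissible y' Q \<and> (\<Sum>\<alpha>\<in>UNIV. y' \<alpha>) = d \<and> f = cox_curve u y' Q \<and>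
        (embedded_degree y' = embedded_degree y \<longrightarrow> p (coord_vector Q) = 0)"
        using x(5) y(2) by (intro exI[of _ y] exI[of _ "split_form y x'"]) (auto simp: params_def)
    qed
    moreover have "cox_curve u y (split_form y x) \<in> S (Suc k)" using x(1,2) by (auto simp: S_def piece_def)
    ultimately show ?thesis using Sclosure[of "Suc k"] closure_of_mono[OF S_mono[of k "Suc k"], of ?T] by auto
  qed
  have CN: "C (?r + d) = normal_coords y (R \<sigma>)"
  proof (rule Set.set_eqI)
    fix c
    show "c \<in> C (?r + d) \<longleftrightarrow> c \<in> normal_coords y (R \<sigma>)"
    proof (cases c)
      case (Scalar \<alpha>)
      have "c \<in> C (?r + d) \<longleftrightarrow> \<alpha> \<in> a ` {..<?r}" by (auto simp: C_def co_def Scalar image_iff intro!: trans_less_add1)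
      then show ?thesis using a by (auto simp: normal_coords_def Scalar bij_betw_def)
    next
      case (Lead \<alpha> i)
      then show ?thesis by (auto simp: C_def co_def normal_coords_def split: if_splits)
    next
      case (Const \<alpha> i)
      have "c \<in> C (?r + d) \<longleftrightarrow> i < y \<alpha>"
      proof
        assume "c \<in> C (?r + d)"
        then obtain k where k: "k < ?r + d" "co k = Const \<alpha> i" by (auto simp: C_def Const)
        then have "idx (k - ?r) = (\<alpha>, i)" "k - ?r < d" by (auto simp: co_def split: if_splits)
        then show "i < y \<alpha>" using idx_mem[of "k - ?r"] by simp
      next
        assume "i < y \<alpha>"
        then have "co (?r + pos (\<alpha>, i)) = c" "pos (\<alpha>, i) < d" using pos Const by (auto simp: co_def)
        then show "c \<in> C (?r + d)" unfolding C_def by (intro image_eqI[of _ _ "?r + pos (\<alpha>, i)"]) auto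
      qed
      then show ?thesis by (auto simp: normal_coords_def Const)
    qed
  qed
  have "S (?r + d) \<subseteq> piece y (normal_coords y (R \<sigma>)) normal_base"
  proof -
    have "x0 c = normal_base c" if "c \<notin> normal_coords y (R \<sigma>)" for c
      using that by (cases c) (auto simp: x0_def pt_def normal_base_def normal_coords_def image_iff)
    then show ?thesis unfolding S_def piece_def CN by auto
  qed
  then have "?T closure_of S (?r + d) \<subseteq> ?T closure_of (piece y (normal_coords y (R \<sigma>)) normal_base)" by (rule closure_of_mono)
  moreover have "irreducible_closed ?T (?T closure_of S k)" for k
    using S_ne[of k] unfolding S_def by (intro piece_irreducible[OF F y(2)])
  ultimately show ?thesis using strict
    by (intro exI[of _ "\<lambda>k. ?T closure_of S k"]) (auto simp: irreducible_chain_def)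
qed

end

section \<open>Strata not contained in one another\<close>

lemma degree_le_via_orders:
  fixes G H :: "'o::alg_closed_field poly"
  assumes "G \<noteq> 0" "H \<noteq> 0" "\<And>w. Polynomial.order w G \<le> k * Polynomial.order w H"
  shows "deg G \<le> k * deg H"
proof -
  have "proots G \<subseteq># repeat_mset k (proots H)"
    by (rule mset_subset_eqI) (simp add: assms)
  then have "size (proots G) \<le> size (repeat_mset k (proots H))" by (rule size_mset_mono)
  then show ?thesis by (simp add: alg_closed_proots(1) assms)
qed

context projective_fan begin

lemma ex_distinct_params:
  assumes y: "\<And>m. (\<Sum>\<alpha>\<in>UNIV. int (y \<alpha>) * pairing m (u \<alpha>)) = 0"
  shows "\<exists>x :: 's coord \<Rightarrow> 'o::alg_closed_field. x \<in> params y \<and> (\<forall>\<alpha> i. x (Lead \<alpha> i) = 1) \<and> (\<forall>\<alpha>. x (Scalar \<alpha>) = 1) \<and>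
    (\<forall>\<alpha> i \<beta> j. i < y \<alpha> \<longrightarrow> j < y \<beta> \<longrightarrow> \<alpha> \<noteq> \<beta> \<longrightarrow> x (Const \<alpha> i) \<noteq> x (Const \<beta> j))"
proof -
  obtain \<rho> :: "nat \<Rightarrow> 'o" where \<rho>: "inj \<rho>" using ex_inj_avoiding[of "{} :: 'o set"] by blast
  obtain f :: "'s \<times> nat \<Rightarrow> nat" where f: "inj_on f (SIGMA \<alpha>:UNIV. {..<y \<alpha>})"
    using finite_imp_inj_to_nat_seg[of "SIGMA \<alpha>:UNIV. {..<y \<alpha>}"] by auto
  define x where "x c = (case c of Const \<alpha> i \<Rightarrow> \<rho> (f (\<alpha>, i)) | _ \<Rightarrow> 1)" for c
  have "x (Const \<alpha> i) \<noteq> x (Const \<beta> j)" if "i < y \<alpha>" "j < y \<beta>" "\<alpha> \<noteq> \<beta>" for \<alpha> i \<beta> j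
    using inj_onD[OF f, of "(\<alpha>, i)" "(\<beta>, j)"] inj_eq[OF \<rho>] that by (auto simp: x_def)
  moreover have "x (Lead \<alpha> i) = 1" "x (Scalar \<alpha>) = 1" for \<alpha> i by (simp_all add: x_def)
  moreover have "x \<in> params y" using calculation by (intro params_distinct_roots y) auto
  ultimately show ?thesis by blast
qed

lemma closure_piece_eq:
  fixes b :: "'s coord \<Rightarrow> 'o::alg_closed_field"
  assumes F: "is_subring F" and y: "\<And>m. (\<Sum>\<alpha>\<in>UNIV. int (y \<alpha>) * pairing m (u \<alpha>)) = 0" "(\<Sum>\<alpha>\<in>UNIV. y \<alpha>) = d"
    and \<sigma>: "full_cone \<sigma>"
  shows "curve_space F \<Sigma> u h d closure_of (piece y UNIV b) =
    curve_space F \<Sigma> u h d closure_of (piece y (normal_coords y (R \<sigma>)) normal_base)"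
proof (rule antisym)
  let ?N = "piece y (normal_coords y (R \<sigma>)) (normal_base :: 's coord \<Rightarrow> 'o)"
  obtain x0 :: "'s coord \<Rightarrow> 'o" where x0: "x0 \<in> params y" "\<forall>\<alpha> i. x0 (Lead \<alpha> i) = 1"
    using ex_distinct_params[OF y(1)] by (elim exE conjE)
  then have "piece y UNIV b \<subseteq> curve_space F \<Sigma> u h d closure_of ?N" by (intro normal_piece_dense[OF F y(2) \<sigma> x0(1)]) auto
  then show "curve_space F \<Sigma> u h d closure_of (piece y UNIV b) \<subseteq> curve_space F \<Sigma> u h d closure_of ?N"
    by (rule closure_of_minimal) simp
  show "curve_space F \<Sigma> u h d closure_of ?N \<subseteq> curve_space F \<Sigma> u h d closure_of (piece y UNIV b)"
    by (rule closure_of_mono) (auto simp: piece_def)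
qed

lemma split_form_degree_eq:
  fixes x :: "'s coord \<Rightarrow> 'o::field"
  assumes "\<And>i. i < y \<alpha> \<Longrightarrow> x (Lead \<alpha> i) = 1" "x (Scalar \<alpha>) \<noteq> 0"
  shows "deg (split_form y x \<alpha>) = y \<alpha>"
proof -
  have "cf (split_form y x \<alpha>) (y \<alpha>) \<noteq> 0"
    using split_form_poly(2)[of y \<alpha> x] assms by (simp add: form_value_def)
  then show ?thesis using le_degree split_form_degree by (metis antisym)
qed

text \<open>If \<open>y' \<alpha> < y \<alpha>\<close> and \<open>k\<close> is the smallest positive order of a section along \<open>\<alpha>\<close>, then the
  sections \<open>m\<close> with positive order along \<open>\<alpha>\<close> have the common factor \<open>Q \<alpha> ^ k\<close> of degree \<open>k * y \<alpha>\<close>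
  on the stratum of \<open>y\<close>, but only one of degree \<open>k * y' \<alpha>\<close> on a curve of the stratum of \<open>y'\<close>
  whose forms have disjoint roots.\<close>

lemma piece_not_in_closure:
  fixes b :: "'s coord \<Rightarrow> 'o::alg_closed_field"
  assumes y: "\<And>m. (\<Sum>\<alpha>\<in>UNIV. int (y \<alpha>) * pairing m (u \<alpha>)) = 0" "(\<Sum>\<alpha>\<in>UNIV. y \<alpha>) = d"
    and y': "\<And>m. (\<Sum>\<alpha>\<in>UNIV. int (y' \<alpha>) * pairing m (u \<alpha>)) = 0" "(\<Sum>\<alpha>\<in>UNIV. y' \<alpha>) = d"
    and ne: "y \<noteq> y'"
  shows "\<not> piece y' UNIV b \<subseteq> curve_space UNIV \<Sigma> u h d closure_of (piece y UNIV b)"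
proof -
  have F: "is_subring (UNIV :: 'o set)" by (simp add: is_subring_def)
  \<comment> \<open>Different multidegrees with the same total cannot be comparable in all
    entries.\<close>
  obtain \<alpha> where \<alpha>: "y' \<alpha> < y \<alpha>"
  proof (rule ccontr)
    assume "\<not> thesis"
    then have le: "\<And>\<alpha>. y \<alpha> \<le> y' \<alpha>" using that not_le by blast
    then have "y \<alpha> = y' \<alpha>" for \<alpha>
      using sum_mono_inv[of y UNIV y' \<alpha>] y(2) y'(2) by simp
    then show False using ne by blast
  qed
  obtain \<sigma> where \<sigma>: "full_cone \<sigma>" using ex_full_cone[of 0] by blast
  obtain x' :: "'s coord \<Rightarrow> 'o" where x': "x' \<in> params y'" "\<forall>\<alpha> i. x' (Lead \<alpha> i) = 1" "\<forall>\<alpha>. x' (Scalar \<alpha>) = 1"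
    "\<forall>\<alpha> i \<beta> j. i < y' \<alpha> \<longrightarrow> j < y' \<beta> \<longrightarrow> \<alpha> \<noteq> \<beta> \<longrightarrow> x' (Const \<alpha> i) \<noteq> x' (Const \<beta> j)"
    using ex_distinct_params[OF y'(1)] by (elim exE conjE)
  define Q' where "Q' = split_form y' x'"
  have ad': "admissible y' Q'" using x'(1) by (simp add: params_def Q'_def)
  have roots: "\<beta> = \<gamma>" if bc: "poly (Q' \<beta>) w = 0" "poly (Q' \<gamma>) w = 0" for \<beta> \<gamma> w
  proof (rule ccontr)
    assume "\<beta> \<noteq> \<gamma>"
    have "\<exists>i<y' \<delta>. x' (Const \<delta> i) = - w" if "poly (Q' \<delta>) w = 0" for \<delta>
      using split_form_poly(1)[of y' \<delta> x' w] that x'(2,3) by (auto simp: Q'_def add_eq_0_iff2)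
    then obtain i j where "i < y' \<beta>" "x' (Const \<beta> i) = - w" "j < y' \<gamma>" "x' (Const \<gamma> j) = - w" using bc by meson
    then show False using x'(4) \<open>\<beta> \<noteq> \<gamma>\<close> by metis
  qed
  have "\<exists>n p. hfun UNIV n p \<and> p (coord_vector Q') \<noteq> 0 \<and>
    (\<forall>x\<in>params y. (\<forall>\<alpha> i. x (Lead \<alpha> i) = 1) \<longrightarrow> embedded_degree y = embedded_degree y' \<longrightarrow> p (coord_vector (split_form y x)) = 0)"
  proof (cases "embedded_degree y = embedded_degree y'")
    case False
    then show ?thesis using hfun_const[of "1 :: 'o" UNIV] by (intro exI[of _ 0] exI[of _ "\<lambda>_. 1"]) auto
  next
    case True
    define e where "e = embedded_degree y"
    \<comment> \<open>Such a section is the vertex of a full cone that contains \<beta> but not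
      \<alpha>. It prevents roots of the form of \<beta> from being common zeros.\<close>
    have "\<exists>m\<in>sections. sec_order m \<beta> = 0 \<and> 0 < sec_order m \<alpha>" if "\<beta> \<noteq> \<alpha>" for \<beta>
    proof -
      obtain \<rho> where \<rho>: "\<rho> \<in> \<Sigma>" "R \<rho> = {\<beta>}" using ray_in_cone by blast
      obtain \<tau> where \<tau>: "full_cone \<tau>" "{\<beta>} \<subseteq> R \<tau>" "\<alpha> \<notin> R \<tau>"
        using ex_full_cone_avoiding[OF \<rho>(1), of "{\<beta>}" \<alpha>] \<rho>(2) \<open>\<beta> \<noteq> \<alpha>\<close> by auto
      obtain m where m: "m \<in> sections" "\<And>\<alpha>. sec_order m \<alpha> = 0 \<longleftrightarrow> \<alpha> \<in> R \<tau>" using vertex[OF \<tau>(1)] by blast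
      have "0 \<le> sec_order m \<alpha>" "sec_order m \<alpha> \<noteq> 0" using m \<tau>(3) sections_iff[of m] by auto
      moreover have "sec_order m \<beta> = 0" using m(2)[of \<beta>] \<tau>(2) by simp
      ultimately show ?thesis using m(1) by (intro bexI[of _ m]) auto
    qed
    then obtain v where v: "\<And>\<beta>. \<beta> \<noteq> \<alpha> \<Longrightarrow> v \<beta> \<in> sections \<and> sec_order (v \<beta>) \<beta> = 0 \<and> 0 < sec_order (v \<beta>) \<alpha>" by metis
    have "\<exists>m. m \<in> sections \<and> 0 < sec_order m \<alpha>"
    proof -
      obtain \<tau> where \<tau>: "full_cone \<tau>" "\<alpha> \<notin> R \<tau>"
        using ex_full_cone_avoiding[OF zero_cone(1), of "{}" \<alpha>] by blast
      obtain m where m: "m \<in> sections" "\<And>\<alpha>. sec_order m \<alpha> = 0 \<longleftrightarrow> \<alpha> \<in> R \<tau>" using vertex[OF \<tau>(1)] by blast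
      have "0 \<le> sec_order m \<alpha>" "sec_order m \<alpha> \<noteq> 0" using m \<tau>(2) sections_iff[of m] by auto
      then show ?thesis using m(1) by (intro exI[of _ m]) auto
    qed
    then obtain m0 where m0: "m0 \<in> sections" "0 < sec_order m0 \<alpha>"
      and min: "\<And>m. m \<in> sections \<Longrightarrow> 0 < sec_order m \<alpha> \<Longrightarrow> nat (sec_order m0 \<alpha>) \<le> nat (sec_order m \<alpha>)"
      using ex_has_least_nat[of "\<lambda>m. m \<in> sections \<and> 0 < sec_order m \<alpha>" _ "\<lambda>m. nat (sec_order m \<alpha>)"] by blast
    define k where "k = nat (sec_order m0 \<alpha>)"
    have k: "0 < k" using m0(2) by (simp add: k_def)
    \<comment> \<open>\<open>m0\<close> attains the least positive order \<open>k\<close> along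
      \<alpha>, and for every other ray there is one section excluding the roots of its form.
      Finitely many sections suffice for the Bezout relation.\<close>
    define M where "M = insert m0 (v ` (UNIV - {\<alpha>}))"
    have M: "finite M" "m0 \<in> M" "\<And>m. m \<in> M \<Longrightarrow> m \<in> sections" "\<And>m. m \<in> M \<Longrightarrow> k \<le> nat (sec_order m \<alpha>)"
      using v m0 min by (auto simp: M_def k_def)
    have "\<exists>m\<in>M. coords Q' m \<noteq> 0" using coords_nonzero[OF ad' m0(1)] M(2) by blast
    from poly_bezout[OF M(1) this] obtain G c where G: "G \<noteq> 0" "G = (\<Sum>m\<in>M. c m * coords Q' m)" "\<forall>m\<in>M. G dvd coords Q' m"
      by (elim exE conjE)
    \<comment> \<open>At a root of \<open>G\<close> only the form of \<alpha> vanishes, so the order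
      of the coordinate \<open>m0\<close> there is exactly \<open>k\<close> times that of this
      form.\<close>
    have "Polynomial.order w G \<le> k * Polynomial.order w (Q' \<alpha>)" for w
    proof (cases "poly G w = 0")
      case False
      then show ?thesis by (simp add: order_0I)
    next
      case True
      have z: "poly (coords Q' m) w = 0" if "m \<in> M" for m using G(3) that True by (auto elim!: dvdE)
      have "poly (coords Q' m0) w = 0" by (rule z[OF M(2)])
      then obtain \<beta> where \<beta>: "poly (Q' \<beta>) w = 0" unfolding coords_poly[OF m0(1)] by (auto simp: prod_zero_iff)
      have "\<beta> = \<alpha>"
      proof (rule ccontr)
        assume ba: "\<beta> \<noteq> \<alpha>"
        then have "poly (coords Q' (v \<beta>)) w = 0" by (intro z) (auto simp: M_def)
        then obtain \<gamma> where "poly (Q' \<gamma>) w ^ nat (sec_order (v \<beta>) \<gamma>) = 0"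
          using v[OF ba] by (auto simp: coords_poly prod_zero_iff)
        then have "poly (Q' \<gamma>) w = 0" "sec_order (v \<beta>) \<gamma> \<noteq> 0" by (auto intro: ccontr)
        then show False using roots[OF \<beta>, of \<gamma>] v[OF ba] by auto
      qed
      then have ne: "poly (Q' \<gamma>) w \<noteq> 0" if "\<gamma> \<noteq> \<alpha>" for \<gamma> using roots[OF \<beta>, of \<gamma>] that by auto
      have "Polynomial.order w G \<le> Polynomial.order w (coords Q' m0)"
        using G(3) M(2) coords_nonzero[OF ad' m0(1)] by (intro dvd_imp_order_le) auto
      also have "\<dots> = form_order (monomial_degree y' (sec_order m0)) (monomial_form Q' (sec_order m0)) (Some w)"
        using m0(1) by (simp add: coords_def form_order_def)
      also have "\<dots> = (\<Sum>\<gamma>\<in>UNIV. nat (sec_order m0 \<gamma>) * form_order (y' \<gamma>) (Q' \<gamma>) (Some w))"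
        by (rule monomial_form_order) (auto simp: admissibleD[OF ad'])
      also have "\<dots> = (\<Sum>\<gamma>\<in>UNIV. if \<gamma> = \<alpha> then k * Polynomial.order w (Q' \<alpha>) else 0)"
        using ne by (intro sum.cong) (auto simp: form_order_def k_def order_0I)
      also have "\<dots> = k * Polynomial.order w (Q' \<alpha>)" by simp
      finally show ?thesis .
    qed
    then have "deg G \<le> k * deg (Q' \<alpha>)" by (intro degree_le_via_orders G(1) admissibleD(1)[OF ad'])
    also have "\<dots> \<le> k * y' \<alpha>" using admissibleD(2)[OF ad', of \<alpha>] by simp
    also have "\<dots> < k * y \<alpha>" using \<alpha> k by simp
    finally have dG: "deg G < k * y \<alpha>" .
    \<comment> \<open>The common factor of many sections is detected by two polynomials: the
      coordinate \<open>m0\<close> and the Bezout combination with its multipliers \<open>c\<close>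
      frozen. The multipliers have arbitrary coefficients in the closed field, so the separating
      function is found over \<open>UNIV\<close>.\<close>
    let ?P1 = "section_poly e m0 :: _ \<Rightarrow> 'o poly" and ?P2 = "\<lambda>z. \<Sum>m\<in>M. c m * section_poly e m z"
    define d2 where "d2 = Max ((\<lambda>m. deg (c m)) ` M) + e"
    have e': "e = embedded_degree y'" using True by (simp add: e_def)
    have P: "section_poly e m (coord_vector Q') = coords Q' m" for m
      unfolding e' by (rule section_poly_coord_vector[OF ad'])
    have P2: "?P2 (coord_vector Q') = G" unfolding P G(2) ..
    have deg2: "deg (?P2 z) \<le> d2" for z
    proof (rule degree_sum_le[OF M(1)])
      fix m assume m: "m \<in> M"
      have "deg (c m * section_poly e m z) \<le> deg (c m) + deg (section_poly e m z)" by (rule degree_mult_le)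
      also have "\<dots> \<le> d2" unfolding d2_def using m M(1) section_poly_degree[of e m z] by (intro add_mono Max_ge) auto
      finally show "deg (c m * section_poly e m z) \<le> d2" .
    qed
    have "\<exists>n p. hfun UNIV n p \<and> p (coord_vector Q') \<noteq> 0 \<and>
      (\<forall>z D. D dvd ?P1 z \<longrightarrow> D dvd ?P2 z \<longrightarrow> k * y \<alpha> \<le> deg D \<longrightarrow> deg (?P1 z) \<le> e \<longrightarrow> deg (?P2 z) \<le> d2 \<longrightarrow> ?P1 z \<noteq> 0 \<longrightarrow> p z = 0)"
    proof (rule common_factor_polynomial[OF F])
      show "hfun UNIV 1 (\<lambda>z. cf (?P1 z) j)" for j by (rule section_poly_hfun[OF F])
      show "hfun UNIV 1 (\<lambda>z. cf (?P2 z) j)" for j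
        unfolding coeff_sum coeff_mult by (intro hfun_sum hfun_cmult[OF F] section_poly_hfun[OF F] M(1)) auto
      have "cf (coords Q' m0) e = 1"
        using coords_leading[OF x'(1) _ m0(1)] x'(2,3) by (simp add: coord_vector_def e' Q'_def)
      then show "deg (?P1 (coord_vector Q')) = e"
        unfolding P using coords_degree[OF ad', of m0] le_degree[of "coords Q' m0" e] by (simp add: e')
      show "?P1 (coord_vector Q') \<noteq> 0" unfolding P by (rule coords_nonzero[OF ad' m0(1)])
      show "?P2 (coord_vector Q') \<noteq> 0" unfolding P2 by (rule G(1))
      show "G = 0 * ?P1 (coord_vector Q') + 1 * ?P2 (coord_vector Q')" unfolding P2 by simp
      show "G dvd ?P1 (coord_vector Q')" unfolding P using G(3) M(2) by blast
      show "G dvd ?P2 (coord_vector Q')" unfolding P2 by simp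
      show "deg G < k * y \<alpha>" by (rule dG)
    qed
    then obtain n p where p: "hfun UNIV n p" "p (coord_vector Q') \<noteq> 0"
      "\<And>z D. D dvd ?P1 z \<Longrightarrow> D dvd ?P2 z \<Longrightarrow> k * y \<alpha> \<le> deg D \<Longrightarrow> deg (?P1 z) \<le> e \<Longrightarrow> deg (?P2 z) \<le> d2 \<Longrightarrow> ?P1 z \<noteq> 0 \<Longrightarrow> p z = 0"
      by blast
    have "p (coord_vector (split_form y x)) = 0" if x: "x \<in> params y" "\<forall>\<alpha> i. x (Lead \<alpha> i) = 1" for x
    proof (rule p(3))
      have ad: "admissible y (split_form y x)" using x(1) by (simp add: params_def)
      have Px: "section_poly e m (coord_vector (split_form y x)) = coords (split_form y x) m" for m
        unfolding e_def by (rule section_poly_coord_vector[OF ad])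
      let ?D = "split_form y x \<alpha> ^ k"
      have D: "?D dvd coords (split_form y x) m" if "m \<in> M" for m
      proof -
        have "?D dvd split_form y x \<alpha> ^ nat (sec_order m \<alpha>)" by (rule le_imp_power_dvd) (rule M(4)[OF that])
        also have "\<dots> dvd monomial_form (split_form y x) (sec_order m)"
          unfolding monomial_form_def by (rule dvd_prodI) auto
        finally show ?thesis using M(3)[OF that] by (simp add: coords_def)
      qed
      show "?D dvd ?P1 (coord_vector (split_form y x))" unfolding Px by (rule D[OF M(2)])
      show "?D dvd ?P2 (coord_vector (split_form y x))" unfolding Px by (intro dvd_sum dvd_mult D)
      have "x (Scalar \<alpha>) \<noteq> 0" using admissibleD(1)[OF ad, of \<alpha>] by (simp add: split_form_nonzero_iff)
      then have "deg (split_form y x \<alpha>) = y \<alpha>" using x(2) by (intro split_form_degree_eq) auto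
      then show "k * y \<alpha> \<le> deg ?D" using admissibleD(1)[OF ad, of \<alpha>] by (simp add: degree_power_eq)
      show "?P1 (coord_vector (split_form y x)) \<noteq> 0" unfolding Px by (rule coords_nonzero[OF ad m0(1)])
    qed (use section_poly_degree deg2 in auto)
    then show ?thesis using p(1,2) by blast
  qed
  then obtain n p where p: "hfun UNIV n p" "p (coord_vector Q') \<noteq> 0"
    "\<forall>x\<in>params y. (\<forall>\<alpha> i. x (Lead \<alpha> i) = 1) \<longrightarrow> embedded_degree y = embedded_degree y' \<longrightarrow> p (coord_vector (split_form y x)) = 0"
    by (elim exE conjE)
  have "cox_curve u y' Q' \<notin> curve_space UNIV \<Sigma> u h d closure_of (piece y (normal_coords y (R \<sigma>)) normal_base)"
  proof (rule not_in_closure[OF F p(1) ad' y'(2) p(2)])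
    fix f :: "'o option \<Rightarrow> ('r, 'o) toric_point" assume "f \<in> piece y (normal_coords y (R \<sigma>)) normal_base"
    then obtain x where x: "x \<in> params y" "\<forall>c. c \<notin> normal_coords y (R \<sigma>) \<longrightarrow> x c = normal_base c" "f = cox_curve u y (split_form y x)"
      by (auto simp: piece_def)
    have "x (Lead \<alpha> i) = 1" for \<alpha> i using x(2)[rule_format, of "Lead \<alpha> i"] by (simp add: normal_coords_def normal_base_def image_iff)
    then show "\<exists>y'' Q. admissible y'' Q \<and> (\<Sum>\<alpha>\<in>UNIV. y'' \<alpha>) = d \<and> f = cox_curve u y'' Q \<and>
        (embedded_degree y'' = embedded_degree y' \<longrightarrow> p (coord_vector Q) = 0)"
      using p(3) x y(2) by (intro exI[of _ y] exI[of _ "split_form y x"]) (auto simp: params_def)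
  qed
  moreover have "cox_curve u y' Q' \<in> piece y' UNIV b" using x'(1) by (auto simp: piece_def Q'_def)
  ultimately show ?thesis unfolding closure_piece_eq[OF F y \<sigma>] by blast
qed

end

section \<open>The separable closure\<close>

lemma poly_map_poly_sum:
  fixes \<iota> :: "'a::field \<Rightarrow> 'o::field"
  assumes "is_field_hom \<iota>" "deg p \<le> n"
  shows "poly (map_poly \<iota> p) z = (\<Sum>i\<le>n. \<iota> (cf p i) * z ^ i)"
proof -
  have "poly (map_poly \<iota> p) z = (\<Sum>i\<le>deg p. \<iota> (cf p i) * z ^ i)"
    by (simp add: poly_altdef hom_map_poly[OF assms(1)])
  also have "\<dots> = (\<Sum>i\<le>n. \<iota> (cf p i) * z ^ i)"
    using assms(2) by (intro sum.mono_neutral_left) (auto simp: coeff_eq_0 is_field_homD[OF assms(1)])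
  finally show ?thesis .
qed

lemma map_poly_mult_hom:
  fixes \<iota> :: "'a::field \<Rightarrow> 'o::field"
  assumes \<iota>: "is_field_hom \<iota>"
  shows "map_poly \<iota> (p + q) = map_poly \<iota> p + map_poly \<iota> q" "map_poly \<iota> (p * q) = map_poly \<iota> p * map_poly \<iota> q"
    "map_poly \<iota> 1 = 1"
  by (rule poly_eqI, simp add: hom_map_poly[OF \<iota>] is_field_homD[OF \<iota>] coeff_mult field_hom_sum[OF \<iota>])+

lemma map_poly_pderiv_hom:
  fixes \<iota> :: "'a::field \<Rightarrow> 'o::field"
  assumes \<iota>: "is_field_hom \<iota>"
  shows "map_poly \<iota> (pderiv p) = pderiv (map_poly \<iota> p)"
proof -
  have "\<iota> (of_nat n) = of_nat n" for n by (induction n) (auto simp: is_field_homD[OF \<iota>])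
  then show ?thesis
    by (intro poly_eqI) (simp add: hom_map_poly[OF \<iota>] coeff_pderiv is_field_homD[OF \<iota>] del: of_nat_Suc)
qed

lemma to_ac_field_hom: "is_field_hom (to_ac :: 'k::field \<Rightarrow> 'k alg_closure)"
  by (simp add: is_field_hom_def)

lemma frobenius_field_hom:
  assumes "Factorial_Ring.prime CHAR('k::field)"
  shows "is_field_hom (\<lambda>x :: 'k. x ^ CHAR('k))"
  using freshmans_dream[OF assms refl] by (simp add: is_field_hom_def power_mult_distrib)

text \<open>Raising the coefficients of a separable polynomial to the power of the characteristic
  commutes with derivation and preserves the Bezout relation between the polynomial and its
  derivative. The new polynomial annihilates the power of \<open>x\<close>.\<close>

lemma sep_closure_frobenius:
  fixes x :: "'k::field alg_closure"
  assumes c: "Factorial_Ring.prime CHAR('k)" and x: "x \<in> sep_closure"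
  shows "x ^ CHAR('k) \<in> sep_closure"
proof -
  let ?c = "CHAR('k)" and ?\<phi> = "\<lambda>x :: 'k. x ^ CHAR('k)"
  note \<phi> = frobenius_field_hom[OF c]
  obtain p :: "'k poly" where p: "coprime p (pderiv p)" "poly (map_poly to_ac p) x = 0" using x by (auto simp: sep_closure_def)
  define g where "g k = (if k then p else pderiv p)" for k
  have "\<exists>k\<in>UNIV. g k \<noteq> 0" using p(1) by (intro bexI[of _ True]) (auto simp: g_def)
  then obtain G s where G: "G \<noteq> 0" "G = (\<Sum>k\<in>UNIV. s k * g k)" "\<forall>k\<in>UNIV. G dvd g k"
    using poly_bezout[of UNIV g] by (meson finite)
  have "G dvd p" "G dvd pderiv p" using bspec[OF G(3), of True] bspec[OF G(3), of False] by (auto simp: g_def)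
  then have "is_unit G" using p(1) coprime_common_divisor by blast
  then obtain G' where "G * G' = 1" by (metis dvd_def)
  moreover have "G = s True * p + s False * pderiv p" unfolding G(2) by (simp add: UNIV_bool g_def)
  ultimately have "(s True * G') * p + (s False * G') * pderiv p = 1" by (simp add: algebra_simps)
  then have "map_poly ?\<phi> ((s True * G') * p + (s False * G') * pderiv p) = map_poly ?\<phi> 1" by simp
  then have b: "map_poly ?\<phi> (s True * G') * map_poly ?\<phi> p + map_poly ?\<phi> (s False * G') * pderiv (map_poly ?\<phi> p) = 1"
    by (simp only: map_poly_mult_hom[OF \<phi>] map_poly_pderiv_hom[OF \<phi>])
  have "coprime (map_poly ?\<phi> p) (pderiv (map_poly ?\<phi> p))"
  proof (rule coprimeI)
    fix D assume "D dvd map_poly ?\<phi> p" "D dvd pderiv (map_poly ?\<phi> p)"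
    then have "D dvd map_poly ?\<phi> (s True * G') * map_poly ?\<phi> p + map_poly ?\<phi> (s False * G') * pderiv (map_poly ?\<phi> p)"
      by (intro dvd_add dvd_mult)
    then show "is_unit D" by (simp only: b)
  qed
  moreover have "poly (map_poly to_ac (map_poly ?\<phi> p)) (x ^ ?c) = 0"
  proof -
    have "poly (map_poly to_ac (map_poly ?\<phi> p)) (x ^ ?c) = (\<Sum>i\<le>deg p. to_ac (cf p i ^ ?c) * (x ^ ?c) ^ i)"
      by (simp add: poly_map_poly_sum[OF to_ac_field_hom, of _ "deg p"] hom_map_poly[OF \<phi>])
    also have "\<dots> = (\<Sum>i\<le>deg p. (to_ac (cf p i) * x ^ i) ^ ?c)"
      by (simp add: power_mult_distrib mult.commute flip: power_mult)
    also have "\<dots> = (\<Sum>i\<le>deg p. to_ac (cf p i) * x ^ i) ^ ?c"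
      by (rule freshmans_dream_sum[symmetric]) (use c in simp_all)
    also have "\<dots> = 0"
      using p(2) c by (simp add: poly_map_poly_sum[OF to_ac_field_hom, of _ "deg p"] prime_gt_0_nat)
    finally show ?thesis .
  qed
  ultimately show ?thesis by (auto simp: sep_closure_def)
qed

text \<open>A vanishing derivative leaves only exponents divisible by the characteristic, which is
  then positive because the degree is; \<open>r\<close> is obtained by dividing all
  exponents.\<close>

lemma inseparable_polynomial:
  fixes p :: "'k::field poly"
  assumes "pderiv p = 0" "deg p \<noteq> 0"
  shows "0 < CHAR('k) \<and> (\<exists>r. deg r < deg p \<and> r \<noteq> 0 \<and> (\<forall>z :: 'k alg_closure. poly (map_poly to_ac p) z = poly (map_poly to_ac r) (z ^ CHAR('k))))"
proof -
  let ?c = "CHAR('k)" and ?n = "deg p"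
  have div: "?c dvd i" if "cf p i \<noteq> 0" for i
  proof (cases i)
    case (Suc j)
    have "cf (pderiv p) j = 0" using assms(1) by simp
    then have "of_nat (Suc j) = (0 :: 'k)" using that Suc by (simp add: coeff_pderiv del: of_nat_Suc)
    then show ?thesis unfolding Suc of_nat_eq_0_iff_char_dvd .
  qed simp
  have n: "cf p ?n \<noteq> 0" using assms(2) by auto
  then have cn: "?c dvd ?n" by (rule div)
  then have c0: "0 < ?c" using assms(2) by (cases "?c = 0") auto
  then have c: "Factorial_Ring.prime ?c" by (rule prime_CHAR_semidom)
  define r where "r = (\<Sum>i\<le>?n div ?c. Polynomial.monom (cf p (?c * i)) i)"
  have cfr: "cf r i = (if i \<le> ?n div ?c then cf p (?c * i) else 0)" for i
    by (simp add: r_def coeff_sum)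
  have "deg r \<le> ?n div ?c" by (rule degree_le) (simp add: cfr)
  also have "\<dots> < ?n" using assms(2) prime_gt_1_nat[OF c] by simp
  finally have "deg r < ?n" .
  moreover have "cf r (?n div ?c) \<noteq> 0" using n cn by (simp add: cfr)
  then have "r \<noteq> 0" by auto
  moreover have "poly (map_poly to_ac p) z = poly (map_poly to_ac r) (z ^ ?c)" for z :: "'k alg_closure"
  proof -
    have "poly (map_poly to_ac p) z = (\<Sum>i\<le>?n. to_ac (cf p i) * z ^ i)"
      by (rule poly_map_poly_sum[OF to_ac_field_hom order_refl])
    also have "\<dots> = (\<Sum>i\<in>(\<lambda>i. ?c * i) ` {..?n div ?c}. to_ac (cf p i) * z ^ i)"
    proof (rule sum.mono_neutral_right)
      show "(\<lambda>i. ?c * i) ` {..?n div ?c} \<subseteq> {..?n}"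
        using c0 by (auto simp: less_eq_div_iff_mult_less_eq mult.commute)
      show "\<forall>i\<in>{..?n} - (\<lambda>i. ?c * i) ` {..?n div ?c}. to_ac (cf p i) * z ^ i = 0"
      proof
        fix i assume i: "i \<in> {..?n} - (\<lambda>i. ?c * i) ` {..?n div ?c}"
        have "\<not> ?c dvd i"
        proof
          assume "?c dvd i"
          then have "i = ?c * (i div ?c)" by simp
          moreover have "i div ?c \<le> ?n div ?c" using i by (intro div_le_mono) simp
          ultimately show False using i by blast
        qed
        then show "to_ac (cf p i) * z ^ i = 0" using div[of i] by auto
      qed
    qed simp
    also have "\<dots> = (\<Sum>i\<le>?n div ?c. to_ac (cf p (?c * i)) * z ^ (?c * i))"
      using c0 by (subst sum.reindex) (auto simp: inj_on_def)
    also have "\<dots> = (\<Sum>i\<le>?n div ?c. to_ac (cf r i) * (z ^ ?c) ^ i)"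
      by (intro sum.cong) (auto simp: cfr power_mult)
    also have "\<dots> = poly (map_poly to_ac r) (z ^ ?c)"
      by (rule poly_map_poly_sum[OF to_ac_field_hom, symmetric]) fact
    finally show ?thesis .
  qed
  ultimately show ?thesis using c0 by blast
qed

text \<open>Powers of the characteristic exponent, so that \<open>q = 1\<close> is the only one in
  characteristic 0 and both characteristics are treated alike.\<close>

definition char_power :: "'k::field itself \<Rightarrow> nat \<Rightarrow> bool" where
  "char_power _ q \<longleftrightarrow> q = 1 \<or> (Factorial_Ring.prime CHAR('k) \<and> (\<exists>j. q = CHAR('k) ^ j))"

lemma char_power_pos: "char_power TYPE('k::field) q \<Longrightarrow> 0 < q"
  by (auto simp: char_power_def prime_gt_0_nat)

lemma char_power_mult:
  "char_power TYPE('k::field) q \<Longrightarrow> char_power TYPE('k) q' \<Longrightarrow> char_power TYPE('k) (q * q')"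
  by (auto simp: char_power_def simp flip: power_add)

lemma char_power_sum:
  assumes "char_power TYPE('k::field) q"
  shows "(\<Sum>i\<in>S. f i :: 'k alg_closure) ^ q = (\<Sum>i\<in>S. f i ^ q)"
  using assms unfolding char_power_def
proof (elim disjE conjE exE)
  fix j assume "Factorial_Ring.prime CHAR('k)" "q = CHAR('k) ^ j"
  then show ?thesis by (intro freshmans_dream_sum'[of q j]) simp_all
qed simp

lemma char_power_sep_closure:
  fixes x :: "'k::field alg_closure"
  assumes "char_power TYPE('k) q" "x \<in> sep_closure"
  shows "x ^ q \<in> sep_closure"
proof -
  have "x ^ (CHAR('k) ^ j) \<in> sep_closure" if "Factorial_Ring.prime CHAR('k)" for j
  proof (induction j)
    case (Suc j)
    then show ?case using sep_closure_frobenius[OF that, of "x ^ (CHAR('k) ^ j)"] by (simp add: mult.commute flip: power_mult)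
  qed (simp add: assms(2))
  then show ?thesis using assms by (auto simp: char_power_def)
qed

text \<open>Among all pairs with \<open>p\<close> annihilating \<open>x ^ q\<close>, take one of
  least degree. If the derivative vanished, \<open>p\<close> could be replaced by a polynomial of
  smaller degree and \<open>q\<close> by a larger power. If \<open>D\<close> divides
  \<open>p\<close> and its derivative, then \<open>D\<close> has smaller degree and cannot
  annihilate \<open>x ^ q\<close>; so the cofactor does, and by minimality \<open>D\<close> is
  constant.\<close>

lemma ex_char_power_sep_closure:
  fixes x :: "'k::field alg_closure"
  shows "\<exists>q. char_power TYPE('k) q \<and> x ^ q \<in> sep_closure"
proof -
  let ?P = "\<lambda>(p :: 'k poly, q). p \<noteq> 0 \<and> char_power TYPE('k) q \<and> poly (map_poly to_ac p) (x ^ q) = 0"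
  obtain p0 :: "'k poly" where "p0 \<noteq> 0" "poly (map_poly to_ac p0) x = 0" by (rule alg_closure_algebraic)
  then have "?P (p0, 1)" by (simp add: char_power_def)
  from ex_has_least_nat[of ?P, OF this, of "\<lambda>(p, q). deg p"] obtain p q where p: "p \<noteq> 0" and q: "char_power TYPE('k) q"
    and root: "poly (map_poly to_ac p) (x ^ q) = 0"
    and min: "\<And>p' q'. p' \<noteq> 0 \<Longrightarrow> char_power TYPE('k) q' \<Longrightarrow> poly (map_poly to_ac p') (x ^ q') = 0 \<Longrightarrow> deg p \<le> deg p'"
    by (auto simp: split_beta)
  have dp: "deg p \<noteq> 0"
  proof
    assume "deg p = 0"
    then obtain a where "p = [:a:]" by (rule degree_eq_zeroE)
    then show False using root p by (simp add: map_poly_pCons)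
  qed
  have pd: "pderiv p \<noteq> 0"
  proof
    assume "pderiv p = 0"
    then obtain r where r: "0 < CHAR('k)" "deg r < deg p" "r \<noteq> 0"
      "\<And>z :: 'k alg_closure. poly (map_poly to_ac p) z = poly (map_poly to_ac r) (z ^ CHAR('k))"
      using inseparable_polynomial[OF _ dp] by blast
    have "Factorial_Ring.prime CHAR('k)" using r(1) by (rule prime_CHAR_semidom)
    then have "char_power TYPE('k) (q * CHAR('k))"
      by (intro char_power_mult q) (auto simp: char_power_def intro!: exI[of _ 1])
    moreover have "poly (map_poly to_ac r) (x ^ (q * CHAR('k))) = 0" using root by (simp add: r(4) flip: power_mult)
    ultimately show False using min[of r] r(2,3) by fastforce
  qed
  have "coprime p (pderiv p)"
  proof (rule coprimeI)
    fix D assume D: "D dvd p" "D dvd pderiv p"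
    obtain E where E: "p = D * E" using D(1) by (elim dvdE)
    have 0: "D \<noteq> 0" "E \<noteq> 0" using E p by auto
    have "deg D \<le> deg (pderiv p)" using D(2) pd by (rule dvd_imp_degree_le)
    also have "\<dots> \<le> deg p - 1" by (rule degree_le) (auto simp: coeff_pderiv coeff_eq_0)
    also have "\<dots> < deg p" using dp by simp
    finally have "\<not> poly (map_poly to_ac D) (x ^ q) = 0" using min[OF 0(1) q] by fastforce
    moreover have "poly (map_poly to_ac D) (x ^ q) * poly (map_poly to_ac E) (x ^ q) = 0"
      using root unfolding E map_poly_mult_hom(2)[OF to_ac_field_hom] by simp
    ultimately have "deg p \<le> deg E" using min[OF 0(2) q] by simp
    moreover have "deg p = deg D + deg E" unfolding E using 0 by (intro degree_mult_eq)
    ultimately have "deg D = 0" by simp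
    then show "is_unit D" using 0(1) by (simp add: is_unit_iff_degree)
  qed
  then show ?thesis using q root by (auto simp: sep_closure_def)
qed

lemma ex_char_power_sep_closure_finite:
  fixes S :: "'k::field alg_closure set"
  assumes "finite S"
  shows "\<exists>q. char_power TYPE('k) q \<and> (\<forall>x\<in>S. x ^ q \<in> sep_closure)"
  using assms
proof induction
  case empty then show ?case by (intro exI[of _ 1]) (simp add: char_power_def)
next
  case (insert x S)
  then obtain q where q: "char_power TYPE('k) q" "\<forall>x\<in>S. x ^ q \<in> sep_closure" by blast
  obtain q' where q': "char_power TYPE('k) q'" "x ^ q' \<in> sep_closure" using ex_char_power_sep_closure by blast
  have "y ^ (q * q') \<in> sep_closure" if "y \<in> insert x S" for y
  proof (cases "y = x")
    case True
    then show ?thesis using char_power_sep_closure[OF q(1) q'(2)] by (simp add: mult.commute flip: power_mult)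
  next
    case False
    then show ?thesis using that q(2) char_power_sep_closure[OF q'(1), of "y ^ q"] by (simp flip: power_mult)
  qed
  then show ?case using char_power_mult[OF q(1) q'(1)] by blast
qed

definition scale_exponents :: "nat \<Rightarrow> ('v \<Rightarrow>\<^sub>0 nat) \<Rightarrow> 'v \<Rightarrow>\<^sub>0 nat" where
  "scale_exponents q t = Poly_Mapping.mapp (\<lambda>_ n. q * n) t"

lemma lookup_scale_exponents [simp]: "Poly_Mapping.lookup (scale_exponents q t) v = q * Poly_Mapping.lookup t v"
  by (simp add: scale_exponents_def lookup_mapp when_def in_keys_iff)

lemma keys_scale_exponents [simp]: "0 < q \<Longrightarrow> Poly_Mapping.keys (scale_exponents q t) = Poly_Mapping.keys t"
  by (auto simp: in_keys_iff)

lemma inj_scale_exponents: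
  assumes "0 < q"
  shows "inj (scale_exponents q)"
proof (rule injI)
  fix s t :: "'v \<Rightarrow>\<^sub>0 nat"
  assume "scale_exponents q s = scale_exponents q t"
  then have "q * Poly_Mapping.lookup s v = q * Poly_Mapping.lookup t v" for v by (metis lookup_scale_exponents)
  then show "s = t" using assms by (intro poly_mapping_eqI) simp
qed

text \<open>Raising to a power of the characteristic exponent is additive: it raises the
  coefficients to this power and multiplies the exponents by it. A single power brings all of the
  finitely many coefficients into the separable closure.\<close>

lemma homogeneous_over_sep_closure:
  fixes p :: "('v \<Rightarrow>\<^sub>0 nat) \<Rightarrow>\<^sub>0 'k::field alg_closure"
  assumes p: "homogeneous_over UNIV p"
  shows "\<exists>p' q. homogeneous_over sep_closure p' \<and> 0 < q \<and> (\<forall>x. mpoly_eval p' x = mpoly_eval p x ^ q)"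
proof -
  let ?K = "Poly_Mapping.keys p" and ?l = "Poly_Mapping.lookup p"
  obtain q where q: "char_power TYPE('k) q" "\<forall>x\<in>?l ` ?K. x ^ q \<in> sep_closure"
    using ex_char_power_sep_closure_finite[of "?l ` ?K"] by auto
  have q0: "0 < q" by (rule char_power_pos[OF q(1)])
  let ?S = "scale_exponents q ` ?K"
  define p' where "p' = (\<Sum>t\<in>?K. Poly_Mapping.single (scale_exponents q t) (?l t ^ q))"
  have inj: "inj_on (scale_exponents q) ?K" using inj_scale_exponents[OF q0] by (rule inj_on_subset) simp
  have sum: "Poly_Mapping.lookup p' s = (\<Sum>t\<in>?K. ?l t ^ q when scale_exponents q t = s)" for s
    by (simp add: p'_def lookup_sum lookup_single)
  have l1: "Poly_Mapping.lookup p' (scale_exponents q t) = ?l t ^ q" if t: "t \<in> ?K" for t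
  proof -
    have "(\<Sum>t'\<in>?K. ?l t' ^ q when scale_exponents q t' = scale_exponents q t) = (\<Sum>t'\<in>?K. if t' = t then ?l t ^ q else 0)"
      using inj_onD[OF inj _ _ t] by (intro sum.cong) (auto simp: when_def)
    then show ?thesis using t by (simp add: sum)
  qed
  have l0: "Poly_Mapping.lookup p' s = 0" if "s \<notin> ?S" for s
    unfolding sum using that by (intro sum.neutral) (auto simp: when_def)
  have keys: "Poly_Mapping.keys p' \<subseteq> ?S" using l0 by (auto simp: in_keys_iff)
  have 0: "(0 :: 'k alg_closure) \<in> sep_closure"
    by (auto simp: sep_closure_def intro!: exI[of _ "[:0, 1:]"] simp: pderiv_pCons map_poly_pCons simp flip: one_pCons)
  have "Poly_Mapping.lookup p' s \<in> sep_closure" for s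
    using l0[of s] l1 q(2) 0 by (cases "s \<in> ?S") auto
  moreover obtain n where n: "\<forall>t\<in>?K. (\<Sum>v\<in>Poly_Mapping.keys t. Poly_Mapping.lookup t v) = n"
    using p by (auto simp: homogeneous_over_def)
  have "(\<Sum>v\<in>Poly_Mapping.keys s. Poly_Mapping.lookup s v) = q * n" if "s \<in> Poly_Mapping.keys p'" for s
    using keys that n q0 by (auto simp flip: sum_distrib_left)
  ultimately have "homogeneous_over sep_closure p'" by (auto simp: homogeneous_over_def)
  moreover have "mpoly_eval p' x = mpoly_eval p x ^ q" for x
  proof -
    have "mpoly_eval p' x = (\<Sum>s\<in>?S. Poly_Mapping.lookup p' s * (\<Prod>v\<in>Poly_Mapping.keys s. x v ^ Poly_Mapping.lookup s v))"
      by (rule mpoly_eval_superset) (use keys in auto)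
    also have "\<dots> = (\<Sum>t\<in>?K. ?l t ^ q * (\<Prod>v\<in>Poly_Mapping.keys t. x v ^ (q * Poly_Mapping.lookup t v)))"
      unfolding sum.reindex[OF inj] using q0 by (simp add: l1)
    also have "\<dots> = (\<Sum>t\<in>?K. (?l t * (\<Prod>v\<in>Poly_Mapping.keys t. x v ^ Poly_Mapping.lookup t v)) ^ q)"
      by (simp add: power_mult_distrib prod_power_distrib mult.commute[of q] power_mult)
    also have "\<dots> = mpoly_eval p x ^ q" unfolding mpoly_eval_def by (rule char_power_sum[OF q(1), symmetric])
    finally show ?thesis .
  qed
  ultimately show ?thesis using q0 by blast
qed

text \<open>A field is purely inseparable over its separable closure, so a polynomial and a suitable
  power of it with separable coefficients define the same open set.\<close>

lemma curve_space_sep_closure: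
  "curve_space (sep_closure :: 'k::field alg_closure set) \<Sigma> u h d = curve_space UNIV \<Sigma> u h d"
proof -
  let ?O = "\<lambda>e p. {f \<in> rational_curves \<Sigma> u d. \<exists>g. embedded_forms u h f e g \<and>
         mpoly_eval p (\<lambda>(m, j). cf (g m) j) \<noteq> (0 :: 'k alg_closure)}"
  have "{?O e p | e p. homogeneous_over sep_closure p} = {?O e p | e p. homogeneous_over UNIV p}"
  proof (intro subset_antisym subsetI)
    fix A assume "A \<in> {?O e p | e p. homogeneous_over sep_closure p}"
    then show "A \<in> {?O e p | e p. homogeneous_over UNIV p}" by (auto simp: homogeneous_over_def)
  next
    fix A assume "A \<in> {?O e p | e p. homogeneous_over UNIV p}"
    then obtain e p where A: "A = ?O e p" "homogeneous_over UNIV p" by blast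
    obtain p' q where p': "homogeneous_over sep_closure p'" "0 < q" "\<forall>x. mpoly_eval p' x = mpoly_eval p x ^ q"
      using homogeneous_over_sep_closure[OF A(2)] by (elim exE conjE)
    have "?O e p' = ?O e p" using p'(2) by (simp add: p'(3))
    then show "A \<in> {?O e p | e p. homogeneous_over sep_closure p}" using A(1) p'(1) by blast
  qed
  then show ?thesis by (simp add: curve_space_def)
qed

section \<open>Dimension and components\<close>

context complete_fan begin

text \<open>The lattice points of the dual effective cone with anticanonical degree
  \<open>d\<close>, which label the strata; nonnegativity on the effective divisors is built into
  the type.\<close>

definition curve_degrees :: "nat \<Rightarrow> ('s \<Rightarrow> nat) set" where
  "curve_degrees d = {y. (\<forall>m. (\<Sum>\<alpha>\<in>UNIV. int (y \<alpha>) * pairing m (u \<alpha>)) = 0) \<and> (\<Sum>\<alpha>\<in>UNIV. y \<alpha>) = d}"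

lemma curve_degreesD:
  assumes "y \<in> curve_degrees d"
  shows "(\<Sum>\<alpha>\<in>UNIV. int (y \<alpha>) * pairing m (u \<alpha>)) = 0" "(\<Sum>\<alpha>\<in>UNIV. y \<alpha>) = d"
  using assms by (auto simp: curve_degrees_def)

lemma finite_curve_degrees: "finite (curve_degrees d)"
proof (rule finite_subset)
  show "curve_degrees d \<subseteq> PiE UNIV (\<lambda>_. {..d})"
  proof
    fix y assume "y \<in> curve_degrees d"
    then have "y \<alpha> \<le> d" for \<alpha> using curve_degreesD(2)[of y d] member_le_sum[of \<alpha> UNIV y] by simp
    then show "y \<in> PiE UNIV (\<lambda>_. {..d})" by (auto simp: PiE_def)
  qed
qed (auto intro: finite_PiE)

end

context projective_fan begin

text \<open>The embedding is \<open>to_ac\<close> for the dimension over the base field and the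
  identity for the components. The count of components asks for a surjective embedding because the
  functions separating different strata have coefficients in the whole closed field.\<close>

lemma curve_space_equidimensional:
  fixes \<iota> :: "'a::field \<Rightarrow> 'o::alg_closed_field"
  assumes \<iota>: "is_field_hom \<iota>" and alg: "\<And>x. \<exists>p. p \<noteq> 0 \<and> poly (map_poly \<iota> p) x = 0"
  shows "curve_degrees d \<noteq> {} \<Longrightarrow> krull_dim (curve_space (range \<iota>) \<Sigma> u h d) = ereal (real (CARD('r) + d))"
    "curve_degrees d = {} \<Longrightarrow> krull_dim (curve_space (range \<iota>) \<Sigma> u h d) = - \<infinity>"
    "range \<iota> = UNIV \<Longrightarrow> card (top_dim_components (curve_space (range \<iota>) \<Sigma> u h d)) = card (curve_degrees d)"
proof -
  let ?T = "curve_space (range \<iota>) \<Sigma> u h d"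
  define S where "S y = piece y UNIV (normal_base :: 's coord \<Rightarrow> 'o)" for y
  have F: "is_subring (range \<iota>)" by (rule is_subring_range[OF \<iota>])
  obtain \<sigma> where \<sigma>: "full_cone \<sigma>" using ex_full_cone[of 0] by blast
  define N where "N y = piece y (normal_coords y (R \<sigma>)) (normal_base :: 's coord \<Rightarrow> 'o)" for y
  have closure: "?T closure_of S y = ?T closure_of N y" if "y \<in> curve_degrees d" for y
    unfolding S_def N_def by (rule closure_piece_eq[OF F curve_degreesD[OF that] \<sigma>])
  have cover: "topspace ?T = (\<Union>y\<in>curve_degrees d. S y)"
  proof (intro subset_antisym subsetI)
    fix f assume "f \<in> topspace ?T"
    then obtain y Q where Q: "admissible y Q" "(\<Sum>\<alpha>\<in>UNIV. y \<alpha>) = d" "f = cox_curve u y Q"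
      unfolding topspace_curve_space[OF F] using rational_curveE by blast
    obtain x where "x \<in> params y" "Q = split_form y x" using admissible_split[OF Q(1)] by blast
    then have "f \<in> S y" using Q(3) by (auto simp: S_def piece_def)
    moreover have "y \<in> curve_degrees d" using Q(2) admissibleD(3)[OF Q(1)] by (simp add: curve_degrees_def)
    ultimately show "f \<in> (\<Union>y\<in>curve_degrees d. S y)" by blast
  next
    fix f assume "f \<in> (\<Union>y\<in>curve_degrees d. S y)"
    then show "f \<in> topspace ?T" unfolding topspace_curve_space[OF F] S_def
      using piece_subset[OF curve_degreesD(2)] by blast
  qed
  have irr: "irreducible_closed ?T (?T closure_of S y)" if y: "y \<in> curve_degrees d" for y
  proof -
    obtain x :: "'s coord \<Rightarrow> 'o" where "x \<in> params y"
      using ex_distinct_params[OF curve_degreesD(1)[OF y]] by (elim exE conjE)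
    then have "piece y UNIV (normal_base :: 's coord \<Rightarrow> 'o) \<noteq> {}" by (auto simp: piece_def)
    then show ?thesis unfolding S_def by (intro piece_irreducible[OF F curve_degreesD(2)[OF y]])
  qed
  have low: "\<exists>Z. irreducible_chain ?T (CARD('r) + d) Z \<and> Z (CARD('r) + d) \<subseteq> ?T closure_of S y"
    if y: "y \<in> curve_degrees d" for y
    unfolding closure[OF y] unfolding N_def by (rule chain_lower[OF \<iota> alg curve_degreesD[OF y] \<sigma>])
  have up: "n \<le> CARD('r) + d"
    if y: "y \<in> curve_degrees d" and Z: "irreducible_chain ?T n Z" "Z n \<subseteq> ?T closure_of S y" for y n Z
  proof -
    have "n \<le> card (normal_coords y (R \<sigma>))"
    proof (rule chain_upper_bound[OF \<iota> curve_degreesD(2)[OF y] normal_coords_card(1) _ Z(1)])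
      show "normal_base c \<in> range \<iota>" for c :: "'s coord"
        using is_subringD(1,2)[OF F] by (cases c) (auto simp: normal_base_def)
      show "Z n \<subseteq> ?T closure_of piece y (normal_coords y (R \<sigma>)) normal_base" using Z(2) closure[OF y] by (simp add: N_def)
    qed
    then show ?thesis by (simp add: normal_coords_card(2) full_cone_basis(2)[OF \<sigma>] curve_degreesD(2)[OF y])
  qed
  note * = equidimensional_space[OF finite_curve_degrees cover irr low up]
  show "curve_degrees d \<noteq> {} \<Longrightarrow> krull_dim ?T = ereal (real (CARD('r) + d))" by (rule *(1))
  show "curve_degrees d = {} \<Longrightarrow> krull_dim ?T = - \<infinity>" by (rule *(2))
  assume U: "range \<iota> = UNIV"
  show "card (top_dim_components ?T) = card (curve_degrees d)"
  proof (rule *(3))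
    fix y y' assume y: "y \<in> curve_degrees d" "y' \<in> curve_degrees d" "y \<noteq> y'"
    show "\<not> S y \<subseteq> ?T closure_of S y'"
      unfolding S_def U by (rule piece_not_in_closure[OF curve_degreesD[OF y(2)] curve_degreesD[OF y(1)] y(3)[symmetric]])
  qed
qed

theorem curves_dim_eq:
  "curves_dim TYPE('k::field) \<Sigma> u h d = (if curve_degrees d = {} then - \<infinity> else ereal (real (CARD('r) + d)))"
proof -
  have "\<exists>p :: 'k poly. p \<noteq> 0 \<and> poly (map_poly to_ac p) x = 0" for x
    using alg_closure_algebraic[of x] by blast
  note * = curve_space_equidimensional[OF to_ac_field_hom this]
  show ?thesis unfolding curves_dim_def base_field_def using *(1,2)[of d] by simp
qed

theorem curves_components_eq:
  "curves_components TYPE('k::field) \<Sigma> u h d = card (curve_degrees d)"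
proof -
  have "\<exists>p :: 'k alg_closure poly. p \<noteq> 0 \<and> poly (map_poly id p) x = 0" for x
    by (intro exI[of _ "[:- x, 1:]"]) simp
  then show ?thesis unfolding curves_components_def curve_space_sep_closure
    using curve_space_equidimensional(3)[of "id :: 'k alg_closure \<Rightarrow> 'k alg_closure" d] by (simp add: is_field_hom_def)
qed

end

section \<open>Lattice points of the dual effective cone\<close>

lemma card_compositions_le:
  fixes l :: "'b \<Rightarrow> nat"
  assumes S: "finite S" "S \<noteq> {}" and l: "\<And>b. b \<in> S \<Longrightarrow> 0 < l b"
  shows "card {n \<in> PiE S (\<lambda>_. {..d}). (\<Sum>b\<in>S. n b * l b) = d} \<le> (d + 1) ^ (card S - 1)"
proof -
  obtain b0 where b0: "b0 \<in> S" using S(2) by blast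
  let ?N = "{n \<in> PiE S (\<lambda>_. {..d}). (\<Sum>b\<in>S. n b * l b) = d}" and ?S = "S - {b0}"
  have sum: "(\<Sum>b\<in>S. n b * l b) = n b0 * l b0 + (\<Sum>b\<in>?S. n b * l b)" for n using S(1) b0 by (simp add: sum.remove)
  have "inj_on (\<lambda>n. restrict n ?S) ?N"
  proof (rule inj_onI)
    fix n n' assume n: "n \<in> ?N" "n' \<in> ?N" and eq: "restrict n ?S = restrict n' ?S"
    have eq': "n b = n' b" if "b \<in> ?S" for b using fun_cong[OF eq, of b] that by simp
    then have "(\<Sum>b\<in>?S. n b * l b) = (\<Sum>b\<in>?S. n' b * l b)" by (intro sum.cong) auto
    moreover have "(\<Sum>b\<in>S. n b * l b) = d" "(\<Sum>b\<in>S. n' b * l b) = d" using n by auto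
    ultimately have "n b0 * l b0 = n' b0 * l b0" using sum[of n] sum[of n'] by linarith
    then have "n b0 = n' b0" using l[OF b0] by simp
    then have "n b = n' b" if "b \<in> S" for b using that eq' by (cases "b = b0") auto
    then show "n = n'" using n by (intro PiE_ext[of n S _ n']) auto
  qed
  moreover have "(\<lambda>n. restrict n ?S) ` ?N \<subseteq> PiE ?S (\<lambda>_. {..d})" by (auto simp: PiE_def Pi_def)
  moreover have "finite (PiE ?S (\<lambda>_. {..d}))" using S(1) by (intro finite_PiE) auto
  ultimately have "card ?N \<le> card (PiE ?S (\<lambda>_. {..d}))" by (intro card_inj_on_le)
  also have "\<dots> = (d + 1) ^ (card S - 1)" using S(1) b0 by (simp add: card_PiE)
  finally show ?thesis .
qed

text \<open>All coordinates but one are chosen freely up to \<open>N div card S\<close>; their sum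
  is at most \<open>N\<close>, and the remaining coordinate fills the gap.\<close>

lemma card_compositions_ge:
  assumes S: "finite S" "S \<noteq> {}"
  shows "(N div card S + 1) ^ (card S - 1) \<le> card {n \<in> PiE S (\<lambda>_. {..N}). (\<Sum>b\<in>S. n b) = N}"
proof -
  obtain b0 where b0: "b0 \<in> S" using S(2) by blast
  let ?N = "{n \<in> PiE S (\<lambda>_. {..N}). (\<Sum>b\<in>S. n b) = N}" and ?S = "S - {b0}" and ?q = "N div card S"
  let ?f = "\<lambda>n. n(b0 := N - (\<Sum>b\<in>?S. n b))"
  have le: "(\<Sum>b\<in>?S. n b) \<le> N" if "n \<in> PiE ?S (\<lambda>_. {..?q})" for n
  proof -
    have "(\<Sum>b\<in>?S. n b) \<le> (\<Sum>b\<in>?S. ?q)" using that by (intro sum_mono) (auto simp: PiE_def Pi_def)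
    also have "\<dots> \<le> card S * ?q" using S(1) b0 by simp
    also have "\<dots> \<le> N" by simp
    finally show ?thesis .
  qed
  have "inj_on ?f (PiE ?S (\<lambda>_. {..?q}))"
  proof (rule inj_onI)
    fix n n' assume n: "n \<in> PiE ?S (\<lambda>_. {..?q})" "n' \<in> PiE ?S (\<lambda>_. {..?q})" and eq: "?f n = ?f n'"
    have "n b = n' b" if "b \<in> ?S" for b using fun_cong[OF eq, of b] that by simp
    then show "n = n'" using n by (intro PiE_ext[of n ?S _ n']) auto
  qed
  moreover have "?f ` PiE ?S (\<lambda>_. {..?q}) \<subseteq> ?N"
  proof
    fix g assume "g \<in> ?f ` PiE ?S (\<lambda>_. {..?q})"
    then obtain n where n: "n \<in> PiE ?S (\<lambda>_. {..?q})" "g = ?f n" by blast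
    have "(\<Sum>b\<in>S. g b) = g b0 + (\<Sum>b\<in>?S. g b)" using S(1) b0 by (simp add: sum.remove)
    also have "(\<Sum>b\<in>?S. g b) = (\<Sum>b\<in>?S. n b)" using n(2) by (intro sum.cong) auto
    finally have s: "(\<Sum>b\<in>S. g b) = N" using le[OF n(1)] n(2) by simp
    have "g b \<le> N" if "b \<in> S" for b using member_le_sum[of b S g] that S(1) s by simp
    moreover have "g b = undefined" if "b \<notin> S" for b
    proof -
      have "b \<noteq> b0" "b \<notin> ?S" using that b0 by auto
      then show ?thesis using n by (simp add: PiE_arb[OF n(1)])
    qed
    ultimately show "g \<in> ?N" using s by (auto simp: PiE_def Pi_def extensional_def)
  qed
  moreover have "finite ?N" using S(1) by (intro finite_subset[OF _ finite_PiE[of S "\<lambda>_. {..N}"]]) auto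
  ultimately have "card (PiE ?S (\<lambda>_. {..?q})) \<le> card ?N" by (intro card_inj_on_le)
  moreover have "card (PiE ?S (\<lambda>_. {..?q})) = (?q + 1) ^ (card S - 1)" using S(1) b0 by (simp add: card_PiE)
  ultimately show ?thesis by simp
qed

section \<open>Generators of the cones of the dual fan\<close>

locale dual_fan = complete_fan \<Sigma> u
  for \<Sigma> :: "(real ^ 'r::finite) set set" and u :: "'s::finite \<Rightarrow> int ^ 'r" +
  fixes \<Delta> :: "(real ^ 's) set set"
  assumes dual_fan: "regular_fan (pic_dual_lattice u) \<Delta>"
    and support: "\<Union>\<Delta> = dual_effective_cone u"
begin

definition degree_vec :: "('s \<Rightarrow> nat) \<Rightarrow> real ^ 's" where
  "degree_vec y = (\<chi> \<alpha>. real (y \<alpha>))"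

text \<open>The same rounding as in the definition of the period; at lattice points of the dual
  effective cone the inner product is already a natural number.\<close>

definition anti_degree :: "real ^ 's \<Rightarrow> nat" where
  "anti_degree v = nat \<lfloor>v \<bullet> int_vec anticanonical_divisor\<rfloor>"

lemma inner_character: "x \<bullet> int_vec (character_divisor u m) = (\<Sum>\<alpha>\<in>UNIV. x $ \<alpha> * of_int (pairing m (u \<alpha>)))"
  by (simp add: inner_vec_def int_vec_def character_divisor_def)

lemma inner_anticanonical: "x \<bullet> int_vec anticanonical_divisor = (\<Sum>\<alpha>\<in>UNIV. x $ \<alpha>)"
  by (simp add: inner_vec_def int_vec_def anticanonical_divisor_def)

lemma degree_vec_inject: "degree_vec y = degree_vec y' \<longleftrightarrow> y = y'"
  by (auto simp: degree_vec_def vec_eq_iff)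

lemma inner_degree_vec: "degree_vec y \<bullet> int_vec anticanonical_divisor = real (\<Sum>\<alpha>\<in>UNIV. y \<alpha>)"
  by (simp add: inner_anticanonical degree_vec_def)

lemma anti_degree_vec [simp]: "anti_degree (degree_vec y) = (\<Sum>\<alpha>\<in>UNIV. y \<alpha>)"
  by (simp add: anti_degree_def inner_degree_vec del: of_nat_sum)

lemma degree_vec_pic_dual: "degree_vec y \<in> pic_dual_space u \<longleftrightarrow> (\<forall>m. (\<Sum>\<alpha>\<in>UNIV. int (y \<alpha>) * pairing m (u \<alpha>)) = 0)"
proof -
  have "degree_vec y \<bullet> int_vec (character_divisor u m) = of_int (\<Sum>\<alpha>\<in>UNIV. int (y \<alpha>) * pairing m (u \<alpha>))" for m
    by (simp add: inner_character degree_vec_def)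
  then show ?thesis unfolding pic_dual_space_def by (simp only: mem_Collect_eq of_int_eq_0_iff)
qed

lemma pic_dual_space_closed:
  assumes "\<And>b. b \<in> S \<Longrightarrow> b \<in> pic_dual_space u"
  shows "(\<Sum>b\<in>S. c b *\<^sub>R b) \<in> pic_dual_space u"
  using assms by (simp add: pic_dual_space_def inner_sum_left)

text \<open>Pairing with the invariant prime divisors gives the entries of \<open>x\<close>, and the
  span of the divisors of characters is orthogonal to \<open>x\<close>.\<close>

lemma dual_effective_cone_iff: "x \<in> dual_effective_cone u \<longleftrightarrow> x \<in> pic_dual_space u \<and> (\<forall>\<alpha>. 0 \<le> x $ \<alpha>)"
proof
  assume x: "x \<in> dual_effective_cone u"
  have "0 \<le> x $ \<alpha>" for \<alpha>
  proof -
    have "axis \<alpha> 1 \<in> effective_cone u" unfolding effective_cone_def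
      by (intro CollectI exI[of _ "axis \<alpha> 1"] exI[of _ 0]) (simp add: axis_def span_zero)
    then have "0 \<le> x \<bullet> axis \<alpha> 1" using x by (simp add: dual_effective_cone_def)
    then show ?thesis by (simp add: inner_axis)
  qed
  then show "x \<in> pic_dual_space u \<and> (\<forall>\<alpha>. 0 \<le> x $ \<alpha>)" using x by (simp add: dual_effective_cone_def)
next
  assume x: "x \<in> pic_dual_space u \<and> (\<forall>\<alpha>. 0 \<le> x $ \<alpha>)"
  have "0 \<le> x \<bullet> w" if w0: "w \<in> effective_cone u" for w
  proof -
    obtain w1 w2 where w: "w = w1 + w2" "\<forall>\<alpha>. 0 \<le> (w1 :: real ^ 's) $ \<alpha>" "w2 \<in> span (range (\<lambda>m. int_vec (character_divisor u m)))"
      using w0 unfolding effective_cone_def by blast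
    have "orthogonal x w2"
      by (rule orthogonal_to_span[OF w(3)]) (use x in \<open>auto simp: pic_dual_space_def orthogonal_def\<close>)
    moreover have "0 \<le> x \<bullet> w1" unfolding inner_vec_def using x w(2) by (intro sum_nonneg) simp
    ultimately show ?thesis by (simp add: w(1) inner_add_right orthogonal_def)
  qed
  then show "x \<in> dual_effective_cone u" using x by (simp add: dual_effective_cone_def)
qed

lemma lattice_point:
  assumes "x \<in> dual_effective_cone u" "x \<in> pic_dual_lattice u"
  shows "\<exists>y. x = degree_vec y \<and> y \<in> curve_degrees (anti_degree x)"
proof -
  obtain k where k: "x = int_vec k" using assms(2) by (auto simp: pic_dual_lattice_def integer_lattice_def)
  have "0 \<le> k $ \<alpha>" for \<alpha> using assms(1) by (simp add: dual_effective_cone_iff k int_vec_def)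
  then have x: "x = degree_vec (\<lambda>\<alpha>. nat (k $ \<alpha>))" by (simp add: k degree_vec_def int_vec_def vec_eq_iff)
  then show ?thesis using assms(1) degree_vec_pic_dual
    by (intro exI[of _ "\<lambda>\<alpha>. nat (k $ \<alpha>)"]) (simp add: curve_degrees_def dual_effective_cone_iff)
qed

lemma degree_vec_lattice_point:
  assumes "y \<in> curve_degrees d"
  shows "degree_vec y \<in> dual_effective_cone u" "degree_vec y \<in> pic_dual_lattice u"
proof -
  have *: "degree_vec y \<in> pic_dual_space u" using assms by (simp add: degree_vec_pic_dual curve_degrees_def)
  then show "degree_vec y \<in> dual_effective_cone u" by (simp add: dual_effective_cone_iff) (simp add: degree_vec_def)
  have "degree_vec y = int_vec (\<chi> \<alpha>. int (y \<alpha>))" by (simp add: degree_vec_def int_vec_def vec_eq_iff)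
  then show "degree_vec y \<in> pic_dual_lattice u" using * by (simp add: pic_dual_lattice_def integer_lattice_def)
qed

lemma degree_positive:
  assumes "x \<in> dual_effective_cone u" "x \<in> pic_dual_lattice u" "x \<noteq> 0"
  shows "0 < anti_degree x"
proof -
  obtain y where y: "x = degree_vec y" using lattice_point assms by blast
  then have "y \<noteq> (\<lambda>_. 0)" using assms(3) by (auto simp: degree_vec_def vec_eq_iff)
  then show ?thesis unfolding y by (auto simp: fun_eq_iff intro: sum_pos2)
qed

lemma ray_generators_properties:
  assumes "v \<in> ray_generators (pic_dual_lattice u) \<Delta>"
  shows "v \<in> dual_effective_cone u" "v \<in> pic_dual_lattice u" "v \<noteq> 0"
proof -
  obtain \<sigma> where \<sigma>: "\<sigma> \<in> \<Delta>" "primitive_generator (pic_dual_lattice u) \<sigma> v"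
    using assms by (auto simp: ray_generators_def)
  then have "v \<in> \<sigma> \<inter> pic_dual_lattice u"
    unfolding primitive_generator_def by (metis of_nat_1 rangeI scaleR_one)
  then show "v \<in> dual_effective_cone u" "v \<in> pic_dual_lattice u" using \<sigma>(1) support by auto
  show "v \<noteq> 0" using \<sigma>(2) by (simp add: primitive_generator_def)
qed

lemma finite_ray_generators: "finite (ray_generators (pic_dual_lattice u) \<Delta>)"
proof (rule finite_subset)
  let ?P = "primitive_generator (pic_dual_lattice u)"
  show "ray_generators (pic_dual_lattice u) \<Delta> \<subseteq> (\<lambda>\<sigma>. THE v. ?P \<sigma> v) ` \<Delta>"
  proof
    fix v assume "v \<in> ray_generators (pic_dual_lattice u) \<Delta>"
    then obtain \<sigma> where \<sigma>: "\<sigma> \<in> \<Delta>" "?P \<sigma> v" by (auto simp: ray_generators_def)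
    then have "(THE v. ?P \<sigma> v) = v" using primitive_generator_unique by blast
    then show "v \<in> (\<lambda>\<sigma>. THE v. ?P \<sigma> v) ` \<Delta>" using \<sigma>(1) by force
  qed
  show "finite ((\<lambda>\<sigma>. THE v. ?P \<sigma> v) ` \<Delta>)" using dual_fan by (simp add: regular_fan_def)
qed

abbreviation period :: nat where "period \<equiv> anticanonical_period u \<Delta>"

lemma period_eq: "period = Lcm (anti_degree ` ray_generators (pic_dual_lattice u) \<Delta>)"
  unfolding anticanonical_period_def anti_degree_def by (rule arg_cong[where f = Lcm]) blast

lemma period_pos: "0 < period"
proof -
  have "0 \<notin> anti_degree ` ray_generators (pic_dual_lattice u) \<Delta>"
    using degree_positive ray_generators_properties by force
  then show ?thesis unfolding period_eq using finite_ray_generators by (auto simp: Lcm_0_iff intro!: Nat.gr0I)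
qed

lemma degree_dvd_period: "v \<in> ray_generators (pic_dual_lattice u) \<Delta> \<Longrightarrow> anti_degree v dvd period"
  unfolding period_eq by (rule dvd_Lcm) simp

text \<open>The cones of \<Delta> are handled through their generators, which are part of a lattice
  basis; this makes coefficients unique, and integral at lattice points.\<close>

definition generator_sets :: "(real ^ 's) set set" where
  "generator_sets = {S. \<exists>B. lattice_basis (pic_dual_lattice u) B \<and> S \<subseteq> B \<and> convex_cone hull S \<in> \<Delta>}"

lemma generator_sets_subset: "S \<in> generator_sets \<Longrightarrow> S \<subseteq> ray_generators (pic_dual_lattice u) \<Delta>"
  unfolding generator_sets_def using fan_generator_is_ray_generator[OF dual_fan] by blast

lemma finite_generator_sets: "finite generator_sets" "S \<in> generator_sets \<Longrightarrow> finite S"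
  using generator_sets_subset finite_ray_generators
  by (auto intro: finite_subset[of generator_sets "Pow (ray_generators (pic_dual_lattice u) \<Delta>)"] finite_subset)

lemma generator_sets_independent: "S \<in> generator_sets \<Longrightarrow> independent S"
  unfolding generator_sets_def lattice_basis_def using independent_mono by blast

lemma inner_anticanonical_degree:
  assumes "x \<in> dual_effective_cone u" "x \<in> pic_dual_lattice u"
  shows "x \<bullet> int_vec anticanonical_divisor = real (anti_degree x)"
  using lattice_point[OF assms] inner_degree_vec anti_degree_vec by metis

lemma combination:
  assumes S: "S \<in> generator_sets"
  shows "\<exists>y. degree_vec y = (\<Sum>b\<in>S. real (n b) *\<^sub>R b) \<and> y \<in> curve_degrees (\<Sum>b\<in>S. n b * anti_degree b)"
proof -
  let ?x = "\<Sum>b\<in>S. real (n b) *\<^sub>R b"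
  obtain B where B: "lattice_basis (pic_dual_lattice u) B" "S \<subseteq> B" "convex_cone hull S \<in> \<Delta>"
    using S by (auto simp: generator_sets_def)
  have g: "b \<in> dual_effective_cone u" "b \<in> pic_dual_lattice u" if "b \<in> S" for b
    using ray_generators_properties generator_sets_subset[OF S] that by blast+
  have "?x \<in> convex_cone hull S" unfolding convex_cone_hull_finite[OF finite_generator_sets(2)[OF S]]
    by (intro CollectI exI[of _ "\<lambda>b. real (n b)"]) simp
  then have x: "?x \<in> dual_effective_cone u" using B(3) support by blast
  have "finite B" using B(1) by (simp add: lattice_basis_def)
  then have "?x = (\<Sum>b\<in>B. of_int (if b \<in> S then int (n b) else 0) *\<^sub>R b)"
    using sum_restrict_subset[OF _ B(2), of "\<lambda>b. real (n b)"] by (simp add: if_distrib cong: if_cong)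
  then have x': "?x \<in> pic_dual_lattice u" by (simp only: lattice_basis_combination[OF B(1)])
  have "?x \<bullet> int_vec anticanonical_divisor = real (\<Sum>b\<in>S. n b * anti_degree b)"
    by (simp add: inner_sum_left inner_anticanonical_degree[OF g])
  then have "anti_degree ?x = (\<Sum>b\<in>S. n b * anti_degree b)"
    unfolding inner_anticanonical_degree[OF x x'] of_nat_eq_iff .
  then show ?thesis using lattice_point[OF x x'] by metis
qed

text \<open>The coordinates in a cone containing the point are natural numbers. Discarding the
  generators with coefficient 0 passes to the face that contains the point in its relative interior,
  and this face belongs to the fan.\<close>

lemma decomposition:
  assumes y: "y \<in> curve_degrees d"
  shows "\<exists>S\<in>generator_sets. \<exists>n. (\<forall>b\<in>S. 0 < n b) \<and> degree_vec y = (\<Sum>b\<in>S. real (n b) *\<^sub>R b)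
    \<and> (\<Sum>b\<in>S. n b * anti_degree b) = d"
proof -
  have x: "degree_vec y \<in> dual_effective_cone u" "degree_vec y \<in> pic_dual_lattice u"
    by (rule degree_vec_lattice_point[OF y])+
  then obtain \<tau> where \<tau>: "\<tau> \<in> \<Delta>" "degree_vec y \<in> \<tau>" using support by blast
  obtain B S where B: "lattice_basis (pic_dual_lattice u) B" "S \<subseteq> B" "\<tau> = convex_cone hull S"
    using regular_fan_coneE[OF dual_fan \<tau>(1)] by blast
  have fin: "finite S" "independent S"
    using B(1,2) finite_subset independent_mono unfolding lattice_basis_def by blast+
  obtain c where c: "degree_vec y = (\<Sum>b\<in>S. c b *\<^sub>R b)" "\<forall>b\<in>S. 0 \<le> c b"
    using \<tau>(2) unfolding B(3) convex_cone_hull_finite[OF fin(1)] by blast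
  have "\<exists>n. c b = real n" if "b \<in> S" for b
  proof -
    have "c b \<in> \<int>" using lattice_basis_int_coeffs[OF B(1,2) _ that] x(2) c(1) by simp
    then obtain k where "c b = of_int k" by (elim Ints_cases)
    then show ?thesis using c(2) that by (intro exI[of _ "nat k"]) auto
  qed
  then obtain n where n: "\<And>b. b \<in> S \<Longrightarrow> c b = real (n b)" by metis
  define S' where "S' = {b \<in> S. 0 < n b}"
  have eq: "degree_vec y = (\<Sum>b\<in>S'. real (n b) *\<^sub>R b)"
    unfolding c(1) S'_def using fin(1) n by (intro sum.mono_neutral_cong_right) auto
  have "convex_cone hull S' \<in> \<Delta>"
  proof (rule regular_fan_face[OF dual_fan \<tau>(1)])
    show "convex_cone hull S' face_of \<tau>" unfolding B(3) using fin by (intro face_of_simplicial_cone) (auto simp: S'_def)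
    have "finite S'" using fin by (simp add: S'_def)
    then have "(\<Sum>b\<in>S'. real (n b) *\<^sub>R b) \<in> convex_cone hull S'"
      unfolding convex_cone_hull_finite[OF \<open>finite S'\<close>] by (intro CollectI exI[of _ "\<lambda>b. real (n b)"]) simp
    then show "convex_cone hull S' \<noteq> {}" by blast
  qed
  then have S': "S' \<in> generator_sets" using B(1,2) by (auto simp: generator_sets_def S'_def)
  obtain y' where y': "degree_vec y' = (\<Sum>b\<in>S'. real (n b) *\<^sub>R b)" "y' \<in> curve_degrees (\<Sum>b\<in>S'. n b * anti_degree b)"
    using combination[OF S'] by blast
  then have "y' = y" using eq degree_vec_inject by metis
  then have "(\<Sum>b\<in>S'. n b * anti_degree b) = d" using curve_degreesD(2)[OF y'(2)] curve_degreesD(2)[OF y] by simp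
  then show ?thesis using S' eq by (intro bexI[of _ S'] exI[of _ n]) (auto simp: S'_def)
qed

text \<open>The generators, which are forms on divisors, are reused as divisors through the inner
  product. A combination equal to the divisor of a character lies in \<open>pic_dual_space u\<close>
  and is orthogonal to that space, so it is orthogonal to itself and vanishes. Independence of the
  generators then kills the coefficients.\<close>

lemma pic_rank_ge:
  assumes S: "S \<in> generator_sets"
  shows "card S \<le> pic_rank u"
proof -
  let ?X = "{card S | S. finite S \<and> (\<forall>k. (\<Sum>D\<in>S. k D *s D) \<in> range (character_divisor u) \<longrightarrow> (\<forall>D\<in>S. k D = (0::int)))}"
  have fin: "finite S" "independent S" using finite_generator_sets(2)[OF S] generator_sets_independent[OF S] by auto
  have g: "b \<in> pic_dual_lattice u" if "b \<in> S" for b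
    using ray_generators_properties generator_sets_subset[OF S] that by blast
  then have "\<forall>b\<in>S. \<exists>k. b = int_vec k" by (auto simp: pic_dual_lattice_def integer_lattice_def)
  then obtain f where f: "\<And>b. b \<in> S \<Longrightarrow> b = int_vec (f b)" by metis
  have inj: "inj_on f S" using f by (metis inj_onI)
  have "card (f ` S) \<in> ?X"
  proof (intro CollectI exI[of _ "f ` S"] conjI allI impI)
    fix k assume "(\<Sum>D\<in>f ` S. k D *s D) \<in> range (character_divisor u)"
    then obtain m where m: "(\<Sum>D\<in>f ` S. k D *s D) = character_divisor u m" by blast
    define w where "w = (\<Sum>b\<in>S. of_int (k (f b)) *\<^sub>R b)"
    have "int_vec (\<Sum>D\<in>f ` S. k D *s D) = (\<Sum>b\<in>S. of_int (k (f b)) *\<^sub>R int_vec (f b))"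
      unfolding sum.reindex[OF inj] by (simp add: int_vec_def vec_eq_iff)
    then have "w = int_vec (character_divisor u m)" using f by (simp add: w_def m)
    moreover have "w \<in> pic_dual_space u" unfolding w_def using g by (intro pic_dual_space_closed) (simp add: pic_dual_lattice_def)
    ultimately have "w \<bullet> w = 0" by (auto simp: pic_dual_space_def)
    then have "(\<Sum>b\<in>S. of_int (k (f b)) *\<^sub>R b) = (\<Sum>b\<in>S. 0 *\<^sub>R b)" by (simp add: w_def)
    then have "of_int (k (f b)) = (0 :: real)" if "b \<in> S" for b using independent_sum_eqD[OF fin _ that, of "\<lambda>b. of_int (k (f b))" "\<lambda>_. 0"] by simp
    then show "\<forall>D\<in>f ` S. k D = 0" by auto
  qed (use fin in auto)
  moreover have "finite ?X"
  proof (rule finite_subset)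
    show "?X \<subseteq> {..CARD('s)}"
    proof
      fix c assume "c \<in> ?X"
      then obtain D where D: "c = card D" "finite D"
        "\<And>k. (\<Sum>D\<in>D. k D *s D) \<in> range (character_divisor u) \<Longrightarrow> (\<forall>D\<in>D. k D = (0::int))" by blast
      \<comment> \<open>The maximum defining the rank needs a bound: more vectors than coordinates
        satisfy a nontrivial integral relation, and 0 is the divisor of the trivial
        character.\<close>
      have "\<not> CARD('s) < card D"
      proof
        assume "CARD('s) < card D"
        from underdetermined_system[OF finite D(2) this, of "\<lambda>i (v :: int ^ 's). v $ i"]
        obtain k where k: "\<exists>v\<in>D. k v \<noteq> 0" "\<forall>i\<in>UNIV. (\<Sum>v\<in>D. (v :: int ^ 's) $ i * k v) = 0" by blast
        have "(\<Sum>v\<in>D. k v *s v) = character_divisor u 0"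
          unfolding vec_eq_iff
        proof
          fix i
          have "(\<Sum>v\<in>D. k v *s v) $ i = (\<Sum>v\<in>D. v $ i * k v)" by (simp add: mult.commute)
          also have "\<dots> = character_divisor u 0 $ i" using k(2) by (simp add: character_divisor_def)
          finally show "(\<Sum>v\<in>D. k v *s v) $ i = character_divisor u 0 $ i" .
        qed
        then have "(\<Sum>v\<in>D. k v *s v) \<in> range (character_divisor u)" by (rule range_eqI)
        then show False using D(3) k(1) by blast
      qed
      then show "c \<in> {..CARD('s)}" using D(1) by simp
    qed
  qed simp
  ultimately have "card (f ` S) \<le> pic_rank u" unfolding pic_rank_def by (intro Max_ge)
  then show ?thesis using card_image[OF inj] by simp
qed

lemma ex_nonempty_generator_set: "\<exists>S\<in>generator_sets. S \<noteq> {}"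
proof -
  obtain y :: "'s \<Rightarrow> nat" where y: "\<forall>\<alpha>. 0 < y \<alpha>" "\<forall>m. (\<Sum>\<alpha>\<in>UNIV. int (y \<alpha>) * pairing m (u \<alpha>)) = 0"
    using ex_positive_relation by blast
  then have "y \<in> curve_degrees (\<Sum>\<alpha>\<in>UNIV. y \<alpha>)" by (simp add: curve_degrees_def)
  from decomposition[OF this] obtain S n where S: "S \<in> generator_sets" "(\<Sum>b\<in>S. n b * anti_degree b) = (\<Sum>\<alpha>\<in>UNIV. y \<alpha>)"
    by blast
  have "0 < (\<Sum>\<alpha>\<in>UNIV. y \<alpha>)" using y(1) by (simp add: sum_pos)
  then show ?thesis using S by (intro bexI[of _ S]) auto
qed

end

text \<open>Only the exponent survives on the logarithmic scale: the shift \<open>n0\<close>, the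
  divisor \<open>k\<close> and the factor \<open>C\<close> change the logarithm by a bounded amount
  for large \<open>n\<close>, while that of the degree tends to infinity.\<close>

lemma log_growth_limit:
  fixes \<kappa> :: "nat \<Rightarrow> nat" and j k C p a n0 :: nat
  assumes a: "0 < a" and k: "0 < k"
    and lower: "\<And>N. (N div k + 1) ^ j \<le> \<kappa> (n0 + N)"
    and upper: "\<And>n. 0 < p + a * n \<Longrightarrow> \<kappa> n \<le> C * (p + a * n + 1) ^ j"
  shows "(\<lambda>n. ln (real (\<kappa> n)) / ln (real (p + a * n))) \<longlonglongrightarrow> real j"
proof (rule tendsto_sandwich)
  let ?d = "\<lambda>n. real p + real a * real n"
  have ev: "\<forall>\<^sub>F n in sequentially. n0 + 2 \<le> n" by (rule eventually_ge_at_top)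
  have d1: "1 < ?d n" if "n0 + 2 \<le> n" for n
  proof -
    have "real 1 * real 2 \<le> real a * real n" using a that by (intro mult_mono) auto
    then show ?thesis by simp
  qed
  have C: "0 < C"
  proof (rule ccontr)
    assume "\<not> 0 < C"
    then have "\<kappa> (n0 + 1) \<le> 0" using upper[of "n0 + 1"] a by simp
    moreover have "0 < \<kappa> (n0 + 1)" using lower[of 1] by (metis add_gr_0 less_le_trans zero_less_one zero_less_power)
    ultimately show False by simp
  qed
  show "\<forall>\<^sub>F n in sequentially. real j * ln ((real n - real n0) / real k) / ln (?d n) \<le> ln (real (\<kappa> n)) / ln (real (p + a * n))"
    using ev
  proof eventually_elim
    case (elim n)
    define N where "N = n - n0"
    have n: "n = n0 + N" "0 < N" using elim by (auto simp: N_def)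
    have "N < (N div k + 1) * k" using k by (metis Suc_eq_plus1 dividend_less_div_times mult_Suc add.commute)
    then have "real N < real ((N div k + 1) * k)" by (simp only: of_nat_less_iff)
    then have "real N / real k \<le> real (N div k + 1)" using k by (simp add: field_simps)
    then have "(real N / real k) ^ j \<le> real (N div k + 1) ^ j" by (intro power_mono) auto
    also have "\<dots> \<le> real (\<kappa> n)" using lower[of N] unfolding n(1) by (metis of_nat_le_iff of_nat_power)
    finally have "(real N / real k) ^ j \<le> real (\<kappa> n)" .
    moreover have "0 < real N / real k" using n(2) k by simp
    ultimately have "ln ((real N / real k) ^ j) \<le> ln (real (\<kappa> n))" by (intro ln_mono) (auto intro: less_le_trans[OF zero_less_power])
    then have "real j * ln ((real n - real n0) / real k) \<le> ln (real (\<kappa> n))"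
      using n(2) k by (simp add: n(1) ln_realpow)
    then show ?case using d1[OF elim] by (simp add: divide_right_mono)
  qed
  show "\<forall>\<^sub>F n in sequentially. ln (real (\<kappa> n)) / ln (real (p + a * n)) \<le> (ln (real C) + real j * ln (?d n + 1)) / ln (?d n)"
    using ev
  proof eventually_elim
    case (elim n)
    obtain N where n: "n = n0 + N" using elim le_Suc_ex[of n0 n] by auto
    have "0 < \<kappa> n" using lower[of N] unfolding n by (metis add_gr_0 less_le_trans zero_less_one zero_less_power)
    have "\<kappa> n \<le> C * (p + a * n + 1) ^ j" using a elim by (intro upper) simp
    then have "real (\<kappa> n) \<le> real (C * (p + a * n + 1) ^ j)" by (simp only: of_nat_le_iff)
    then have "real (\<kappa> n) \<le> real C * (?d n + 1) ^ j" by (simp add: add.commute add.left_commute)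
    then have "ln (real (\<kappa> n)) \<le> ln (real C * (?d n + 1) ^ j)" using \<open>0 < \<kappa> n\<close> by (intro ln_mono) auto
    also have "\<dots> = ln (real C) + real j * ln (?d n + 1)"
      using C d1[OF elim] by (simp add: ln_mult ln_realpow)
    finally show ?case using d1[OF elim] by (simp add: divide_right_mono)
  qed
  show "(\<lambda>n. real j * ln ((real n - real n0) / real k) / ln (?d n)) \<longlonglongrightarrow> real j"
    using a k by real_asymp
  show "(\<lambda>n. (ln (real C) + real j * ln (?d n + 1)) / ln (?d n)) \<longlonglongrightarrow> real j"
    using a by real_asymp
qed

section \<open>Lattice points with degree in a congruence class\<close>

context dual_fan begin

text \<open>The cones of \<Delta> whose relative interior contains a lattice point with degree in
  the class of \<open>p\<close>. The empty set, which stands for the zero cone, can occur only for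
  \<open>p = 0\<close>.\<close>

definition interior_sets :: "nat \<Rightarrow> (real ^ 's) set set" where
  "interior_sets p = {S \<in> generator_sets. \<exists>n. (\<forall>b\<in>S. 0 < n b) \<and> (\<Sum>b\<in>S. n b * anti_degree b) mod period = p}"

lemma finite_interior_sets: "finite (interior_sets p)"
  using finite_generator_sets(1) by (simp add: interior_sets_def)

lemma generator_degree_pos: "S \<in> generator_sets \<Longrightarrow> b \<in> S \<Longrightarrow> 0 < anti_degree b"
  using generator_sets_subset degree_positive ray_generators_properties by blast

text \<open>A point of positive degree is not 0, so its set of generators is nonempty. This removes
  the empty set from the union and makes the exponent \<open>card S - 1\<close> of the later count
  meaningful.\<close>

lemma curve_degrees_decomposition:
  assumes "0 < d"
  shows "degree_vec ` curve_degrees d \<subseteq> (\<Union>S\<in>interior_sets (d mod period) - {{}}.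
    (\<lambda>n. \<Sum>b\<in>S. real (n b) *\<^sub>R b) ` {n \<in> PiE S (\<lambda>_. {..d}). (\<Sum>b\<in>S. n b * anti_degree b) = d})"
proof
  fix x assume "x \<in> degree_vec ` curve_degrees d"
  then obtain y where y: "y \<in> curve_degrees d" "x = degree_vec y" by blast
  obtain S n where S: "S \<in> generator_sets" "\<forall>b\<in>S. 0 < n b" "degree_vec y = (\<Sum>b\<in>S. real (n b) *\<^sub>R b)"
    "(\<Sum>b\<in>S. n b * anti_degree b) = d" using decomposition[OF y(1)] by (elim bexE exE conjE)
  have fin: "finite S" by (rule finite_generator_sets(2)[OF S(1)])
  have "n b \<le> d" if "b \<in> S" for b
  proof -
    have "n b \<le> n b * anti_degree b" using generator_degree_pos[OF S(1) that] by simp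
    also have "\<dots> \<le> d" using member_le_sum[OF that _ fin, of "\<lambda>b. n b * anti_degree b"] S(4) by simp
    finally show ?thesis .
  qed
  then have "restrict n S \<in> {n \<in> PiE S (\<lambda>_. {..d}). (\<Sum>b\<in>S. n b * anti_degree b) = d}" using S(4) by auto
  moreover have "x = (\<Sum>b\<in>S. real (restrict n S b) *\<^sub>R b)" using y(2) S(3) by simp
  moreover have "S \<in> interior_sets (d mod period) - {{}}" using S assms by (auto simp: interior_sets_def)
  ultimately show "x \<in> (\<Union>S\<in>interior_sets (d mod period) - {{}}.
    (\<lambda>n. \<Sum>b\<in>S. real (n b) *\<^sub>R b) ` {n \<in> PiE S (\<lambda>_. {..d}). (\<Sum>b\<in>S. n b * anti_degree b) = d})" by blast
qed

lemma card_curve_degrees_le: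
  assumes "0 < d" and k: "\<And>S. S \<in> interior_sets (d mod period) \<Longrightarrow> card S \<le> k"
  shows "card (curve_degrees d) \<le> card (interior_sets (d mod period)) * (d + 1) ^ (k - 1)"
proof -
  let ?T = "interior_sets (d mod period) - {{}}"
  let ?N = "\<lambda>S. {n \<in> PiE S (\<lambda>_. {..d}). (\<Sum>b\<in>S. n b * anti_degree b) = d}"
  let ?P = "\<lambda>S. (\<lambda>n. \<Sum>b\<in>S. real (n b) *\<^sub>R b) ` ?N S"
  have g: "S \<in> generator_sets" if "S \<in> ?T" for S using that by (simp add: interior_sets_def)
  have fN: "finite (?N S)" if "S \<in> ?T" for S
    using finite_generator_sets(2)[OF g[OF that]] by (intro finite_subset[OF _ finite_PiE[of S "\<lambda>_. {..d}"]]) auto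
  have fT: "finite ?T" using finite_interior_sets by simp
  have c: "card (?P S) \<le> (d + 1) ^ (k - 1)" if S: "S \<in> ?T" for S
  proof -
    have "card (?P S) \<le> card (?N S)" by (rule card_image_le[OF fN[OF S]])
    also have "\<dots> \<le> (d + 1) ^ (card S - 1)"
      using S generator_degree_pos[OF g[OF S]] by (intro card_compositions_le finite_generator_sets(2)[OF g[OF S]]) auto
    also have "\<dots> \<le> (d + 1) ^ (k - 1)" using k[of S] S by (intro power_increasing diff_le_mono) auto
    finally show ?thesis .
  qed
  have "card (curve_degrees d) = card (degree_vec ` curve_degrees d)"
    by (rule card_image[symmetric]) (simp add: inj_on_def degree_vec_inject)
  also have "\<dots> \<le> card (\<Union>S\<in>?T. ?P S)"
    by (rule card_mono[OF _ curve_degrees_decomposition[OF assms(1)]]) (use fT fN in blast)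
  also have "\<dots> \<le> (\<Sum>S\<in>?T. card (?P S))" by (rule card_UN_le[OF fT])
  also have "\<dots> \<le> (\<Sum>S\<in>?T. (d + 1) ^ (k - 1))" by (rule sum_mono) (rule c)
  also have "\<dots> = card ?T * (d + 1) ^ (k - 1)" by simp
  also have "\<dots> \<le> card (interior_sets (d mod period)) * (d + 1) ^ (k - 1)"
    using finite_interior_sets by (intro mult_right_mono card_mono) auto
  finally show ?thesis .
qed

text \<open>Adding \<open>period / anti_degree b\<close> times a generator \<open>b\<close> raises the degree by the period.\<close>

lemma card_curve_degrees_ge:
  assumes S: "S \<in> interior_sets p" "S \<noteq> {}"
  shows "\<exists>n0. \<forall>N. (N div card S + 1) ^ (card S - 1) \<le> card (curve_degrees (p + period * (n0 + N)))"
proof -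
  have g: "S \<in> generator_sets" using S(1) by (simp add: interior_sets_def)
  have fin: "finite S" "independent S" using finite_generator_sets(2) generator_sets_independent g by auto
  obtain n1 where n1: "(\<Sum>b\<in>S. n1 b * anti_degree b) mod period = p" using S(1) by (auto simp: interior_sets_def)
  define n0 where "n0 = (\<Sum>b\<in>S. n1 b * anti_degree b) div period"
  have d0: "(\<Sum>b\<in>S. n1 b * anti_degree b) = p + period * n0" unfolding n0_def n1[symmetric] by simp
  define q where "q b = period div anti_degree b" for b
  have q: "q b * anti_degree b = period" if "b \<in> S" for b
    using degree_dvd_period generator_sets_subset[OF g] that by (auto simp: q_def)
  then have q0: "0 < q b" if "b \<in> S" for b using q[OF that] period_pos by (cases "q b") auto
  have "(N div card S + 1) ^ (card S - 1) \<le> card (curve_degrees (p + period * (n0 + N)))" for N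
  proof -
    let ?K = "{n \<in> PiE S (\<lambda>_. {..N}). (\<Sum>b\<in>S. n b) = N}"
    have deg: "(\<Sum>b\<in>S. (n1 b + q b * k b) * anti_degree b) = p + period * (n0 + N)" if "k \<in> ?K" for k
    proof -
      have "(\<Sum>b\<in>S. (n1 b + q b * k b) * anti_degree b) = (\<Sum>b\<in>S. n1 b * anti_degree b) + (\<Sum>b\<in>S. k b * (q b * anti_degree b))"
        by (simp add: sum.distrib algebra_simps)
      also have "(\<Sum>b\<in>S. k b * (q b * anti_degree b)) = (\<Sum>b\<in>S. k b * period)" by (intro sum.cong refl) (simp only: q)
      also have "\<dots> = period * N" using that by (simp flip: sum_distrib_right)
      finally show ?thesis unfolding d0 by (simp add: distrib_left)
    qed
    have "\<forall>k. \<exists>y. k \<in> ?K \<longrightarrow> degree_vec y = (\<Sum>b\<in>S. real (n1 b + q b * k b) *\<^sub>R b) \<and> y \<in> curve_degrees (p + period * (n0 + N))"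
    proof
      fix k
      show "\<exists>y. k \<in> ?K \<longrightarrow> degree_vec y = (\<Sum>b\<in>S. real (n1 b + q b * k b) *\<^sub>R b) \<and> y \<in> curve_degrees (p + period * (n0 + N))"
        using combination[OF g, of "\<lambda>b. n1 b + q b * k b"] deg[of k] by (cases "k \<in> ?K") auto
    qed
    from choice[OF this] obtain Y where Y: "\<And>k. k \<in> ?K \<Longrightarrow> degree_vec (Y k) = (\<Sum>b\<in>S. real (n1 b + q b * k b) *\<^sub>R b)"
      "\<And>k. k \<in> ?K \<Longrightarrow> Y k \<in> curve_degrees (p + period * (n0 + N))" by blast
    have "inj_on Y ?K"
    proof (rule inj_onI)
      fix k k' assume k: "k \<in> ?K" "k' \<in> ?K" and eq: "Y k = Y k'"
      have "k b = k' b" if "b \<in> S" for b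
      proof -
        have "(\<Sum>b\<in>S. real (n1 b + q b * k b) *\<^sub>R b) = (\<Sum>b\<in>S. real (n1 b + q b * k' b) *\<^sub>R b)"
          using Y(1)[OF k(1)] Y(1)[OF k(2)] eq by simp
        from independent_sum_eqD[OF fin this that] have "n1 b + q b * k b = n1 b + q b * k' b" by (simp only: of_nat_eq_iff)
        then show ?thesis using q0[OF that] by simp
      qed
      then show "k = k'" using k by (intro PiE_ext[of k S _ k']) auto
    qed
    then have "card ?K \<le> card (curve_degrees (p + period * (n0 + N)))"
      using Y(2) by (intro card_inj_on_le[OF _ _ finite_curve_degrees]) auto
    then show ?thesis using card_compositions_ge[OF fin(1) S(2), of N] by simp
  qed
  then show ?thesis by blast
qed

lemma interior_sets_empty:
  assumes "interior_sets p = {}" "p < period"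
  shows "curve_degrees (p + period * n) = {}"
proof (rule ccontr)
  assume "curve_degrees (p + period * n) \<noteq> {}"
  then obtain y where "y \<in> curve_degrees (p + period * n)" by blast
  from decomposition[OF this] obtain S k where S: "S \<in> generator_sets" "\<forall>b\<in>S. 0 < k b"
    "(\<Sum>b\<in>S. k b * anti_degree b) = p + period * n" by blast
  then have "S \<in> interior_sets p" using assms(2) by (auto simp: interior_sets_def intro!: exI[of _ k])
  then show False using assms(1) by blast
qed

text \<open>Taking all coefficients equal to the period gives an interior point whose degree is a
  multiple of the period. This is why the second case occurs in class 0.\<close>

lemma ex_nonempty_interior_set_0: "\<exists>S\<in>interior_sets 0. S \<noteq> {}"
proof -
  obtain S where "S \<in> generator_sets" "S \<noteq> {}" using ex_nonempty_generator_set by blast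
  then show ?thesis using period_pos
    by (intro bexI[of _ S]) (auto simp: interior_sets_def intro!: exI[of _ "\<lambda>_. period"] simp flip: sum_distrib_left)
qed

lemma ex_nonempty_interior_set:
  assumes "interior_sets p \<noteq> {}"
  shows "\<exists>S\<in>interior_sets p. S \<noteq> {}"
proof (rule ccontr)
  assume *: "\<not> ?thesis"
  obtain S where "S \<in> interior_sets p" using assms by blast
  then have "{} \<in> interior_sets p" using * by (cases "S = {}") auto
  then have "p = 0" by (auto simp: interior_sets_def)
  then show False using * ex_nonempty_interior_set_0 by blast
qed

theorem curve_degrees_growth:
  assumes p: "p < period" and ne: "interior_sets p \<noteq> {}"
  shows "\<exists>j n0. j < pic_rank u \<and> (\<forall>n\<ge>n0. curve_degrees (p + period * n) \<noteq> {}) \<and>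
    (\<lambda>n. ln (real (card (curve_degrees (p + period * n)))) / ln (real (p + period * n))) \<longlonglongrightarrow> real j"
proof -
  let ?T = "interior_sets p" and ?\<kappa> = "\<lambda>n. card (curve_degrees (p + period * n))"
  define k where "k = Max (card ` ?T)"
  have k: "card S \<le> k" if "S \<in> ?T" for S unfolding k_def using that finite_interior_sets by (intro Max_ge) auto
  have "k \<in> card ` ?T" unfolding k_def using ne finite_interior_sets by (intro Max_in) auto
  then obtain S where S: "S \<in> ?T" "card S = k" by blast
  \<comment> \<open>A nonempty set ensures that the maximum \<open>k\<close> is positive, so that
    \<open>k - 1\<close> is a true difference.\<close>
  obtain S1 where S1: "S1 \<in> ?T" "S1 \<noteq> {}" using ex_nonempty_interior_set[OF ne] by blast
  have g: "S \<in> generator_sets" "S1 \<in> generator_sets" using S(1) S1(1) by (simp_all add: interior_sets_def)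
  have "0 < card S1" using S1(2) finite_generator_sets(2)[OF g(2)] by (simp add: card_gt_0_iff)
  then have k0: "0 < k" using k[OF S1(1)] by simp
  then have "S \<noteq> {}" using S(2) by auto
  then obtain n0 where n0: "\<forall>N. (N div k + 1) ^ (k - 1) \<le> ?\<kappa> (n0 + N)"
    using card_curve_degrees_ge[OF S(1)] S(2) by auto
  have up: "?\<kappa> n \<le> card ?T * (p + period * n + 1) ^ (k - 1)" if "0 < p + period * n" for n
    using card_curve_degrees_le[OF that, of k] k p by simp
  have "(\<lambda>n. ln (real (?\<kappa> n)) / ln (real (p + period * n))) \<longlonglongrightarrow> real (k - 1)"
    using period_pos k0 n0 up by (intro log_growth_limit[of period k "k - 1" ?\<kappa> n0 p "card ?T"]) auto
  moreover have "k - 1 < pic_rank u" using pic_rank_ge[OF g(1)] S(2) k0 by simp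
  moreover have "curve_degrees (p + period * n) \<noteq> {}" if n: "n0 \<le> n" for n
  proof -
    obtain N where N: "n = n0 + N" using le_Suc_ex[OF n] by blast
    have "(0 :: nat) < (N div k + 1) ^ (k - 1)" by simp
    also have "\<dots> \<le> ?\<kappa> n" using n0 by (simp add: N)
    finally show ?thesis by auto
  qed
  ultimately show ?thesis by blast
qed

end

text \<open>A class without interior sets contains no curve: all dimensions are
  \<open>- \<infinity>\<close>, which gives the first case and excludes the second. In any other
  class the spaces are eventually nonempty, and the difference in the second case is eventually the
  constant \<open>r\<close>.\<close>

theorem corollary1p6p1:
  fixes \<Sigma> :: "(real ^ 'r::finite) set set"
    and u :: "'s::finite \<Rightarrow> int ^ 'r"
    and h :: "int ^ 's"
    and \<Delta> :: "(real ^ 's) set set"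
  assumes fan: "regular_fan integer_lattice \<Sigma>"
    and complete: "\<Union>\<Sigma> = UNIV"
    and rays: "bij_betw (\<lambda>\<alpha>. int_vec (u \<alpha>)) UNIV (ray_generators integer_lattice \<Sigma>)"
    and projective: "ample_divisor \<Sigma> u h"
    and dual_fan: "regular_fan (pic_dual_lattice u) \<Delta>"
    and dual_fan_support: "\<Union>\<Delta> = dual_effective_cone u"
  shows
    "let a = anticanonical_period u \<Delta>;
         dimU = curves_dim TYPE('k::field) \<Sigma> u h;
         \<kappa> = curves_components TYPE('k) \<Sigma> u h;
         case_i = (\<lambda>p. limsup (\<lambda>n. dimU (p + a * n) / ereal (real (p + a * n))) < 1);
         case_ii = (\<lambda>p. \<exists>l::real. (\<lambda>n. dimU (p + a * n) - ereal (real (p + a * n))) \<longlonglongrightarrow> ereal l)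
     in (\<forall>p\<in>{0..<a}.
           (case_i p \<or> case_ii p) \<and>
           (case_ii p \<longrightarrow>
              (\<exists>j\<in>{0..<pic_rank u}.
                 (\<lambda>n. ln (real (\<kappa> (p + a * n))) / ln (real (p + a * n))) \<longlonglongrightarrow> real j))) \<and>
        (\<exists>p\<in>{0..<a}. case_ii p)"
proof -
  interpret projective_fan \<Sigma> u h
    using fan complete rays projective by unfold_locales
  interpret dual_fan \<Sigma> u \<Delta>
    using dual_fan dual_fan_support by unfold_locales
  let ?dim = "curves_dim TYPE('k) \<Sigma> u h" and ?\<kappa> = "curves_components TYPE('k) \<Sigma> u h"
  let ?case_i = "\<lambda>p. limsup (\<lambda>n. ?dim (p + period * n) / ereal (real (p + period * n))) < 1"
  let ?case_ii = "\<lambda>p. \<exists>l::real. (\<lambda>n. ?dim (p + period * n) - ereal (real (p + period * n))) \<longlonglongrightarrow> ereal l"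
  have i: "?case_i p" and not_ii: "\<not> ?case_ii p" if p: "p < period" "interior_sets p = {}" for p
  proof -
    have dim: "?dim (p + period * n) = - \<infinity>" for n
      by (simp add: curves_dim_eq interior_sets_empty[OF p(2,1)])
    \<comment> \<open>For \<open>d = 0\<close> this relies on the convention that the inverse of 0
      is \<open>\<infinity>\<close> in the extended reals.\<close>
    have "- \<infinity> / ereal (real d) = - \<infinity>" for d
      by (cases "d = 0") (simp_all add: divide_ereal_def)
    then show "?case_i p" unfolding dim by (simp add: Limsup_const)
    have "\<not> (\<lambda>n. - \<infinity>) \<longlonglongrightarrow> ereal l" for l
    proof
      assume "(\<lambda>n :: nat. - \<infinity>) \<longlonglongrightarrow> ereal l"
      then have "- \<infinity> = ereal l" by (rule LIMSEQ_unique[OF tendsto_const])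
      then show False by simp
    qed
    then show "\<not> ?case_ii p" unfolding dim by simp
  qed
  have ii: "?case_ii p" and growth: "\<exists>j\<in>{0..<pic_rank u}. (\<lambda>n. ln (real (?\<kappa> (p + period * n))) / ln (real (p + period * n))) \<longlonglongrightarrow> real j"
    if p: "p < period" "interior_sets p \<noteq> {}" for p
  proof -
    obtain j n0 where j: "j < pic_rank u" "\<forall>n\<ge>n0. curve_degrees (p + period * n) \<noteq> {}"
      "(\<lambda>n. ln (real (card (curve_degrees (p + period * n)))) / ln (real (p + period * n))) \<longlonglongrightarrow> real j"
      using curve_degrees_growth[OF p] by (elim exE conjE)
    have "\<forall>\<^sub>F n in sequentially. ?dim (p + period * n) - ereal (real (p + period * n)) = ereal (real CARD('r))"
      using eventually_ge_at_top[of n0] by eventually_elim (use j(2) in \<open>simp add: curves_dim_eq\<close>)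
    then have "(\<lambda>n. ?dim (p + period * n) - ereal (real (p + period * n))) \<longlonglongrightarrow> ereal (real CARD('r))"
      by (rule tendsto_eventually)
    then show "?case_ii p" by blast
    show "\<exists>j\<in>{0..<pic_rank u}. (\<lambda>n. ln (real (?\<kappa> (p + period * n))) / ln (real (p + period * n))) \<longlonglongrightarrow> real j"
      using j(1,3) by (intro bexI[of _ j]) (simp_all add: curves_components_eq)
  qed
  have "?case_i p \<or> ?case_ii p" if "p < period" for p
    using i[OF that] ii[OF that] by (cases "interior_sets p = {}") blast+
  moreover have "?case_ii p \<longrightarrow> (\<exists>j\<in>{0..<pic_rank u}. (\<lambda>n. ln (real (?\<kappa> (p + period * n))) / ln (real (p + period * n))) \<longlonglongrightarrow> real j)"
    if "p < period" for p
    using not_ii[OF that] growth[OF that] by (cases "interior_sets p = {}") blast+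
  moreover have "?case_ii 0" using ii[OF period_pos] ex_nonempty_interior_set_0 by blast
  ultimately show ?thesis unfolding Let_def using period_pos by (intro conjI ballI bexI[of _ 0]) auto
qed

end
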